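(* Let $L>0$ and $y\in\mathcal H_0=\mathbb C^N\times L^2(0,k^2)$. As $\xi\to0$, the family of processes $\big(\mathbf T^\xi(\cdot)(y)\big)_{\xi}$ converges in distribution on $\mathcal C([0,L],(\mathcal H_0,\|\cdot\|_{\mathcal H_0}))$ to a limit $\mathbf T^0(\cdot)(y)$. This limit is the unique diffusion process on $\mathcal H_0$ starting from $y$ associated with the infinitesimal generator $\mathcal L=\mathcal L_1+\mathcal L_2+\mathcal L_3$, which acts only on the discrete coordinates $T_1,\dots,T_N$, where $$\begin{aligned}\mathcal L_1=&\ \tfrac12\sum_{j\neq l}\Gamma^c_{jl}\big(T_j\overline{T_j}\partial_{T_l}\partial_{\overline{T_l}}+T_l\overline{T_l}\partial_{T_j}\partial_{\overline{T_j}}-T_jT_l\partial_{T_j}\partial_{T_l}-\overline{T_j}\,\overline{T_l}\partial_{\overline{T_j}}\partial_{\overline{T_l}}\big)\\&+\tfrac12\sum_{j,l=1}^N\Gamma^1_{jl}\big(T_j\overline{T_l}\partial_{T_j}\partial_{\overline{T_l}}+\overline{T_j}T_l\partial_{\overline{T_j}}\partial_{T_l}-T_jT_l\partial_{T_j}\partial_{T_l}-\overline{T_j}\,\overline{T_l}\partial_{\overline{T_j}}\partial_{\overline{T_l}}\big)\\&+\tfrac12\sum_{j=1}^N(\Gamma^c_{jj}-\Gamma^1_{jj})\big(T_j\partial_{T_j}+\overline{T_j}\partial_{\overline{T_j}}\big)+\tfrac i2\sum_{j=1}^N\Gamma^s_{jj}\big(T_j\partial_{T_j}-\overline{T_j}\partial_{\overline{T_j}}\big),\end{aligned}$$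 $$\mathcal L_2=-\tfrac12\sum_{j=1}^N\Big[(\Lambda^c_j+i\Lambda^s_j)T_j\partial_{T_j}+(\Lambda^c_j-i\Lambda^s_j)\overline{T_j}\partial_{\overline{T_j}}\Big],\qquad \mathcal L_3=i\sum_{j=1}^N\kappa_j\big(T_j\partial_{T_j}-\overline{T_j}\partial_{\overline{T_j}}\big),$$ with $\Lambda^c_j=\lim_{\xi\to0}\Lambda^{c,\xi}_j$, $\Lambda^s_j=\lim_{\xi\to0}\Lambda^{s,\xi}_j$, $\kappa_j=\lim_{\xi\to0}\kappa^\xi_j$.
   Context: **Modes.** Fix $d>0$, $n_1>1$, $k>0$ (the wavenumber $k=\omega/c$ at a fixed frequency $\omega$), $\theta=\sqrt{1-1/n_1^2}$. Let $0<\sigma_1<\dots<\sigma_N$ be the solutions in $(0,n_1kd\theta)$ of $\tan y=-y/\sqrt{(n_1kd\theta)^2-y^2}$ (assume $N\ge1$), and put $\beta_j=\sqrt{n_1^2k^2-\sigma_j^2/d^2}>k$, $\zeta_j=d\sqrt{\beta_j^2-k^2}$. For $x\in[0,d]$ let $\phi_j(x)=A_j\sin(\sigma_jx/d)$ with $$A_j=\sqrt{\frac{2/d}{1+\frac{\sin^2\sigma_j}{\zeta_j}-\frac{\sin 2\sigma_j}{2\sigma_j}}}.$$ For $\gamma\in(-\infty,k^2)$ let $\eta_\gamma=d\sqrt{n_1^2k^2-\gamma}$, $\xi_\gamma=d\sqrt{k^2-\gamma}$ and, for $x\in[0,d]$, $\phi_\gamma(x)=A_\gamma\sin(\eta_\gamma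 x/d)$ with $$A_\gamma=\sqrt{\frac{d\,\xi_\gamma}{\pi(\xi_\gamma^2\sin^2\eta_\gamma+\eta_\gamma^2\cos^2\eta_\gamma)}}.$$ **Random field.** $V=(V(x,z))_{x\in[0,d],z\ge0}$ is a continuous real zero-mean Gaussian field with $\mathbb E[V(x,z_1)V(y,z_2)]=\gamma_0(x,y)e^{-a|z_1-z_2|}$, where $a>0$ and $\gamma_0:[0,d]^2\to\mathbb R$ is Lipschitz and is the kernel of a nonnegative operator on $L^2(0,d)$. For $p,q\in\{1,\dots,N\}\cup(-\infty,k^2)$ (integers label the discrete modes, reals label the continuum) set $C_{pq}(z)=\int_0^d\phi_p(x)\phi_q(x)V(x,z)\,dx$. **Coefficients.** For $j\ne l$ in $\{1,\dots,N\}$, $$\Gamma^c_{jl}=\frac{k^4}{2\beta_j\beta_l}\int_0^\infty\mathbb E[C_{jl}(0)C_{jl}(z)]\cos((\beta_l-\beta_j)z)dz,\quad \Gamma^s_{jl}=\frac{k^4}{2\beta_j\beta_l}\int_0^\infty\mathbb E[C_{jl}(0)C_{jl}(z)]\sin((\beta_l-\beta_j)z)dz,$$ $\Gamma^c_{jj}=-\sum_{l\ne j}\Gamma^c_{jl}$, $\Gamma^s_{jj}=-\sum_{l\ne j}\Gamma^s_{jl}$; for all $j,l$, $\Gamma^1_{jl}=\frac{k^4}{2\beta_j\beta_l}\int_0^\infty\mathbb E[C_{jj}(0)C_{ll}(z)]dz$; $$\Lambda^{c,\xi}_j=\int_\xi^{k^2}\frac{k^4}{2\sqrt{\gamma'}\beta_j}\int_0^\infty\mathbb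 E[C_{j\gamma'}(0)C_{j\gamma'}(z)]\cos((\sqrt{\gamma'}-\beta_j)z)dz\,d\gamma',$$ $\Lambda^{s,\xi}_j$ is the same expression with $\sin$ in place of $\cos$, and $$\kappa^\xi_j=\int_{-\infty}^{-\xi}\frac{k^4}{2\beta_j\sqrt{|\gamma'|}}\int_0^\infty\mathbb E[C_{j\gamma'}(0)C_{j\gamma'}(z)]\cos(\beta_jz)e^{-\sqrt{|\gamma'|}z}dz\,d\gamma'.$$ **The processes $\mathbf T^\xi$.** For small $\xi>0$ let $\mathcal H_\xi=\mathbb C^N\times L^2(\xi,k^2)$, viewed inside $\mathcal H_0$ (extension by $0$ on $(0,\xi)$). For $y\in\mathcal H_0$, $\mathbf T^\xi(\cdot)(y)$ denotes the unique diffusion process on $\mathcal H_\xi$ starting from the restriction $y^\xi$ of $y$ to $\mathcal H_\xi$, with generator $\mathcal L_1+\mathcal L_{2,\xi}+\mathcal L_{3,\xi}$, where $\mathcal L_{2,\xi}$ and $\mathcal L_{3,\xi}$ are given by the formulas for $\mathcal L_2,\mathcal L_3$ with $\Lambda^c_j,\Lambda^s_j,\kappa_j$ replaced by $\Lambda^{c,\xi}_j,\Lambda^{s,\xi}_j,\kappa^\xi_j$; its $L^2(\xi,k^2)$ component is constant in time. **Conventions.** For $v=v_1+iv_2$: $\partial_v=\frac12(\partial_{v_1}-i\partial_{v_2})$, $\partial_{\overline v}=\frac12(\partial_{v_1}+i\partial_{v_2})$. "The unique diffusion process associated with the generator" means the unique solution of the corresponding (well-posed) martingale problem. *)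

theory Defs
  imports "HOL-Probability.Probability"
begin

section \<open>The Hilbert space of square-integrable complex functions\<close>

definition sq_integrable :: "(real \<Rightarrow> complex) \<Rightarrow> bool" where
  "sq_integrable f \<longleftrightarrow> f \<in> borel_measurable lborel \<and> integrable lborel (\<lambda>x. (cmod (f x))\<^sup>2)"

lemma sq_integrable_zero: "sq_integrable (\<lambda>x. 0)"
  by (simp add: sq_integrable_def)

lemma sq_integrable_scaleR: "sq_integrable f \<Longrightarrow> sq_integrable (\<lambda>x. r *\<^sub>R f x)"
  by (auto simp: sq_integrable_def power_mult_distrib)

lemma sq_integrable_uminus: "sq_integrable f \<Longrightarrow> sq_integrable (\<lambda>x. - f x)"
  by (auto simp: sq_integrable_def)

lemma sq_integrable_add:
  assumes "sq_integrable f" "sq_integrable g"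
  shows "sq_integrable (\<lambda>x. f x + g x)"
proof -
  have [measurable]: "f \<in> borel_measurable borel" "g \<in> borel_measurable borel"
    using assms by (auto simp: sq_integrable_def)
  have "integrable lborel (\<lambda>x. (cmod (f x + g x))\<^sup>2)"
  proof (rule Bochner_Integration.integrable_bound)
    show "integrable lborel (\<lambda>x. 2 * (cmod (f x))\<^sup>2 + 2 * (cmod (g x))\<^sup>2)"
      using assms by (auto simp: sq_integrable_def)
    have "(cmod (a + b))\<^sup>2 \<le> 2 * (cmod a)\<^sup>2 + 2 * (cmod b)\<^sup>2" for a b
    proof -
      have "(cmod (a + b))\<^sup>2 \<le> (cmod a + cmod b)\<^sup>2"
        by (intro power_mono norm_triangle_ineq) auto
      also have "\<dots> \<le> 2 * (cmod a)\<^sup>2 + 2 * (cmod b)\<^sup>2"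
        using sum_squares_bound[of "cmod a" "cmod b"] by (simp add: power2_sum)
      finally show ?thesis .
    qed
    then show "AE x in lborel. norm ((cmod (f x + g x))\<^sup>2)
        \<le> norm (2 * (cmod (f x))\<^sup>2 + 2 * (cmod (g x))\<^sup>2)"
      by auto
  qed measurable
  then show ?thesis by (simp add: sq_integrable_def)
qed

lemma sq_integrable_cut:
  assumes "sq_integrable f"
  shows "sq_integrable (\<lambda>x. indicator {a<..<b::real} x *\<^sub>R f x)"
proof -
  have [measurable]: "f \<in> borel_measurable borel"
    using assms by (auto simp: sq_integrable_def)
  have "integrable lborel (\<lambda>x. (cmod (indicator {a<..<b} x *\<^sub>R f x))\<^sup>2)"
    by (rule Bochner_Integration.integrable_bound[where f = "\<lambda>x. (cmod (f x))\<^sup>2"])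
      (use assms in \<open>auto simp: sq_integrable_def indicator_def\<close>)
  then show ?thesis by (simp add: sq_integrable_def)
qed

lemma sq_integrable_inner:
  assumes "sq_integrable f" "sq_integrable g"
  shows "integrable lborel (\<lambda>x. inner (f x) (g x))"
proof -
  have [measurable]: "f \<in> borel_measurable borel" "g \<in> borel_measurable borel"
    using assms by (auto simp: sq_integrable_def)
  show ?thesis
  proof (rule Bochner_Integration.integrable_bound)
    show "integrable lborel (\<lambda>x. (cmod (f x))\<^sup>2 + (cmod (g x))\<^sup>2)"
      using assms by (auto simp: sq_integrable_def)
    have "\<bar>inner a b\<bar> \<le> (cmod a)\<^sup>2 + (cmod b)\<^sup>2" for a b :: complex
    proof -
      have "\<bar>inner a b\<bar> \<le> cmod a * cmod b"
        by (rule Cauchy_Schwarz_ineq2)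
      also have "\<dots> \<le> (cmod a)\<^sup>2 + (cmod b)\<^sup>2"
        using sum_squares_bound[of "cmod a" "cmod b"]
          mult_nonneg_nonneg[OF norm_ge_zero[of a] norm_ge_zero[of b]] by linarith
      finally show ?thesis .
    qed
    then show "AE x in lborel. norm (inner (f x) (g x))
        \<le> norm ((cmod (f x))\<^sup>2 + (cmod (g x))\<^sup>2)"
      by auto
  qed measurable
qed

quotient_type L2 = "real \<Rightarrow> complex" / partial:
  "\<lambda>f g. sq_integrable f \<and> sq_integrable g \<and> (AE x in lborel. f x = g x)"
proof (rule part_equivpI)
  show "\<exists>f. sq_integrable f \<and> sq_integrable f \<and> (AE x in lborel. f x = f x)"
    using sq_integrable_zero by auto
  show "symp (\<lambda>f g. sq_integrable f \<and> sq_integrable g \<and> (AE x in lborel. f x = g x))"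
    by (auto intro!: sympI)
  show "transp (\<lambda>f g. sq_integrable f \<and> sq_integrable g \<and> (AE x in lborel. f x = g x))"
    by (auto intro!: transpI)
qed

text \<open>The restriction of \<open>f\<close> to \<open>(a,b)\<close>, extended by zero.\<close>

lift_definition L2_cut :: "real \<Rightarrow> real \<Rightarrow> L2 \<Rightarrow> L2" is
  "\<lambda>a b f x. indicator {a<..<b} x *\<^sub>R f x"
  by (auto intro: sq_integrable_cut)

instantiation L2 :: real_inner
begin

lift_definition zero_L2 :: L2 is "\<lambda>x. 0"
  by (simp add: sq_integrable_zero)

lift_definition plus_L2 :: "L2 \<Rightarrow> L2 \<Rightarrow> L2" is "\<lambda>f g x. f x + g x"
  by (auto intro: sq_integrable_add)

lift_definition uminus_L2 :: "L2 \<Rightarrow> L2" is "\<lambda>f x. - f x"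
  by (auto intro: sq_integrable_uminus)

definition minus_L2 :: "L2 \<Rightarrow> L2 \<Rightarrow> L2" where
  "minus_L2 f g = f + (- g)"

lift_definition scaleR_L2 :: "real \<Rightarrow> L2 \<Rightarrow> L2" is "\<lambda>r f x. r *\<^sub>R f x"
  by (auto intro: sq_integrable_scaleR)

lift_definition inner_L2 :: "L2 \<Rightarrow> L2 \<Rightarrow> real" is "\<lambda>f g. LBINT x. inner (f x) (g x)"
proof -
  fix f f' g g' :: "real \<Rightarrow> complex"
  assume f: "sq_integrable f \<and> sq_integrable f' \<and> (AE x in lborel. f x = f' x)"
    and g: "sq_integrable g \<and> sq_integrable g' \<and> (AE x in lborel. g x = g' x)"
  then have "integrable lborel (\<lambda>x. inner (f x) (g x))" "integrable lborel (\<lambda>x. inner (f' x) (g' x))"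
    by (auto intro: sq_integrable_inner)
  moreover have "AE x in lborel. inner (f x) (g x) = inner (f' x) (g' x)"
    using f g by auto
  ultimately show "(LBINT x. inner (f x) (g x)) = (LBINT x. inner (f' x) (g' x))"
    by (intro integral_cong_AE) auto
qed

definition norm_L2 :: "L2 \<Rightarrow> real" where
  "norm_L2 f = sqrt (inner f f)"

definition sgn_L2 :: "L2 \<Rightarrow> L2" where
  "sgn_L2 f = scaleR (inverse (norm f)) f"

definition dist_L2 :: "L2 \<Rightarrow> L2 \<Rightarrow> real" where
  "dist_L2 f g = norm (f - g)"

definition uniformity_L2 :: "(L2 \<times> L2) filter" where
  "uniformity_L2 = (INF e\<in>{0<..}. principal {(f, g). dist f g < e})"

definition open_L2 :: "L2 set \<Rightarrow> bool" where
  "open_L2 U \<longleftrightarrow> (\<forall>f\<in>U. \<forall>\<^sub>F (f', g) in uniformity. f' = f \<longrightarrow> g \<in> U)"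

instance
proof
  fix f g h :: L2 and r s :: real
  show "f + g + h = f + (g + h)"
    by transfer (auto simp: add.assoc intro: sq_integrable_add)
  show "f + g = g + f"
    by transfer (auto simp: add.commute intro: sq_integrable_add)
  show "0 + f = f"
    by transfer auto
  show "- f + f = 0"
    by transfer (auto simp: sq_integrable_zero)
  show "f - g = f + (- g)"
    by (simp add: minus_L2_def)
  show "r *\<^sub>R (f + g) = r *\<^sub>R f + r *\<^sub>R g"
    by transfer (auto simp: scaleR_add_right simp del: scaleR_conv_of_real
        intro!: sq_integrable_add sq_integrable_scaleR)
  show "(r + s) *\<^sub>R f = r *\<^sub>R f + s *\<^sub>R f"
    by transfer (auto simp: scaleR_add_left simp del: scaleR_conv_of_real
        intro!: sq_integrable_add sq_integrable_scaleR)
  show "r *\<^sub>R s *\<^sub>R f = (r * s) *\<^sub>R f"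
    by transfer (auto simp del: scaleR_conv_of_real intro!: sq_integrable_scaleR)
  show "1 *\<^sub>R f = f"
    by transfer auto
  show "sgn f = scaleR (inverse (norm f)) f"
    by (simp add: sgn_L2_def)
  show "dist f g = norm (f - g)"
    by (rule dist_L2_def)
  show "(uniformity :: (L2 \<times> L2) filter) = (INF e\<in>{0<..}. principal {(f, g). dist f g < e})"
    by (rule uniformity_L2_def)
  show "open U \<longleftrightarrow> (\<forall>f\<in>U. \<forall>\<^sub>F (f', g) in uniformity. f' = f \<longrightarrow> g \<in> U)" for U :: "L2 set"
    by (rule open_L2_def)
  show "inner f g = inner g f"
    by transfer (simp add: inner_commute)
  show "inner (f + g) h = inner f h + inner g h"
    by transfer (simp add: inner_add_left sq_integrable_inner)
  show "inner (r *\<^sub>R f) g = r * inner f g"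
    by transfer (simp add: inner_scaleR_left del: scaleR_conv_of_real)
  show "0 \<le> inner f f"
    by transfer (auto intro!: integral_nonneg_AE)
  show "inner f f = 0 \<longleftrightarrow> f = 0"
  proof transfer
    fix f :: "real \<Rightarrow> complex"
    assume f: "sq_integrable f \<and> sq_integrable f \<and> (AE x in lborel. f x = f x)"
    then have "integrable lborel (\<lambda>x. inner (f x) (f x))"
      by (auto intro: sq_integrable_inner)
    then have "(LBINT x. inner (f x) (f x)) = 0 \<longleftrightarrow> (AE x in lborel. inner (f x) (f x) = 0)"
      by (intro integral_nonneg_eq_0_iff_AE) auto
    then show "((LBINT x. inner (f x) (f x)) = 0) =
        (sq_integrable f \<and> sq_integrable (\<lambda>x. 0) \<and> (AE x in lborel. f x = 0))"
      using f by (simp add: sq_integrable_zero)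
  qed
  show "norm f = sqrt (inner f f)"
    by (rule norm_L2_def)
qed

end


section \<open>State spaces\<close>

text \<open>
  The discrete modes are indexed by a finite type \<open>'n\<close>, so that the number of modes is
  \<open>CARD('n)\<close>.  The product norm is the Hilbert norm \<open>sqrt (\<parallel>T\<parallel>\<^sup>2 + \<parallel>\<phi>\<parallel>\<^sup>2)\<close>.
\<close>

type_synonym 'n state = "(complex, 'n) vec \<times> L2"

text \<open>\<open>\<H>\<^sub>\<xi> = \<complex>\<^sup>N \<times> L\<^sup>2(\<xi>, k\<^sup>2)\<close> and the restriction \<open>y\<^sup>\<xi>\<close> of \<open>y\<close>; elements of
  \<open>L\<^sup>2(\<xi>, k\<^sup>2)\<close> are extended by zero.\<close>

definition H_space :: "real \<Rightarrow> real \<Rightarrow> 'n::finite state set" where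
  "H_space k \<xi> = {x. L2_cut \<xi> (k\<^sup>2) (snd x) = snd x}"

definition H_restrict :: "real \<Rightarrow> real \<Rightarrow> 'n::finite state \<Rightarrow> 'n state" where
  "H_restrict k \<xi> y = (fst y, L2_cut \<xi> (k\<^sup>2) (snd y))"


section \<open>Modes and coupling coefficients\<close>

text \<open>The family \<open>\<sigma>\<close> of transverse wavenumbers of the discrete modes, listed increasingly.\<close>

definition discrete_modes :: "real \<Rightarrow> real \<Rightarrow> real \<Rightarrow> ('n::{finite,linorder} \<Rightarrow> real) \<Rightarrow> bool" where
  "discrete_modes d n1 k \<sigma> \<longleftrightarrow> strict_mono \<sigma> \<and>
     range \<sigma> = {s. 0 < s \<and> s < n1 * k * d * sqrt (1 - 1 / n1\<^sup>2) \<and>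
       tan s = - s / sqrt ((n1 * k * d * sqrt (1 - 1 / n1\<^sup>2))\<^sup>2 - s\<^sup>2)}"

definition wavenumber :: "real \<Rightarrow> real \<Rightarrow> real \<Rightarrow> ('n \<Rightarrow> real) \<Rightarrow> 'n \<Rightarrow> real" where
  "wavenumber d n1 k \<sigma> j = sqrt (n1\<^sup>2 * k\<^sup>2 - (\<sigma> j)\<^sup>2 / d\<^sup>2)"

definition mode_zeta :: "real \<Rightarrow> real \<Rightarrow> real \<Rightarrow> ('n \<Rightarrow> real) \<Rightarrow> 'n \<Rightarrow> real" where
  "mode_zeta d n1 k \<sigma> j = d * sqrt ((wavenumber d n1 k \<sigma> j)\<^sup>2 - k\<^sup>2)"

definition mode_amplitude :: "real \<Rightarrow> real \<Rightarrow> real \<Rightarrow> ('n \<Rightarrow> real) \<Rightarrow> 'n \<Rightarrow> real" where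
  "mode_amplitude d n1 k \<sigma> j = sqrt ((2 / d) /
     (1 + (sin (\<sigma> j))\<^sup>2 / mode_zeta d n1 k \<sigma> j - sin (2 * \<sigma> j) / (2 * \<sigma> j)))"

definition cont_eta :: "real \<Rightarrow> real \<Rightarrow> real \<Rightarrow> real \<Rightarrow> real" where
  "cont_eta d n1 k \<gamma> = d * sqrt (n1\<^sup>2 * k\<^sup>2 - \<gamma>)"

definition cont_xi :: "real \<Rightarrow> real \<Rightarrow> real \<Rightarrow> real" where
  "cont_xi d k \<gamma> = d * sqrt (k\<^sup>2 - \<gamma>)"

definition cont_amplitude :: "real \<Rightarrow> real \<Rightarrow> real \<Rightarrow> real \<Rightarrow> real" where
  "cont_amplitude d n1 k \<gamma> = sqrt (d * cont_xi d k \<gamma> /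
     (pi * ((cont_xi d k \<gamma>)\<^sup>2 * (sin (cont_eta d n1 k \<gamma>))\<^sup>2 +
            (cont_eta d n1 k \<gamma>)\<^sup>2 * (cos (cont_eta d n1 k \<gamma>))\<^sup>2)))"

text \<open>Discrete modes are labelled \<open>Inl j\<close>, modes of the continuum \<open>Inr \<gamma>\<close> (with \<open>\<gamma> < k\<^sup>2\<close>).\<close>

fun mode :: "real \<Rightarrow> real \<Rightarrow> real \<Rightarrow> ('n \<Rightarrow> real) \<Rightarrow> 'n + real \<Rightarrow> real \<Rightarrow> real" where
  "mode d n1 k \<sigma> (Inl j) x = mode_amplitude d n1 k \<sigma> j * sin (\<sigma> j * x / d)"
| "mode d n1 k \<sigma> (Inr \<gamma>) x = cont_amplitude d n1 k \<gamma> * sin (cont_eta d n1 k \<gamma> * x / d)"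

definition coupling :: "real \<Rightarrow> real \<Rightarrow> real \<Rightarrow> ('n \<Rightarrow> real) \<Rightarrow> (real \<Rightarrow> real \<Rightarrow> 'w \<Rightarrow> real) \<Rightarrow>
    'n + real \<Rightarrow> 'n + real \<Rightarrow> real \<Rightarrow> 'w \<Rightarrow> real" where
  "coupling d n1 k \<sigma> V p q z \<omega> =
     (LBINT x:{0..d}. mode d n1 k \<sigma> p x * mode d n1 k \<sigma> q x * V x z \<omega>)"

text \<open>\<open>coupling_cov \<dots> p q r s z\<close> is \<open>\<bbbE>[C\<^sub>p\<^sub>q(0) C\<^sub>r\<^sub>s(z)]\<close>.\<close>

definition coupling_cov :: "real \<Rightarrow> real \<Rightarrow> real \<Rightarrow> ('n \<Rightarrow> real) \<Rightarrow> 'w measure \<Rightarrow>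
    (real \<Rightarrow> real \<Rightarrow> 'w \<Rightarrow> real) \<Rightarrow>
    'n + real \<Rightarrow> 'n + real \<Rightarrow> 'n + real \<Rightarrow> 'n + real \<Rightarrow> real \<Rightarrow> real" where
  "coupling_cov d n1 k \<sigma> M V p q r s z =
     (\<integral>\<omega>. coupling d n1 k \<sigma> V p q 0 \<omega> * coupling d n1 k \<sigma> V r s z \<omega> \<partial>M)"

text \<open>The trigonometric function \<open>trig\<close> is \<open>cos\<close> for \<open>\<Gamma>\<^sup>c\<close>, \<open>\<Lambda>\<^sup>c\<close> and \<open>sin\<close> for \<open>\<Gamma>\<^sup>s\<close>, \<open>\<Lambda>\<^sup>s\<close>.\<close>

definition Gamma_offdiag :: "(real \<Rightarrow> real) \<Rightarrow> real \<Rightarrow> real \<Rightarrow> real \<Rightarrow> ('n \<Rightarrow> real) \<Rightarrow>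
    'w measure \<Rightarrow> (real \<Rightarrow> real \<Rightarrow> 'w \<Rightarrow> real) \<Rightarrow> 'n \<Rightarrow> 'n \<Rightarrow> real" where
  "Gamma_offdiag trig d n1 k \<sigma> M V j l =
     (let \<beta> = wavenumber d n1 k \<sigma> in
      k ^ 4 / (2 * \<beta> j * \<beta> l) *
      (LBINT z:{0..}. coupling_cov d n1 k \<sigma> M V (Inl j) (Inl l) (Inl j) (Inl l) z *
         trig ((\<beta> l - \<beta> j) * z)))"

definition Gamma :: "(real \<Rightarrow> real) \<Rightarrow> real \<Rightarrow> real \<Rightarrow> real \<Rightarrow> ('n::finite \<Rightarrow> real) \<Rightarrow>
    'w measure \<Rightarrow> (real \<Rightarrow> real \<Rightarrow> 'w \<Rightarrow> real) \<Rightarrow> 'n \<Rightarrow> 'n \<Rightarrow> real" where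
  "Gamma trig d n1 k \<sigma> M V j l =
     (if j = l then - (\<Sum>l'\<in>UNIV - {j}. Gamma_offdiag trig d n1 k \<sigma> M V j l')
      else Gamma_offdiag trig d n1 k \<sigma> M V j l)"

definition Gamma1 :: "real \<Rightarrow> real \<Rightarrow> real \<Rightarrow> ('n \<Rightarrow> real) \<Rightarrow>
    'w measure \<Rightarrow> (real \<Rightarrow> real \<Rightarrow> 'w \<Rightarrow> real) \<Rightarrow> 'n \<Rightarrow> 'n \<Rightarrow> real" where
  "Gamma1 d n1 k \<sigma> M V j l =
     (let \<beta> = wavenumber d n1 k \<sigma> in
      k ^ 4 / (2 * \<beta> j * \<beta> l) *
      (LBINT z:{0..}. coupling_cov d n1 k \<sigma> M V (Inl j) (Inl j) (Inl l) (Inl l) z))"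

definition Lambda_cut :: "(real \<Rightarrow> real) \<Rightarrow> real \<Rightarrow> real \<Rightarrow> real \<Rightarrow> ('n \<Rightarrow> real) \<Rightarrow>
    'w measure \<Rightarrow> (real \<Rightarrow> real \<Rightarrow> 'w \<Rightarrow> real) \<Rightarrow> real \<Rightarrow> 'n \<Rightarrow> real" where
  "Lambda_cut trig d n1 k \<sigma> M V \<xi> j =
     (let \<beta> = wavenumber d n1 k \<sigma> in
      LBINT \<gamma>:{\<xi><..<k\<^sup>2}. k ^ 4 / (2 * sqrt \<gamma> * \<beta> j) *
        (LBINT z:{0..}. coupling_cov d n1 k \<sigma> M V (Inl j) (Inr \<gamma>) (Inl j) (Inr \<gamma>) z *
           trig ((sqrt \<gamma> - \<beta> j) * z)))"

definition kappa_cut :: "real \<Rightarrow> real \<Rightarrow> real \<Rightarrow> ('n \<Rightarrow> real) \<Rightarrow>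
    'w measure \<Rightarrow> (real \<Rightarrow> real \<Rightarrow> 'w \<Rightarrow> real) \<Rightarrow> real \<Rightarrow> 'n \<Rightarrow> real" where
  "kappa_cut d n1 k \<sigma> M V \<xi> j =
     (let \<beta> = wavenumber d n1 k \<sigma> in
      LBINT \<gamma>:{..< - \<xi>}. k ^ 4 / (2 * \<beta> j * sqrt \<bar>\<gamma>\<bar>) *
        (LBINT z:{0..}. coupling_cov d n1 k \<sigma> M V (Inl j) (Inr \<gamma>) (Inl j) (Inr \<gamma>) z *
           cos (\<beta> j * z) * exp (- sqrt \<bar>\<gamma>\<bar> * z)))"


section \<open>The random medium\<close>

text \<open>Jointly Gaussian families; degenerate laws (Dirac masses) are allowed.\<close>

definition gaussian_rv :: "'w measure \<Rightarrow> ('w \<Rightarrow> real) \<Rightarrow> bool" where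
  "gaussian_rv M X \<longleftrightarrow> X \<in> borel_measurable M \<and>
     (\<exists>m. (AE \<omega> in M. X \<omega> = m) \<or> (\<exists>s>0. distributed M lborel X (normal_density m s)))"

definition gaussian_family :: "'w measure \<Rightarrow> 'i set \<Rightarrow> ('i \<Rightarrow> 'w \<Rightarrow> real) \<Rightarrow> bool" where
  "gaussian_family M I X \<longleftrightarrow>
     (\<forall>J c. finite J \<and> J \<subseteq> I \<longrightarrow> gaussian_rv M (\<lambda>\<omega>. \<Sum>i\<in>J. c i * X i \<omega>))"

text \<open>\<open>\<gamma>\<^sub>0\<close> is the kernel of a nonnegative (symmetric) operator on \<open>L\<^sup>2(0,d)\<close>.\<close>

definition nonneg_kernel :: "real \<Rightarrow> (real \<times> real \<Rightarrow> real) \<Rightarrow> bool" where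
  "nonneg_kernel d \<gamma>0 \<longleftrightarrow>
     (\<forall>x\<in>{0..d}. \<forall>y\<in>{0..d}. \<gamma>0 (x, y) = \<gamma>0 (y, x)) \<and>
     (\<forall>f :: real \<Rightarrow> real. f \<in> borel_measurable borel \<and> set_integrable lborel {0..d} (\<lambda>x. (f x)\<^sup>2) \<longrightarrow>
        (LBINT x:{0..d}. (LBINT y:{0..d}. \<gamma>0 (x, y) * f y) * f x) \<ge> 0)"

definition random_medium :: "real \<Rightarrow> real \<Rightarrow> (real \<times> real \<Rightarrow> real) \<Rightarrow> 'w measure \<Rightarrow>
    (real \<Rightarrow> real \<Rightarrow> 'w \<Rightarrow> real) \<Rightarrow> bool" where
  "random_medium d a \<gamma>0 M V \<longleftrightarrow>
     prob_space M \<and>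
     (\<exists>C. C-lipschitz_on ({0..d} \<times> {0..d}) \<gamma>0) \<and>
     nonneg_kernel d \<gamma>0 \<and>
     gaussian_family M ({0..d} \<times> {0..}) (\<lambda>(x, z). V x z) \<and>
     (\<forall>\<omega>\<in>space M. continuous_on ({0..d} \<times> {0..}) (\<lambda>(x, z). V x z \<omega>)) \<and>
     (\<forall>x\<in>{0..d}. \<forall>z\<ge>0. (\<integral>\<omega>. V x z \<omega> \<partial>M) = 0) \<and>
     (\<forall>x\<in>{0..d}. \<forall>y\<in>{0..d}. \<forall>z1\<ge>0. \<forall>z2\<ge>0.
        (\<integral>\<omega>. V x z1 \<omega> * V y z2 \<omega> \<partial>M) = \<gamma>0 (x, y) * exp (- a * \<bar>z1 - z2\<bar>))"


section \<open>The infinitesimal generator\<close>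

text \<open>Derivative of \<open>f\<close> in the direction \<open>u\<close> of the discrete coordinates.\<close>

definition disc_deriv :: "(complex, 'n::finite) vec \<Rightarrow> ('n state \<Rightarrow> complex) \<Rightarrow> 'n state \<Rightarrow> complex" where
  "disc_deriv u f x = vector_derivative (\<lambda>t. f (x + t *\<^sub>R (u, 0))) (at 0)"

text \<open>The Wirtinger derivatives \<open>\<partial>\<^bsub>T\<^sub>j\<^esub>\<close> and \<open>\<partial>\<close> with respect to the conjugate of \<open>T\<^sub>j\<close>.\<close>

definition dT :: "'n::finite \<Rightarrow> ('n state \<Rightarrow> complex) \<Rightarrow> 'n state \<Rightarrow> complex" where
  "dT j f x = (1 / 2) * (disc_deriv (axis j 1) f x - \<i> * disc_deriv (axis j \<i>) f x)"

definition dTbar :: "'n::finite \<Rightarrow> ('n state \<Rightarrow> complex) \<Rightarrow> 'n state \<Rightarrow> complex" where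
  "dTbar j f x = (1 / 2) * (disc_deriv (axis j 1) f x + \<i> * disc_deriv (axis j \<i>) f x)"

definition L1_op :: "('n::finite \<Rightarrow> 'n \<Rightarrow> real) \<Rightarrow> ('n \<Rightarrow> 'n \<Rightarrow> real) \<Rightarrow> ('n \<Rightarrow> 'n \<Rightarrow> real) \<Rightarrow>
    ('n state \<Rightarrow> complex) \<Rightarrow> 'n state \<Rightarrow> complex" where
  "L1_op Gc Gs G1 f x = (let T = (\<lambda>j. fst x $ j) in
     (1 / 2) * (\<Sum>j\<in>UNIV. \<Sum>l\<in>UNIV - {j}. of_real (Gc j l) *
        (T j * cnj (T j) * dT l (dTbar l f) x + T l * cnj (T l) * dT j (dTbar j f) x
         - T j * T l * dT j (dT l f) x - cnj (T j) * cnj (T l) * dTbar j (dTbar l f) x))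
   + (1 / 2) * (\<Sum>j\<in>UNIV. \<Sum>l\<in>UNIV. of_real (G1 j l) *
        (T j * cnj (T l) * dT j (dTbar l f) x + cnj (T j) * T l * dTbar j (dT l f) x
         - T j * T l * dT j (dT l f) x - cnj (T j) * cnj (T l) * dTbar j (dTbar l f) x))
   + (1 / 2) * (\<Sum>j\<in>UNIV. of_real (Gc j j - G1 j j) * (T j * dT j f x + cnj (T j) * dTbar j f x))
   + (\<i> / 2) * (\<Sum>j\<in>UNIV. of_real (Gs j j) * (T j * dT j f x - cnj (T j) * dTbar j f x)))"

definition L2_op :: "('n::finite \<Rightarrow> real) \<Rightarrow> ('n \<Rightarrow> real) \<Rightarrow> ('n state \<Rightarrow> complex) \<Rightarrow> 'n state \<Rightarrow> complex" where
  "L2_op Lc Ls f x = (let T = (\<lambda>j. fst x $ j) in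
     - (1 / 2) * (\<Sum>j\<in>UNIV.
        (of_real (Lc j) + \<i> * of_real (Ls j)) * T j * dT j f x
      + (of_real (Lc j) - \<i> * of_real (Ls j)) * cnj (T j) * dTbar j f x))"

definition L3_op :: "('n::finite \<Rightarrow> real) \<Rightarrow> ('n state \<Rightarrow> complex) \<Rightarrow> 'n state \<Rightarrow> complex" where
  "L3_op \<kappa> f x = (let T = (\<lambda>j. fst x $ j) in
     \<i> * (\<Sum>j\<in>UNIV. of_real (\<kappa> j) * (T j * dT j f x - cnj (T j) * dTbar j f x)))"

text \<open>The generator with the coefficients \<open>\<Gamma>\<^sup>c\<close>, \<open>\<Gamma>\<^sup>s\<close>, \<open>\<Gamma>\<^sup>1\<close> of the medium and the given
  \<open>\<Lambda>\<^sup>c\<close>, \<open>\<Lambda>\<^sup>s\<close>, \<open>\<kappa>\<close>.\<close>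

definition generator :: "real \<Rightarrow> real \<Rightarrow> real \<Rightarrow> ('n::finite \<Rightarrow> real) \<Rightarrow> 'w measure \<Rightarrow>
    (real \<Rightarrow> real \<Rightarrow> 'w \<Rightarrow> real) \<Rightarrow> ('n \<Rightarrow> real) \<Rightarrow> ('n \<Rightarrow> real) \<Rightarrow> ('n \<Rightarrow> real) \<Rightarrow>
    ('n state \<Rightarrow> complex) \<Rightarrow> 'n state \<Rightarrow> complex" where
  "generator d n1 k \<sigma> M V Lc Ls \<kappa> f x =
     L1_op (Gamma cos d n1 k \<sigma> M V) (Gamma sin d n1 k \<sigma> M V) (Gamma1 d n1 k \<sigma> M V) f x
     + L2_op Lc Ls f x + L3_op \<kappa> f x"

text \<open>
  Test functions: bounded continuous functions on the whole state space that are twice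
  continuously differentiable, with bounded derivatives, in the discrete coordinates, and vanish
  when these are large.  No smoothness in the \<open>L\<^sup>2\<close> component is required, as no generator
  above differentiates in it; since functions of the \<open>L\<^sup>2\<close> component are included (up to a cutoff
  in the discrete coordinates), the martingale problem forces that component to be constant in time.
\<close>

definition test_functions :: "('n::finite state \<Rightarrow> complex) set" where
  "test_functions = {f.
     continuous_on UNIV f \<and> bounded (range f) \<and>
     (\<exists>R. \<forall>T \<phi>. norm T > R \<longrightarrow> f (T, \<phi>) = 0) \<and>
     (\<forall>u. (\<forall>x. (\<lambda>t::real. f (x + t *\<^sub>R (u, 0))) differentiable (at 0)) \<and>
        continuous_on UNIV (disc_deriv u f) \<and> bounded (range (disc_deriv u f)) \<and>
        (\<forall>v. (\<forall>x. (\<lambda>t::real. disc_deriv u f (x + t *\<^sub>R (v, 0))) differentiable (at 0)) \<and>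
           continuous_on UNIV (disc_deriv v (disc_deriv u f)) \<and>
           bounded (range (disc_deriv v (disc_deriv u f)))))}"


section \<open>Martingale problems\<close>

text \<open>Continuous paths \<open>[0,\<infinity>) \<rightarrow> S\<close> with the \<open>\<sigma>\<close>-algebra generated by the coordinates.\<close>

definition path_space :: "'a::topological_space set \<Rightarrow> (real \<Rightarrow> 'a) measure" where
  "path_space S = restrict_space (PiM {0..} (\<lambda>_. borel))
     {w. continuous_on {0..} w \<and> (\<forall>t\<ge>0. w t \<in> S)}"

definition path_filtration :: "'a::topological_space set \<Rightarrow> real \<Rightarrow> (real \<Rightarrow> 'a) measure" where
  "path_filtration S t = sigma (space (path_space S))
     {(\<lambda>w. w s) -` B \<inter> space (path_space S) | s B. 0 \<le> s \<and> s \<le> t \<and> B \<in> sets borel}"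

definition real_martingale :: "'w measure \<Rightarrow> (real \<Rightarrow> 'w measure) \<Rightarrow> (real \<Rightarrow> 'w \<Rightarrow> real) \<Rightarrow> bool" where
  "real_martingale P F X \<longleftrightarrow>
     (\<forall>t\<ge>0. X t \<in> borel_measurable (F t) \<and> integrable P (X t)) \<and>
     (\<forall>s t. 0 \<le> s \<and> s \<le> t \<longrightarrow> (AE w in P. real_cond_exp P (F s) (X t) w = X s w))"

definition complex_martingale :: "'w measure \<Rightarrow> (real \<Rightarrow> 'w measure) \<Rightarrow> (real \<Rightarrow> 'w \<Rightarrow> complex) \<Rightarrow> bool" where
  "complex_martingale P F X \<longleftrightarrow>
     real_martingale P F (\<lambda>t w. Re (X t w)) \<and> real_martingale P F (\<lambda>t w. Im (X t w))"

definition solves_martingale_problem :: "'n::finite state set \<Rightarrow>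
    (('n state \<Rightarrow> complex) \<Rightarrow> 'n state \<Rightarrow> complex) \<Rightarrow> 'n state \<Rightarrow> (real \<Rightarrow> 'n state) measure \<Rightarrow> bool" where
  "solves_martingale_problem S G y P \<longleftrightarrow>
     prob_space P \<and> sets P = sets (path_space S) \<and> (AE w in P. w 0 = y) \<and>
     (\<forall>f\<in>test_functions. complex_martingale P (path_filtration S)
        (\<lambda>t w. f (w t) - f (w 0) - (LBINT s:{0..t}. G f (w s))))"

text \<open>\<open>P\<close> is the law, on path space, of the unique diffusion on \<open>S\<close> started at \<open>y\<close> with generator \<open>G\<close>.\<close>

definition unique_diffusion_law :: "'n::finite state set \<Rightarrow>
    (('n state \<Rightarrow> complex) \<Rightarrow> 'n state \<Rightarrow> complex) \<Rightarrow> 'n state \<Rightarrow> (real \<Rightarrow> 'n state) measure \<Rightarrow> bool" where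
  "unique_diffusion_law S G y P \<longleftrightarrow>
     solves_martingale_problem S G y P \<and> (\<forall>Q. solves_martingale_problem S G y Q \<longrightarrow> Q = P)"


section \<open>Convergence in distribution on \<open>\<C>([0,L], S)\<close>\<close>

definition cpaths :: "real \<Rightarrow> 'a::metric_space set \<Rightarrow> (real \<Rightarrow> 'a) set" where
  "cpaths L S = {w \<in> extensional {0..L}. continuous_on {0..L} w \<and> w ` {0..L} \<subseteq> S}"

text \<open>The supremum metric; the value outside \<open>cpaths L S\<close> is irrelevant, but the library notion
  of a metric asks for nonnegativity everywhere.\<close>

definition sup_dist :: "real \<Rightarrow> 'a::metric_space set \<Rightarrow> (real \<Rightarrow> 'a) \<Rightarrow> (real \<Rightarrow> 'a) \<Rightarrow> real" where
  "sup_dist L S u v =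
     (if u \<in> cpaths L S \<and> v \<in> cpaths L S then SUP t\<in>{0..L}. dist (u t) (v t) else 0)"

lemma sup_dist_bdd:
  assumes "u \<in> cpaths L S" "v \<in> cpaths L S"
  shows "bdd_above ((\<lambda>t. dist (u t) (v t)) ` {0..L})"
proof -
  have "compact ((\<lambda>t. dist (u t) (v t)) ` {0..L})"
    using assms by (intro compact_continuous_image continuous_intros) (auto simp: cpaths_def)
  then show ?thesis
    by (intro bounded_imp_bdd_above compact_imp_bounded)
qed

lemma dist_le_sup_dist:
  assumes "u \<in> cpaths L S" "v \<in> cpaths L S" "t \<in> {0..L}"
  shows "dist (u t) (v t) \<le> sup_dist L S u v"
  unfolding sup_dist_def using assms by (auto intro!: cSUP_upper sup_dist_bdd)

lemma Metric_space_cpaths: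
  assumes "0 \<le> L"
  shows "Metric_space (cpaths L S) (sup_dist L S)"
proof
  fix u v w :: "real \<Rightarrow> 'a"
  show "sup_dist L S u v = sup_dist L S v u"
    by (simp add: sup_dist_def dist_commute)
  show "0 \<le> sup_dist L S u v"
  proof (cases "u \<in> cpaths L S \<and> v \<in> cpaths L S")
    case True
    then have "dist (u 0) (v 0) \<le> sup_dist L S u v"
      using assms by (intro dist_le_sup_dist) auto
    then show ?thesis
      using zero_le_dist[of "u 0" "v 0"] by linarith
  qed (auto simp: sup_dist_def)
  assume u: "u \<in> cpaths L S" and v: "v \<in> cpaths L S"
  show "sup_dist L S u v = 0 \<longleftrightarrow> u = v"
  proof
    assume *: "sup_dist L S u v = 0"
    show "u = v"
    proof (rule extensionalityI)
      show "u \<in> extensional {0..L}" "v \<in> extensional {0..L}"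
        using u v by (auto simp: cpaths_def)
      show "u t = v t" if "t \<in> {0..L}" for t
        using dist_le_sup_dist[OF u v that] * by simp
    qed
  next
    assume "u = v"
    then show "sup_dist L S u v = 0"
      using assms by (simp add: sup_dist_def)
  qed
  assume w: "w \<in> cpaths L S"
  have "(SUP t\<in>{0..L}. dist (u t) (w t)) \<le> sup_dist L S u v + sup_dist L S v w"
  proof (rule cSUP_least)
    show "{0..L} \<noteq> {}"
      using assms by auto
    fix t assume t: "t \<in> {0..L}"
    show "dist (u t) (w t) \<le> sup_dist L S u v + sup_dist L S v w"
      using dist_triangle[of "u t" "w t" "v t"] dist_le_sup_dist[OF u v t] dist_le_sup_dist[OF v w t]
      by linarith
  qed
  then show "sup_dist L S u w \<le> sup_dist L S u v + sup_dist L S v w"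
    using u w by (simp add: sup_dist_def[of L S u w])
qed

definition cpaths_topology :: "real \<Rightarrow> 'a::metric_space set \<Rightarrow> (real \<Rightarrow> 'a) topology" where
  "cpaths_topology L S = Metric_space.mtopology (cpaths L S) (sup_dist L S)"

definition borel_of_topology :: "'b topology \<Rightarrow> 'b measure" where
  "borel_of_topology X = sigma (topspace X) {U. openin X U}"

text \<open>Weak convergence of Borel probability measures on the space \<open>X\<close>.\<close>

definition weakly_converges :: "'b topology \<Rightarrow> ('i \<Rightarrow> 'b measure) \<Rightarrow> 'b measure \<Rightarrow> 'i filter \<Rightarrow> bool" where
  "weakly_converges X \<mu> \<nu> F \<longleftrightarrow>
     (\<forall>\<^sub>F i in F. prob_space (\<mu> i) \<and> sets (\<mu> i) = sets (borel_of_topology X)) \<and>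
     prob_space \<nu> \<and> sets \<nu> = sets (borel_of_topology X) \<and>
     (\<forall>g. continuous_map X euclideanreal g \<and> bounded (g ` topspace X) \<longrightarrow>
        ((\<lambda>i. \<integral>w. g w \<partial>\<mu> i) \<longlongrightarrow> (\<integral>w. g w \<partial>\<nu>)) F)"

text \<open>The law on \<open>\<C>([0,L], S)\<close> of the restriction to \<open>[0,L]\<close> of a process with law \<open>P\<close>.\<close>

definition law_upto :: "real \<Rightarrow> 'a::metric_space set \<Rightarrow> (real \<Rightarrow> 'a) measure \<Rightarrow> (real \<Rightarrow> 'a) measure" where
  "law_upto L S P = distr P (borel_of_topology (cpaths_topology L S)) (\<lambda>w. restrict w {0..L})"

end

theory Submission
  imports Defs
begin

text \<open>
  The amplitude \<open>A\<^sub>\<gamma>\<close> satisfies \<open>A\<^sub>\<gamma>\<^sup>2 \<le> 1 / (\<pi> sqrt (k\<^sup>2 - \<gamma>))\<close>, which makes the coefficient integrals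
  converge as \<open>\<xi> \<rightarrow> 0\<close>; nonnegativity of the kernel gives \<open>\<Lambda>\<^sup>c \<ge> 0\<close>. Applied to cutoffs of \<open>|T|\<^sup>2\<close>, on which \<open>\<L>\<^sub>1\<close>
  vanishes, the martingale property then shows that \<open>|T|\<close> never exceeds its initial value, while test functions of
  the \<open>L\<^sup>2\<close> component show that this component is constant.

  Uniqueness: the generator maps monomials in \<open>T\<close> and its conjugate of a given degree to such monomials, so their
  moments solve a linear system of differential equations; Gronwall's inequality and the Stone-Weierstrass theorem
  determine the finite-dimensional laws.

  Existence and convergence: the fourth moments of increments are bounded by a multiple of \<open>(t - s)\<^sup>2\<close>, uniformly in
  \<open>\<xi>\<close>. Encoding the values at rational times, together with a variable controlling a Hoelder modulus, into a single
  real number reduces the Skorokhod representation of the path laws to that of laws on the line. Along a subsequence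
  the paths then converge locally uniformly almost surely, the limit solves the limiting martingale problem, and
  uniqueness upgrades this to convergence of the whole family.
\<close>

section \<open>Time integrals of random functions\<close>

text \<open>No stochastic integration is involved. The approximating diffusions are given, and the
  limiting one is found as a subsequential limit of them, so that existence and convergence rest on
  one compactness argument. The state space is infinite-dimensional, where bounded sets need not be
  relatively compact; compactness is available because the L2 component turns out to be
  deterministic, which leaves finitely many random coordinates in a ball. This is why confinement is
  proved before anything else: test functions vanish for large T, and monomials become admissible
  only once the paths are known to stay where the cutoff equals 1. Confinement uses the symmetry and
  the zero row sums of \<Gamma>^c; through them all \<Gamma> terms cancel on functions of the norm
  and only a damping by \<Lambda>^c is left. Moments of order (t - s)^2 are summable over dyadic
  grids with allowed increments (9/10)^n because 2 (9/10)^4 > 1. Separability of L2 enters where the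
  restriction of a path has to be measurable for the Borel sets of the uniform topology.\<close>

lemma continuous_on_compact_bound:
 fixes f :: "'a::topological_space \<Rightarrow> 'b::real_normed_vector"
 assumes "compact S" "continuous_on S f"
 obtains B where "0 \<le> B" "\<And>x. x \<in> S \<Longrightarrow> norm (f x) \<le> B"
proof -
 have "bounded (f ` S)"
  using compact_continuous_image[OF assms(2,1)] by (rule compact_imp_bounded)
 then obtain B where B: "\<And>x. x \<in> S \<Longrightarrow> norm (f x) \<le> B"
  by (metis bounded_iff imageI)
 have "norm (f x) \<le> max 0 B" if "x \<in> S" for x
  using B[OF that] by simp
 then show ?thesis using that[of "max 0 B"] by simp
qed

text \<open>Rounding the time down to a grid turns the function into a countable patchwork of
  measurable pieces, and continuity in time recovers it as the mesh shrinks. Joint measurability is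
  what allows Fubini for time integrals along paths.\<close>

lemma caratheodory_measurable:
 fixes X :: "real \<Rightarrow> 'w \<Rightarrow> 'b::{second_countable_topology, real_normed_vector}"
 assumes meas: "\<And>u. u \<in> {a..b} \<Longrightarrow> X u \<in> borel_measurable M"
  and cont: "\<And>\<omega>. \<omega> \<in> space M \<Longrightarrow> continuous_on {a..b} (\<lambda>u. X u \<omega>)"
  and ab: "a \<le> b"
 shows "(\<lambda>p. indicator {a..b} (fst p) *\<^sub>R X (fst p) (snd p)) \<in> borel_measurable (lborel \<Otimes>\<^sub>M M)"
proof -
 \<comment> \<open>The clamp to [a, b] keeps every grid point in the interval, the only place where
   \<open>X\<close> is known to be measurable.\<close>
 define r :: "nat \<Rightarrow> int \<Rightarrow> real" where "r n i = max a (min b (of_int i / Suc n))" for n i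
 define q :: "nat \<Rightarrow> real \<Rightarrow> real" where "q n u = r n \<lfloor>real (Suc n) * u\<rfloor>" for n u
 have r_mem: "r n i \<in> {a..b}" for n i
  using ab by (auto simp: r_def)
 have q_lim: "(\<lambda>n. q n u) \<longlonglongrightarrow> u" if u: "u \<in> {a..b}" for u :: real
 proof -
  have "(\<lambda>n. of_int \<lfloor>Suc n * u\<rfloor> / real (Suc n)) \<longlonglongrightarrow> u"
  proof (rule tendsto_sandwich[of "\<lambda>n. u - 1 / real (Suc n)" _ _ "\<lambda>n. u"])
   have "(\<lambda>n. u - 1 / real (Suc n)) \<longlonglongrightarrow> u - (0::real)"
    by (intro tendsto_diff tendsto_const LIMSEQ_Suc[OF lim_1_over_n])
   then show "(\<lambda>n. u - 1 / real (Suc n)) \<longlonglongrightarrow> u" by simp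
   show "\<forall>\<^sub>F n in sequentially. u - 1 / real (Suc n) \<le> of_int \<lfloor>Suc n * u\<rfloor> / real (Suc n)"
   proof (rule always_eventually, rule allI)
    fix n
    have "real (Suc n) * u - 1 \<le> of_int \<lfloor>real (Suc n) * u\<rfloor>" by linarith
    then have "(real (Suc n) * u - 1) / real (Suc n) \<le> of_int \<lfloor>real (Suc n) * u\<rfloor> / real (Suc n)"
     by (intro divide_right_mono) auto
    then show "u - 1 / real (Suc n) \<le> of_int \<lfloor>Suc n * u\<rfloor> / real (Suc n)"
     by (simp add: diff_divide_distrib del: of_nat_Suc)
   qed
   show "\<forall>\<^sub>F n in sequentially. of_int \<lfloor>Suc n * u\<rfloor> / real (Suc n) \<le> u"
    by (intro always_eventually allI) (simp add: divide_le_eq mult.commute del: of_nat_Suc)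
  qed simp
  then have "(\<lambda>n. max a (min b (of_int \<lfloor>Suc n * u\<rfloor> / real (Suc n)))) \<longlonglongrightarrow> max a (min b u)"
   by (intro tendsto_intros)
  then show ?thesis using u by (simp add: q_def r_def)
 qed
 have m: "(\<lambda>p :: real \<times> 'w. indicator {a..b} (fst p) *\<^sub>R X (q n (fst p)) (snd p))
   \<in> borel_measurable (lborel \<Otimes>\<^sub>M M)" for n
 proof -
  have "(\<lambda>p :: real \<times> 'w. X (r n \<lfloor>real (Suc n) * fst p\<rfloor>) (snd p)) \<in> borel_measurable (lborel \<Otimes>\<^sub>M M)"
  proof (rule measurable_compose_countable[where f="\<lambda>i p. X (r n i) (snd p)"])
   fix i show "(\<lambda>p. X (r n i) (snd p)) \<in> borel_measurable (lborel \<Otimes>\<^sub>M M)"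
    using meas[OF r_mem[of n i]] by measurable
  qed measurable
  then show ?thesis unfolding q_def by measurable
 qed
 show ?thesis
 proof (rule borel_measurable_LIMSEQ_metric[OF m])
  fix p :: "real \<times> 'w" assume "p \<in> space (lborel \<Otimes>\<^sub>M M)"
  then have p: "snd p \<in> space M" by (auto simp: space_pair_measure)
  show "(\<lambda>n. indicator {a..b} (fst p) *\<^sub>R X (q n (fst p)) (snd p))
    \<longlonglongrightarrow> indicator {a..b} (fst p) *\<^sub>R X (fst p) (snd p)"
  proof (cases "fst p \<in> {a..b}")
   case True
   have "(\<lambda>n. X (q n (fst p)) (snd p)) \<longlonglongrightarrow> X (fst p) (snd p)"
    using cont[OF p] True q_lim[OF True] r_mem
    by (auto simp: continuous_on_sequentially comp_def q_def)
   then show ?thesis by (intro tendsto_intros)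
  qed simp
 qed
qed

lemma measurable_time_integral:
 fixes X :: "real \<Rightarrow> 'w \<Rightarrow> 'b::{second_countable_topology, banach}"
 assumes meas: "\<And>u. u \<in> {a..b} \<Longrightarrow> X u \<in> borel_measurable M"
  and cont: "\<And>\<omega>. \<omega> \<in> space M \<Longrightarrow> continuous_on {a..b} (\<lambda>u. X u \<omega>)"
  and ab: "a \<le> b"
 shows "(\<lambda>\<omega>. LBINT u:{a..b}. X u \<omega>) \<in> borel_measurable M"
proof -
 have "(\<lambda>(\<omega>, u). indicator {a..b} u *\<^sub>R X u \<omega>) \<in> borel_measurable (M \<Otimes>\<^sub>M lborel)"
  using measurable_compose[OF measurable_pair_swap' caratheodory_measurable[OF meas cont ab]]
  by (simp add: case_prod_beta)
 then show ?thesis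
  unfolding set_lebesgue_integral_def by (rule lborel.borel_measurable_lebesgue_integral)
qed

text \<open>The uniform bound makes the integrand integrable over the product of a finite interval
  with a probability space, so Fubini applies.\<close>

lemma expectation_time_integral:
 fixes X :: "real \<Rightarrow> 'w \<Rightarrow> 'b::{second_countable_topology, banach}"
 assumes meas: "\<And>u. u \<in> {a..b} \<Longrightarrow> X u \<in> borel_measurable M"
  and cont: "\<And>\<omega>. \<omega> \<in> space M \<Longrightarrow> continuous_on {a..b} (\<lambda>u. X u \<omega>)"
  and ab: "a \<le> b"
  and bound: "\<And>u \<omega>. u \<in> {a..b} \<Longrightarrow> \<omega> \<in> space M \<Longrightarrow> norm (X u \<omega>) \<le> B"
  and M: "prob_space M"
 shows "(\<integral>\<omega>. (LBINT u:{a..b}. X u \<omega>) \<partial>M) = (LBINT u:{a..b}. (\<integral>\<omega>. X u \<omega> \<partial>M))"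
proof -
 interpret Pr: prob_space M by fact
 interpret pair_sigma_finite lborel M ..
 let ?F = "\<lambda>p. indicator {a..b} (fst p) *\<^sub>R X (fst p) (snd p)"
 have F[measurable]: "?F \<in> borel_measurable (lborel \<Otimes>\<^sub>M M)"
  by (rule caratheodory_measurable[OF meas cont ab])
 have B: "0 \<le> B"
  using bound[of a] ab Pr.not_empty norm_ge_zero order_trans by (metis all_not_in_conv atLeastAtMost_iff order_refl)
 have i: "integrable (lborel \<Otimes>\<^sub>M M) ?F"
 proof (rule Bochner_Integration.integrable_bound[OF _ F])
  show "integrable (lborel \<Otimes>\<^sub>M M) (\<lambda>p. B * indicator ({a..b} \<times> space M) p)"
  proof (intro integrable_mult_right integrable_real_indicator)
   show "emeasure (lborel \<Otimes>\<^sub>M M) ({a..b} \<times> space M) < \<infinity>"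
    using Pr.emeasure_pair_measure_Times[of "{a..b}" lborel "space M"]
    by (simp add: Pr.emeasure_space_1 ab)
  qed auto
  show "AE p in lborel \<Otimes>\<^sub>M M. norm (?F p) \<le> norm (B * indicator ({a..b} \<times> space M) p)"
   by (rule AE_I2) (auto simp: space_pair_measure indicator_def intro: bound order_trans[OF bound abs_ge_self])
 qed
 then have "integrable (lborel \<Otimes>\<^sub>M M) (\<lambda>(u, \<omega>). indicator {a..b} u *\<^sub>R X u \<omega>)"
  by (simp add: case_prod_beta')
 from Fubini_integral[OF this] show ?thesis
  by (simp add: set_lebesgue_integral_def)
qed

section \<open>The coefficients of the medium\<close>

lemma random_medium_measurable:
 assumes "random_medium d a \<gamma>0 M V" "x \<in> {0..d}" "z \<ge> 0"
 shows "V x z \<in> borel_measurable M"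
proof -
 have "gaussian_family M ({0..d} \<times> {0..}) (\<lambda>(x, z). V x z)"
  using assms by (auto simp: random_medium_def)
 from this[unfolded gaussian_family_def, rule_format, of "{(x, z)}" "\<lambda>_. 1"]
 show ?thesis using assms by (simp add: gaussian_rv_def)
qed

text \<open>The covariance in \<open>random_medium\<close> is stated through Bochner integrals,
  which return 0 on functions that are not integrable; the Gaussian law is what makes the second
  moments genuinely finite.\<close>

lemma gaussian_rv_square_integrable:
 assumes "prob_space M" "gaussian_rv M X"
 shows "integrable M (\<lambda>\<omega>. (X \<omega>)\<^sup>2)"
proof -
 interpret prob_space M by fact
 have [measurable]: "X \<in> borel_measurable M"
  using assms by (simp add: gaussian_rv_def)
 from assms obtain m where "(AE \<omega> in M. X \<omega> = m) \<or> (\<exists>s>0. distributed M lborel X (normal_density m s))"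
  by (auto simp: gaussian_rv_def)
 then show ?thesis
 proof
  assume "AE \<omega> in M. X \<omega> = m"
  then have "AE \<omega> in M. m\<^sup>2 = (X \<omega>)\<^sup>2" by auto
  then show ?thesis
   by (rule Bochner_Integration.integrable_cong_AE_imp[rotated 2]) auto
 next
  assume "\<exists>s>0. distributed M lborel X (normal_density m s)"
  then obtain s where s: "s > 0" "distributed M lborel X (normal_density m s)" by auto
  have "integrable lborel (\<lambda>x. normal_density m s x * (x - m) ^ (2 * 1))"
   using normal_moment_even[OF s(1), of m 1] by (auto simp: integrable.simps)
  then have "integrable M (\<lambda>\<omega>. (X \<omega> - m)\<^sup>2)"
   using distributed_integrable[OF s(2), of "\<lambda>x. (x - m)\<^sup>2"] by simp
  then have "integrable M (\<lambda>\<omega>. 2 * (X \<omega> - m)\<^sup>2 + 2 * m\<^sup>2)" by simp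
  then show ?thesis
  proof (rule Bochner_Integration.integrable_bound)
   have "x\<^sup>2 \<le> 2 * (x - m)\<^sup>2 + 2 * m\<^sup>2" for x
    using zero_le_power2[of "x - 2 * m"] by (simp add: power2_eq_square algebra_simps)
   then show "AE \<omega> in M. norm ((X \<omega>)\<^sup>2) \<le> norm (2 * (X \<omega> - m)\<^sup>2 + 2 * m\<^sup>2)" by simp
  qed simp
 qed
qed

lemma random_medium_square_integrable:
 assumes "random_medium d a \<gamma>0 M V" "x \<in> {0..d}" "z \<ge> 0"
 shows "integrable M (\<lambda>\<omega>. (V x z \<omega>)\<^sup>2)"
proof (rule gaussian_rv_square_integrable)
 have "gaussian_family M ({0..d} \<times> {0..}) (\<lambda>(x, z). V x z)"
  using assms by (auto simp: random_medium_def)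
 from this[unfolded gaussian_family_def, rule_format, of "{(x, z)}" "\<lambda>_. 1"]
 show "gaussian_rv M (V x z)" using assms by simp
qed (use assms in \<open>simp add: random_medium_def\<close>)

lemma random_medium_kernel_continuous:
 "random_medium d a \<gamma>0 M V \<Longrightarrow> continuous_on ({0..d} \<times> {0..d}) \<gamma>0"
 by (auto simp: random_medium_def dest: lipschitz_on_continuous_on)

lemma random_medium_kernel_bound:
 assumes "random_medium d a \<gamma>0 M V"
 shows "\<exists>G\<ge>0. \<forall>x\<in>{0..d}. \<forall>y\<in>{0..d}. \<bar>\<gamma>0 (x, y)\<bar> \<le> G"
proof -
 obtain G where "0 \<le> G" "\<And>p. p \<in> {0..d} \<times> {0..d} \<Longrightarrow> norm (\<gamma>0 p) \<le> G"
  using continuous_on_compact_bound[OF compact_Times[OF compact_Icc compact_Icc]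
   random_medium_kernel_continuous[OF assms]] by blast
 then show ?thesis by (intro exI[of _ G]) auto
qed

text \<open>The quadratic form of the covariance operator, written as the same iterated integral as
  in \<open>nonneg_kernel\<close>, so that nonnegativity applies verbatim.\<close>

definition kernel_form :: "real \<Rightarrow> (real \<times> real \<Rightarrow> real) \<Rightarrow> (real \<Rightarrow> real) \<Rightarrow> real" where
 "kernel_form d \<gamma>0 f = (LBINT x:{0..d}. (LBINT y:{0..d}. \<gamma>0 (x, y) * f y) * f x)"

text \<open>Fubini moves the expectation inside both space integrals, where the covariance is a
  kernel times a factor of time alone. The work lies in the integrability over both space variables
  and \<omega> together.\<close>

lemma expectation_product_integrals:
 assumes rm: "random_medium d a \<gamma>0 M V" and d: "d > 0" and z: "z \<ge> 0"
  and f: "continuous_on {0..d} f"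
 shows "(\<integral>\<omega>. (LBINT x:{0..d}. f x * V x 0 \<omega>) * (LBINT x:{0..d}. f x * V x z \<omega>) \<partial>M)
  = exp (- a * z) * kernel_form d \<gamma>0 f"
proof -
 interpret prob_space M using rm by (simp add: random_medium_def)
 let ?I = "\<lambda>x. indicator {0..d} x :: real"
 define W where "W z x \<omega> = ?I x * (f x * V x z \<omega>)" for z x \<omega>
 let ?L2 = "lborel \<Otimes>\<^sub>M (lborel :: real measure)"
 interpret P3: pair_sigma_finite ?L2 M ..
 obtain G where G: "0 \<le> G" "\<And>x y. x \<in> {0..d} \<Longrightarrow> y \<in> {0..d} \<Longrightarrow> \<bar>\<gamma>0 (x, y)\<bar> \<le> G"
  using random_medium_kernel_bound[OF rm] by metis
 have contV: "continuous_on {0..d} (\<lambda>x. V x z \<omega>)" if "\<omega> \<in> space M" "z \<ge> 0" for \<omega> z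
 proof -
  have "continuous_on ({0..d} \<times> {0..}) (\<lambda>(x, z). V x z \<omega>)"
   using rm that by (auto simp: random_medium_def)
  moreover have "continuous_on {0..d} (\<lambda>x. (x, z))" by (intro continuous_intros)
  ultimately show ?thesis
   using continuous_on_compose2[of "{0..d} \<times> {0..}" "\<lambda>(x, z). V x z \<omega>" "{0..d}" "\<lambda>x. (x, z)"] that by auto
 qed
 have mW: "(\<lambda>p. W z (fst p) (snd p)) \<in> borel_measurable (lborel \<Otimes>\<^sub>M M)" if "z \<ge> 0" for z
 proof -
  have "(\<lambda>p. indicator {0..d} (fst p) *\<^sub>R (f (fst p) * V (fst p) z (snd p))) \<in> borel_measurable (lborel \<Otimes>\<^sub>M M)"
  proof (rule caratheodory_measurable[where X="\<lambda>x \<omega>. f x * V x z \<omega>"])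
   show "(\<lambda>\<omega>. f u * V u z \<omega>) \<in> borel_measurable M" if "u \<in> {0..d}" for u
    using random_medium_measurable[OF rm that \<open>z \<ge> 0\<close>] by measurable
   show "continuous_on {0..d} (\<lambda>u. f u * V u z \<omega>)" if "\<omega> \<in> space M" for \<omega>
    by (intro continuous_intros f contV that \<open>z \<ge> 0\<close>)
  qed (use d in auto)
  then show ?thesis by (simp add: W_def)
 qed
 have mWW[measurable]: "(\<lambda>q. W 0 (fst (fst q)) (snd q) * W z (snd (fst q)) (snd q)) \<in> borel_measurable (?L2 \<Otimes>\<^sub>M M)"
 proof (intro borel_measurable_times)
  show "(\<lambda>q. W 0 (fst (fst q)) (snd q)) \<in> borel_measurable (?L2 \<Otimes>\<^sub>M M)"
   using measurable_compose[OF _ mW[of 0], of "\<lambda>q. (fst (fst q), snd q)" "?L2 \<Otimes>\<^sub>M M"] by simp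
  show "(\<lambda>q. W z (snd (fst q)) (snd q)) \<in> borel_measurable (?L2 \<Otimes>\<^sub>M M)"
   using measurable_compose[OF _ mW[OF z], of "\<lambda>q. (snd (fst q), snd q)" "?L2 \<Otimes>\<^sub>M M"] by simp
 qed
 obtain B where B: "0 \<le> B" "\<And>x. x \<in> {0..d} \<Longrightarrow> \<bar>f x\<bar> \<le> B"
  using continuous_on_compact_bound[OF compact_Icc f] by (metis real_norm_def)
 have VV: "(\<integral>\<omega>. V x z1 \<omega> * V y z2 \<omega> \<partial>M) = \<gamma>0 (x, y) * exp (- a * \<bar>z1 - z2\<bar>)"
  if "x \<in> {0..d}" "y \<in> {0..d}" "z1 \<ge> 0" "z2 \<ge> 0" for x y z1 z2
  using rm that by (auto simp: random_medium_def)
 have intW: "integrable lborel (\<lambda>x. W z x \<omega>)" if "\<omega> \<in> space M" "z \<ge> 0" for z \<omega>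
 proof -
  have "set_integrable lborel {0..d} (\<lambda>x. f x * V x z \<omega>)"
   by (intro borel_integrable_atLeastAtMost' continuous_intros f contV that)
  then show ?thesis by (simp add: set_integrable_def W_def)
 qed
 have prodW: "(\<integral>x. W 0 x \<omega> \<partial>lborel) * (\<integral>x. W z x \<omega> \<partial>lborel) = (\<integral>p. W 0 (fst p) \<omega> * W z (snd p) \<omega> \<partial>?L2)"
  if \<omega>: "\<omega> \<in> space M" for \<omega>
 proof -
  have [measurable]: "(\<lambda>x. W 0 x \<omega>) \<in> borel_measurable borel" "(\<lambda>x. W z x \<omega>) \<in> borel_measurable borel"
   using intW[OF \<omega>, of 0] intW[OF \<omega> z] by auto
  have i: "integrable ?L2 (\<lambda>p. W 0 (fst p) \<omega> * W z (snd p) \<omega>)"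
   by (rule lborel_pair.Fubini_integrable)
    (use intW[OF \<omega>, of 0] intW[OF \<omega> z] in \<open>auto simp: abs_mult\<close>)
  show ?thesis
   using lborel_pair.integral_fst'[OF i] by simp
 qed
 \<comment> \<open>No bound holds uniformly over the paths, but in expectation the product is
   dominated by the mean of two second moments, and these are values of \<open>\<gamma>0\<close> on
   the diagonal because the time factor is 1 at equal times.\<close>
 have bnd: "(\<integral>\<omega>. norm (W 0 x \<omega> * W z y \<omega>) \<partial>M) \<le> indicator ({0..d} \<times> {0..d}) (x, y) * (B * B * G)" for x y
 proof (cases "x \<in> {0..d} \<and> y \<in> {0..d}")
  case True
  then have xy: "x \<in> {0..d}" "y \<in> {0..d}" by auto
  note i1 = random_medium_square_integrable[OF rm xy(1), of 0, simplified]
  note i2 = random_medium_square_integrable[OF rm xy(2) z]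
  have [measurable]: "V x 0 \<in> borel_measurable M" "V y z \<in> borel_measurable M"
   using random_medium_measurable[OF rm] xy z by auto
  have le: "\<bar>s * t\<bar> \<le> (s\<^sup>2 + t\<^sup>2) / 2" for s t :: real
   using sum_squares_bound[of "\<bar>s\<bar>" "\<bar>t\<bar>"] by (simp add: abs_mult)
  have "(\<integral>\<omega>. norm (W 0 x \<omega> * W z y \<omega>) \<partial>M) \<le> (\<integral>\<omega>. B * B * (((V x 0 \<omega>)\<^sup>2 + (V y z \<omega>)\<^sup>2) / 2) \<partial>M)"
  proof (rule integral_mono_AE')
   show "integrable M (\<lambda>\<omega>. B * B * (((V x 0 \<omega>)\<^sup>2 + (V y z \<omega>)\<^sup>2) / 2))"
    using i1 i2 by simp
   show "AE \<omega> in M. norm (W 0 x \<omega> * W z y \<omega>) \<le> B * B * (((V x 0 \<omega>)\<^sup>2 + (V y z \<omega>)\<^sup>2) / 2)"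
   proof (rule AE_I2)
    fix \<omega>
    have "norm (W 0 x \<omega> * W z y \<omega>) = (\<bar>f x\<bar> * \<bar>f y\<bar>) * \<bar>V x 0 \<omega> * V y z \<omega>\<bar>"
     using xy by (simp add: W_def abs_mult)
    also have "\<dots> \<le> (B * B) * (((V x 0 \<omega>)\<^sup>2 + (V y z \<omega>)\<^sup>2) / 2)"
     using B xy by (intro mult_mono le) auto
    finally show "norm (W 0 x \<omega> * W z y \<omega>) \<le> B * B * (((V x 0 \<omega>)\<^sup>2 + (V y z \<omega>)\<^sup>2) / 2)" .
   qed
  qed auto
  also have "\<dots> = B * B * ((\<gamma>0 (x, x) + \<gamma>0 (y, y)) / 2)"
   using i1 i2 VV[OF xy(1) xy(1), of 0 0] VV[OF xy(2) xy(2) z z] by (simp add: power2_eq_square)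
  also have "\<dots> \<le> B * B * G"
   using G(2)[OF xy(1) xy(1)] G(2)[OF xy(2) xy(2)] B by (intro mult_left_mono) auto
  finally show ?thesis using xy by simp
 next
  case False
  then have "(\<lambda>\<omega>. norm (W 0 x \<omega> * W z y \<omega>)) = (\<lambda>_. 0)" by (auto simp: W_def)
  then show ?thesis using B(1) G(1) by (simp only: integral_zero) simp
 qed
 have int3: "integrable (?L2 \<Otimes>\<^sub>M M) (\<lambda>(p, \<omega>). W 0 (fst p) \<omega> * W z (snd p) \<omega>)"
 proof (rule P3.Fubini_integrable)
  show m3: "(\<lambda>(p, \<omega>). W 0 (fst p) \<omega> * W z (snd p) \<omega>) \<in> borel_measurable (?L2 \<Otimes>\<^sub>M M)"
   using mWW by (simp add: case_prod_beta')
  show "integrable ?L2 (\<lambda>p. \<integral>\<omega>. norm (case (p, \<omega>) of (p, \<omega>) \<Rightarrow> W 0 (fst p) \<omega> * W z (snd p) \<omega>) \<partial>M)"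
  proof (rule Bochner_Integration.integrable_bound)
   show "integrable ?L2 (\<lambda>p. indicator ({0..d} \<times> {0..d}) p * (B * B * G))"
   proof (intro integrable_mult_left integrable_real_indicator)
    show "emeasure ?L2 ({0..d} \<times> {0..d}) < \<infinity>"
     by (subst lborel.emeasure_pair_measure_Times) (auto simp: less_imp_le[OF d] ennreal_mult_less_top)
   qed auto
   show "(\<lambda>p. \<integral>\<omega>. norm (case (p, \<omega>) of (p, \<omega>) \<Rightarrow> W 0 (fst p) \<omega> * W z (snd p) \<omega>) \<partial>M) \<in> borel_measurable ?L2"
    using m3 by (intro borel_measurable_lebesgue_integral) (simp add: case_prod_beta')
   show "AE p in ?L2. norm (\<integral>\<omega>. norm (case (p, \<omega>) of (p, \<omega>) \<Rightarrow> W 0 (fst p) \<omega> * W z (snd p) \<omega>) \<partial>M)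
     \<le> norm (indicator ({0..d} \<times> {0..d}) p * (B * B * G))"
   proof (rule AE_I2)
    fix p :: "real \<times> real"
    show "norm (\<integral>\<omega>. norm (case (p, \<omega>) of (p, \<omega>) \<Rightarrow> W 0 (fst p) \<omega> * W z (snd p) \<omega>) \<partial>M)
     \<le> norm (indicator ({0..d} \<times> {0..d}) p * (B * B * G))"
     using bnd[of "fst p" "snd p"] by (simp add: order_trans[OF _ abs_ge_self])
   qed
  qed
  show "AE p in ?L2. integrable M (\<lambda>\<omega>. case (p, \<omega>) of (p, \<omega>) \<Rightarrow> W 0 (fst p) \<omega> * W z (snd p) \<omega>)"
  proof (rule AE_I2, simp)
   fix p :: "real \<times> real"
   show "integrable M (\<lambda>\<omega>. W 0 (fst p) \<omega> * W z (snd p) \<omega>)"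
   proof (cases "p \<in> {0..d} \<times> {0..d}")
    case True
    then have xy: "fst p \<in> {0..d}" "snd p \<in> {0..d}" by auto
    have [measurable]: "V (fst p) 0 \<in> borel_measurable M" "V (snd p) z \<in> borel_measurable M"
     using random_medium_measurable[OF rm] xy z by auto
    have "integrable M (\<lambda>\<omega>. V (fst p) 0 \<omega> * V (snd p) z \<omega>)"
    proof (rule Bochner_Integration.integrable_bound)
     show "integrable M (\<lambda>\<omega>. ((V (fst p) 0 \<omega>)\<^sup>2 + (V (snd p) z \<omega>)\<^sup>2) / 2)"
      using random_medium_square_integrable[OF rm xy(1), of 0]
       random_medium_square_integrable[OF rm xy(2) z] by simp
     have le: "\<bar>s * t\<bar> \<le> (s\<^sup>2 + t\<^sup>2) / 2" for s t :: real
      using sum_squares_bound[of "\<bar>s\<bar>" "\<bar>t\<bar>"] by (simp add: abs_mult)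
     show "AE \<omega> in M. norm (V (fst p) 0 \<omega> * V (snd p) z \<omega>)
      \<le> norm (((V (fst p) 0 \<omega>)\<^sup>2 + (V (snd p) z \<omega>)\<^sup>2) / 2)"
      by (rule AE_I2) (simp only: real_norm_def, rule order_trans[OF le abs_ge_self])
    qed simp
    then have "integrable M (\<lambda>\<omega>. (f (fst p) * f (snd p)) * (V (fst p) 0 \<omega> * V (snd p) z \<omega>))"
     by simp
    then show ?thesis using xy by (simp add: W_def ac_simps)
   next
    case False
    then have "(\<lambda>\<omega>. W 0 (fst p) \<omega> * W z (snd p) \<omega>) = (\<lambda>_. 0)" by (cases p) (auto simp: W_def)
    then show ?thesis by (simp only: integrable_zero)
   qed
  qed
 qed
 define K where "K p = ?I (fst p) * ?I (snd p) * (f (fst p) * f (snd p)) * \<gamma>0 p" for p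
 have EW: "(\<integral>\<omega>. W 0 (fst p) \<omega> * W z (snd p) \<omega> \<partial>M) = exp (- a * z) * K p" for p
 proof (cases "p \<in> {0..d} \<times> {0..d}")
  case True
  then have xy: "fst p \<in> {0..d}" "snd p \<in> {0..d}" by auto
  have "(\<integral>\<omega>. W 0 (fst p) \<omega> * W z (snd p) \<omega> \<partial>M)
   = (\<integral>\<omega>. (f (fst p) * f (snd p)) * (V (fst p) 0 \<omega> * V (snd p) z \<omega>) \<partial>M)"
   using xy by (simp add: W_def ac_simps)
  then show ?thesis using VV[OF xy, of 0 z] xy z by (simp add: K_def)
 next
  case False
  then have "(\<lambda>\<omega>. W 0 (fst p) \<omega> * W z (snd p) \<omega>) = (\<lambda>_. 0)" by (cases p) (auto simp: W_def)
  moreover have "K p = 0" using False by (cases p) (auto simp: K_def)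
  ultimately show ?thesis by (simp only: integral_zero)
 qed
 have intK: "integrable ?L2 K"
 proof -
  have "integrable ?L2 (\<lambda>p. exp (- a * z) * K p)"
   using P3.integrable_fst'[OF int3] by (simp add: EW)
  then show ?thesis by simp
 qed
 have "(\<integral>\<omega>. (LBINT x:{0..d}. f x * V x 0 \<omega>) * (LBINT x:{0..d}. f x * V x z \<omega>) \<partial>M)
  = (\<integral>\<omega>. (\<integral>p. W 0 (fst p) \<omega> * W z (snd p) \<omega> \<partial>?L2) \<partial>M)"
  by (intro Bochner_Integration.integral_cong refl)
   (simp add: prodW[unfolded W_def] set_lebesgue_integral_def W_def)
 also have "\<dots> = (\<integral>p. (\<integral>\<omega>. W 0 (fst p) \<omega> * W z (snd p) \<omega> \<partial>M) \<partial>?L2)"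
  using P3.Fubini_integral[OF int3] by simp
 also have "\<dots> = exp (- a * z) * (\<integral>p. K p \<partial>?L2)"
  by (simp add: EW)
 also have "(\<integral>p. K p \<partial>?L2) = kernel_form d \<gamma>0 f"
  unfolding lborel_pair.integral_fst'[OF intK, symmetric] kernel_form_def set_lebesgue_integral_def
  by (simp add: K_def mult_ac flip: integral_mult_left_zero integral_mult_right_zero)
 finally show ?thesis .
qed

section \<open>Cutoff limits and the elementary integrals that control the coefficients\<close>

lemma set_integral_cutoff_tendsto:
 fixes f :: "real \<Rightarrow> real"
 assumes f: "set_integrable lborel A f"
  and A: "\<And>\<xi>. A' \<xi> \<in> sets borel" "\<And>\<xi>. \<xi> > 0 \<Longrightarrow> A' \<xi> \<subseteq> A"
  and ev: "\<And>x. x \<in> A \<Longrightarrow> \<forall>\<^sub>F \<xi> in at_right 0. x \<in> A' \<xi>"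
 shows "((\<lambda>\<xi>. LBINT x:A' \<xi>. f x) \<longlongrightarrow> (LBINT x:A. f x)) (at_right (0::real))"
 unfolding tendsto_at_iff_sequentially comp_def set_lebesgue_integral_def
proof (intro allI impI)
 fix X :: "nat \<Rightarrow> real" assume X: "\<forall>i. X i \<in> {0<..} - {0}" "X \<longlonglongrightarrow> 0"
 have X0: "X i > 0" for i using X by auto
 have limX: "filterlim X (at_right 0) sequentially"
  using X(2) X0 by (intro tendsto_imp_filterlim_at_right) auto
 have eq: "indicator (A' (X i)) x *\<^sub>R f x = indicator (A' (X i)) x *\<^sub>R (indicator A x *\<^sub>R f x)" for i x
  using A(2)[OF X0[of i]] by (auto simp: indicator_def)
 have m: "(\<lambda>x. indicator A x *\<^sub>R f x) \<in> borel_measurable lborel"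
  using f by (simp add: set_integrable_def)
 show "(\<lambda>i. LBINT x. indicator (A' (X i)) x *\<^sub>R f x) \<longlonglongrightarrow> (LBINT x. indicator A x *\<^sub>R f x)"
 proof (rule integral_dominated_convergence)
  show "integrable lborel (\<lambda>x. norm (indicator A x *\<^sub>R f x))"
   using f unfolding set_integrable_def by (rule integrable_norm)
  show "(\<lambda>x. indicator (A' (X i)) x *\<^sub>R f x) \<in> borel_measurable lborel" for i
   unfolding eq using m A(1)[of "X i"] by measurable
  show "AE x in lborel. (\<lambda>i. indicator (A' (X i)) x *\<^sub>R f x) \<longlonglongrightarrow> indicator A x *\<^sub>R f x"
  proof (rule AE_I2)
   fix x :: real
   show "(\<lambda>i. indicator (A' (X i)) x *\<^sub>R f x) \<longlonglongrightarrow> indicator A x *\<^sub>R f x"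
   proof (cases "x \<in> A")
    case True
    have "\<forall>\<^sub>F i in sequentially. x \<in> A' (X i)"
     by (rule eventually_compose_filterlim[OF ev[OF True] limX])
    then have "\<forall>\<^sub>F i in sequentially. indicator (A' (X i)) x *\<^sub>R f x = indicator A x *\<^sub>R f x"
     by eventually_elim (use True in auto)
    then show ?thesis by (rule tendsto_eventually)
   next
    case False
    then have "(\<lambda>i. indicator (A' (X i)) x *\<^sub>R f x) = (\<lambda>_. 0)"
     using A(2)[OF X0] by (auto simp: indicator_def fun_eq_iff)
    then show ?thesis using False by (simp only:) simp
   qed
  qed
  show "AE x in lborel. norm (indicator (A' (X i)) x *\<^sub>R f x) \<le> norm (indicator A x *\<^sub>R f x)" for i
   using A(2)[OF X0[of i]] by (auto simp: indicator_def)
 qed (use m in simp)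
qed

text \<open>These are the two singular endpoints of the integrand of \<Lambda>: the factor
  \<open>1 / sqrt \<gamma>\<close> at 0, and the squared amplitude, of order
  \<open>1 / sqrt (c - \<gamma>)\<close>, at the cut \<open>c = k\<^sup>2\<close>.\<close>

lemma set_integrable_inverse_sqrt:
 fixes c :: real assumes "c > 0"
 shows "set_integrable lborel {0<..<c} (\<lambda>x. 1 / sqrt x)"
  and "set_integrable lborel {0<..<c} (\<lambda>x. 1 / sqrt (c - x))"
proof -
 have "set_integrable lborel (einterval 0 c) (\<lambda>x. 1 / sqrt x)"
 proof (rule interval_integral_FTC_nonneg(1)[where F="\<lambda>x. 2 * sqrt x" and A=0 and B="2 * sqrt c"])
  show "DERIV (\<lambda>x. 2 * sqrt x) x :> 1 / sqrt x" if "0 < ereal x" for x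
   using that by (auto intro!: derivative_eq_intros simp: field_simps zero_ereal_def)
  show "isCont (\<lambda>x. 1 / sqrt x) x" if "0 < ereal x" for x
   using that by (auto intro!: continuous_intros simp: zero_ereal_def)
  have "((\<lambda>x. 2 * sqrt x) \<longlongrightarrow> 2 * sqrt 0) (at_right 0)"
   by (intro tendsto_intros)
  then show "(((\<lambda>x. 2 * sqrt x) \<circ> real_of_ereal) \<longlongrightarrow> 0) (at_right 0)"
   by (simp add: zero_ereal_def ereal_tendsto_simps)
  have "((\<lambda>x. 2 * sqrt x) \<longlongrightarrow> 2 * sqrt c) (at_left c)"
   by (intro tendsto_intros)
  then show "(((\<lambda>x. 2 * sqrt x) \<circ> real_of_ereal) \<longlongrightarrow> 2 * sqrt c) (at_left (ereal c))"
   by (simp add: ereal_tendsto_simps)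
 qed (use assms in \<open>auto simp: zero_ereal_def\<close>)
 then show "set_integrable lborel {0<..<c} (\<lambda>x. 1 / sqrt x)" by (simp add: zero_ereal_def)
 have "set_integrable lborel (einterval 0 c) (\<lambda>x. 1 / sqrt (c - x))"
 proof (rule interval_integral_FTC_nonneg(1)[where F="\<lambda>x. - 2 * sqrt (c - x)" and A="- 2 * sqrt c" and B=0])
  show "DERIV (\<lambda>x. - 2 * sqrt (c - x)) x :> 1 / sqrt (c - x)" if "ereal x < c" for x
   using that by (auto intro!: derivative_eq_intros simp: field_simps)
  show "isCont (\<lambda>x. 1 / sqrt (c - x)) x" if "ereal x < c" for x
   using that by (auto intro!: continuous_intros)
  have "((\<lambda>x. - 2 * sqrt (c - x)) \<longlongrightarrow> - 2 * sqrt (c - 0)) (at_right 0)"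
   by (intro tendsto_intros)
  then show "(((\<lambda>x. - 2 * sqrt (c - x)) \<circ> real_of_ereal) \<longlongrightarrow> - 2 * sqrt c) (at_right 0)"
   by (simp add: zero_ereal_def ereal_tendsto_simps)
  have "((\<lambda>x. - 2 * sqrt (c - x)) \<longlongrightarrow> - 2 * sqrt (c - c)) (at_left c)"
   by (intro tendsto_intros)
  then show "(((\<lambda>x. - 2 * sqrt (c - x)) \<circ> real_of_ereal) \<longlongrightarrow> 0) (at_left (ereal c))"
   by (simp add: ereal_tendsto_simps)
 qed (use assms in \<open>auto simp: zero_ereal_def\<close>)
 then show "set_integrable lborel {0<..<c} (\<lambda>x. 1 / sqrt (c - x))" by (simp add: zero_ereal_def)
qed

text \<open>A majorant for the integrand of \<kappa>: the singularity at 0 is of order -1/2, the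
  decay at minus infinity of order -3/2, and \<open>2 / (c + sqrt (- x))\<close> is an explicit
  antiderivative up to constants.\<close>

lemma set_integrable_evanescent:
 fixes c :: real assumes c: "c > 0"
 shows "set_integrable lborel {..<0} (\<lambda>x. 1 / (sqrt \<bar>x\<bar> * (c + sqrt \<bar>x\<bar>)\<^sup>2))"
proof -
 let ?f = "\<lambda>x. 1 / (sqrt (- x) * (c + sqrt (- x))\<^sup>2)"
 have "set_integrable lborel (einterval (-\<infinity>) 0) ?f"
 proof (rule interval_integral_FTC_nonneg(1)[where F="\<lambda>x. 2 / (c + sqrt (- x))" and A=0 and B="2 / c"])
  show "DERIV (\<lambda>x. 2 / (c + sqrt (- x))) x :> ?f x" if "ereal x < 0" for x
  proof -
   have x: "x < 0" using that by (simp add: zero_ereal_def)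
   then have nz: "c + sqrt (- x) \<noteq> 0" using c by (metis add_pos_nonneg less_numeral_extra(3) real_sqrt_ge_zero neg_0_le_iff_le less_imp_le)
   have "((\<lambda>x. 2 / (c + sqrt (- x))) has_real_derivative
     (0 * (c + sqrt (- x)) - 2 * (- (inverse (sqrt (- x)) / 2))) / ((c + sqrt (- x)) * (c + sqrt (- x)))) (at x)"
    using x nz by (auto intro!: derivative_eq_intros)
   also have "(0 * (c + sqrt (- x)) - 2 * (- (inverse (sqrt (- x)) / 2))) / ((c + sqrt (- x)) * (c + sqrt (- x))) = ?f x"
    by (simp add: power2_eq_square inverse_eq_divide)
   finally show ?thesis .
  qed
  show "isCont ?f x" if "ereal x < 0" for x
  proof -
   have x: "x < 0" using that by (simp add: zero_ereal_def)
   then have "c + sqrt (- x) > 0" using c by (intro add_pos_nonneg) auto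
   then show ?thesis using x by (auto intro!: continuous_intros)
  qed
  show "AE x in lborel. - \<infinity> < ereal x \<longrightarrow> ereal x < 0 \<longrightarrow> 0 \<le> ?f x"
   by (auto simp: zero_ereal_def)
  have "filterlim (\<lambda>x. c + sqrt (- x)) at_top at_bot"
   by (intro filterlim_tendsto_add_at_top[OF tendsto_const] filterlim_compose[OF sqrt_at_top] filterlim_uminus_at_top_at_bot)
  then have "((\<lambda>x. 2 / (c + sqrt (- x))) \<longlongrightarrow> 0) at_bot"
   by (intro tendsto_divide_0[OF tendsto_const] filterlim_at_top_imp_at_infinity)
  then show "(((\<lambda>x. 2 / (c + sqrt (- x))) \<circ> real_of_ereal) \<longlongrightarrow> 0) (at_right (-\<infinity>))"
   by (simp add: ereal_tendsto_simps)
  have "((\<lambda>x. 2 / (c + sqrt (- x))) \<longlongrightarrow> 2 / (c + sqrt (- 0))) (at_left 0)"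
   using c by (intro tendsto_intros) auto
  then show "(((\<lambda>x. 2 / (c + sqrt (- x))) \<circ> real_of_ereal) \<longlongrightarrow> 2 / c) (at_left 0)"
   by (simp add: zero_ereal_def ereal_tendsto_simps)
 qed auto
 moreover have "einterval (-\<infinity>) 0 = {..<0::real}" by (auto simp: einterval_def zero_ereal_def)
 ultimately have "set_integrable lborel {..<0} ?f" by simp
 moreover have "set_integrable lborel {..<0} ?f = set_integrable lborel {..<0} (\<lambda>x. 1 / (sqrt \<bar>x\<bar> * (c + sqrt \<bar>x\<bar>)\<^sup>2))"
  by (rule set_integrable_cong) auto
 ultimately show ?thesis by simp
qed

lemma integrable_exp_decay:
 fixes c :: real assumes c: "c > 0"
 shows "set_integrable lborel {0..} (\<lambda>z. exp (- c * z))" "(LBINT z:{0..}. exp (- c * z)) = 1 / c"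
proof -
 have "has_bochner_integral lborel (\<lambda>z. indicator {0..} z *\<^sub>R exp (- c * z)) (1 / c)"
 proof (rule has_bochner_integral_nn_integral)
  have "((\<lambda>z. - exp (- c * z) / c) \<longlongrightarrow> - 0 / c) at_top"
   using c by (intro tendsto_intros filterlim_compose[OF exp_at_bot] filterlim_tendsto_neg_mult_at_bot[OF tendsto_const] filterlim_ident) auto
  then have "(\<integral>\<^sup>+z. ennreal (exp (- c * z)) * indicator {0..} z \<partial>lborel) = 0 - (- exp (- c * 0) / c)"
   using c by (intro nn_integral_FTC_atLeast) (auto intro!: derivative_eq_intros)
  then show "(\<integral>\<^sup>+z. ennreal (indicator {0..} z *\<^sub>R exp (- c * z)) \<partial>lborel) = ennreal (1 / c)"
   by (simp add: ennreal_mult' ennreal_indicator mult.commute)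
 qed (use c in auto)
 then show "set_integrable lborel {0..} (\<lambda>z. exp (- c * z))" "(LBINT z:{0..}. exp (- c * z)) = 1 / c"
  by (auto simp: set_integrable_def set_lebesgue_integral_def has_bochner_integral_iff)
qed

lemma bounded_decay_integral:
 fixes c :: real and g :: "real \<Rightarrow> real"
 assumes c: "c > 0" and g: "g \<in> borel_measurable borel" "\<And>z. \<bar>g z\<bar> \<le> 1"
 shows "set_integrable lborel {0..} (\<lambda>z. exp (- c * z) * g z)"
  "\<bar>LBINT z:{0..}. exp (- c * z) * g z\<bar> \<le> 1 / c"
proof -
 have le: "norm (indicator {0..} z *\<^sub>R (exp (- c * z) * g z)) \<le> indicator {0..} z *\<^sub>R exp (- c * z)" for z
  using g(2)[of z] by (simp add: abs_mult mult_left_le indicator_def)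
 show i: "set_integrable lborel {0..} (\<lambda>z. exp (- c * z) * g z)"
  using integrable_exp_decay(1)[OF c] unfolding set_integrable_def
 proof (rule Bochner_Integration.integrable_bound)
  show "AE z in lborel. norm (indicator {0..} z *\<^sub>R (exp (- c * z) * g z)) \<le> norm (indicator {0..} z *\<^sub>R exp (- c * z))"
   using le by (intro AE_I2) (metis abs_ge_self order_trans real_norm_def)
 qed (use g(1) in measurable)
 have "norm (LBINT z:{0..}. exp (- c * z) * g z) \<le> (LBINT z:{0..}. exp (- c * z))"
  unfolding set_lebesgue_integral_def
  by (rule order_trans[OF integral_norm_bound integral_mono])
   (use i integrable_exp_decay(1)[OF c] le in \<open>auto simp: set_integrable_def\<close>)
 then show "\<bar>LBINT z:{0..}. exp (- c * z) * g z\<bar> \<le> 1 / c"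
  using integrable_exp_decay(2)[OF c] by simp
qed

text \<open>The value is \<open>c / (c\<^sup>2 + b\<^sup>2)\<close>, the Laplace transform of the
  cosine. Together with the sign of the kernel form it gives \<Lambda>^c its sign.\<close>

lemma exp_cos_integral_nonneg:
 fixes c b :: real assumes c: "c > 0"
 shows "0 \<le> (LBINT z:{0..}. exp (- c * z) * cos (b * z))"
proof -
 let ?D = "c\<^sup>2 + b\<^sup>2"
 define F where "F z = exp (- c * z) * (b * sin (b * z) - c * cos (b * z)) / ?D" for z
 have D: "?D > 0" using c by (simp add: add_pos_nonneg)
 have deriv: "DERIV F z :> exp (- c * z) * cos (b * z)" for z
 proof -
  have "DERIV (\<lambda>z. exp (- c * z) * (b * sin (b * z) - c * cos (b * z))) z :> (- c * exp (- c * z) * (b * sin (b * z) - c * cos (b * z))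
    + exp (- c * z) * (b * (b * cos (b * z)) + c * (b * sin (b * z))))"
   by (auto intro!: derivative_eq_intros simp: algebra_simps)
  from DERIV_cdivide[OF this, of ?D]
  have "DERIV F z :> (- c * exp (- c * z) * (b * sin (b * z) - c * cos (b * z))
    + exp (- c * z) * (b * (b * cos (b * z)) + c * (b * sin (b * z)))) / ?D"
   by (simp add: F_def[abs_def])
  also have "(- c * exp (- c * z) * (b * sin (b * z) - c * cos (b * z))
    + exp (- c * z) * (b * (b * cos (b * z)) + c * (b * sin (b * z)))) = ?D * (exp (- c * z) * cos (b * z))"
   by (simp add: power2_eq_square algebra_simps)
  finally show ?thesis using D c by simp
 qed
 have fin: "(LBINT z:{0..t}. exp (- c * z) * cos (b * z)) = F t + c / ?D" if "t \<ge> 0" for t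
 proof -
  have "(LBINT z:{0..t}. exp (- c * z) * cos (b * z)) = F t - F 0"
   unfolding set_lebesgue_integral_def
  proof (rule integral_FTC_atLeastAtMost[OF that])
   show "(F has_vector_derivative exp (- c * x) * cos (b * x)) (at x within {0..t})" for x
    using deriv[of x] unfolding has_real_derivative_iff_has_vector_derivative
    by (rule has_vector_derivative_at_within)
   show "continuous_on {0..t} (\<lambda>x. exp (- c * x) * cos (b * x))"
    by (intro continuous_intros)
  qed
  then show ?thesis by (simp add: F_def)
 qed
 have i: "set_integrable lborel {0..} (\<lambda>z. exp (- c * z) * cos (b * z))"
  by (rule bounded_decay_integral(1)[OF c]) auto
 have "((\<lambda>t. LBINT z:{0..t}. exp (- c * z) * cos (b * z)) \<longlongrightarrow> (LBINT z:{0..}. exp (- c * z) * cos (b * z))) at_top"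
  by (rule tendsto_set_lebesgue_integral_at_top[OF _ i]) auto
 then have lim: "((\<lambda>t. F t + c / ?D) \<longlongrightarrow> (LBINT z:{0..}. exp (- c * z) * cos (b * z))) at_top"
  by (rule Lim_transform_eventually) (rule eventually_mono[OF eventually_ge_at_top[of 0] fin])
 have "(F \<longlongrightarrow> 0) at_top"
 proof (rule Lim_null_comparison)
  have "\<bar>b * sin (b * z) - c * cos (b * z)\<bar> \<le> \<bar>b\<bar> + \<bar>c\<bar>" for z
  proof -
   have "\<bar>b * sin (b * z)\<bar> \<le> \<bar>b\<bar> * 1" "\<bar>c * cos (b * z)\<bar> \<le> \<bar>c\<bar> * 1"
    unfolding abs_mult by (intro mult_left_mono; simp)+
   then show ?thesis by linarith
  qed
  then show "\<forall>\<^sub>F z in at_top. norm (F z) \<le> exp (- c * z) * ((\<bar>b\<bar> + \<bar>c\<bar>) / ?D)"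
   using D by (intro always_eventually allI) (auto simp: F_def abs_mult intro!: mult_left_mono divide_right_mono)
  have "((\<lambda>z. exp (- c * z) * ((\<bar>b\<bar> + \<bar>c\<bar>) / ?D)) \<longlongrightarrow> 0 * ((\<bar>b\<bar> + \<bar>c\<bar>) / ?D)) at_top"
   using c by (intro tendsto_mult tendsto_const filterlim_compose[OF exp_at_bot] filterlim_tendsto_neg_mult_at_bot[OF tendsto_const] filterlim_ident) auto
  then show "((\<lambda>z. exp (- c * z) * ((\<bar>b\<bar> + \<bar>c\<bar>) / ?D)) \<longlongrightarrow> 0) at_top" by simp
 qed
 then have "((\<lambda>t. F t + c / ?D) \<longlongrightarrow> 0 + c / ?D) at_top"
  by (intro tendsto_intros)
 with lim have "(LBINT z:{0..}. exp (- c * z) * cos (b * z)) = 0 + c / ?D"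
  by (rule tendsto_unique[OF trivial_limit_at_top_linorder])
 then show ?thesis using c D by simp
qed

text \<open>Since \<open>n1 > 1\<close>, \<open>cont_eta\<close> is at least \<open>cont_xi\<close>,
  so the denominator is at least the square of \<open>cont_xi\<close> times sin^2 + cos^2 = 1:
  oscillations of the mode cannot make it small.\<close>

lemma cont_amplitude_bound:
 assumes d: "d > 0" and n1: "n1 > 1" and k: "k > 0" and \<gamma>: "\<gamma> < k\<^sup>2"
 shows "(cont_amplitude d n1 k \<gamma>)\<^sup>2 \<le> 1 / (pi * sqrt (k\<^sup>2 - \<gamma>))"
proof -
 let ?x = "cont_xi d k \<gamma>" and ?e = "cont_eta d n1 k \<gamma>"
 let ?den = "?x\<^sup>2 * (sin ?e)\<^sup>2 + ?e\<^sup>2 * (cos ?e)\<^sup>2"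
 define s where "s = sqrt (k\<^sup>2 - \<gamma>)"
 have s: "s > 0" using \<gamma> by (simp add: s_def)
 have x_eq: "?x = d * s" by (simp add: cont_xi_def s_def)
 have x: "?x > 0" using d s by (simp add: x_eq)
 have "1 * k\<^sup>2 \<le> n1\<^sup>2 * k\<^sup>2" using n1 by (intro mult_right_mono) auto
 then have "?x \<le> ?e" using d by (simp add: cont_xi_def cont_eta_def)
 then have "?x\<^sup>2 \<le> ?e\<^sup>2" using x by (intro power_mono) auto
 then have "?x\<^sup>2 * (cos ?e)\<^sup>2 \<le> ?e\<^sup>2 * (cos ?e)\<^sup>2" by (intro mult_right_mono) auto
 moreover have "?x\<^sup>2 * (sin ?e)\<^sup>2 + ?x\<^sup>2 * (cos ?e)\<^sup>2 = ?x\<^sup>2" by (simp flip: distrib_left)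
 ultimately have den: "?x\<^sup>2 \<le> ?den" by linarith
 have "?x\<^sup>2 > 0" using x by simp
 with den have den_pos: "?den > 0" by linarith
 have "(cont_amplitude d n1 k \<gamma>)\<^sup>2 = d * ?x / (pi * ?den)"
  unfolding cont_amplitude_def using d x by (intro real_sqrt_pow2) auto
 also have "\<dots> \<le> d * ?x / (pi * ?x\<^sup>2)"
  using den den_pos d x \<open>?x\<^sup>2 > 0\<close> by (intro divide_left_mono mult_left_mono mult_pos_pos pi_gt_zero den_pos) simp_all
 also have "\<dots> = 1 / (pi * s)"
  using s d unfolding x_eq by (simp add: power2_eq_square)
 finally show ?thesis by (simp add: s_def)
qed

lemma borel_measurable_cont_amplitude[measurable]:
 "cont_amplitude d n1 k \<in> borel_measurable borel"
 unfolding cont_amplitude_def[abs_def] cont_xi_def cont_eta_def by measurable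

lemma coupling_cov_eq:
 assumes rm: "random_medium d a \<gamma>0 M V" and d: "d > 0" and z: "z \<ge> 0"
 shows "coupling_cov d n1 k \<sigma> M V (Inl j) (Inr \<gamma>) (Inl j) (Inr \<gamma>) z
  = exp (- a * z) * kernel_form d \<gamma>0 (\<lambda>x. mode d n1 k \<sigma> (Inl j) x * mode d n1 k \<sigma> (Inr \<gamma>) x)"
 unfolding coupling_cov_def coupling_def
 by (rule expectation_product_integrals[OF rm d z]) (use d in \<open>auto intro!: continuous_intros\<close>)

section \<open>The coefficients as integrals of a spectral weight\<close>

context
 fixes d n1 k a :: real and \<sigma> :: "'n \<Rightarrow> real" and \<gamma>0 M V
 assumes rm: "random_medium d a \<gamma>0 M V" and d: "d > 0" and n1: "n1 > 1" and k: "k > 0" and a: "a > 0"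
begin

text \<open>What is left of E[C(0) C(z)] once the factor \<open>exp (- a * z)\<close> is split off;
  the medium enters \<Lambda> and \<kappa> only through this function of \<gamma> and through
  \<open>a\<close>.\<close>

definition spectral_weight :: "'n \<Rightarrow> real \<Rightarrow> real" where
 "spectral_weight j \<gamma> = kernel_form d \<gamma>0 (\<lambda>x. mode d n1 k \<sigma> (Inl j) x * mode d n1 k \<sigma> (Inr \<gamma>) x)"

lemma spectral_weight_nonneg: "0 \<le> spectral_weight j \<gamma>"
proof -
 let ?f = "\<lambda>x. mode d n1 k \<sigma> (Inl j) x * mode d n1 k \<sigma> (Inr \<gamma>) x"
 have nk: "nonneg_kernel d \<gamma>0" using rm by (simp add: random_medium_def)
 have "?f \<in> borel_measurable borel" by simp
 moreover have "set_integrable lborel {0..d} (\<lambda>x. (?f x)\<^sup>2)"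
  by (intro borel_integrable_atLeastAtMost') (use d in \<open>auto intro!: continuous_intros\<close>)
 ultimately show ?thesis
  using nk unfolding spectral_weight_def kernel_form_def nonneg_kernel_def by blast
qed

text \<open>\<open>\<gamma>0\<close> is controlled only on the square, so it is extended by zero to
  a Borel function on the plane before the integrals with parameter \<gamma> are taken.\<close>

lemma spectral_weight_measurable[measurable]: "spectral_weight j \<in> borel_measurable borel"
proof -
 note cont = random_medium_kernel_continuous[OF rm]
 define h where "h p = indicator ({0..d} \<times> {0..d}) p *\<^sub>R \<gamma>0 p" for p
 define F where "F p = mode d n1 k \<sigma> (Inl j) (snd p) * mode d n1 k \<sigma> (Inr (fst p)) (snd p)" for p
 have "h \<in> borel_measurable borel"
  unfolding h_def[abs_def]
  by (rule borel_measurable_continuous_on_indicator[OF _ cont]) (auto intro: borel_closed closed_Times)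
 then have [measurable]: "h \<in> borel_measurable (borel \<Otimes>\<^sub>M borel)"
  by (simp only: borel_prod)
 have [measurable]: "F \<in> borel_measurable (borel \<Otimes>\<^sub>M borel)"
  unfolding F_def[abs_def] mode.simps cont_eta_def by measurable
 have eq: "spectral_weight j \<gamma> = (LBINT x. (LBINT y. h (x, y) * F (\<gamma>, y)) * F (\<gamma>, x))" for \<gamma>
  unfolding spectral_weight_def kernel_form_def set_lebesgue_integral_def
 proof (intro Bochner_Integration.integral_cong refl)
  fix x
  let ?g = "\<lambda>x. mode d n1 k \<sigma> (Inl j) x * mode d n1 k \<sigma> (Inr \<gamma>) x"
  show "indicator {0..d} x *\<^sub>R ((LBINT y. indicator {0..d} y *\<^sub>R (\<gamma>0 (x, y) * ?g y)) * ?g x)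
   = (LBINT y. h (x, y) * F (\<gamma>, y)) * F (\<gamma>, x)"
   by (cases "x \<in> {0..d}") (simp_all add: h_def F_def indicator_times mult.assoc del: mode.simps)
 qed
 show ?thesis
  unfolding eq[abs_def] by measurable
qed

text \<open>Sines are at most 1, so only the amplitudes count; the continuum amplitude enters
  squared, and \<open>cont_amplitude_bound\<close> turns it into an inverse square root at the
  cut.\<close>

lemma spectral_weight_bound:
 obtains C where "0 \<le> C" "\<And>\<gamma>. \<gamma> < k\<^sup>2 \<Longrightarrow> spectral_weight j \<gamma> \<le> C / sqrt (k\<^sup>2 - \<gamma>)"
proof -
 obtain G where G: "0 \<le> G" "\<And>x y. x \<in> {0..d} \<Longrightarrow> y \<in> {0..d} \<Longrightarrow> \<bar>\<gamma>0 (x, y)\<bar> \<le> G"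
  using random_medium_kernel_bound[OF rm] by metis
 let ?A = "\<bar>mode_amplitude d n1 k \<sigma> j\<bar>"
 have main: "spectral_weight j \<gamma> \<le> (G * ?A\<^sup>2 * d\<^sup>2 / pi) / sqrt (k\<^sup>2 - \<gamma>)" if \<gamma>: "\<gamma> < k\<^sup>2" for \<gamma>
 proof -
  define F where "F = ?A * \<bar>cont_amplitude d n1 k \<gamma>\<bar>"
  let ?g = "\<lambda>x. mode d n1 k \<sigma> (Inl j) x * mode d n1 k \<sigma> (Inr \<gamma>) x"
  have F0: "0 \<le> F" by (simp add: F_def)
  have gF: "\<bar>?g x\<bar> \<le> F" for x
  proof -
   have "\<bar>?g x\<bar> = F * (\<bar>sin (\<sigma> j * x / d)\<bar> * \<bar>sin (cont_eta d n1 k \<gamma> * x / d)\<bar>)"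
    by (simp add: F_def abs_mult)
   also have "\<dots> \<le> F * (1 * 1)"
    by (intro mult_left_mono mult_mono F0) auto
   finally show ?thesis by simp
  qed
  have ind: "integrable lborel (\<lambda>x. indicator {0..d} x * c)" for c :: real
   by (intro integrable_mult_left integrable_real_indicator) (auto simp: less_imp_le[OF d])
  have indv: "(LBINT x. indicator {0..d} x * c) = d * c" for c :: real
   using d by simp
  have inner: "\<bar>LBINT y:{0..d}. \<gamma>0 (x, y) * ?g y\<bar> \<le> d * (G * F)" if "x \<in> {0..d}" for x
  proof -
   have "\<bar>LBINT y:{0..d}. \<gamma>0 (x, y) * ?g y\<bar> \<le> (LBINT y. norm (indicator {0..d} y *\<^sub>R (\<gamma>0 (x, y) * ?g y)))"
    unfolding set_lebesgue_integral_def using integral_norm_bound[of lborel "\<lambda>y. indicator {0..d} y *\<^sub>R (\<gamma>0 (x, y) * ?g y)"] by simp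
   also have "\<dots> \<le> (LBINT y. indicator {0..d} y * (G * F))"
   proof (rule integral_mono_AE'[OF ind])
    show "AE y in lborel. norm (indicator {0..d} y *\<^sub>R (\<gamma>0 (x, y) * ?g y)) \<le> indicator {0..d} y * (G * F)"
    proof (rule AE_I2)
     fix y
     show "norm (indicator {0..d} y *\<^sub>R (\<gamma>0 (x, y) * ?g y)) \<le> indicator {0..d} y * (G * F)"
     proof (cases "y \<in> {0..d}")
      case True
      have "\<bar>\<gamma>0 (x, y)\<bar> * \<bar>?g y\<bar> \<le> G * F"
       by (rule mult_mono[OF G(2)[OF that True] gF G(1) abs_ge_zero])
      then show ?thesis using True by (simp only: real_norm_def abs_mult scaleR_conv_of_real) simp
     qed simp
    qed
   qed (use G(1) F0 in auto)
   finally show ?thesis unfolding indv .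
  qed
  have "\<bar>spectral_weight j \<gamma>\<bar> \<le> (LBINT x. norm (indicator {0..d} x *\<^sub>R ((LBINT y:{0..d}. \<gamma>0 (x, y) * ?g y) * ?g x)))"
   unfolding spectral_weight_def kernel_form_def
   unfolding set_lebesgue_integral_def[of _ _ "\<lambda>x. (LBINT y:{0..d}. \<gamma>0 (x, y) * ?g y) * ?g x"]
   using integral_norm_bound[of lborel "\<lambda>x. indicator {0..d} x *\<^sub>R ((LBINT y:{0..d}. \<gamma>0 (x, y) * ?g y) * ?g x)"] by simp
  also have "\<dots> \<le> (LBINT x. indicator {0..d} x * (d * (G * F) * F))"
  proof (rule integral_mono_AE'[OF ind])
   show "AE x in lborel. norm (indicator {0..d} x *\<^sub>R ((LBINT y:{0..d}. \<gamma>0 (x, y) * ?g y) * ?g x)) \<le> indicator {0..d} x * (d * (G * F) * F)"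
   proof (rule AE_I2)
    fix x
    show "norm (indicator {0..d} x *\<^sub>R ((LBINT y:{0..d}. \<gamma>0 (x, y) * ?g y) * ?g x)) \<le> indicator {0..d} x * (d * (G * F) * F)"
    proof (cases "x \<in> {0..d}")
     case True
     have "\<bar>LBINT y:{0..d}. \<gamma>0 (x, y) * ?g y\<bar> * \<bar>?g x\<bar> \<le> d * (G * F) * F"
      by (rule mult_mono[OF inner[OF True] gF _ abs_ge_zero]) (use d G F0 in auto)
     then show ?thesis using True by (simp only: real_norm_def abs_mult scaleR_conv_of_real) simp
    qed simp
   qed
  qed (use G(1) F0 d in auto)
  finally have "spectral_weight j \<gamma> \<le> d * (d * (G * F) * F)" unfolding indv by simp
  also have "\<dots> = (G * ?A\<^sup>2 * d\<^sup>2) * (cont_amplitude d n1 k \<gamma>)\<^sup>2"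
   by (simp add: F_def power2_eq_square flip: abs_mult)
  also have "\<dots> \<le> (G * ?A\<^sup>2 * d\<^sup>2) * (1 / (pi * sqrt (k\<^sup>2 - \<gamma>)))"
   using G(1) by (intro mult_left_mono cont_amplitude_bound d n1 k \<gamma>) auto
  finally show ?thesis by simp
 qed
 show ?thesis
  by (rule that[OF _ main]) (use G(1) in auto)
qed

lemma time_integral_measurable:
 assumes [measurable]: "trig \<in> borel_measurable borel"
 shows "(\<lambda>b::real. LBINT z:{0..}. exp (- a * z) * trig (b * z)) \<in> borel_measurable borel"
 unfolding set_lebesgue_integral_def by measurable

lemma Lambda_cut_eq:
 assumes trig: "\<And>x. \<bar>trig x\<bar> \<le> 1"
 shows "Lambda_cut trig d n1 k \<sigma> M V \<xi> j = (LBINT \<gamma>:{\<xi><..<k\<^sup>2}.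
   k ^ 4 / (2 * sqrt \<gamma> * wavenumber d n1 k \<sigma> j) * (spectral_weight j \<gamma> *
    (LBINT z:{0..}. exp (- a * z) * trig ((sqrt \<gamma> - wavenumber d n1 k \<sigma> j) * z))))"
proof -
 have "(LBINT z:{0..}. coupling_cov d n1 k \<sigma> M V (Inl j) (Inr \<gamma>) (Inl j) (Inr \<gamma>) z *
      trig ((sqrt \<gamma> - wavenumber d n1 k \<sigma> j) * z))
   = spectral_weight j \<gamma> * (LBINT z:{0..}. exp (- a * z) * trig ((sqrt \<gamma> - wavenumber d n1 k \<sigma> j) * z))" for \<gamma>
  unfolding set_integral_mult_right[symmetric]
  by (rule set_lebesgue_integral_cong) (auto simp: coupling_cov_eq[OF rm d] spectral_weight_def simp del: mode.simps)
 then show ?thesis by (simp add: Lambda_cut_def Let_def)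
qed

lemma kappa_cut_eq:
 "kappa_cut d n1 k \<sigma> M V \<xi> j = (LBINT \<gamma>:{..< - \<xi>}.
   k ^ 4 / (2 * wavenumber d n1 k \<sigma> j * sqrt \<bar>\<gamma>\<bar>) * (spectral_weight j \<gamma> *
    (LBINT z:{0..}. exp (- (a + sqrt \<bar>\<gamma>\<bar>) * z) * cos (wavenumber d n1 k \<sigma> j * z))))"
proof -
 have "(LBINT z:{0..}. coupling_cov d n1 k \<sigma> M V (Inl j) (Inr \<gamma>) (Inl j) (Inr \<gamma>) z *
     cos (wavenumber d n1 k \<sigma> j * z) * exp (- sqrt \<bar>\<gamma>\<bar> * z))
   = spectral_weight j \<gamma> * (LBINT z:{0..}. exp (- (a + sqrt \<bar>\<gamma>\<bar>) * z) * cos (wavenumber d n1 k \<sigma> j * z))" for \<gamma>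
  unfolding set_integral_mult_right[symmetric]
  by (rule set_lebesgue_integral_cong)
   (auto simp: coupling_cov_eq[OF rm d] spectral_weight_def distrib_right minus_add_distrib exp_diff exp_minus field_simps simp del: mode.simps)
 then show ?thesis by (simp add: kappa_cut_def Let_def)
qed

lemma Lambda_cut_nonneg:
 assumes "\<xi> \<ge> 0" and b: "0 \<le> wavenumber d n1 k \<sigma> j"
 shows "0 \<le> Lambda_cut cos d n1 k \<sigma> M V \<xi> j"
proof -
 have "0 \<le> indicator {\<xi><..<k\<^sup>2} \<gamma> *\<^sub>R (k ^ 4 / (2 * sqrt \<gamma> * wavenumber d n1 k \<sigma> j) * (spectral_weight j \<gamma> *
    (LBINT z:{0..}. exp (- a * z) * cos ((sqrt \<gamma> - wavenumber d n1 k \<sigma> j) * z))))" for \<gamma>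
 proof (cases "\<gamma> \<in> {\<xi><..<k\<^sup>2}")
  case True
  then have "0 \<le> sqrt \<gamma>" using assms by simp
  then show ?thesis
   using b by (intro mult_nonneg_nonneg scaleR_nonneg_nonneg divide_nonneg_nonneg spectral_weight_nonneg exp_cos_integral_nonneg[OF a]) auto
 qed simp
 then show ?thesis
  unfolding Lambda_cut_eq[OF abs_cos_le_one] set_lebesgue_integral_def[of _ "{\<xi><..<k\<^sup>2}"]
  by (intro Bochner_Integration.integral_nonneg)
qed

lemma Lambda_cut_tendsto:
 assumes trig: "\<And>x. \<bar>trig x\<bar> \<le> 1" and [measurable]: "trig \<in> borel_measurable borel"
 shows "\<exists>\<Lambda>. ((\<lambda>\<xi>. Lambda_cut trig d n1 k \<sigma> M V \<xi> j) \<longlongrightarrow> \<Lambda>) (at_right 0)"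
proof -
 let ?b = "wavenumber d n1 k \<sigma> j"
 define J where "J b = (LBINT z:{0..}. exp (- a * z) * trig (b * z))" for b
 have [measurable]: "J \<in> borel_measurable borel"
  unfolding J_def[abs_def] by (rule time_integral_measurable) simp
 have J: "\<bar>J b\<bar> \<le> 1 / a" for b
  unfolding J_def by (rule bounded_decay_integral(2)[OF a]) (auto simp: trig)
 obtain C where C: "0 \<le> C" "\<And>\<gamma>. \<gamma> < k\<^sup>2 \<Longrightarrow> spectral_weight j \<gamma> \<le> C / sqrt (k\<^sup>2 - \<gamma>)"
  using spectral_weight_bound[of j] by blast
 let ?f = "\<lambda>\<gamma>. k ^ 4 / (2 * sqrt \<gamma> * ?b) * (spectral_weight j \<gamma> * J (sqrt \<gamma> - ?b))"
 have k2: "k\<^sup>2 > 0" using k by simp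
 let ?D = "k ^ 4 / (2 * \<bar>?b\<bar>) * (C * (1 / a)) / k"
 have "set_integrable lborel {0<..<k\<^sup>2} ?f"
  unfolding set_integrable_def
 proof (rule Bochner_Integration.integrable_bound)
  show "integrable lborel (\<lambda>\<gamma>. ?D * (indicator {0<..<k\<^sup>2} \<gamma> *\<^sub>R (1 / sqrt \<gamma>) + indicator {0<..<k\<^sup>2} \<gamma> *\<^sub>R (1 / sqrt (k\<^sup>2 - \<gamma>))))"
   using set_integrable_inverse_sqrt[OF k2] unfolding set_integrable_def
   by (intro integrable_mult_right Bochner_Integration.integrable_add)
  show "AE \<gamma> in lborel. norm (indicator {0<..<k\<^sup>2} \<gamma> *\<^sub>R ?f \<gamma>) \<le> norm (?D * (indicator {0<..<k\<^sup>2} \<gamma> *\<^sub>R (1 / sqrt \<gamma>) + indicator {0<..<k\<^sup>2} \<gamma> *\<^sub>R (1 / sqrt (k\<^sup>2 - \<gamma>))))"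
  proof (rule AE_I2)
   fix \<gamma> :: real
   show "norm (indicator {0<..<k\<^sup>2} \<gamma> *\<^sub>R ?f \<gamma>) \<le> norm (?D * (indicator {0<..<k\<^sup>2} \<gamma> *\<^sub>R (1 / sqrt \<gamma>) + indicator {0<..<k\<^sup>2} \<gamma> *\<^sub>R (1 / sqrt (k\<^sup>2 - \<gamma>))))"
   proof (cases "\<gamma> \<in> {0<..<k\<^sup>2}")
    case True
    \<comment> \<open>From \<open>p\<^sup>2 + q\<^sup>2 = k\<^sup>2\<close> follows
      \<open>k \<le> p + q\<close>, hence
      \<open>1 / (p * q) \<le> (1 / k) * (1 / p + 1 / q)\<close>: the product of the two endpoint
      singularities is split into a sum of integrable ones.\<close>
    define p where "p = sqrt \<gamma>"
    define q where "q = sqrt (k\<^sup>2 - \<gamma>)"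
    have pq: "p > 0" "q > 0" using True by (auto simp: p_def q_def)
    have "k\<^sup>2 = p\<^sup>2 + q\<^sup>2" using True by (simp add: p_def q_def)
    also have "\<dots> \<le> (p + q)\<^sup>2" using pq by (simp add: power2_sum)
    finally have kpq: "k \<le> p + q" by (rule power2_le_imp_le) (use pq in simp)
    have "1 / (p * q) \<le> (1 / k) * ((p + q) / (p * q))"
     using kpq k pq by (simp add: field_simps)
    also have "\<dots> = (1 / k) * (1 / p + 1 / q)" using pq by (simp add: field_simps)
    finally have pq1: "1 / (p * q) \<le> (1 / k) * (1 / p + 1 / q)" .
    have "\<bar>?f \<gamma>\<bar> = k ^ 4 / (2 * p * \<bar>?b\<bar>) * (spectral_weight j \<gamma> * \<bar>J (p - ?b)\<bar>)"
     using k pq spectral_weight_nonneg[of j \<gamma>] by (simp add: abs_mult p_def)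
    also have "\<dots> \<le> k ^ 4 / (2 * p * \<bar>?b\<bar>) * (C / q * (1 / a))"
     using k pq C(1) C(2)[of \<gamma>] True by (intro mult_left_mono mult_mono J) (auto simp: q_def)
    also have "\<dots> = (k ^ 4 / (2 * \<bar>?b\<bar>) * (C * (1 / a))) * (1 / (p * q))" by (simp add: field_simps)
    also have "\<dots> \<le> (k ^ 4 / (2 * \<bar>?b\<bar>) * (C * (1 / a))) * ((1 / k) * (1 / p + 1 / q))"
     using k C(1) a by (intro mult_left_mono pq1) auto
    also have "\<dots> = ?D * (1 / p + 1 / q)" by simp
    finally have "\<bar>?f \<gamma>\<bar> \<le> ?D * (1 / p + 1 / q)" .
    then have "\<bar>?f \<gamma>\<bar> \<le> \<bar>?D * (1 / p + 1 / q)\<bar>" by linarith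
    then show ?thesis using True unfolding p_def q_def by simp
   qed simp
  qed
 qed measurable
 then have "((\<lambda>\<xi>. LBINT \<gamma>:{\<xi><..<k\<^sup>2}. ?f \<gamma>) \<longlongrightarrow> (LBINT \<gamma>:{0<..<k\<^sup>2}. ?f \<gamma>)) (at_right 0)"
 proof (rule set_integral_cutoff_tendsto)
  show "\<forall>\<^sub>F \<xi> in at_right 0. x \<in> {\<xi><..<k\<^sup>2}" if "x \<in> {0<..<k\<^sup>2}" for x
   using that eventually_at_right_less[of 0] eventually_at_right[of 0 1, simplified]
   by (auto simp: eventually_at_right_field intro!: exI[of _ x])
 qed auto
 then show ?thesis by (auto simp: Lambda_cut_eq[OF trig] J_def)
qed

lemma kappa_cut_tendsto:
 "\<exists>\<kappa>. ((\<lambda>\<xi>. kappa_cut d n1 k \<sigma> M V \<xi> j) \<longlongrightarrow> \<kappa>) (at_right 0)"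
proof -
 let ?b = "wavenumber d n1 k \<sigma> j"
 define J where "J \<gamma> = (LBINT z:{0..}. exp (- (a + sqrt \<bar>\<gamma>\<bar>) * z) * cos (?b * z))" for \<gamma>
 have [measurable]: "J \<in> borel_measurable borel"
  unfolding J_def[abs_def] set_lebesgue_integral_def by measurable
 have J: "\<bar>J \<gamma>\<bar> \<le> 1 / (a + sqrt \<bar>\<gamma>\<bar>)" for \<gamma>
  unfolding J_def by (rule bounded_decay_integral(2)) (auto simp: a add_pos_nonneg)
 obtain C where C: "0 \<le> C" "\<And>\<gamma>. \<gamma> < k\<^sup>2 \<Longrightarrow> spectral_weight j \<gamma> \<le> C / sqrt (k\<^sup>2 - \<gamma>)"
  using spectral_weight_bound[of j] by blast
 let ?f = "\<lambda>\<gamma>. k ^ 4 / (2 * ?b * sqrt \<bar>\<gamma>\<bar>) * (spectral_weight j \<gamma> * J \<gamma>)"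
 let ?D = "k ^ 4 / (2 * \<bar>?b\<bar>) * (C * 2)"
 \<comment> \<open>One constant serves both estimates: \<open>m + p\<close> is at most
   \<open>a + p\<close>, which governs the time integral, and at most \<open>2 * q\<close>, which
   governs the spectral weight.\<close>
 define m where "m = min a k"
 have m: "m > 0" "m \<le> a" "m \<le> k" using a k by (auto simp: m_def)
 have "set_integrable lborel {..<0} ?f"
  unfolding set_integrable_def
 proof (rule Bochner_Integration.integrable_bound)
  show "integrable lborel (\<lambda>\<gamma>. ?D * (indicator {..<0} \<gamma> *\<^sub>R (1 / (sqrt \<bar>\<gamma>\<bar> * (m + sqrt \<bar>\<gamma>\<bar>)\<^sup>2))))"
   using set_integrable_evanescent[OF m(1)] unfolding set_integrable_def
   by (intro integrable_mult_right)
  show "AE \<gamma> in lborel. norm (indicator {..<0} \<gamma> *\<^sub>R ?f \<gamma>) \<le> norm (?D * (indicator {..<0} \<gamma> *\<^sub>R (1 / (sqrt \<bar>\<gamma>\<bar> * (m + sqrt \<bar>\<gamma>\<bar>)\<^sup>2))))"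
  proof (rule AE_I2)
   fix \<gamma> :: real
   show "norm (indicator {..<0} \<gamma> *\<^sub>R ?f \<gamma>) \<le> norm (?D * (indicator {..<0} \<gamma> *\<^sub>R (1 / (sqrt \<bar>\<gamma>\<bar> * (m + sqrt \<bar>\<gamma>\<bar>)\<^sup>2))))"
   proof (cases "\<gamma> \<in> {..<0}")
    case True
    define p where "p = sqrt \<bar>\<gamma>\<bar>"
    define q where "q = sqrt (k\<^sup>2 - \<gamma>)"
    have p: "p > 0" using True by (auto simp: p_def)
    have "\<gamma> < 0" "0 < k\<^sup>2" using True k by auto
    then have gk: "\<gamma> < k\<^sup>2" by linarith
    have p2: "p\<^sup>2 = - \<gamma>" using True by (simp add: p_def)
    have q2: "q\<^sup>2 = k\<^sup>2 + p\<^sup>2" using gk by (simp add: q_def p2)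
    have q: "q > 0" using gk by (simp add: q_def)
    have "0 \<le> (k - p)\<^sup>2" by simp
    then have "(k + p)\<^sup>2 \<le> 2 * (k\<^sup>2 + p\<^sup>2)" by (simp add: power2_eq_square algebra_simps)
    also have "\<dots> \<le> (2 * q)\<^sup>2" by (simp add: power_mult_distrib q2)
    finally have "k + p \<le> 2 * q" by (rule power2_le_imp_le) (use q in simp)
    with m(3) have "m + p \<le> 2 * q" by linarith
    then have qm: "(m + p) / 2 \<le> q" by simp
    have "1 / (p * (q * (a + p))) \<le> 1 / (p * ((m + p) / 2 * (m + p)))"
     using p q m a qm by (intro divide_left_mono mult_left_mono mult_mono mult_pos_pos) auto
    also have "\<dots> = 2 * (1 / (p * (m + p)\<^sup>2))" by (simp add: power2_eq_square)
    finally have pq1: "1 / (p * (q * (a + p))) \<le> 2 * (1 / (p * (m + p)\<^sup>2))" .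
    have "\<bar>?f \<gamma>\<bar> = k ^ 4 / (2 * \<bar>?b\<bar> * p) * (spectral_weight j \<gamma> * \<bar>J \<gamma>\<bar>)"
     using k p spectral_weight_nonneg[of j \<gamma>] by (simp add: abs_mult p_def)
    also have "\<dots> \<le> k ^ 4 / (2 * \<bar>?b\<bar> * p) * (C / q * (1 / (a + p)))"
     using k p q C(1) C(2)[OF gk] J[of \<gamma>]
     by (intro mult_left_mono mult_mono) (auto simp: q_def p_def)
    also have "\<dots> = (k ^ 4 / (2 * \<bar>?b\<bar>) * C) * (1 / (p * (q * (a + p))))" by simp
    also have "\<dots> \<le> (k ^ 4 / (2 * \<bar>?b\<bar>) * C) * (2 * (1 / (p * (m + p)\<^sup>2)))"
     using k C(1) by (intro mult_left_mono pq1) auto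
    also have "\<dots> = ?D * (1 / (p * (m + p)\<^sup>2))" by simp
    finally have "\<bar>?f \<gamma>\<bar> \<le> ?D * (1 / (p * (m + p)\<^sup>2))" .
    then have "\<bar>?f \<gamma>\<bar> \<le> \<bar>?D * (1 / (p * (m + p)\<^sup>2))\<bar>" by linarith
    then show ?thesis using True unfolding p_def by simp
   qed simp
  qed
 qed measurable
 then have "((\<lambda>\<xi>. LBINT \<gamma>:{..<-\<xi>}. ?f \<gamma>) \<longlongrightarrow> (LBINT \<gamma>:{..<0}. ?f \<gamma>)) (at_right 0)"
 proof (rule set_integral_cutoff_tendsto)
  show "\<forall>\<^sub>F \<xi> in at_right 0. x \<in> {..<- \<xi>}" if "x \<in> {..<0}" for x :: real
   using that by (intro eventually_mono[OF eventually_at_right_real[of 0 "- x"]]) auto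
 qed auto
 then show ?thesis by (auto simp: kappa_cut_eq J_def)
qed

end

text \<open>\<open>sqrt\<close> is an odd function on the reals, so the sign of a square root is a
  statement about the radicand; the range of the modes gives
  \<open>\<sigma> j / d \<le> n1 * k\<close>.\<close>

lemma wavenumber_nonneg:
 assumes "discrete_modes d n1 k \<sigma>" "d > 0" "n1 > 1" "k > 0"
 shows "0 \<le> wavenumber d n1 k \<sigma> j"
proof -
 have \<sigma>: "0 < \<sigma> j" "\<sigma> j < n1 * k * d * sqrt (1 - 1 / n1\<^sup>2)"
  using assms(1) rangeI[of \<sigma> j] by (auto simp: discrete_modes_def)
 have "sqrt (1 - 1 / n1\<^sup>2) \<le> sqrt 1" by (intro real_sqrt_le_mono) simp
 then have "n1 * k * d * sqrt (1 - 1 / n1\<^sup>2) \<le> n1 * k * d * 1"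
  using assms by (intro mult_left_mono) auto
 with \<sigma>(2) have "\<sigma> j \<le> n1 * k * d" by linarith
 then have "\<sigma> j / d \<le> n1 * k" using assms(2) by (simp add: pos_divide_le_eq)
 then have "(\<sigma> j / d)\<^sup>2 \<le> (n1 * k)\<^sup>2" using \<sigma> assms by (intro power_mono) auto
 then show ?thesis by (simp add: wavenumber_def power_divide power_mult_distrib)
qed

text \<open>The cosine is even and the coupling is symmetric in its two modes. In
  \<open>jet_op_radial\<close> this makes the exchange terms between modes cancel on functions of
  the norm.\<close>

lemma Gamma_cos_symmetric: "Gamma cos d n1 k \<sigma> M V j l = Gamma cos d n1 k \<sigma> M V l j"
proof -
 have "coupling d n1 k \<sigma> V (Inl j) (Inl l) = coupling d n1 k \<sigma> V (Inl l) (Inl j)"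
  by (simp add: coupling_def fun_eq_iff mult_ac)
 moreover have "cos ((wavenumber d n1 k \<sigma> l - wavenumber d n1 k \<sigma> j) * z)
   = cos ((wavenumber d n1 k \<sigma> j - wavenumber d n1 k \<sigma> l) * z)" for z
  by (metis cos_minus minus_diff_eq minus_mult_left)
 ultimately show ?thesis
  by (simp add: Gamma_def Gamma_offdiag_def coupling_cov_def Let_def mult_ac)
qed

section \<open>The Hilbert component of the state space\<close>

lemma L2_norm_eq: "sq_integrable f \<Longrightarrow> norm (abs_L2 f) = sqrt (LBINT x. (cmod (f x))\<^sup>2)"
 unfolding norm_eq_sqrt_inner
 by (subst inner_L2.abs_eq) (auto simp: eq_onp_def power2_norm_eq_inner)

lemma L2_diff_eq: "sq_integrable f \<Longrightarrow> sq_integrable g \<Longrightarrow> abs_L2 f - abs_L2 g = abs_L2 (\<lambda>x. f x - g x)"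
 unfolding minus_L2_def
 by (subst uminus_L2.abs_eq, simp, subst plus_L2.abs_eq) (auto intro: sq_integrable_uminus)

lemma L2_cases: obtains f where "sq_integrable f" "\<phi> = abs_L2 f"
proof -
 have "\<exists>f. sq_integrable f \<and> \<phi> = abs_L2 f" by (rule L2.abs_induct) auto
 then show ?thesis using that by auto
qed

lemma L2_cut_eq: "sq_integrable f \<Longrightarrow> L2_cut a b (abs_L2 f) = abs_L2 (\<lambda>x. indicator {a<..<b} x *\<^sub>R f x)"
 by (rule L2_cut.abs_eq) simp

lemma L2_cut_cut: "\<xi> \<ge> \<xi>' \<Longrightarrow> L2_cut \<xi>' b (L2_cut \<xi> b \<phi>) = L2_cut \<xi> b \<phi>"
proof -
 assume le: "\<xi> \<ge> \<xi>'"
 obtain f where f: "sq_integrable f" "\<phi> = abs_L2 f" by (rule L2_cases)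
 have "(\<lambda>x. indicator {\<xi>'<..<b} x *\<^sub>R indicator {\<xi><..<b} x *\<^sub>R f x) = (\<lambda>x. indicator {\<xi><..<b} x *\<^sub>R f x)"
  using le by (auto simp: indicator_def fun_eq_iff)
 then show ?thesis
  using f by (simp add: L2_cut_eq sq_integrable_cut del: scaleR_scaleR)
qed

lemma H_space_mono: "\<xi> \<ge> 0 \<Longrightarrow> H_space k \<xi> \<subseteq> (H_space k 0 :: 'n::finite state set)"
proof
 fix x :: "'n state" assume "\<xi> \<ge> 0" "x \<in> H_space k \<xi>"
 then show "x \<in> H_space k 0"
  using L2_cut_cut[of 0 \<xi> "k\<^sup>2" "snd x"] by (simp add: H_space_def)
qed

lemma H_restrict_in: "H_restrict k \<xi> y \<in> H_space k \<xi>"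
 by (simp add: H_restrict_def H_space_def L2_cut_cut)

lemma H_restrict_tendsto:
 assumes y: "y \<in> H_space k 0" and X: "\<And>n. X n > 0" "X \<longlonglongrightarrow> 0"
 shows "(\<lambda>n. L2_cut (X n) (k\<^sup>2) (snd y)) \<longlonglongrightarrow> snd y"
proof -
 obtain f where f: "sq_integrable f" "snd y = abs_L2 f" by (rule L2_cases)
 define g where "g n x = indicator {X n<..<k\<^sup>2} x *\<^sub>R f x - indicator {0<..<k\<^sup>2} x *\<^sub>R f x" for n x
 have [measurable]: "f \<in> borel_measurable borel" using f by (simp add: sq_integrable_def)
 have y': "snd y = abs_L2 (\<lambda>x. indicator {0<..<k\<^sup>2} x *\<^sub>R f x)"
  using y f by (simp add: H_space_def L2_cut_eq)
 have cut: "L2_cut (X n) (k\<^sup>2) (snd y) = abs_L2 (\<lambda>x. indicator {X n<..<k\<^sup>2} x *\<^sub>R f x)" for n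
  using f by (simp add: L2_cut_eq)
 have g: "sq_integrable (g n)" for n
  using sq_integrable_add[OF sq_integrable_cut[OF f(1)] sq_integrable_uminus[OF sq_integrable_cut[OF f(1)]]]
  by (simp add: g_def[abs_def])
 have "(\<lambda>n. LBINT x. (cmod (g n x))\<^sup>2) \<longlonglongrightarrow> (\<integral>x. (0::real) \<partial>(lborel :: real measure))"
 proof (rule integral_dominated_convergence)
  show "integrable lborel (\<lambda>x. (cmod (f x))\<^sup>2)" using f by (simp add: sq_integrable_def)
  show "AE x in lborel. (\<lambda>n. (cmod (g n x))\<^sup>2) \<longlonglongrightarrow> 0"
  proof (rule AE_I2)
   fix x :: real
   have "\<forall>\<^sub>F n in sequentially. g n x = 0"
   proof (cases "x > 0")
    case True
    then have "\<forall>\<^sub>F n in sequentially. X n < x" using X(2) by (simp add: order_tendstoD)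
    then show ?thesis by eventually_elim (use True in \<open>auto simp: g_def indicator_def\<close>)
   next
    case False
    then have "g n x = 0" for n using X(1)[of n] by (auto simp: g_def indicator_def)
    then show ?thesis by simp
   qed
   then have "\<forall>\<^sub>F n in sequentially. (cmod (g n x))\<^sup>2 = 0" by eventually_elim simp
   then show "(\<lambda>n. (cmod (g n x))\<^sup>2) \<longlonglongrightarrow> 0" by (rule tendsto_eventually)
  qed
  show "AE x in lborel. norm ((cmod (g n x))\<^sup>2) \<le> (cmod (f x))\<^sup>2" for n
   by (rule AE_I2) (auto simp: g_def indicator_def)
 qed (auto simp: g_def)
 then have "(\<lambda>n. sqrt (LBINT x. (cmod (g n x))\<^sup>2)) \<longlonglongrightarrow> sqrt 0"
  by (intro tendsto_intros) simp
 then have "(\<lambda>n. norm (abs_L2 (g n))) \<longlonglongrightarrow> 0"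
  by (simp add: L2_norm_eq[OF g])
 moreover have "L2_cut (X n) (k\<^sup>2) (snd y) - snd y = abs_L2 (g n)" for n
  unfolding cut unfolding y' by (subst L2_diff_eq) (auto simp: g_def[abs_def] f sq_integrable_cut)
 ultimately have "(\<lambda>n. norm (L2_cut (X n) (k\<^sup>2) (snd y) - snd y)) \<longlonglongrightarrow> 0" by simp
 then show ?thesis by (rule LIM_zero_cancel[OF tendsto_norm_zero_cancel])
qed

section \<open>Density of rational step functions and separability\<close>

definition step_fun :: "(complex \<times> real \<times> real) list \<Rightarrow> real \<Rightarrow> complex" where
 "step_fun l x = (\<Sum>(c, a, b)\<leftarrow>l. indicator {a<..<b} x *\<^sub>R c)"

lemma step_fun_simps[simp]:
 "step_fun [] = (\<lambda>x. 0)"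
 "step_fun ((c, a, b) # l) = (\<lambda>x. indicator {a<..<b} x *\<^sub>R c + step_fun l x)"
 "step_fun (l @ l') = (\<lambda>x. step_fun l x + step_fun l' x)"
 by (auto simp: step_fun_def)

lemma sq_integrable_indicator:
 assumes "A \<in> sets borel" "emeasure lborel A < \<infinity>"
 shows "sq_integrable (\<lambda>x. indicator A x *\<^sub>R c)"
proof -
 have "(\<lambda>x. (cmod (indicator A x *\<^sub>R c))\<^sup>2) = (\<lambda>x. indicator A x * (cmod c)\<^sup>2)"
  by (auto simp: indicator_def)
 then show ?thesis using assms unfolding sq_integrable_def by auto
qed

lemma sq_integrable_step: "sq_integrable (step_fun l)"
proof (induction l)
 case (Cons p l)
 obtain c a b where p: "p = (c, a, b)" by (cases p)
 have "emeasure lborel {a<..<b} < \<infinity>" by (cases "a \<le> b") auto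
 then show ?case using Cons sq_integrable_add[OF sq_integrable_indicator] by (simp add: p)
qed (simp add: sq_integrable_zero)

text \<open>Lists of pieces with rational data form a countable set, and appending lists adds the
  step functions.\<close>

definition rational_steps :: "(complex \<times> real \<times> real) list set" where
 "rational_steps = lists ({c. Re c \<in> \<rat> \<and> Im c \<in> \<rat>} \<times> \<rat> \<times> \<rat>)"

definition L2_adherent :: "(real \<Rightarrow> complex) \<Rightarrow> bool" where
 "L2_adherent f \<longleftrightarrow> (\<forall>e>0. \<exists>l\<in>rational_steps. norm (abs_L2 f - abs_L2 (step_fun l)) < e)"

lemma L2_adherent_add:
 assumes "sq_integrable f" "sq_integrable g" "L2_adherent f" "L2_adherent g"
 shows "L2_adherent (\<lambda>x. f x + g x)"
 unfolding L2_adherent_def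
proof (intro allI impI)
 fix e :: real assume "e > 0"
 then obtain u v where uv: "u \<in> rational_steps" "v \<in> rational_steps" and u: "norm (abs_L2 f - abs_L2 (step_fun u)) < e / 2" and v: "norm (abs_L2 g - abs_L2 (step_fun v)) < e / 2"
  using assms(3,4)[unfolded L2_adherent_def, rule_format, of "e / 2"] by auto
 have add: "abs_L2 f + abs_L2 g = abs_L2 (\<lambda>x. f x + g x)" if "sq_integrable f" "sq_integrable g" for f g
  using that by (subst plus_L2.abs_eq) auto
 have "abs_L2 (\<lambda>x. f x + g x) - abs_L2 (step_fun (u @ v)) = (abs_L2 f - abs_L2 (step_fun u)) + (abs_L2 g - abs_L2 (step_fun v))"
  using add[OF assms(1,2)] add[OF sq_integrable_step sq_integrable_step, of u v] by (simp add: algebra_simps)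
 also have "norm \<dots> < e"
  using norm_triangle_ineq[of "abs_L2 f - abs_L2 (step_fun u)" "abs_L2 g - abs_L2 (step_fun v)"] u v by linarith
 finally show "\<exists>l\<in>rational_steps. norm (abs_L2 (\<lambda>x. f x + g x) - abs_L2 (step_fun l)) < e"
  using uv by (intro bexI[of _ "u @ v"]) (auto simp: rational_steps_def)
qed

lemma L2_adherent_lim:
 assumes f: "sq_integrable f" and s: "\<And>n. sq_integrable (s n)" "\<And>n. L2_adherent (s n)"
  and lim: "(\<lambda>n. norm (abs_L2 f - abs_L2 (s n))) \<longlonglongrightarrow> 0"
 shows "L2_adherent f"
 unfolding L2_adherent_def
proof (intro allI impI)
 fix e :: real assume e: "e > 0"
 then have "\<forall>\<^sub>F n in sequentially. norm (abs_L2 f - abs_L2 (s n)) < e / 2"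
  by (intro order_tendstoD(2)[OF lim]) simp
 then obtain n where n: "norm (abs_L2 f - abs_L2 (s n)) < e / 2" by (auto simp: eventually_sequentially)
 obtain u where u0: "u \<in> rational_steps" and u: "norm (abs_L2 (s n) - abs_L2 (step_fun u)) < e / 2"
  using s(2)[of n, unfolded L2_adherent_def, rule_format, of "e / 2"] e by auto
 have "norm (abs_L2 f - abs_L2 (step_fun u)) < e"
  using norm_triangle_ineq[of "abs_L2 f - abs_L2 (s n)" "abs_L2 (s n) - abs_L2 (step_fun u)"] n u by simp
 then show "\<exists>l\<in>rational_steps. norm (abs_L2 f - abs_L2 (step_fun l)) < e"
  using u0 by blast
qed

lemma L2_norm_tendsto:
 assumes f: "sq_integrable f" and s: "\<And>n. sq_integrable (s n)"
  and lim: "(\<lambda>n. LBINT x. (cmod (f x - s n x))\<^sup>2) \<longlonglongrightarrow> 0"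
 shows "(\<lambda>n. norm (abs_L2 f - abs_L2 (s n))) \<longlonglongrightarrow> 0"
proof -
 have "sq_integrable (\<lambda>x. f x - s n x)" for n
  using sq_integrable_add[OF f sq_integrable_uminus[OF s]] by simp
 then have "norm (abs_L2 f - abs_L2 (s n)) = sqrt (LBINT x. (cmod (f x - s n x))\<^sup>2)" for n
  using L2_norm_eq by (simp add: L2_diff_eq[OF f s])
 moreover have "(\<lambda>n. sqrt (LBINT x. (cmod (f x - s n x))\<^sup>2)) \<longlonglongrightarrow> sqrt 0"
  by (intro tendsto_intros lim)
 ultimately show ?thesis by simp
qed

lemma lim_indicator:
 assumes AB: "\<And>n. B n \<in> sets borel" "A \<in> sets borel" and m: "\<And>n. emeasure lborel (sym_diff A (B n)) \<le> ennreal (1 / Suc n)"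
  and A: "emeasure lborel A < \<infinity>" and B: "\<And>n. emeasure lborel (B n) < \<infinity>"
 shows "(\<lambda>n. norm (abs_L2 (\<lambda>x. indicator A x *\<^sub>R c) - abs_L2 (\<lambda>x. indicator (B n) x *\<^sub>R c))) \<longlonglongrightarrow> 0"
proof (rule L2_norm_tendsto)
 have eq: "(cmod (indicator A x *\<^sub>R c - indicator (B n) x *\<^sub>R c))\<^sup>2 = indicator (sym_diff A (B n)) x * (cmod c)\<^sup>2" for x n
  by (auto simp: indicator_def)
 have "(LBINT x. (cmod (indicator A x *\<^sub>R c - indicator (B n) x *\<^sub>R c))\<^sup>2) = measure lborel (sym_diff A (B n)) * (cmod c)\<^sup>2" for n
  unfolding eq by simp
 moreover have "measure lborel (sym_diff A (B n)) \<le> 1 / Suc n" for n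
  using m[of n] unfolding measure_def by (intro enn2real_leI) auto
 then have "(\<lambda>n. measure lborel (sym_diff A (B n))) \<longlonglongrightarrow> 0"
  by (intro Lim_null_comparison[OF _ LIMSEQ_Suc[OF lim_1_over_n]]) auto
 then have "(\<lambda>n. measure lborel (sym_diff A (B n)) * (cmod c)\<^sup>2) \<longlonglongrightarrow> 0"
  by (rule tendsto_mult_left_zero)
 ultimately show "(\<lambda>n. LBINT x. (cmod (indicator A x *\<^sub>R c - indicator (B n) x *\<^sub>R c))\<^sup>2) \<longlonglongrightarrow> 0" by simp
qed (auto intro: sq_integrable_indicator AB A B)

text \<open>Overlapping intervals are resolved by inclusion-exclusion: on a window, the indicator of
  a union of U and J is that of J plus that of U minus that of their intersection. An arbitrary
  rational window is carried through the induction, so that the last term is the induction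
  hypothesis for a smaller window.\<close>

lemma adherent_interval_UN:
 fixes I :: "nat \<Rightarrow> real \<times> real"
 assumes I: "\<And>i. I i \<in> \<rat> \<times> \<rat>" and c: "Re c \<in> \<rat>" "Im c \<in> \<rat>"
 shows "L2_adherent (\<lambda>x. indicator (\<Union>i<n. {fst (I i)<..<snd (I i)}) x *\<^sub>R c)"
proof -
 have I': "fst (I i) \<in> \<rat>" "snd (I i) \<in> \<rat>" for i using I[of i] by (auto simp: mem_Times_iff)
 have pos: "\<exists>l\<in>rational_steps. (\<lambda>x. indicator ((\<Union>i<n. {fst (I i)<..<snd (I i)}) \<inter> {a<..<b}) x *\<^sub>R c) = step_fun l"
  if "a \<in> \<rat>" "b \<in> \<rat>" for a b
  using that
 proof (induction n arbitrary: a b)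
  case 0
  then show ?case by (intro bexI[of _ "[]"]) (auto simp: rational_steps_def)
 next
  case (Suc n)
  let ?U = "\<Union>i<n. {fst (I i)<..<snd (I i)}"
  define a' where "a' = max a (fst (I n))"
  define b' where "b' = min b (snd (I n))"
  have ab': "a' \<in> \<rat>" "b' \<in> \<rat>" using Suc.prems I' by (auto simp: a'_def b'_def max_def min_def)
  obtain l where l0: "l \<in> rational_steps" and l: "(\<lambda>x. indicator (?U \<inter> {a<..<b}) x *\<^sub>R c) = step_fun l" using Suc by blast
  obtain l' where l'0: "l' \<in> rational_steps" and l': "(\<lambda>x. indicator (?U \<inter> {a'<..<b'}) x *\<^sub>R c) = step_fun l'"
   using Suc.IH[OF ab'] by blast
  have neg: "\<exists>l''\<in>rational_steps. (\<lambda>x. - step_fun l' x) = step_fun l''" if "l' \<in> rational_steps" for l'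
   using that
  proof (induction l')
   case Nil show ?case by (intro bexI[of _ "[]"]) (auto simp: rational_steps_def)
  next
   case (Cons p l')
   obtain c a b where p: "p = (c, a, b)" by (cases p)
   from Cons obtain l'' where l'': "l'' \<in> rational_steps" "(\<lambda>x. - step_fun l' x) = step_fun l''" by (auto simp: rational_steps_def)
   show ?case
   proof (intro bexI[of _ "(- c, a, b) # l''"])
    show "(\<lambda>x. - step_fun (p # l') x) = step_fun ((- c, a, b) # l'')"
     by (simp add: p l''(2)[symmetric] fun_eq_iff)
    show "(- c, a, b) # l'' \<in> rational_steps"
     using Cons.prems l''(1) by (auto simp: rational_steps_def p)
   qed
  qed
  from neg[OF l'0] obtain l'' where l''0: "l'' \<in> rational_steps" and l'': "(\<lambda>x. - step_fun l' x) = step_fun l''" by blast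
  have "(\<lambda>x. indicator ((\<Union>i<Suc n. {fst (I i)<..<snd (I i)}) \<inter> {a<..<b}) x *\<^sub>R c)
   = step_fun (((c, a', b') # l) @ l'')"
   unfolding step_fun_simps l[symmetric] l''[symmetric] l'[symmetric]
   by (auto simp: fun_eq_iff indicator_def a'_def b'_def less_Suc_eq)
  moreover have "((c, a', b') # l) @ l'' \<in> rational_steps"
   using l0 l''0 c ab' by (auto simp: rational_steps_def)
  ultimately show ?case by blast
 qed
 \<comment> \<open>A window that contains all the intervals, so that it disappears from the
   statement. Inserting 0 keeps \<open>Min\<close> and \<open>Max\<close> meaningful when there is
   no interval.\<close>
 define a where "a = Min (insert 0 ((\<lambda>i. fst (I i)) ` {..<n}))"
 define b where "b = Max (insert 0 ((\<lambda>i. snd (I i)) ` {..<n}))"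
 have "a \<in> insert 0 ((\<lambda>i. fst (I i)) ` {..<n})" unfolding a_def by (rule Min_in) auto
 moreover have "b \<in> insert 0 ((\<lambda>i. snd (I i)) ` {..<n})" unfolding b_def by (rule Max_in) auto
 ultimately have ab: "a \<in> \<rat>" "b \<in> \<rat>" using I' by auto
 have "fst (I i) \<ge> a" "snd (I i) \<le> b" if "i < n" for i
  using that by (auto simp: a_def b_def)
 then have "(\<Union>i<n. {fst (I i)<..<snd (I i)}) \<inter> {a<..<b} = (\<Union>i<n. {fst (I i)<..<snd (I i)})"
  by fastforce
 with pos[OF ab] obtain l where "l \<in> rational_steps" "(\<lambda>x. indicator (\<Union>i<n. {fst (I i)<..<snd (I i)}) x *\<^sub>R c) = step_fun l" by auto
 then show ?thesis unfolding L2_adherent_def by (auto intro!: bexI[of _ l])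
qed

lemma open_real_rational_intervals:
 assumes "open (U :: real set)"
 obtains I :: "nat \<Rightarrow> real \<times> real" where "\<And>i. I i \<in> \<rat> \<times> \<rat>" "U = (\<Union>i. {fst (I i)<..<snd (I i)})"
proof -
 define R where "R = {p \<in> \<rat> \<times> \<rat>. {fst p<..<snd p} \<subseteq> U}"
 have "countable R"
  by (rule countable_subset[of _ "\<rat> \<times> \<rat>"]) (auto simp: R_def countable_rat)
 moreover have ne: "(0, 0) \<in> R" by (auto simp: R_def)
 ultimately have R: "range (from_nat_into R) = R" by (intro range_from_nat_into) auto
 have "U = (\<Union>p\<in>R. {fst p<..<snd p})"
 proof (intro equalityI subsetI)
  fix x assume "x \<in> U"
  then obtain e where e: "e > 0" "ball x e \<subseteq> U" using assms openE by blast
  obtain p where p: "p \<in> \<rat>" "x - e < p" "p < x" using Rats_dense_in_real[of "x - e" x] e by auto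
  obtain q where q: "q \<in> \<rat>" "x < q" "q < x + e" using Rats_dense_in_real[of x "x + e"] e by auto
  have "{p<..<q} \<subseteq> ball x e" using p q by (auto simp: dist_real_def)
  then have "(p, q) \<in> R" using p q e by (auto simp: R_def)
  then show "x \<in> (\<Union>p\<in>R. {fst p<..<snd p})" using p q by force
 qed (auto simp: R_def)
 then have "U = (\<Union>p\<in>range (from_nat_into R). {fst p<..<snd p})"
  unfolding R .
 also have "\<dots> = (\<Union>i. {fst (from_nat_into R i)<..<snd (from_nat_into R i)})" by blast
 finally have "U = (\<Union>i. {fst (from_nat_into R i)<..<snd (from_nat_into R i)})" .
 moreover have "from_nat_into R i \<in> \<rat> \<times> \<rat>" for i
 proof -
  have "R \<subseteq> \<rat> \<times> \<rat>" by (auto simp: R_def)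
  moreover have "from_nat_into R i \<in> R" by (rule from_nat_into) (use ne in auto)
  ultimately show ?thesis by blast
 qed
 ultimately show ?thesis by (rule that[rotated])
qed

text \<open>The set is approximated from outside by an open set, and that set from inside by
  finitely many of its rational intervals. Each error is below 1 / (2 (n + 1)), so the symmetric
  difference is within 1 / (n + 1).\<close>

lemma adherent_indicator_rational:
 assumes A: "A \<in> sets borel" "emeasure lborel A < \<infinity>" and c: "Re c \<in> \<rat>" "Im c \<in> \<rat>"
 shows "L2_adherent (\<lambda>x. indicator A x *\<^sub>R c)"
proof -
 have ex: "\<exists>V. L2_adherent (\<lambda>x. indicator V x *\<^sub>R c) \<and> V \<in> sets borel \<and> emeasure lborel V < \<infinity> \<and>
   emeasure lborel (sym_diff A V) \<le> ennreal (1 / Suc n)" for n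
 proof -
  define e where "e = 1 / (2 * real (Suc n))"
  have e: "e > 0" by (simp add: e_def)
  obtain U where U: "open U" "A \<subseteq> U" "emeasure lborel (U - A) < ennreal e"
   using outer_regular_lborel[OF A(1) e] by blast
  have [measurable]: "U \<in> sets borel" "A \<in> sets borel" using U A by auto
  have "emeasure lborel U \<le> emeasure lborel A + emeasure lborel (U - A)"
   using emeasure_subadditive[of A lborel "U - A"] U(2) by (auto simp: Un_absorb1)
  also have "\<dots> < \<infinity>" using A(2) U(3) by (auto simp: ennreal_add_eq_top less_top intro: order.strict_trans)
  finally have finU: "emeasure lborel U < \<infinity>" .
  obtain I :: "nat \<Rightarrow> real \<times> real" where I: "\<And>i. I i \<in> \<rat> \<times> \<rat>" "U = (\<Union>i. {fst (I i)<..<snd (I i)})"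
   using open_real_rational_intervals[OF U(1)] by blast
  define V where "V m = (\<Union>i<m. {fst (I i)<..<snd (I i)})" for m
  have [measurable]: "V m \<in> sets borel" for m unfolding V_def by auto
  have VU: "V m \<subseteq> U" for m unfolding V_def I(2) by blast
  have "(\<lambda>m. emeasure lborel (U - V m)) \<longlonglongrightarrow> emeasure lborel (\<Inter>m. U - V m)"
  proof (rule Lim_emeasure_decseq)
   show "decseq (\<lambda>m. U - V m)" unfolding decseq_def V_def by force
   show "emeasure lborel (U - V i) \<noteq> \<infinity>" for i
    using finU emeasure_mono[of "U - V i" U lborel] by (auto simp: top_unique)
  qed auto
  moreover have "(\<Inter>m. U - V m) = {}" unfolding V_def I(2) by auto
  ultimately have "(\<lambda>m. emeasure lborel (U - V m)) \<longlonglongrightarrow> 0" by (simp only: emeasure_empty)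
  then have "\<forall>\<^sub>F m in sequentially. emeasure lborel (U - V m) < ennreal e"
   by (rule order_tendstoD(2)) (use e in simp)
  then obtain m where m: "emeasure lborel (U - V m) < ennreal e" by (auto simp: eventually_sequentially)
  have "emeasure lborel (sym_diff A (V m)) \<le> emeasure lborel ((U - V m) \<union> (U - A))"
   using U(2) VU by (intro emeasure_mono) auto
  also have "\<dots> \<le> emeasure lborel (U - V m) + emeasure lborel (U - A)"
   by (rule emeasure_subadditive) auto
  also have "\<dots> \<le> ennreal e + ennreal e" using m U(3) by (intro add_mono) auto
  also have "\<dots> = ennreal (e + e)" by (rule ennreal_plus[symmetric]) (use e in auto)
  also have "e + e = 1 / Suc n" by (simp add: e_def field_simps)
  finally have "emeasure lborel (sym_diff A (V m)) \<le> ennreal (1 / Suc n)" .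
  moreover have "emeasure lborel (V m) < \<infinity>" using finU emeasure_mono[OF VU, of lborel m] by (auto simp: less_top[symmetric] top_unique)
  moreover have "L2_adherent (\<lambda>x. indicator (V m) x *\<^sub>R c)"
   unfolding V_def by (rule adherent_interval_UN[OF I(1) c])
  ultimately show ?thesis by (intro exI[of _ "V m"]) auto
 qed
 then obtain V where V: "\<And>n. L2_adherent (\<lambda>x. indicator (V n) x *\<^sub>R c)" "\<And>n. V n \<in> sets borel"
  "\<And>n. emeasure lborel (V n) < \<infinity>" "\<And>n. emeasure lborel (sym_diff A (V n)) \<le> ennreal (1 / Suc n)"
  by metis
 show ?thesis
  by (rule L2_adherent_lim[OF sq_integrable_indicator[OF A] sq_integrable_indicator V(1) lim_indicator]) (use V A in auto)
qed

lemma adherent_indicator: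
 assumes A: "A \<in> sets borel" "emeasure lborel A < \<infinity>"
 shows "L2_adherent (\<lambda>x. indicator A x *\<^sub>R c)"
proof -
 have r: "\<exists>q\<in>\<rat>. \<bar>x - q\<bar> < 1 / real (Suc n)" for x n
  using Rats_dense_in_real[of x "x + 1 / real (Suc n)"] by auto (metis abs_minus_commute abs_of_pos diff_gt_0_iff_gt diff_less_eq add.commute)
 then obtain q where q: "\<And>x n. q x n \<in> \<rat>" "\<And>x n. \<bar>x - q x n\<bar> < 1 / real (Suc n)" by metis
 have lq: "(\<lambda>n. q x n) \<longlonglongrightarrow> x" for x
 proof (rule LIM_zero_cancel, rule Lim_null_comparison[OF _ LIMSEQ_Suc[OF lim_1_over_n]])
  show "\<forall>\<^sub>F n in sequentially. norm (q x n - x) \<le> 1 / real (Suc n)"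
   using q(2)[of x] by (intro always_eventually allI) (simp add: abs_minus_commute less_imp_le del: of_nat_Suc)
 qed
 define c' where "c' n = Complex (q (Re c) n) (q (Im c) n)" for n
 have lc: "c' \<longlonglongrightarrow> c"
  using tendsto_Complex[OF lq lq, of "Re c" "Im c"] by (simp add: c'_def[abs_def])
 show ?thesis
 proof (rule L2_adherent_lim[OF sq_integrable_indicator[OF A] sq_integrable_indicator[OF A] _ L2_norm_tendsto])
  show "L2_adherent (\<lambda>x. indicator A x *\<^sub>R c' n)" for n
   by (rule adherent_indicator_rational[OF A]) (simp_all add: c'_def q)
  have "(cmod (indicator A x *\<^sub>R c - indicator A x *\<^sub>R c' n))\<^sup>2 = indicator A x * (cmod (c - c' n))\<^sup>2" for x n
   by (auto simp: indicator_def)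
  then have "(LBINT x. (cmod (indicator A x *\<^sub>R c - indicator A x *\<^sub>R c' n))\<^sup>2) = measure lborel A * (cmod (c - c' n))\<^sup>2" for n
   using A by simp
  moreover have "(\<lambda>n. measure lborel A * (cmod (c - c' n))\<^sup>2) \<longlonglongrightarrow> measure lborel A * (cmod (c - c))\<^sup>2"
   by (intro tendsto_intros lc)
  ultimately show "(\<lambda>n. LBINT x. (cmod (indicator A x *\<^sub>R c - indicator A x *\<^sub>R c' n))\<^sup>2) \<longlonglongrightarrow> 0" by simp
 qed (use A sq_integrable_indicator in auto)
qed

lemma L2_adherent_all:
 assumes f: "sq_integrable f"
 shows "L2_adherent f"
proof -
 have [measurable]: "f \<in> borel_measurable borel" and fi: "integrable lborel (\<lambda>x. (cmod (f x))\<^sup>2)"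
  using f by (auto simp: sq_integrable_def)
 have "f \<in> borel_measurable lborel" by simp
 \<comment> \<open>The approximants satisfy |s| \<le> 2 |f|, whence the constants 4 = 2^2 and 9 = (1
   + 2)^2 in the majorants below.\<close>
 from borel_measurable_implies_sequence_metric[OF this, of 0] obtain s where
  s: "\<And>i. simple_function lborel (s i)" "\<And>x. (\<lambda>i. s i x) \<longlonglongrightarrow> f x" "\<And>i x. dist (s i x) 0 \<le> 2 * dist (f x) 0"
  by auto
 have [measurable]: "s i \<in> borel_measurable borel" for i
  using borel_measurable_simple_function[OF s(1)[of i]] by simp
 have s2: "(cmod (s i x))\<^sup>2 \<le> 4 * (cmod (f x))\<^sup>2" for i x
  using power_mono[OF s(3)[of i x], of 2] by (simp add: power_mult_distrib)
 have ss: "sq_integrable (s i)" for i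
  unfolding sq_integrable_def
 proof
  show "integrable lborel (\<lambda>x. (cmod (s i x))\<^sup>2)"
  proof (rule Bochner_Integration.integrable_bound)
   show "integrable lborel (\<lambda>x. 4 * (cmod (f x))\<^sup>2)" using fi by simp
  qed (use s2 in auto)
 qed simp
 show ?thesis
 proof (rule L2_adherent_lim[OF f ss _ L2_norm_tendsto[OF f ss]])
  have "(\<lambda>n. LBINT x. (cmod (f x - s n x))\<^sup>2) \<longlonglongrightarrow> (\<integral>x. (0::real) \<partial>(lborel :: real measure))"
  proof (rule integral_dominated_convergence)
   show "integrable lborel (\<lambda>x. 9 * (cmod (f x))\<^sup>2)" using fi by simp
   show "AE x in lborel. (\<lambda>n. (cmod (f x - s n x))\<^sup>2) \<longlonglongrightarrow> 0"
   proof (rule AE_I2)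
    fix x
    have "(\<lambda>n. (cmod (f x - s n x))\<^sup>2) \<longlonglongrightarrow> (cmod (f x - f x))\<^sup>2"
     by (intro tendsto_intros s)
    then show "(\<lambda>n. (cmod (f x - s n x))\<^sup>2) \<longlonglongrightarrow> 0" by simp
   qed
   show "AE x in lborel. norm ((cmod (f x - s n x))\<^sup>2) \<le> 9 * (cmod (f x))\<^sup>2" for n
   proof (rule AE_I2)
    fix x
    have "cmod (f x - s n x) \<le> 3 * cmod (f x)"
     using norm_triangle_ineq4[of "f x" "s n x"] s(3)[of n x] by simp
    then have "(cmod (f x - s n x))\<^sup>2 \<le> (3 * cmod (f x))\<^sup>2" by (intro power_mono) auto
    then show "norm ((cmod (f x - s n x))\<^sup>2) \<le> 9 * (cmod (f x))\<^sup>2" by (simp add: power_mult_distrib)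
   qed
  qed auto
  then show "(\<lambda>n. LBINT x. (cmod (f x - s n x))\<^sup>2) \<longlonglongrightarrow> 0" by simp
  fix i
  have fin: "finite (s i ` UNIV)" using s(1)[of i] by (simp add: simple_function_def)
  \<comment> \<open>Chebyshev: on the level set of a nonzero value the square integrable function is
    bounded below, so the measure is finite. The value 0 is left out, as its level set may have
    infinite measure while contributing nothing to the sum.\<close>
  have level: "s i -` {y} \<in> sets borel \<and> emeasure lborel (s i -` {y}) < \<infinity>" if "y \<noteq> 0" for y
  proof
   show [measurable]: "s i -` {y} \<in> sets borel"
    using measurable_sets[of "s i" borel borel "{y}"] by simp
   have "integrable lborel (indicator (s i -` {y}) :: real \<Rightarrow> real)"
   proof (rule Bochner_Integration.integrable_bound)
    show "integrable lborel (\<lambda>x. (cmod (s i x))\<^sup>2 / (cmod y)\<^sup>2)"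
     using ss[of i] by (simp add: sq_integrable_def)
   qed (use that in \<open>auto simp: indicator_def\<close>)
   then show "emeasure lborel (s i -` {y}) < \<infinity>"
    by (simp add: integrable_indicator_iff)
  qed
  have "sq_integrable (\<lambda>x. \<Sum>y\<in>F. indicator (s i -` {y}) x *\<^sub>R y) \<and> L2_adherent (\<lambda>x. \<Sum>y\<in>F. indicator (s i -` {y}) x *\<^sub>R y)"
   if "finite F" "0 \<notin> F" for F
   using that
  proof (induction F rule: finite_induct)
   case empty
   have "L2_adherent (\<lambda>x. indicator {} x *\<^sub>R 0)" by (rule adherent_indicator) auto
   then show ?case by (simp add: sq_integrable_zero)
  next
   case (insert y F)
   then have IH: "sq_integrable (\<lambda>x. \<Sum>y\<in>F. indicator (s i -` {y}) x *\<^sub>R y)" "L2_adherent (\<lambda>x. \<Sum>y\<in>F. indicator (s i -` {y}) x *\<^sub>R y)" and y: "y \<noteq> 0" by auto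
   note l = level[OF y]
   show ?case
    unfolding sum.insert[OF insert.hyps]
    using sq_integrable_add[OF sq_integrable_indicator IH(1)] L2_adherent_add[OF sq_integrable_indicator IH(1) adherent_indicator IH(2)] l
    by auto
  qed
  from this[of "s i ` UNIV - {0}"] fin
  have "L2_adherent (\<lambda>x. \<Sum>y\<in>s i ` UNIV - {0}. indicator (s i -` {y}) x *\<^sub>R y)" by auto
  also have "(\<lambda>x. \<Sum>y\<in>s i ` UNIV - {0}. indicator (s i -` {y}) x *\<^sub>R y) = s i"
  proof
   fix x
   have "(\<Sum>y\<in>s i ` UNIV - {0}. indicator (s i -` {y}) x *\<^sub>R y) = (\<Sum>y\<in>s i ` UNIV - {0}. if y = s i x then y else 0)"
    by (intro sum.cong) (auto simp: indicator_def)
   also have "\<dots> = s i x" using fin by (auto simp: sum.delta')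
   finally show "(\<Sum>y\<in>s i ` UNIV - {0}. indicator (s i -` {y}) x *\<^sub>R y) = s i x" .
  qed
  finally show "L2_adherent (s i)" .
 qed
qed

text \<open>This permits writing open sets of paths as countable unions of sets determined by
  countably many coordinates.\<close>

lemma state_space_separable:
 "\<exists>D :: 'n::finite state set. countable D \<and> (\<forall>x e. e > 0 \<longrightarrow> (\<exists>y\<in>D. dist x y < e))"
proof -
 define E where "E = (\<lambda>l. abs_L2 (step_fun l)) ` rational_steps"
 have E: "countable E"
  unfolding E_def rational_steps_def
 proof (intro countable_image countable_lists countable_SIGMA)
  have "{c. Re c \<in> \<rat> \<and> Im c \<in> \<rat>} \<subseteq> (\<lambda>(a, b). Complex a b) ` (\<rat> \<times> \<rat>)"
   by (auto simp: image_iff) (metis complex_surj)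
  then show "countable {c. Re c \<in> \<rat> \<and> Im c \<in> \<rat>}"
   by (rule countable_subset) (intro countable_image countable_SIGMA countable_rat)
 qed (auto simp: countable_rat)
 have Ed: "\<exists>g\<in>E. dist \<phi> g < e" if "e > 0" for \<phi> e
 proof -
  obtain f where f: "sq_integrable f" "\<phi> = abs_L2 f" by (rule L2_cases)
  show ?thesis using L2_adherent_all[OF f(1)] that unfolding L2_adherent_def E_def f(2) dist_norm by auto
 qed
 obtain D0 :: "(complex, 'n) vec set" where D0: "countable D0" "\<And>X. open X \<Longrightarrow> X \<noteq> {} \<Longrightarrow> \<exists>d\<in>D0. d \<in> X"
  using countable_dense_exists by metis
 show ?thesis
 proof (intro exI[of _ "D0 \<times> E"] conjI allI impI)
  show "countable (D0 \<times> E)" using D0 E by auto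
  fix x :: "'n state" and e :: real assume e: "e > 0"
  obtain T where T: "T \<in> D0" "dist (fst x) T < e / 2" using D0(2)[of "ball (fst x) (e / 2)"] e by auto
  obtain g where g: "g \<in> E" "dist (snd x) g < e / 2" using Ed[of "e / 2"] e by auto
  have "dist x (T, g) \<le> dist (fst x) T + dist (snd x) g"
   by (simp add: dist_prod_def sqrt_sum_squares_le_sum)
  then show "\<exists>y\<in>D0 \<times> E. dist x y < e" using T g by (intro bexI[of _ "(T, g)"]) auto
 qed
qed

section \<open>Path space\<close>

lemma space_path_space:
 "space (path_space S) = {w \<in> extensional {0..}. continuous_on {0..} w \<and> (\<forall>t\<ge>0. w t \<in> S)}"
 by (auto simp: path_space_def space_restrict_space space_PiM PiE_def)

lemma measurable_path_space_coord[measurable (raw)]: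
 assumes "t \<ge> 0"
 shows "(\<lambda>w. w t) \<in> borel_measurable (path_space S)"
 unfolding path_space_def
 by (rule measurable_restrict_space1) (use assms in \<open>auto intro: measurable_component_singleton\<close>)

lemma measurable_into_path_space:
 assumes "\<And>\<omega>. \<omega> \<in> space M \<Longrightarrow> f \<omega> \<in> space (path_space S)"
  and "\<And>t. t \<ge> 0 \<Longrightarrow> (\<lambda>\<omega>. f \<omega> t) \<in> borel_measurable M"
 shows "f \<in> M \<rightarrow>\<^sub>M path_space S"
 unfolding path_space_def
proof (rule measurable_restrict_space2)
 show "f \<in> space M \<rightarrow> {w. continuous_on {0..} w \<and> (\<forall>t\<ge>0. w t \<in> S)}"
  using assms(1) by (auto simp: space_path_space)
 show "f \<in> M \<rightarrow>\<^sub>M Pi\<^sub>M {0..} (\<lambda>_. borel)"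
 proof (rule measurable_PiM_single')
  show "f \<in> space M \<rightarrow> (\<Pi>\<^sub>E i\<in>{0..}. space borel)"
   using assms(1) by (auto simp: space_path_space PiE_def)
 qed (use assms(2) in auto)
qed

section \<open>Cylinder sets and continuous cylinder functions\<close>

definition coord_sets :: "'a::topological_space set \<Rightarrow> real set \<Rightarrow> (real \<Rightarrow> 'a) set set" where
 "coord_sets S J = {(\<lambda>w. w s) -` B \<inter> space (path_space S) | s B. s \<in> J \<and> B \<in> sets borel}"

lemma coord_sets_Pow: "coord_sets S J \<subseteq> Pow (space (path_space S))"
 by (auto simp: coord_sets_def)

lemma coord_setsI: "s \<in> J \<Longrightarrow> B \<in> sets borel \<Longrightarrow> (\<lambda>w. w s) -` B \<inter> space (path_space S) \<in> coord_sets S J"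
 unfolding coord_sets_def by blast

lemma path_filtration_eq: "path_filtration S t = sigma (space (path_space S)) (coord_sets S {0..t})"
 unfolding path_filtration_def coord_sets_def by (intro arg_cong2[where f=sigma] refl) auto

lemma sets_path_filtration: "sets (path_filtration S t) = sigma_sets (space (path_space S)) (coord_sets S {0..t})"
 unfolding path_filtration_eq by (rule sets_measure_of[OF coord_sets_Pow])

lemma space_path_filtration: "space (path_filtration S t) = space (path_space S)"
 unfolding path_filtration_eq by (rule space_measure_of[OF coord_sets_Pow])

lemma coord_sets_subset: "J \<subseteq> {0..} \<Longrightarrow> coord_sets S J \<subseteq> sets (path_space S)"
 unfolding coord_sets_def using measurable_sets[OF measurable_path_space_coord] by blast

lemma subalgebra_path_filtration: "subalgebra (path_space S) (path_filtration S t)"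
 unfolding subalgebra_def sets_path_filtration space_path_filtration
 by (auto intro!: sets.sigma_sets_subset coord_sets_subset)

lemma measurable_path_filtration_coord:
 assumes "0 \<le> s" "s \<le> t"
 shows "(\<lambda>w. w s) \<in> borel_measurable (path_filtration S t)"
 by (rule measurableI)
  (use assms in \<open>auto simp: space_path_filtration sets_path_filtration coord_sets_def intro!: sigma_sets.Basic\<close>)

lemma sets_path_space: "sets (path_space S) = sigma_sets (space (path_space S)) (coord_sets S {0..})"
proof
 show "sigma_sets (space (path_space S)) (coord_sets S {0..}) \<subseteq> sets (path_space S)"
  by (intro sets.sigma_sets_subset coord_sets_subset) auto
 let ?G = "sigma (space (path_space S)) (coord_sets S {0..})"
 have sG: "sets ?G = sigma_sets (space (path_space S)) (coord_sets S {0..})" "space ?G = space (path_space S)"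
  by (simp_all add: sets_measure_of[OF coord_sets_Pow] space_measure_of[OF coord_sets_Pow])
 have "(\<lambda>w. w) \<in> ?G \<rightarrow>\<^sub>M path_space S"
 proof (rule measurable_into_path_space)
  show "(\<lambda>w. w t) \<in> borel_measurable ?G" if "t \<ge> 0" for t
  proof (rule measurableI)
   fix B :: "'a set" assume "B \<in> sets borel"
   then have "(\<lambda>w. w t) -` B \<inter> space (path_space S) \<in> coord_sets S {0..}"
    using that by (intro coord_setsI) auto
   then show "(\<lambda>w. w t) -` B \<inter> space ?G \<in> sets ?G" unfolding sG by (rule sigma_sets.Basic)
  qed simp
 qed (simp add: sG)
 then show "sets (path_space S) \<subseteq> sigma_sets (space (path_space S)) (coord_sets S {0..})"
  using measurable_sets[of "\<lambda>w. w" ?G "path_space S"] sets.sets_into_space[of _ "path_space S"]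
  by (auto simp: sG)
qed

text \<open>Closed sets generate the Borel sets, and their indicators are limits of continuous
  functions. Lists may repeat a time, so intersecting two cylinders is appending their
  lists.\<close>

definition cyl :: "'a::topological_space set \<Rightarrow> real set \<Rightarrow> (real \<Rightarrow> 'a) set set" where
 "cyl S J = {{w \<in> space (path_space S). \<forall>p\<in>set l. w (fst p) \<in> snd p} | l. \<forall>p\<in>set l. fst p \<in> J \<and> closed (snd p)}"

lemma Int_stable_cyl: "Int_stable (cyl S J)"
proof (rule Int_stableI)
 fix X Y assume "X \<in> cyl S J" "Y \<in> cyl S J"
 then obtain l l' where "X = {w \<in> space (path_space S). \<forall>p\<in>set l. w (fst p) \<in> snd p}" "\<forall>p\<in>set l. fst p \<in> J \<and> closed (snd p)"
  "Y = {w \<in> space (path_space S). \<forall>p\<in>set l'. w (fst p) \<in> snd p}" "\<forall>p\<in>set l'. fst p \<in> J \<and> closed (snd p)"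
  by (auto simp: cyl_def)
 then show "X \<inter> Y \<in> cyl S J" unfolding cyl_def by (intro CollectI exI[of _ "l @ l'"]) auto
qed

lemma sigma_sets_cyl:
 "sigma_sets (space (path_space S)) (cyl S J) = sigma_sets (space (path_space S)) (coord_sets S J)"
proof (rule sigma_sets_eqI)
 let ?\<Omega> = "space (path_space S)"
 fix X assume "X \<in> cyl S J"
 then obtain l where l: "X = {w \<in> ?\<Omega>. \<forall>p\<in>set l. w (fst p) \<in> snd p}" "\<forall>p\<in>set l. fst p \<in> J \<and> closed (snd p)"
  by (auto simp: cyl_def)
 interpret sigma_algebra ?\<Omega> "sigma_sets ?\<Omega> (coord_sets S J)"
  by (rule sigma_algebra_sigma_sets[OF coord_sets_Pow])
 have "{w \<in> ?\<Omega>. \<forall>p\<in>set l. w (fst p) \<in> snd p} \<in> sigma_sets ?\<Omega> (coord_sets S J)"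
  using l(2)
 proof (induction l)
  case Nil then show ?case by (simp add: sigma_sets_top)
 next
  case (Cons p l)
  obtain t A where p: "p = (t, A)" by (cases p)
  have "{w \<in> ?\<Omega>. \<forall>p\<in>set (p # l). w (fst p) \<in> snd p} = ((\<lambda>w. w t) -` A \<inter> ?\<Omega>) \<inter> {w \<in> ?\<Omega>. \<forall>p\<in>set l. w (fst p) \<in> snd p}"
   by (auto simp: p)
  moreover have "(\<lambda>w. w t) -` A \<inter> ?\<Omega> \<in> sigma_sets ?\<Omega> (coord_sets S J)"
   using Cons.prems by (intro sigma_sets.Basic coord_setsI) (auto simp: p)
  moreover have "{w \<in> ?\<Omega>. \<forall>p\<in>set l. w (fst p) \<in> snd p} \<in> sigma_sets ?\<Omega> (coord_sets S J)"
   using Cons by auto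
  ultimately show ?case by (simp only: Int)
 qed
 then show "X \<in> sigma_sets ?\<Omega> (coord_sets S J)" using l by simp
next
 let ?\<Omega> = "space (path_space S)"
 let ?G = "sigma ?\<Omega> (cyl S J)"
 have P: "cyl S J \<subseteq> Pow ?\<Omega>" by (auto simp: cyl_def)
 fix X assume "X \<in> coord_sets S J"
 then obtain s B where X: "X = (\<lambda>w. w s) -` B \<inter> ?\<Omega>" "s \<in> J" "B \<in> sets borel" by (auto simp: coord_sets_def)
 have "(\<lambda>w. w s) \<in> ?G \<rightarrow>\<^sub>M borel"
  unfolding borel_eq_closed
 proof (rule measurable_sigma_sets)
  fix A :: "'a set" assume "A \<in> Collect closed"
  then have "(\<lambda>w. w s) -` A \<inter> ?\<Omega> \<in> cyl S J"
   unfolding cyl_def using X by (intro CollectI exI[of _ "[(s, A)]"]) auto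
  then show "(\<lambda>w. w s) -` A \<inter> space ?G \<in> sets ?G" using P by (auto simp: space_measure_of sets_measure_of)
 qed (auto)
 from measurable_sets[OF this X(3)] show "X \<in> sigma_sets ?\<Omega> (cyl S J)"
  using P X by (simp add: space_measure_of sets_measure_of)
qed

definition cylf :: "(real \<times> ('a \<Rightarrow> real)) list \<Rightarrow> (real \<Rightarrow> 'a) \<Rightarrow> real" where
 "cylf l w = (\<Prod>(t, h)\<leftarrow>l. h (w t))"

text \<open>Continuous substitutes for cylinder indicators: their expectations pass to the limit
  under pointwise convergence of paths, and they suffice to identify laws and conditional
  expectations.\<close>

definition cyl_tests :: "real set \<Rightarrow> (real \<times> ('a::topological_space \<Rightarrow> real)) list set" where
 "cyl_tests J = {l. \<forall>(t, h)\<in>set l. t \<in> J \<and> continuous_on UNIV h \<and> (\<forall>x. 0 \<le> h x \<and> h x \<le> 1)}"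

lemma cylf_simps[simp]: "cylf [] w = 1" "cylf ((t, h) # l) w = h (w t) * cylf l w"
 by (auto simp: cylf_def)

lemma cylf_range: "l \<in> cyl_tests J \<Longrightarrow> 0 \<le> cylf l w \<and> cylf l w \<le> 1"
 by (induction l) (auto simp: cyl_tests_def intro!: mult_le_one)

lemma cylf_measurable:
 assumes "l \<in> cyl_tests J" "\<And>t. t \<in> J \<Longrightarrow> (\<lambda>w. w t) \<in> borel_measurable M"
 shows "cylf l \<in> borel_measurable M"
 using assms(1)
proof (induction l)
 case (Cons p l)
 obtain t h where p: "p = (t, h)" by (cases p)
 have "h \<in> borel_measurable borel" "t \<in> J"
  using Cons.prems by (auto simp: cyl_tests_def p intro: borel_measurable_continuous_onI)
 then have "(\<lambda>w. h (w t)) \<in> borel_measurable M"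
  using measurable_compose[OF assms(2)] by blast
 moreover have "cylf l \<in> borel_measurable M" using Cons by (auto simp: cyl_tests_def)
 ultimately have "(\<lambda>w. h (w t) * cylf l w) \<in> borel_measurable M" by (rule borel_measurable_times)
 then show ?case by (simp add: p fun_eq_iff[symmetric] cylf_simps[abs_def])
qed (simp add: cylf_simps[abs_def])

lemma cyl_approx:
 fixes S :: "'a::metric_space set"
 assumes "X \<in> cyl S J"
 obtains ln where "\<And>n::nat. ln n \<in> cyl_tests J" "\<And>w. w \<in> space (path_space S) \<Longrightarrow> (\<lambda>n. cylf (ln n) w) \<longlonglongrightarrow> indicator X w"
proof -
 obtain l where l: "X = {w \<in> space (path_space S). \<forall>p\<in>set l. w (fst p) \<in> snd p}" "\<forall>p\<in>set l. fst p \<in> J \<and> closed (snd p)"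
  using assms by (auto simp: cyl_def)
 \<comment> \<open>The functions \<open>max 0 (1 - n * infdist x A)\<close> decrease to the
   indicator of a closed \<open>A\<close>. The empty set is treated apart because
   \<open>infdist x {}\<close> is 0, which would give 1 everywhere.\<close>
 define hn :: "nat \<Rightarrow> 'a set \<Rightarrow> 'a \<Rightarrow> real"
  where "hn n A x = (if A = {} then 0 else max 0 (1 - real n * infdist x A))" for n A x
 define ln where "ln n = map (\<lambda>p. (fst p, hn n (snd p))) l" for n
 have hn: "continuous_on UNIV (hn n A)" "0 \<le> hn n A x" "hn n A x \<le> 1" for n A x
  by (cases "A = {}"; auto simp: hn_def[abs_def] infdist_nonneg intro!: continuous_intros)+
 have lim: "(\<lambda>n. hn n A x) \<longlonglongrightarrow> indicator A x" if "closed A" for A x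
 proof (cases "A = {}")
  case False
  show ?thesis
  proof (cases "x \<in> A")
   case True then show ?thesis using False by (simp add: hn_def)
  next
   case nx: False
   then have pos: "infdist x A > 0"
    using in_closed_iff_infdist_zero[OF that False] infdist_nonneg[of x A] by (metis less_eq_real_def)
   obtain N :: nat where N: "1 / infdist x A < real N" using reals_Archimedean2 by blast
   have "\<forall>\<^sub>F n in sequentially. hn n A x = 0"
    using eventually_ge_at_top[of N]
   proof eventually_elim
    case (elim n)
    then have "1 / infdist x A \<le> real n" using N by linarith
    then have "1 \<le> real n * infdist x A" using pos by (simp add: divide_le_eq)
    then show ?case using False by (simp add: hn_def)
   qed
   then show ?thesis using nx by (simp add: tendsto_eventually)
  qed
 qed (simp add: hn_def)
 show ?thesis
 proof (rule that[of ln])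
  show "ln n \<in> cyl_tests J" for n using l(2) hn unfolding cyl_tests_def ln_def by auto
  fix w assume w: "w \<in> space (path_space S)"
  have "(\<lambda>n. cylf (map (\<lambda>p. (fst p, hn n (snd p))) l) w) \<longlonglongrightarrow> (if \<forall>p\<in>set l. w (fst p) \<in> snd p then 1 else 0)"
   using l(2)
  proof (induction l)
   case (Cons p l)
   obtain t A where p: "p = (t, A)" by (cases p)
   have "(\<lambda>n. hn n A (w t) * cylf (map (\<lambda>p. (fst p, hn n (snd p))) l) w) \<longlonglongrightarrow> indicator A (w t) * (if \<forall>p\<in>set l. w (fst p) \<in> snd p then 1 else 0)"
    using Cons p by (intro tendsto_mult lim) auto
   then show ?case by (auto simp: p indicator_def split: if_splits)
  qed simp
  moreover have "(if \<forall>p\<in>set l. w (fst p) \<in> snd p then 1 else 0) = (indicator X w :: real)"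
   using w unfolding l(1) by (simp add: indicator_def)
  ultimately show "(\<lambda>n. cylf (ln n) w) \<longlonglongrightarrow> indicator X w"
   unfolding ln_def by (simp only:)
 qed
qed

text \<open>A Dynkin system argument: cylinders are stable under intersection and generate the
  \<sigma>-algebra, and their indicators are bounded limits of test products. It reduces the
  martingale property to integrals against continuous functions of finitely many past
  values.\<close>

lemma set_integral_zero_of_cyl_tests:
 fixes S :: "'a::metric_space set" and Z :: "(real \<Rightarrow> 'a) \<Rightarrow> real"
 assumes P: "sets P = sets (path_space S)" and Z: "integrable P Z" and J: "J \<subseteq> {0..}"
  and zero: "\<And>l. l \<in> cyl_tests J \<Longrightarrow> (\<integral>w. cylf l w * Z w \<partial>P) = 0"
  and A: "A \<in> sigma_sets (space (path_space S)) (coord_sets S J)"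
 shows "(\<integral>w. indicator A w * Z w \<partial>P) = 0"
proof -
 let ?\<Omega> = "space (path_space S)"
 have sp: "space P = ?\<Omega>" using P by (rule sets_eq_imp_space_eq)
 have sub: "sigma_sets ?\<Omega> (cyl S J) \<subseteq> sets P"
  unfolding sigma_sets_cyl P using J by (intro sets.sigma_sets_subset coord_sets_subset)
 have cm: "cylf l \<in> borel_measurable P" if "l \<in> cyl_tests J" for l
  using cylf_measurable[OF that, of P] measurable_path_space_coord J measurable_cong_sets[OF P refl] by blast
 have [measurable]: "Z \<in> borel_measurable P" using Z by auto
 have cylP: "cyl S J \<subseteq> Pow ?\<Omega>" by (auto simp: cyl_def)
 from A have "A \<in> sigma_sets ?\<Omega> (cyl S J)" by (simp add: sigma_sets_cyl)
 then show ?thesis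
 proof (induct rule: sigma_sets_induct_disjoint[OF Int_stable_cyl cylP, consumes 1, case_names basic empty compl union])
  case (basic X)
  then obtain ln where ln: "\<And>n::nat. ln n \<in> cyl_tests J" "\<And>w. w \<in> ?\<Omega> \<Longrightarrow> (\<lambda>n. cylf (ln n) w) \<longlonglongrightarrow> indicator X w"
   using cyl_approx by blast
  have [measurable]: "X \<in> sets P" using basic sub by (auto intro: sigma_sets.Basic)
  have [measurable]: "cylf (ln n) \<in> borel_measurable P" for n using cm ln by auto
  have "(\<lambda>n. \<integral>w. cylf (ln n) w * Z w \<partial>P) \<longlonglongrightarrow> (\<integral>w. indicator X w * Z w \<partial>P)"
  proof (rule integral_dominated_convergence)
   show "integrable P (\<lambda>w. norm (Z w))" using Z by simp
   show "AE w in P. (\<lambda>n. cylf (ln n) w * Z w) \<longlonglongrightarrow> indicator X w * Z w"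
    using ln(2) by (intro AE_I2 tendsto_mult tendsto_const) (simp add: sp)
   show "AE w in P. norm (cylf (ln n) w * Z w) \<le> norm (Z w)" for n
    using cylf_range[OF ln(1)[of n]] by (intro AE_I2) (simp add: abs_mult mult_left_le_one_le)
  qed measurable
  then show ?case by (simp add: zero[OF ln(1)] LIMSEQ_const_iff)
 next
  case empty
  then show ?case by simp
 next
  case (compl X)
  have [measurable]: "X \<in> sets P" using compl sub by auto
  have "(\<integral>w. Z w \<partial>P) = 0" using zero[of "[]"] by (simp add: cyl_tests_def)
  moreover have "(\<integral>w. indicator (?\<Omega> - X) w * Z w \<partial>P) = (\<integral>w. Z w - indicator X w * Z w \<partial>P)"
   by (intro Bochner_Integration.integral_cong refl) (auto simp: indicator_def sp)
  moreover have "\<dots> = (\<integral>w. Z w \<partial>P) - (\<integral>w. indicator X w * Z w \<partial>P)"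
   using Z by (intro Bochner_Integration.integral_diff integrable_real_mult_indicator) (auto simp: mult.commute intro!: integrable_real_mult_indicator)
  ultimately show ?case using compl by simp
 next
  case (union X)
  then have X[measurable]: "X i \<in> sets P" for i using sub by auto
  have "set_integrable P (\<Union>i. X i) Z"
   unfolding set_integrable_def using integrable_mult_indicator[OF _ Z, of "\<Union>i. X i"] by auto
  from lebesgue_integral_countable_add[OF X _ this] union(1)
  have "(LINT w:(\<Union>i. X i)|P. Z w) = (\<Sum>i. (LINT w:(X i)|P. Z w))"
   by (auto simp: disjoint_family_on_def)
  then show ?case using union by (simp add: set_lebesgue_integral_def)
 qed
qed

lemma path_measure_eqI:
 fixes S :: "'a::metric_space set"
 assumes P: "prob_space P" "sets P = sets (path_space S)" and Q: "prob_space Q" "sets Q = sets (path_space S)"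
  and eq: "\<And>l. l \<in> cyl_tests {0..} \<Longrightarrow> (\<integral>w. cylf l w \<partial>P) = (\<integral>w. cylf l w \<partial>Q)"
 shows "P = Q"
proof -
 let ?\<Omega> = "space (path_space S)"
 interpret P: prob_space P by fact
 interpret Q: prob_space Q by fact
 have sp: "space P = ?\<Omega>" "space Q = ?\<Omega>" using P Q by (auto dest: sets_eq_imp_space_eq)
 have cylP: "cyl S {0..} \<subseteq> Pow ?\<Omega>" by (auto simp: cyl_def)
 have sub: "cyl S {0..} \<subseteq> sets (path_space S)"
  unfolding sets_path_space sigma_sets_cyl[symmetric] by (auto intro: sigma_sets.Basic)
 have lim: "(\<lambda>n. \<integral>w. cylf (ln n) w \<partial>R) \<longlonglongrightarrow> measure R X"
  if R: "prob_space R" "sets R = sets (path_space S)" and X: "X \<in> cyl S {0..}"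
   and ln: "\<And>n::nat. ln n \<in> cyl_tests {0..}" "\<And>w. w \<in> ?\<Omega> \<Longrightarrow> (\<lambda>n. cylf (ln n) w) \<longlonglongrightarrow> indicator X w" for R X ln
 proof -
  interpret prob_space R by fact
  have sR: "space R = ?\<Omega>" using R by (auto dest: sets_eq_imp_space_eq)
  have [measurable]: "X \<in> sets R" using X sub R by auto
  have [measurable]: "cylf (ln n) \<in> borel_measurable R" for n
   using cylf_measurable[OF ln(1), of "path_space S"] measurable_path_space_coord measurable_cong_sets[OF R(2) refl] by auto
  have "(\<lambda>n. \<integral>w. cylf (ln n) w \<partial>R) \<longlonglongrightarrow> (\<integral>w. indicator X w \<partial>R)"
   by (rule integral_dominated_convergence[where w="\<lambda>_. 1"])
    (use ln cylf_range[OF ln(1)] in \<open>auto simp: sR\<close>)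
  then show ?thesis by simp
 qed
 show ?thesis
 proof (rule measure_eqI_generator_eq[OF Int_stable_cyl cylP, where A="\<lambda>_. ?\<Omega>"])
  fix X assume X: "X \<in> cyl S {0..}"
  then obtain ln where ln: "\<And>n::nat. ln n \<in> cyl_tests {0..}" "\<And>w. w \<in> ?\<Omega> \<Longrightarrow> (\<lambda>n. cylf (ln n) w) \<longlonglongrightarrow> indicator X w"
   using cyl_approx by blast
  have "measure P X = measure Q X"
   using LIMSEQ_unique[OF lim[OF P X ln]] lim[OF Q X ln] eq[OF ln(1)] by simp
  then show "emeasure P X = emeasure Q X" by (simp add: P.emeasure_eq_measure Q.emeasure_eq_measure)
 next
  show "sets P = sigma_sets ?\<Omega> (cyl S {0..})" "sets Q = sigma_sets ?\<Omega> (cyl S {0..})"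
   using P Q by (auto simp: sigma_sets_cyl sets_path_space)
  show "range (\<lambda>_. ?\<Omega>) \<subseteq> cyl S {0..}" unfolding cyl_def by (auto intro!: exI[of _ "[]"])
 qed (auto simp: sp P.emeasure_space_1[unfolded sp])
qed

lemma rational_interval_bound:
 fixes g :: "real \<Rightarrow> real"
 assumes g: "continuous_on {0..1} g" and r: "\<And>q. q \<in> \<rat> \<Longrightarrow> q \<in> {0..1} \<Longrightarrow> g q \<le> r" and u: "u \<in> {0..1}"
 shows "g u \<le> r"
proof -
 define q where "q n = of_int \<lfloor>real (Suc n) * u\<rfloor> / real (Suc n)" for n
 have q: "q n \<in> \<rat>" "q n \<in> {0..1}" "u - 1 / real (Suc n) \<le> q n" "q n \<le> u" for n
 proof -
  show "q n \<in> \<rat>" unfolding q_def by auto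
  have "of_int \<lfloor>real (Suc n) * u\<rfloor> \<le> real (Suc n) * u" by linarith
  then show le: "q n \<le> u" unfolding q_def by (simp add: divide_le_eq mult.commute del: of_nat_Suc)
  have "real (Suc n) * u - 1 \<le> of_int \<lfloor>real (Suc n) * u\<rfloor>" by linarith
  then have "(real (Suc n) * u - 1) / real (Suc n) \<le> q n" unfolding q_def by (intro divide_right_mono) auto
  then show "u - 1 / real (Suc n) \<le> q n" by (simp add: diff_divide_distrib del: of_nat_Suc)
  have "0 \<le> \<lfloor>real (Suc n) * u\<rfloor>" using u by simp
  then have "0 \<le> q n" unfolding q_def by simp
  then show "q n \<in> {0..1}" using le u by auto
 qed
 have "q \<longlonglongrightarrow> u"
 proof (rule tendsto_sandwich[of "\<lambda>n. u - 1 / real (Suc n)" _ _ "\<lambda>n. u"])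
  have "(\<lambda>n. u - 1 / real (Suc n)) \<longlonglongrightarrow> u - 0" by (intro tendsto_diff tendsto_const LIMSEQ_Suc[OF lim_1_over_n])
  then show "(\<lambda>n. u - 1 / real (Suc n)) \<longlonglongrightarrow> u" by simp
 qed (use q in auto)
 then have "(\<lambda>n. g (q n)) \<longlonglongrightarrow> g u"
  using g u q(2) by (auto simp: continuous_on_sequentially comp_def)
 then show ?thesis by (rule LIMSEQ_le_const2) (use r q in auto)
qed

section \<open>Restriction of paths to a compact time interval\<close>

lemma restrict_in_cpaths:
 assumes "w \<in> space (path_space S')" "S' \<subseteq> S"
 shows "restrict w {0..L} \<in> cpaths L S"
proof -
 have "continuous_on {0..L} w"
  using assms by (auto simp: space_path_space intro: continuous_on_subset)
 then have "continuous_on {0..L} (restrict w {0..L})" by (rule continuous_on_eq) auto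
 then show ?thesis using assms by (auto simp: cpaths_def space_path_space subset_iff)
qed

lemma topspace_cpaths: "0 \<le> L \<Longrightarrow> topspace (cpaths_topology L S) = cpaths L S"
 unfolding cpaths_topology_def using Metric_space.topspace_mtopology[OF Metric_space_cpaths] by blast

lemma space_borel_of_topology: "space (borel_of_topology X) = topspace X"
 unfolding borel_of_topology_def by (rule space_measure_of) (auto dest: openin_subset)

lemma sets_borel_of_topology: "sets (borel_of_topology X) = sigma_sets (topspace X) {U. openin X U}"
 unfolding borel_of_topology_def by (rule sets_measure_of) (auto dest: openin_subset)

text \<open>The path space carries the \<sigma>-algebra of the coordinates, the target the Borel
  sets of a uniform topology. The two are reconciled by covering an open set of paths with countably
  many tubes around step functions whose values lie in the dense set.\<close>

lemma measurable_restrict_path: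
 fixes S S' :: "'a::metric_space set"
 assumes L: "L > 0" and S: "S' \<subseteq> S"
  and sep: "\<exists>D :: 'a set. countable D \<and> (\<forall>x e. e > 0 \<longrightarrow> (\<exists>y\<in>D. dist x y < e))"
 shows "(\<lambda>w. restrict w {0..L}) \<in> path_space S' \<rightarrow>\<^sub>M borel_of_topology (cpaths_topology L S)"
proof -
 let ?\<Omega> = "space (path_space S')"
 interpret ms: Metric_space "cpaths L S" "sup_dist L S" by (rule Metric_space_cpaths) (use L in simp)
 obtain D :: "'a set" where D: "countable D" "\<And>x e. e > 0 \<Longrightarrow> \<exists>y\<in>D. dist x y < e" using sep by blast
 \<comment> \<open>For \<open>q\<close> in [0, 1], \<open>tm m i q\<close> runs through the
   \<open>i\<close>-th of \<open>m\<close> equal subintervals of [0, L]; rational \<open>q\<close>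
   give countably many times that are dense in it.\<close>
 define tm where "tm m i q = (real i + q) * L / real m" for m i :: nat and q :: real
 have tm_cover: "\<exists>i<m. \<exists>q\<in>{0..1}. t = tm m i q" if "t \<in> {0..L}" "m > 0" for t m
 proof -
  let ?x = "t * real m / L"
  have x: "0 \<le> ?x" "?x \<le> real m" using that L by (auto simp: divide_le_eq)
  have t: "t = ?x * L / real m" using that L by simp
  show ?thesis
  proof (cases "?x = real m")
   case True
   have "t = tm m (m - 1) 1" using t that by (simp add: tm_def True of_nat_diff)
   then show ?thesis using that by (intro exI[of _ "m - 1"]) auto
  next
   case False
   define i where "i = nat \<lfloor>?x\<rfloor>"
   have i: "real i \<le> ?x" "?x \<le> real i + 1" using x by (auto simp: i_def)
   have "real i < real m" using i x False by linarith
   moreover have "t = tm m i (?x - real i)" using t by (simp add: tm_def)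
   moreover have "?x - real i \<in> {0..1}" using i by auto
   ultimately show ?thesis by (intro exI[of _ i]) auto
  qed
 qed
 have tm_in: "tm m i q \<in> {0..L}" if "i < m" "q \<in> {0..1}" for m i q
 proof -
  have "real i + 1 \<le> real m" using that by (simp add: nat_less_real_le)
  then have "(real i + q) * L \<le> real m * L" using that L by (intro mult_right_mono) auto
  then show ?thesis using that L by (auto simp: tm_def divide_le_eq mult.commute)
 qed
 \<comment> \<open>The tube of paths that stay within \<open>1 / (k + 1)\<close> of
   \<open>c ! i\<close> on the \<open>i\<close>-th subinterval. Rational \<open>q\<close> keep it a
   countable intersection, and by continuity the bound extends to all \<open>q\<close>.\<close>
 define C where "C m c k = {w \<in> ?\<Omega>. \<forall>i<m. \<forall>q\<in>\<rat> \<inter> {0..1}. dist (w (tm m i q)) (c ! i) \<le> 1 / real (Suc k)}"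
  for m :: nat and c :: "'a list" and k :: nat
 have C_meas: "C m c k \<in> sets (path_space S')" for m c k
 proof -
  have cnt: "countable (\<rat> \<inter> {0..1::real})" by (rule countable_subset[OF _ countable_rat]) auto
  have "{w \<in> ?\<Omega>. dist (w (tm m i q)) (c ! i) \<le> 1 / real (Suc k)} \<in> sets (path_space S')"
   if "i < m" "q \<in> {0..1}" for i q
  proof -
   have m: "(\<lambda>w. w (tm m i q)) \<in> borel_measurable (path_space S')"
    using tm_in[OF that] by (intro measurable_path_space_coord) auto
   have "(\<lambda>x. dist x (c ! i)) \<in> borel_measurable borel"
    by (intro borel_measurable_continuous_onI continuous_intros)
   from measurable_compose[OF m this] have [measurable]: "(\<lambda>w. dist (w (tm m i q)) (c ! i)) \<in> borel_measurable (path_space S')" .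
   show ?thesis by measurable
  qed
  then have cm: "{w \<in> ?\<Omega>. \<forall>q\<in>\<rat> \<inter> {0..1}. dist (w (tm m i q)) (c ! i) \<le> 1 / real (Suc k)} \<in> sets (path_space S')"
   if "i < m" for i using that by (intro sets.sets_Collect_countable_All' cnt) auto
  have "{w \<in> ?\<Omega>. \<forall>i\<in>{..<m}. \<forall>q\<in>\<rat> \<inter> {0..1}. dist (w (tm m i q)) (c ! i) \<le> 1 / real (Suc k)} \<in> sets (path_space S')"
   by (rule sets.sets_Collect_countable_All') (use cm in auto)
  then show ?thesis by (simp only: C_def Ball_def lessThan_iff)
 qed
 have C_full: "dist (w (tm m i q)) (c ! i) \<le> 1 / real (Suc k)" if w: "w \<in> C m c k" and i: "i < m" and q: "q \<in> {0..1}" for w m c k i q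
 proof (rule rational_interval_bound[OF _ _ q])
  have "continuous_on {0..} w" using w by (auto simp: C_def space_path_space)
  moreover have "continuous_on {0..1} (\<lambda>q. tm m i q)" unfolding tm_def using i by (intro continuous_intros) auto
  moreover have "(\<lambda>q. tm m i q) ` {0..1} \<subseteq> {0..}" using tm_in[OF i] by auto
  ultimately have "continuous_on {0..1} (\<lambda>q. w (tm m i q))" using continuous_on_compose2[of "{0..}" w] by blast
  then show "continuous_on {0..1} (\<lambda>q. dist (w (tm m i q)) (c ! i))" by (intro continuous_intros)
 qed (use w i in \<open>auto simp: C_def\<close>)
 have C_close: "sup_dist L S (restrict w {0..L}) (restrict w' {0..L}) \<le> 2 / real (Suc k)"
  if w: "w \<in> C m c k" "w' \<in> C m c k" and m: "m > 0" for w w' m c k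
 proof -
  have sp: "w \<in> ?\<Omega>" "w' \<in> ?\<Omega>" using w by (auto simp: C_def)
  note r = restrict_in_cpaths[OF sp(1) S, of L] restrict_in_cpaths[OF sp(2) S, of L]
  have "(SUP t\<in>{0..L}. dist (restrict w {0..L} t) (restrict w' {0..L} t)) \<le> 2 / real (Suc k)"
  proof (rule cSUP_least)
   show "{0..L} \<noteq> {}" using L by auto
   fix t assume t: "t \<in> {0..L}"
   obtain i q where iq: "i < m" "q \<in> {0..1}" "t = tm m i q" using tm_cover[OF t m] by auto
   have "dist (w t) (w' t) \<le> dist (w t) (c ! i) + dist (w' t) (c ! i)" by (rule dist_triangle2)
   also have "\<dots> \<le> 1 / real (Suc k) + 1 / real (Suc k)"
    using C_full[OF w(1) iq(1,2)] C_full[OF w(2) iq(1,2)] unfolding iq(3) by (rule add_mono)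
   finally show "dist (restrict w {0..L} t) (restrict w' {0..L} t) \<le> 2 / real (Suc k)" using t by simp
  qed
  then show ?thesis using r by (simp add: sup_dist_def)
 qed
 have C_ex: "\<exists>m>0. \<exists>c\<in>lists D. w \<in> C m c k" if w: "w \<in> ?\<Omega>" for w k
 proof -
  \<comment> \<open>Half of the tube radius: one half for the oscillation of the path on a
    subinterval, one half for the distance to the dense set.\<close>
  define e where "e = 1 / (2 * real (Suc k))"
  have e: "e > 0" by (simp add: e_def)
  have "continuous_on {0..L} w" using w by (auto simp: space_path_space intro: continuous_on_subset)
  then have "uniformly_continuous_on {0..L} w" by (rule compact_uniformly_continuous) simp
  then obtain \<delta> where \<delta>: "\<delta> > 0" "\<And>s t. s \<in> {0..L} \<Longrightarrow> t \<in> {0..L} \<Longrightarrow> dist s t < \<delta> \<Longrightarrow> dist (w s) (w t) < e"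
   using e unfolding uniformly_continuous_on_def by metis
  obtain m :: nat where m: "L / \<delta> < real m" using reals_Archimedean2 by blast
  have m0: "m > 0" using m L \<delta> by (metis divide_pos_pos less_trans of_nat_0_less_iff)
  have Lm: "L / real m < \<delta>" using m m0 \<delta> by (simp add: divide_less_eq mult.commute)
  define c where "c = map (\<lambda>i. SOME y. y \<in> D \<and> dist (w (tm m i 0)) y < e) [0..<m]"
  have c: "c ! i \<in> D \<and> dist (w (tm m i 0)) (c ! i) < e" if "i < m" for i
  proof -
   have "\<exists>y. y \<in> D \<and> dist (w (tm m i 0)) y < e" using D(2)[OF e] by blast
   from someI_ex[OF this] show ?thesis using that by (simp add: c_def)
  qed
  have "length c = m" by (simp add: c_def)
  then have "c \<in> lists D" using c by (auto simp: in_set_conv_nth)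
  moreover have "w \<in> C m c k"
   unfolding C_def
  proof (intro CollectI conjI w allI impI ballI)
   fix i q assume i: "i < m" and "q \<in> \<rat> \<inter> {0..1::real}"
   then have q: "q \<in> {0..1}" by auto
   have "tm m i q - tm m i 0 = q * (L / real m)" by (simp add: tm_def add_divide_distrib distrib_right)
   moreover have "\<bar>q * (L / real m)\<bar> \<le> 1 * (L / real m)"
    using q L unfolding abs_mult by (intro mult_mono) auto
   ultimately have "dist (tm m i q) (tm m i 0) < \<delta>" using Lm by (simp add: dist_real_def)
   then have "dist (w (tm m i q)) (w (tm m i 0)) < e"
    using \<delta>(2) tm_in[OF i q] tm_in[OF i, of 0] by auto
   have ee: "e + e = 1 / real (Suc k)" by (simp add: e_def field_simps)
   have "dist (w (tm m i q)) (c ! i) \<le> e + e" using \<open>dist (w (tm m i q)) (w (tm m i 0)) < e\<close>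
    using c[OF i] dist_triangle[of "w (tm m i q)" "c ! i" "w (tm m i 0)"] by linarith
   then show "dist (w (tm m i q)) (c ! i) \<le> 1 / real (Suc k)" unfolding ee .
  qed
  ultimately show ?thesis using m0 by blast
 qed
 show ?thesis
  unfolding borel_of_topology_def
 proof (rule measurable_measure_of)
  show "{U. openin (cpaths_topology L S) U} \<subseteq> Pow (topspace (cpaths_topology L S))"
   by (auto dest: openin_subset)
  show "(\<lambda>w. restrict w {0..L}) \<in> ?\<Omega> \<rightarrow> topspace (cpaths_topology L S)"
   using restrict_in_cpaths[OF _ S] L by (auto simp: topspace_cpaths)
  fix U assume "U \<in> {U. openin (cpaths_topology L S) U}"
  then have U: "openin ms.mtopology U" by (simp add: cpaths_topology_def)
  \<comment> \<open>The tubes whose restrictions lie in \<open>U\<close>. Two paths in one tube are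
    at distance at most \<open>2 / (k + 1)\<close>, so around each path in the preimage a thin
    enough tube is of this kind.\<close>
  define I where "I = {(m, c, k). m > 0 \<and> c \<in> lists D \<and> C m c k \<subseteq> (\<lambda>w. restrict w {0..L}) -` U}"
  have "I \<subseteq> UNIV \<times> lists D \<times> UNIV" by (auto simp: I_def)
  then have cI: "countable I" by (rule countable_subset) (intro countable_SIGMA countable_lists D, auto)
  have "(\<lambda>w. restrict w {0..L}) -` U \<inter> ?\<Omega> = (\<Union>(m, c, k)\<in>I. C m c k)"
  proof (intro equalityI subsetI)
   fix w assume w: "w \<in> (\<lambda>w. restrict w {0..L}) -` U \<inter> ?\<Omega>"
   then obtain r where r: "r > 0" "ms.mball (restrict w {0..L}) r \<subseteq> U"
    using U unfolding ms.openin_mtopology by auto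
   obtain k :: nat where k: "2 / r < real k" using reals_Archimedean2 by blast
   then have "2 / r < real (Suc k)" by simp
   then have "2 < real (Suc k) * r" using r(1) by (simp add: pos_divide_less_eq)
   then have "2 / real (Suc k) < r" by (simp add: pos_divide_less_eq mult.commute del: of_nat_Suc)
   obtain m c where mc: "m > 0" "c \<in> lists D" "w \<in> C m c k" using C_ex[of w k] w by auto
   have "C m c k \<subseteq> (\<lambda>w. restrict w {0..L}) -` U"
   proof
    fix w' assume w': "w' \<in> C m c k"
    have "sup_dist L S (restrict w {0..L}) (restrict w' {0..L}) < r"
     using C_close[OF mc(3) w' mc(1)] \<open>2 / real (Suc k) < r\<close> by linarith
    moreover have "w' \<in> ?\<Omega>" using w' by (auto simp: C_def)
    ultimately have "restrict w' {0..L} \<in> ms.mball (restrict w {0..L}) r"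
     using w restrict_in_cpaths[OF _ S, of _ L] by (auto simp: ms.in_mball)
    then show "w' \<in> (\<lambda>w. restrict w {0..L}) -` U" using r by auto
   qed
   then have "(m, c, k) \<in> I" using mc by (auto simp: I_def)
   then show "w \<in> (\<Union>(m, c, k)\<in>I. C m c k)" using mc by blast
  next
   fix w assume "w \<in> (\<Union>(m, c, k)\<in>I. C m c k)"
   then obtain m c k where "(m, c, k) \<in> I" "w \<in> C m c k" by auto
   then show "w \<in> (\<lambda>w. restrict w {0..L}) -` U \<inter> ?\<Omega>" by (auto simp: I_def C_def)
  qed
  also have "\<dots> \<in> sets (path_space S')"
   by (rule sets.countable_UN'[OF cI]) (auto intro: C_meas)
  finally show "(\<lambda>w. restrict w {0..L}) -` U \<inter> ?\<Omega> \<in> sets (path_space S')" .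
 qed
qed

section \<open>Generators and test functions\<close>

text \<open>
 The letters \<open>(j, True)\<close> and \<open>(j, False)\<close> stand for \<open>T\<^sub>j\<close> and its complex conjugate.
\<close>

definition dirsum :: "('n::finite \<times> bool \<Rightarrow> complex) \<Rightarrow> (complex, 'n) vec \<Rightarrow> complex" where
 "dirsum p u = (\<Sum>j\<in>UNIV. u $ j * p (j, True) + cnj (u $ j) * p (j, False))"

text \<open>A directional derivative whose Wirtinger components are supplied as data
  \<open>D\<close>. Derivatives are then computed by rules for sums, products and compositions, and
  are linked to \<open>dT\<close> and \<open>dTbar\<close> through \<open>Dc_prod\<close>.\<close>

definition wd :: "((complex, 'n::finite) vec \<Rightarrow> complex) \<Rightarrow> ('n \<times> bool \<Rightarrow> (complex, 'n) vec \<Rightarrow> complex) \<Rightarrow> bool" where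
 "wd F D \<longleftrightarrow> (\<forall>T u. ((\<lambda>t::real. F (T + t *\<^sub>R u)) has_vector_derivative dirsum (\<lambda>c. D c T) u) (at 0))"

definition Dc :: "'n::finite \<times> bool \<Rightarrow> ('n state \<Rightarrow> complex) \<Rightarrow> 'n state \<Rightarrow> complex" where
 "Dc c = (if snd c then dT (fst c) else dTbar (fst c))"

definition Zc :: "'n::finite \<times> bool \<Rightarrow> (complex, 'n) vec \<Rightarrow> complex" where
 "Zc c T = (if snd c then T $ fst c else cnj (T $ fst c))"

text \<open>In \<open>D2 c e\<close> the derivative in the letter \<open>c\<close> is taken first
  and the one in \<open>e\<close> second.\<close>

definition C2 where
 "C2 F D1 D2 \<longleftrightarrow> wd F D1 \<and> (\<forall>c. wd (D1 c) (D2 c)) \<and> continuous_on UNIV F \<and>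
   (\<forall>c. continuous_on UNIV (D1 c)) \<and> (\<forall>c e. continuous_on UNIV (D2 c e))"

lemma dirsum_axis:
 "dirsum p (axis j 1) = p (j, True) + p (j, False)"
 "dirsum p (axis j \<i>) = \<i> * p (j, True) - \<i> * p (j, False)"
proof -
 have *: "dirsum p (axis j x) = x * p (j, True) + cnj x * p (j, False)" for x
 proof -
  have "dirsum p (axis j x) = (\<Sum>i\<in>UNIV. if i = j then x * p (i, True) + cnj x * p (i, False) else 0)"
   unfolding dirsum_def by (intro sum.cong refl) (auto simp: axis_def)
  then show ?thesis by simp
 qed
 show "dirsum p (axis j 1) = p (j, True) + p (j, False)"
 "dirsum p (axis j \<i>) = \<i> * p (j, True) - \<i> * p (j, False)" by (simp_all add: *)
qed

lemma wdD: "wd F D \<Longrightarrow> ((\<lambda>t::real. F (T + t *\<^sub>R u)) has_vector_derivative dirsum (\<lambda>c. D c T) u) (at 0)"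
 by (simp add: wd_def)

lemma disc_deriv_prod:
 assumes "wd F D"
 shows "((\<lambda>t::real. (\<lambda>x. F (fst x) * h (snd x)) (x + t *\<^sub>R (u, 0))) has_vector_derivative dirsum (\<lambda>c. D c (fst x)) u * h (snd x)) (at 0)"
 and "disc_deriv u (\<lambda>x. F (fst x) * h (snd x)) x = dirsum (\<lambda>c. D c (fst x)) u * h (snd x)"
proof -
 show *: "((\<lambda>t::real. (\<lambda>x. F (fst x) * h (snd x)) (x + t *\<^sub>R (u, 0))) has_vector_derivative dirsum (\<lambda>c. D c (fst x)) u * h (snd x)) (at 0)"
  using has_vector_derivative_mult_left[OF wdD[OF assms, of "fst x" u], of "h (snd x)"] by simp
 show "disc_deriv u (\<lambda>x. F (fst x) * h (snd x)) x = dirsum (\<lambda>c. D c (fst x)) u * h (snd x)"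
  unfolding disc_deriv_def by (rule vector_derivative_at[OF *])
qed

lemma Dc_prod:
 assumes "wd F D"
 shows "Dc c (\<lambda>x. F (fst x) * h (snd x)) = (\<lambda>x. D c (fst x) * h (snd x))"
proof
 fix x
 show "Dc c (\<lambda>x. F (fst x) * h (snd x)) x = D c (fst x) * h (snd x)"
  by (cases c, case_tac b) (simp_all add: Dc_def dT_def dTbar_def disc_deriv_prod(2)[OF assms] dirsum_axis algebra_simps)
qed

lemma disc_deriv_vanish:
 assumes "\<And>x. norm (fst x) > R \<Longrightarrow> f x = 0" and x: "norm (fst x) > R"
 shows "disc_deriv u f x = 0"
proof -
 let ?S = "{t::real. norm (fst x + t *\<^sub>R u) > R}"
 have S: "open ?S" by (intro open_Collect_less continuous_intros)
 have "((\<lambda>t::real. 0) has_vector_derivative 0) (at 0)" by simp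
 then have "((\<lambda>t::real. f (x + t *\<^sub>R (u, 0))) has_vector_derivative 0) (at 0)"
  by (rule has_vector_derivative_transform_within_open[OF _ S]) (use x assms(1) in auto)
 then show ?thesis unfolding disc_deriv_def by (rule vector_derivative_at)
qed

lemma continuous_vanish_bounded:
 fixes F :: "(complex, 'n::finite) vec \<Rightarrow> complex"
 assumes "continuous_on UNIV F" "\<And>T. norm T > R \<Longrightarrow> F T = 0"
 shows "bounded (range F)"
proof -
 obtain B where B: "0 \<le> B" "\<And>T. T \<in> cball 0 R \<Longrightarrow> norm (F T) \<le> B"
  using continuous_on_compact_bound[OF compact_cball, of 0 R F] continuous_on_subset[OF assms(1)] by (metis subset_UNIV)
 have "norm (F T) \<le> B" for T
  using B assms(2)[of T] by (cases "norm T > R") auto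
 then show ?thesis by (auto simp: bounded_iff)
qed

lemma continuous_dirsum:
 assumes "\<And>c. continuous_on A (\<lambda>x. D c x)"
 shows "continuous_on A (\<lambda>x. dirsum (\<lambda>c. D c x) u)"
 unfolding dirsum_def by (intro continuous_intros assms)

lemma wd_dirsum:
 assumes "\<And>c. wd (D1 c) (D2 c)"
 shows "wd (\<lambda>T. dirsum (\<lambda>c. D1 c T) u) (\<lambda>e T. dirsum (\<lambda>c. D2 c e T) u)"
 unfolding wd_def
proof (intro allI)
 fix T v
 have "((\<lambda>t::real. dirsum (\<lambda>c. D1 c (T + t *\<^sub>R v)) u) has_vector_derivative
   (\<Sum>j\<in>UNIV. u $ j * dirsum (\<lambda>e. D2 (j, True) e T) v + cnj (u $ j) * dirsum (\<lambda>e. D2 (j, False) e T) v)) (at 0)"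
  unfolding dirsum_def[of _ u]
  by (intro has_vector_derivative_sum has_vector_derivative_add has_vector_derivative_mult_right wdD[OF assms])
 also have "(\<Sum>j\<in>UNIV. u $ j * dirsum (\<lambda>e. D2 (j, True) e T) v + cnj (u $ j) * dirsum (\<lambda>e. D2 (j, False) e T) v)
  = dirsum (\<lambda>e. dirsum (\<lambda>c. D2 c e T) u) v"
  unfolding dirsum_def sum_distrib_left sum.distrib[symmetric]
  by (subst sum.swap) (simp add: sum_distrib_left sum.distrib algebra_simps)
 finally show "((\<lambda>t::real. dirsum (\<lambda>c. D1 c (T + t *\<^sub>R v)) u) has_vector_derivative dirsum (\<lambda>e. dirsum (\<lambda>c. D2 c e T) u) v) (at 0)" .
qed

text \<open>The support is bounded in the finite-dimensional variable, so continuity alone bounds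
  \<open>F\<close> and its derivatives, while \<open>h\<close>, which is not cut off, has to be
  bounded itself. The test functions built explicitly below are all of this form.\<close>

lemma test_function_prod:
 fixes F :: "(complex, 'n::finite) vec \<Rightarrow> complex" and h :: "L2 \<Rightarrow> complex"
 assumes F: "C2 F D1 D2" and R: "\<And>T. norm T > R \<Longrightarrow> F T = 0"
  and h: "continuous_on UNIV h" "bounded (range h)"
 shows "(\<lambda>x. F (fst x) * h (snd x)) \<in> test_functions"
proof -
 have wF: "wd F D1" and wD: "\<And>c. wd (D1 c) (D2 c)" using F by (auto simp: C2_def)
 have cF: "continuous_on UNIV F" "\<And>c. continuous_on UNIV (D1 c)" "\<And>c e. continuous_on UNIV (D2 c e)"
  using F by (auto simp: C2_def)
 have pb: "continuous_on UNIV (\<lambda>x. G (fst x) * h (snd x)) \<and> bounded (range (\<lambda>x. G (fst x) * h (snd x)))"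
  if "continuous_on UNIV G" "\<And>T. norm T > R \<Longrightarrow> G T = 0" for G :: "(complex, 'n) vec \<Rightarrow> complex"
 proof
  show "continuous_on UNIV (\<lambda>x. G (fst x) * h (snd x))"
   by (intro continuous_intros continuous_on_compose2[OF that(1)] continuous_on_compose2[OF h(1)]) auto
  have "bounded (range G)" by (rule continuous_vanish_bounded[OF that(1)]) (rule that(2))
  then obtain B where B: "\<And>T. norm (G T) \<le> B" by (auto simp: bounded_iff)
  obtain C where C: "\<And>T. norm (h T) \<le> C" using h(2) by (auto simp: bounded_iff)
  have "norm (G (fst x) * h (snd x)) \<le> B * C" for x
   unfolding norm_mult by (intro mult_mono B C order_trans[OF norm_ge_zero B]) auto
  then show "bounded (range (\<lambda>x. G (fst x) * h (snd x)))"
   unfolding bounded_iff by (intro exI[of _ "B * C"]) auto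
 qed
 have vanish: "dirsum (\<lambda>c. D c T) u = 0" if "wd G D" "\<And>T. norm T > R \<Longrightarrow> G T = 0" "norm T > R" for G D T u
 proof -
  have "disc_deriv u (\<lambda>x. G (fst x) * 1) (T, 0) = 0"
   by (rule disc_deriv_vanish[where R=R]) (use that in auto)
  then show ?thesis using disc_deriv_prod(2)[OF that(1), of u "\<lambda>_. 1" "(T, 0)"] by simp
 qed
 have dd1: "disc_deriv u (\<lambda>x. F (fst x) * h (snd x)) = (\<lambda>x. dirsum (\<lambda>c. D1 c (fst x)) u * h (snd x))" for u
  by (rule ext) (rule disc_deriv_prod(2)[OF wF])
 have dd2: "disc_deriv v (\<lambda>x. dirsum (\<lambda>c. D1 c (fst x)) u * h (snd x))
   = (\<lambda>x. dirsum (\<lambda>e. dirsum (\<lambda>c. D2 c e (fst x)) u) v * h (snd x))" for u v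
  by (rule ext) (rule disc_deriv_prod(2)[OF wd_dirsum[OF wD]])
 have cd1: "continuous_on UNIV (\<lambda>T. dirsum (\<lambda>c. D1 c T) u)" for u
  by (rule continuous_dirsum) (rule cF(2))
 have cd2: "continuous_on UNIV (\<lambda>T. dirsum (\<lambda>e. dirsum (\<lambda>c. D2 c e T) u) v)" for u v
  by (rule continuous_dirsum, rule continuous_dirsum) (rule cF(3))
 have v1: "dirsum (\<lambda>c. D1 c T) u = 0" if "norm T > R" for T u
  using vanish[OF wF R that] .
 have v2: "dirsum (\<lambda>e. dirsum (\<lambda>c. D2 c e T) u) v = 0" if "norm T > R" for T u v
  using vanish[OF wd_dirsum[OF wD] v1 that] .
 show ?thesis
  unfolding test_functions_def mem_Collect_eq dd1 dd2
 proof (intro conjI allI)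
  show "continuous_on UNIV (\<lambda>x. F (fst x) * h (snd x))" "bounded (range (\<lambda>x. F (fst x) * h (snd x)))"
   using pb[OF cF(1) R] by auto
  show "\<exists>R. \<forall>T \<phi>. R < norm T \<longrightarrow> F (fst (T, \<phi>)) * h (snd (T, \<phi>)) = 0" using R by auto
  fix u x
  show "(\<lambda>t. F (fst (x + t *\<^sub>R (u, 0))) * h (snd (x + t *\<^sub>R (u, 0)))) differentiable at 0"
   using disc_deriv_prod(1)[OF wF] by (rule differentiableI_vector)
  show "continuous_on UNIV (\<lambda>x. dirsum (\<lambda>c. D1 c (fst x)) u * h (snd x))"
   "bounded (range (\<lambda>x. dirsum (\<lambda>c. D1 c (fst x)) u * h (snd x)))"
   using pb[OF cd1 v1] by blast+
  fix v
  show "(\<lambda>t. dirsum (\<lambda>c. D1 c (fst (x + t *\<^sub>R (v, 0)))) u * h (snd (x + t *\<^sub>R (v, 0)))) differentiable at 0"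
   using disc_deriv_prod(1)[OF wd_dirsum[OF wD]] by (rule differentiableI_vector)
  show "continuous_on UNIV (\<lambda>x. dirsum (\<lambda>e. dirsum (\<lambda>c. D2 c e (fst x)) u) v * h (snd x))"
   "bounded (range (\<lambda>x. dirsum (\<lambda>e. dirsum (\<lambda>c. D2 c e (fst x)) u) v * h (snd x)))"
   using pb[OF cd2 v2] by blast+
 qed
qed

section \<open>The generator as a function of the derivatives at a point\<close>

definition gen :: "('n::finite \<Rightarrow> 'n \<Rightarrow> real) \<Rightarrow> ('n \<Rightarrow> 'n \<Rightarrow> real) \<Rightarrow> ('n \<Rightarrow> 'n \<Rightarrow> real) \<Rightarrow>
  ('n \<Rightarrow> real) \<Rightarrow> ('n \<Rightarrow> real) \<Rightarrow> ('n \<Rightarrow> real) \<Rightarrow> ('n state \<Rightarrow> complex) \<Rightarrow> 'n state \<Rightarrow> complex" where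
 "gen Gc Gs G1 Lc Ls \<kappa> f x = L1_op Gc Gs G1 f x + L2_op Lc Ls f x + L3_op \<kappa> f x"

text \<open>The generator at a point is linear in the first derivatives \<open>p\<close> and the
  second derivatives \<open>q\<close> there. \<open>q c e\<close> stands for
  \<open>Dc e (Dc c f)\<close>, so the letters appear in the reverse of the order in which
  \<open>L1_op\<close> writes the operators.\<close>

definition jet_op :: "('n::finite \<Rightarrow> 'n \<Rightarrow> real) \<Rightarrow> ('n \<Rightarrow> 'n \<Rightarrow> real) \<Rightarrow> ('n \<Rightarrow> 'n \<Rightarrow> real) \<Rightarrow>
  ('n \<Rightarrow> real) \<Rightarrow> ('n \<Rightarrow> real) \<Rightarrow> ('n \<Rightarrow> real) \<Rightarrow>
  (complex, 'n) vec \<Rightarrow> ('n \<times> bool \<Rightarrow> complex) \<Rightarrow> ('n \<times> bool \<Rightarrow> 'n \<times> bool \<Rightarrow> complex) \<Rightarrow> complex" where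
 "jet_op Gc Gs G1 Lc Ls \<kappa> T p q =
   ((1 / 2) * (\<Sum>j\<in>UNIV. \<Sum>l\<in>UNIV - {j}. of_real (Gc j l) *
    (T $ j * cnj (T $ j) * q (l, False) (l, True) + T $ l * cnj (T $ l) * q (j, False) (j, True)
     - T $ j * T $ l * q (l, True) (j, True) - cnj (T $ j) * cnj (T $ l) * q (l, False) (j, False)))
  + (1 / 2) * (\<Sum>j\<in>UNIV. \<Sum>l\<in>UNIV. of_real (G1 j l) *
    (T $ j * cnj (T $ l) * q (l, False) (j, True) + cnj (T $ j) * T $ l * q (l, True) (j, False)
     - T $ j * T $ l * q (l, True) (j, True) - cnj (T $ j) * cnj (T $ l) * q (l, False) (j, False)))
  + (1 / 2) * (\<Sum>j\<in>UNIV. of_real (Gc j j - G1 j j) * (T $ j * p (j, True) + cnj (T $ j) * p (j, False)))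
  + (\<i> / 2) * (\<Sum>j\<in>UNIV. of_real (Gs j j) * (T $ j * p (j, True) - cnj (T $ j) * p (j, False))))
  + - (1 / 2) * (\<Sum>j\<in>UNIV.
    (of_real (Lc j) + \<i> * of_real (Ls j)) * T $ j * p (j, True)
   + (of_real (Lc j) - \<i> * of_real (Ls j)) * cnj (T $ j) * p (j, False))
  + \<i> * (\<Sum>j\<in>UNIV. of_real (\<kappa> j) * (T $ j * p (j, True) - cnj (T $ j) * p (j, False)))"

lemma gen_eq_jet_op:
 "gen Gc Gs G1 Lc Ls \<kappa> f x = jet_op Gc Gs G1 Lc Ls \<kappa> (fst x) (\<lambda>c. Dc c f x) (\<lambda>c e. Dc e (Dc c f) x)"
 by (simp add: gen_def jet_op_def L1_op_def L2_op_def L3_op_def Dc_def Let_def)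

lemma jet_op_linear:
 "jet_op Gc Gs G1 Lc Ls \<kappa> T (\<lambda>c. p c * \<alpha>) (\<lambda>c e. q c e * \<alpha>) = jet_op Gc Gs G1 Lc Ls \<kappa> T p q * \<alpha>"
 "jet_op Gc Gs G1 Lc Ls \<kappa> T (\<lambda>c. p c + p' c) (\<lambda>c e. q c e + q' c e) = jet_op Gc Gs G1 Lc Ls \<kappa> T p q + jet_op Gc Gs G1 Lc Ls \<kappa> T p' q'"
proof -
 show "jet_op Gc Gs G1 Lc Ls \<kappa> T (\<lambda>c. p c * \<alpha>) (\<lambda>c e. q c e * \<alpha>) = jet_op Gc Gs G1 Lc Ls \<kappa> T p q * \<alpha>"
  unfolding jet_op_def distrib_right sum_distrib_left sum_distrib_right
  by (simp add: sum_distrib_left algebra_simps)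
 have s1: "(\<Sum>j\<in>UNIV. \<Sum>l\<in>UNIV - {j}. of_real (Gc j l) *
    (T $ j * cnj (T $ j) * (q (l, False) (l, True) + q' (l, False) (l, True)) + T $ l * cnj (T $ l) * (q (j, False) (j, True) + q' (j, False) (j, True))
     - T $ j * T $ l * (q (l, True) (j, True) + q' (l, True) (j, True)) - cnj (T $ j) * cnj (T $ l) * (q (l, False) (j, False) + q' (l, False) (j, False))))
  = (\<Sum>j\<in>UNIV. \<Sum>l\<in>UNIV - {j}. of_real (Gc j l) *
    (T $ j * cnj (T $ j) * q (l, False) (l, True) + T $ l * cnj (T $ l) * q (j, False) (j, True)
     - T $ j * T $ l * q (l, True) (j, True) - cnj (T $ j) * cnj (T $ l) * q (l, False) (j, False)))
  + (\<Sum>j\<in>UNIV. \<Sum>l\<in>UNIV - {j}. of_real (Gc j l) *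
    (T $ j * cnj (T $ j) * q' (l, False) (l, True) + T $ l * cnj (T $ l) * q' (j, False) (j, True)
     - T $ j * T $ l * q' (l, True) (j, True) - cnj (T $ j) * cnj (T $ l) * q' (l, False) (j, False)))"
  unfolding sum.distrib[symmetric] by (intro sum.cong refl) (simp add: algebra_simps)
 have s2: "(\<Sum>j\<in>UNIV. \<Sum>l\<in>UNIV. of_real (G1 j l) *
    (T $ j * cnj (T $ l) * (q (l, False) (j, True) + q' (l, False) (j, True)) + cnj (T $ j) * T $ l * (q (l, True) (j, False) + q' (l, True) (j, False))
     - T $ j * T $ l * (q (l, True) (j, True) + q' (l, True) (j, True)) - cnj (T $ j) * cnj (T $ l) * (q (l, False) (j, False) + q' (l, False) (j, False))))
  = (\<Sum>j\<in>UNIV. \<Sum>l\<in>UNIV. of_real (G1 j l) *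
    (T $ j * cnj (T $ l) * q (l, False) (j, True) + cnj (T $ j) * T $ l * q (l, True) (j, False)
     - T $ j * T $ l * q (l, True) (j, True) - cnj (T $ j) * cnj (T $ l) * q (l, False) (j, False)))
  + (\<Sum>j\<in>UNIV. \<Sum>l\<in>UNIV. of_real (G1 j l) *
    (T $ j * cnj (T $ l) * q' (l, False) (j, True) + cnj (T $ j) * T $ l * q' (l, True) (j, False)
     - T $ j * T $ l * q' (l, True) (j, True) - cnj (T $ j) * cnj (T $ l) * q' (l, False) (j, False)))"
  unfolding sum.distrib[symmetric] by (intro sum.cong refl) (simp add: algebra_simps)
 have s3: "(\<Sum>j\<in>UNIV. a j * (T $ j * (p (j, True) + p' (j, True)) + cnj (T $ j) * (p (j, False) + p' (j, False))))
  = (\<Sum>j\<in>UNIV. a j * (T $ j * p (j, True) + cnj (T $ j) * p (j, False))) + (\<Sum>j\<in>UNIV. a j * (T $ j * p' (j, True) + cnj (T $ j) * p' (j, False)))" for a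
  unfolding sum.distrib[symmetric] by (intro sum.cong refl) (simp add: algebra_simps)
 have s4: "(\<Sum>j\<in>UNIV. a j * (T $ j * (p (j, True) + p' (j, True)) - cnj (T $ j) * (p (j, False) + p' (j, False))))
  = (\<Sum>j\<in>UNIV. a j * (T $ j * p (j, True) - cnj (T $ j) * p (j, False))) + (\<Sum>j\<in>UNIV. a j * (T $ j * p' (j, True) - cnj (T $ j) * p' (j, False)))" for a
  unfolding sum.distrib[symmetric] by (intro sum.cong refl) (simp add: algebra_simps)
 have s5: "(\<Sum>j\<in>UNIV. a j * T $ j * (p (j, True) + p' (j, True)) + b j * cnj (T $ j) * (p (j, False) + p' (j, False)))
  = (\<Sum>j\<in>UNIV. a j * T $ j * p (j, True) + b j * cnj (T $ j) * p (j, False)) + (\<Sum>j\<in>UNIV. a j * T $ j * p' (j, True) + b j * cnj (T $ j) * p' (j, False))" for a b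
  unfolding sum.distrib[symmetric] by (intro sum.cong refl) (simp add: algebra_simps)
 show "jet_op Gc Gs G1 Lc Ls \<kappa> T (\<lambda>c. p c + p' c) (\<lambda>c e. q c e + q' c e) = jet_op Gc Gs G1 Lc Ls \<kappa> T p q + jet_op Gc Gs G1 Lc Ls \<kappa> T p' q'"
  unfolding jet_op_def s1 s2 s3 s4 s5 by (simp only: distrib_left add_ac)
qed

lemma gen_prod:
 assumes F: "C2 F D1 D2"
 shows "gen Gc Gs G1 Lc Ls \<kappa> (\<lambda>x. F (fst x) * h (snd x)) x
  = jet_op Gc Gs G1 Lc Ls \<kappa> (fst x) (\<lambda>c. D1 c (fst x)) (\<lambda>c e. D2 c e (fst x)) * h (snd x)"
proof -
 have wF: "wd F D1" and wD: "\<And>c. wd (D1 c) (D2 c)" using F by (auto simp: C2_def)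
 show ?thesis unfolding gen_eq_jet_op Dc_prod[OF wF] Dc_prod[OF wD] jet_op_linear ..
qed

lemma jet_op_tendsto:
 assumes "\<And>j. ((\<lambda>n. Lc n j) \<longlongrightarrow> Lc0 j) F" "\<And>j. ((\<lambda>n. Ls n j) \<longlongrightarrow> Ls0 j) F" "\<And>j. ((\<lambda>n. \<kappa> n j) \<longlongrightarrow> \<kappa>0 j) F"
  and "((\<lambda>n. T n) \<longlongrightarrow> T0) F" "\<And>c. ((\<lambda>n. p n c) \<longlongrightarrow> p0 c) F" "\<And>c e. ((\<lambda>n. q n c e) \<longlongrightarrow> q0 c e) F"
 shows "((\<lambda>n. jet_op Gc Gs G1 (Lc n) (Ls n) (\<kappa> n) (T n) (p n) (q n)) \<longlongrightarrow> jet_op Gc Gs G1 Lc0 Ls0 \<kappa>0 T0 p0 q0) F"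
 unfolding jet_op_def by (intro tendsto_intros assms)

lemma norm_diff_sum_le: "norm (\<Sum>j\<in>(A::'n::finite set). f j) \<le> real CARD('n) * K" if "\<And>j. norm (f j :: complex) \<le> K" "0 \<le> K"
proof -
 have "norm (\<Sum>j\<in>A. f j) \<le> (\<Sum>j\<in>A. K)" by (rule order_trans[OF norm_sum sum_mono]) (use that in auto)
 also have "\<dots> \<le> (\<Sum>j\<in>(UNIV :: 'n set). K)" by (rule sum_mono2) (use that in auto)
 finally show ?thesis by simp
qed

text \<open>Each of the two double sums gives 2 N^2 r^2; the first order terms give 2 + 1 + 2 + 2 =
  7 times N r, rounded up to 8. Proportionality to the coefficient bound \<open>B\<close> makes the
  later estimates uniform in \<xi>.\<close>

lemma jet_op_bound:
 fixes Gc Gs G1 :: "'n::finite \<Rightarrow> 'n \<Rightarrow> real"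
 assumes B: "\<And>j l. \<bar>Gc j l\<bar> \<le> B" "\<And>j l. \<bar>Gs j l\<bar> \<le> B" "\<And>j l. \<bar>G1 j l\<bar> \<le> B"
   "\<And>j. \<bar>Lc j\<bar> \<le> B" "\<And>j. \<bar>Ls j\<bar> \<le> B" "\<And>j. \<bar>\<kappa> j\<bar> \<le> B"
  and T: "norm T \<le> r" and p: "\<And>c. norm (p c) \<le> M" and q: "\<And>c e. norm (q c e) \<le> M"
 shows "norm (jet_op Gc Gs G1 Lc Ls \<kappa> T p q) \<le> (4 * (real CARD('n))\<^sup>2 * r\<^sup>2 + 8 * real CARD('n) * r) * B * M"
proof -
 let ?N = "real CARD('n)"
 have B0: "0 \<le> B" using B(4)[of undefined] by linarith
 have M0: "0 \<le> M" using p[of undefined] norm_ge_zero order_trans by blast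
 have r0: "0 \<le> r" using T norm_ge_zero order_trans by blast
 have Tj: "norm (T $ j) \<le> r" for j using Finite_Cartesian_Product.norm_nth_le[of T j] T by linarith
 have Tc: "norm (cnj (T $ j)) \<le> r" for j using Tj[of j] by simp
 have q3: "norm (a * b * z) \<le> r * r * M" if "norm a \<le> r" "norm b \<le> r" "norm z \<le> M" for a b z :: complex
  unfolding norm_mult using that r0 M0 by (intro mult_mono) auto
 have q2: "norm (a * z) \<le> r * M" if "norm a \<le> r" "norm z \<le> M" for a z :: complex
  unfolding norm_mult using that r0 M0 by (intro mult_mono) auto
 have four: "norm (x + y - z - w) \<le> 4 * K" if "norm x \<le> K" "norm y \<le> K" "norm z \<le> K" "norm w \<le> K" for x y z w :: complex and K
  using norm_triangle_ineq4[of "x + y - z" w] norm_triangle_ineq4[of "x + y" z] norm_triangle_ineq[of x y] that by linarith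
 have two: "norm (x + y) \<le> 2 * K" "norm (x - y) \<le> 2 * K" if "norm x \<le> K" "norm y \<le> K" for x y :: complex and K
  using norm_triangle_ineq4[of x y] norm_triangle_ineq[of x y] that by linarith+
 have cf: "norm (of_real c * z) \<le> D * K" if "\<bar>c\<bar> \<le> D" "norm z \<le> K" for c D K and z :: complex
  unfolding norm_mult norm_of_real using that by (intro mult_mono) (auto intro: order_trans[OF abs_ge_zero])
 have t1: "norm ((1 / 2) * (\<Sum>j\<in>UNIV. \<Sum>l\<in>UNIV - {j}. of_real (Gc j l) *
    (T $ j * cnj (T $ j) * q (l, False) (l, True) + T $ l * cnj (T $ l) * q (j, False) (j, True)
     - T $ j * T $ l * q (l, True) (j, True) - cnj (T $ j) * cnj (T $ l) * q (l, False) (j, False)))) \<le> (1/2) * (?N * (?N * (B * (4 * (r * r * M)))))"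
  unfolding norm_mult[of "1/2"]
  by (intro mult_mono norm_diff_sum_le cf B four q3 Tj Tc q) (use B0 M0 r0 in auto)
 have t2: "norm ((1 / 2) * (\<Sum>j\<in>UNIV. \<Sum>l\<in>UNIV. of_real (G1 j l) *
    (T $ j * cnj (T $ l) * q (l, False) (j, True) + cnj (T $ j) * T $ l * q (l, True) (j, False)
     - T $ j * T $ l * q (l, True) (j, True) - cnj (T $ j) * cnj (T $ l) * q (l, False) (j, False)))) \<le> (1/2) * (?N * (?N * (B * (4 * (r * r * M)))))"
  unfolding norm_mult[of "1/2"]
  by (intro mult_mono norm_diff_sum_le cf B four q3 Tj Tc q) (use B0 M0 r0 in auto)
 have G: "\<bar>Gc j j - G1 j j\<bar> \<le> 2 * B" for j using B(1)[of j j] B(3)[of j j] by linarith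
 have t3: "norm ((1 / 2) * (\<Sum>j\<in>UNIV. of_real (Gc j j - G1 j j) * (T $ j * p (j, True) + cnj (T $ j) * p (j, False)))) \<le> (1/2) * (?N * ((2 * B) * (2 * (r * M))))"
  unfolding norm_mult[of "1/2"]
  by (intro mult_mono norm_diff_sum_le cf G two q2 Tj Tc p) (use B0 M0 r0 in auto)
 have t4: "norm ((\<i> / 2) * (\<Sum>j\<in>UNIV. of_real (Gs j j) * (T $ j * p (j, True) - cnj (T $ j) * p (j, False)))) \<le> (1/2) * (?N * (B * (2 * (r * M))))"
  unfolding norm_mult[of "\<i>/2"]
  by (intro mult_mono norm_diff_sum_le cf B two q2 Tj Tc p) (use B0 M0 r0 in \<open>auto simp: norm_divide\<close>)
 have L: "norm (complex_of_real (Lc j) + \<i> * of_real (Ls j)) \<le> 2 * B" "norm (complex_of_real (Lc j) - \<i> * of_real (Ls j)) \<le> 2 * B" for j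
  using two[of "complex_of_real (Lc j)" B "\<i> * of_real (Ls j)"] B(4)[of j] B(5)[of j] by (simp_all add: norm_mult)
 have l3: "norm (a * b * z) \<le> (2 * B) * (r * M)" if "norm a \<le> 2 * B" "norm b \<le> r" "norm z \<le> M" for a b z :: complex
  unfolding norm_mult mult.assoc[symmetric] using that r0 M0 B0 by (intro mult_mono mult_nonneg_nonneg) auto
 have t5: "norm (- (1 / 2) * (\<Sum>j\<in>UNIV.
    (of_real (Lc j) + \<i> * of_real (Ls j)) * T $ j * p (j, True)
   + (of_real (Lc j) - \<i> * of_real (Ls j)) * cnj (T $ j) * p (j, False))) \<le> (1/2) * (?N * (2 * ((2 * B) * (r * M))))"
  unfolding norm_mult[of "- (1/2)"]
  by (intro mult_mono norm_diff_sum_le two l3 L Tj Tc p) (use B0 M0 r0 in auto)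
 have t6: "norm (\<i> * (\<Sum>j\<in>UNIV. of_real (\<kappa> j) * (T $ j * p (j, True) - cnj (T $ j) * p (j, False)))) \<le> 1 * (?N * (B * (2 * (r * M))))"
  unfolding norm_mult[of "\<i>"]
  by (intro mult_mono norm_diff_sum_le cf B two q2 Tj Tc p) (use B0 M0 r0 in auto)
 have "norm (jet_op Gc Gs G1 Lc Ls \<kappa> T p q) \<le>
   (((((1/2) * (?N * (?N * (B * (4 * (r * r * M))))) + (1/2) * (?N * (?N * (B * (4 * (r * r * M))))))
   + (1/2) * (?N * ((2 * B) * (2 * (r * M))))) + (1/2) * (?N * (B * (2 * (r * M)))))
   + (1/2) * (?N * (2 * ((2 * B) * (r * M))))) + 1 * (?N * (B * (2 * (r * M))))"
  unfolding jet_op_def by (intro norm_triangle_mono t1 t2 t3 t4 t5 t6)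
 also have "\<dots> = (4 * ?N\<^sup>2 * r\<^sup>2 + 7 * ?N * r) * B * M" by (simp add: power2_eq_square algebra_simps)
 also have "\<dots> \<le> (4 * ?N\<^sup>2 * r\<^sup>2 + 8 * ?N * r) * B * M"
  using B0 M0 r0 by (intro mult_right_mono) auto
 finally show ?thesis .
qed

lemma differentiable_has_disc_deriv:
 assumes "(\<lambda>t::real. f (x + t *\<^sub>R (u, 0))) differentiable (at 0)"
 shows "((\<lambda>t::real. f (x + t *\<^sub>R (u, 0))) has_vector_derivative disc_deriv u f x) (at 0)"
 using assms unfolding disc_deriv_def by (simp add: vector_derivative_works)

text \<open>Test functions are defined through real directional derivatives; the second order
  Wirtinger derivatives are recovered as combinations of the mixed ones along the axes.\<close>

lemma test_functionsD:
 fixes f :: "'n::finite state \<Rightarrow> complex"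
 assumes f: "f \<in> test_functions"
 shows "continuous_on UNIV f" "bounded (range f)"
  "\<And>c. continuous_on UNIV (Dc c f)" "\<And>c. bounded (range (Dc c f))"
  "\<And>c e. continuous_on UNIV (Dc e (Dc c f))" "\<And>c e. bounded (range (Dc e (Dc c f)))"
  "\<exists>R. \<forall>x c e. norm (fst x) > R \<longrightarrow> f x = 0 \<and> Dc c f x = 0 \<and> Dc e (Dc c f) x = 0"
proof -
 let ?d = "\<lambda>u. disc_deriv u f" and ?dd = "\<lambda>v u. disc_deriv v (disc_deriv u f)"
 have f': "continuous_on UNIV f \<and> bounded (range f) \<and> (\<exists>R. \<forall>T \<phi>. norm T > R \<longrightarrow> f (T, \<phi>) = 0) \<and>
   (\<forall>u. (\<forall>x. (\<lambda>t::real. f (x + t *\<^sub>R (u, 0))) differentiable (at 0)) \<and>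
    continuous_on UNIV (?d u) \<and> bounded (range (?d u)) \<and>
    (\<forall>v. (\<forall>x. (\<lambda>t::real. ?d u (x + t *\<^sub>R (v, 0))) differentiable (at 0)) \<and>
      continuous_on UNIV (?dd v u) \<and> bounded (range (?dd v u))))"
  using f unfolding test_functions_def mem_Collect_eq .
 note f0 = f'[THEN conjunct1] f'[THEN conjunct2, THEN conjunct1] f'[THEN conjunct2, THEN conjunct2, THEN conjunct1]
 note fu = f'[THEN conjunct2, THEN conjunct2, THEN conjunct2, rule_format]
 note c1 = fu[THEN conjunct2, THEN conjunct1] fu[THEN conjunct2, THEN conjunct2, THEN conjunct1]
 note fv = fu[THEN conjunct2, THEN conjunct2, THEN conjunct2, rule_format]
 note df = fv[THEN conjunct1, rule_format]
 note c2 = fv[THEN conjunct2, THEN conjunct1] fv[THEN conjunct2, THEN conjunct2]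
 show "continuous_on UNIV f" "bounded (range f)" by (rule f0)+
 define s :: "'n \<times> bool \<Rightarrow> complex" where "s c = (if snd c then - \<i> else \<i>)" for c
 have Dc: "Dc c g x = (1 / 2) * (disc_deriv (axis (fst c) 1) g x + s c * disc_deriv (axis (fst c) \<i>) g x)" for c and g :: "'n state \<Rightarrow> complex" and x
  by (simp add: Dc_def dT_def dTbar_def s_def)
 have dDc: "disc_deriv v (Dc c f) x = (1 / 2) * (?dd v (axis (fst c) 1) x + s c * ?dd v (axis (fst c) \<i>) x)" for v c x
 proof -
  have "((\<lambda>t::real. Dc c f (x + t *\<^sub>R (v, 0))) has_vector_derivative (1 / 2) * (?dd v (axis (fst c) 1) x + s c * ?dd v (axis (fst c) \<i>) x)) (at 0)"
   unfolding Dc by (intro has_vector_derivative_mult_right has_vector_derivative_add differentiable_has_disc_deriv df)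
  then show ?thesis unfolding disc_deriv_def[of v "Dc c f"] by (rule vector_derivative_at)
 qed
 have cont: "continuous_on UNIV (\<lambda>x. (1 / 2) * (g x + a * g' x))" if "continuous_on UNIV g" "continuous_on UNIV g'" for g g' :: "'n state \<Rightarrow> complex" and a
  by (intro continuous_intros that)
 have bnd: "bounded (range (\<lambda>x. (1 / 2) * (g x + a * g' x)))" if bg: "bounded (range g)" "bounded (range g')" for g g' :: "'n state \<Rightarrow> complex" and a
 proof -
  obtain B where B0: "\<And>x. norm (g x) \<le> B" using bg(1) unfolding bounded_iff by blast
  obtain B' where B1: "\<And>x. norm (g' x) \<le> B'" using bg(2) unfolding bounded_iff by blast
  note B = B0 B1
  have "norm ((1 / 2) * (g x + a * g' x)) \<le> (1 / 2) * (B + norm a * B')" for x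
  proof -
   have "norm (g x + a * g' x) \<le> norm (g x) + norm a * norm (g' x)"
    using norm_triangle_ineq[of "g x" "a * g' x"] by (simp add: norm_mult)
   also have "\<dots> \<le> B + norm a * B'" by (intro add_mono mult_left_mono B) simp
   finally show ?thesis unfolding norm_mult[of "1/2"] by simp
  qed
  then show ?thesis unfolding bounded_iff by (intro exI[of _ "(1 / 2) * (B + norm a * B')"]) blast
 qed
 have e1: "Dc c f = (\<lambda>x. (1 / 2) * (?d (axis (fst c) 1) x + s c * ?d (axis (fst c) \<i>) x))" for c
  by (rule ext) (rule Dc)
 show k1: "continuous_on UNIV (Dc c f)" "bounded (range (Dc c f))" for c
  unfolding e1 by (rule cont[OF c1(1) c1(1)], rule bnd[OF c1(2) c1(2)])
 have e2: "disc_deriv v (Dc c f) = (\<lambda>x. (1 / 2) * (?dd v (axis (fst c) 1) x + s c * ?dd v (axis (fst c) \<i>) x))" for v c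
  by (rule ext) (rule dDc)
 have d2: "continuous_on UNIV (disc_deriv v (Dc c f))" "bounded (range (disc_deriv v (Dc c f)))" for c v
  unfolding e2 by (rule cont[OF c2(1) c2(1)], rule bnd[OF c2(2) c2(2)])
 have e3: "Dc e (Dc c f) = (\<lambda>x. (1 / 2) * (disc_deriv (axis (fst e) 1) (Dc c f) x + s e * disc_deriv (axis (fst e) \<i>) (Dc c f) x))" for c e
  by (rule ext) (rule Dc)
 show "continuous_on UNIV (Dc e (Dc c f))" "bounded (range (Dc e (Dc c f)))" for c e
  unfolding e3 by (rule cont[OF d2(1) d2(1)], rule bnd[OF d2(2) d2(2)])
 obtain R where R: "\<And>T \<phi>. norm T > R \<Longrightarrow> f (T, \<phi>) = 0" using f0(3) by auto
 then have R0: "\<And>x. norm (fst x) > R \<Longrightarrow> f x = 0" by (metis prod.collapse)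
 have R1: "Dc c f x = 0" if "norm (fst x) > R" for c x
  unfolding Dc by (simp add: disc_deriv_vanish[OF R0 that])
 have R2: "Dc e (Dc c f) x = 0" if "norm (fst x) > R" for c e x
  unfolding Dc[of e] by (simp add: disc_deriv_vanish[OF R1 that])
 show "\<exists>R. \<forall>x c e. norm (fst x) > R \<longrightarrow> f x = 0 \<and> Dc c f x = 0 \<and> Dc e (Dc c f) x = 0"
  using R0 R1 R2 by (intro exI[of _ R]) blast
qed

lemma jet_op_zero: "jet_op Gc Gs G1 Lc Ls \<kappa> T (\<lambda>c. 0) (\<lambda>c e. 0) = 0"
 by (simp add: jet_op_def)

text \<open>The constant is fixed before the coefficients and depends on \<open>f\<close> alone, so
  one bound serves the whole family of generators as \<xi> tends to 0.\<close>

lemma gen_bounded: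
 fixes f :: "'n::finite state \<Rightarrow> complex"
 assumes f: "f \<in> test_functions"
 obtains C where "\<And>Gc Gs G1 Lc Ls \<kappa> B x. (\<And>j l. \<bar>Gc j l\<bar> \<le> B) \<Longrightarrow> (\<And>j l. \<bar>Gs j l\<bar> \<le> B) \<Longrightarrow> (\<And>j l. \<bar>G1 j l\<bar> \<le> B) \<Longrightarrow>
   (\<And>j. \<bar>Lc j\<bar> \<le> B) \<Longrightarrow> (\<And>j. \<bar>Ls j\<bar> \<le> B) \<Longrightarrow> (\<And>j. \<bar>\<kappa> j\<bar> \<le> B) \<Longrightarrow> norm (gen Gc Gs G1 Lc Ls \<kappa> f x) \<le> C * B"
proof -
 note t = test_functionsD[OF f]
 obtain R where R: "\<And>x c e. norm (fst x) > R \<Longrightarrow> f x = 0 \<and> Dc c f x = 0 \<and> Dc e (Dc c f) x = 0" using t(7) by blast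
 have "\<exists>M. \<forall>x. norm (Dc c f x) \<le> M" for c using t(4)[of c] unfolding bounded_iff by blast
 then obtain M1 where M1: "\<And>c x. norm (Dc c f x) \<le> M1 c" by metis
 have ex2: "\<exists>M. \<forall>x. norm (Dc e (Dc c f) x) \<le> M" for c e using t(6)[of e c] unfolding bounded_iff by blast
 define M2 where "M2 c e = (SOME M. \<forall>x. norm (Dc e (Dc c f) x) \<le> M)" for c e
 have M2: "norm (Dc e (Dc c f) x) \<le> M2 c e" for c e x
  using someI_ex[OF ex2[of e c]] unfolding M2_def by blast
 define M where "M = (\<Sum>c\<in>UNIV. M1 c) + (\<Sum>c\<in>UNIV. \<Sum>e\<in>UNIV. M2 c e)"
 have M1p: "0 \<le> M1 c" for c using M1[of c] norm_ge_zero order_trans by blast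
 have M2p: "0 \<le> M2 c e" for c e using M2[of e c] norm_ge_zero order_trans by blast
 have m1: "M1 c \<le> M" for c
  unfolding M_def using member_le_sum[of c UNIV M1] M1p M2p by (simp add: add_increasing2 sum_nonneg)
 have m2: "M2 c e \<le> M" for c e
 proof -
  have "M2 c e \<le> (\<Sum>e\<in>UNIV. M2 c e)" using M2p by (intro member_le_sum) auto
  also have "\<dots> \<le> (\<Sum>c\<in>UNIV. \<Sum>e\<in>UNIV. M2 c e)"
   using member_le_sum[of c UNIV "\<lambda>c. \<Sum>e\<in>UNIV. M2 c e"] M2p by (simp add: sum_nonneg)
  finally show ?thesis unfolding M_def using M1p by (simp add: add_increasing sum_nonneg)
 qed
 define r where "r = max 0 R"
 show ?thesis
 proof (rule that[of "(4 * (real CARD('n))\<^sup>2 * r\<^sup>2 + 8 * real CARD('n) * r) * M"])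
  fix Gc Gs G1 :: "'n \<Rightarrow> 'n \<Rightarrow> real" and Lc Ls \<kappa> :: "'n \<Rightarrow> real" and B x
  assume B: "\<And>j l. \<bar>Gc j l\<bar> \<le> B" "\<And>j l. \<bar>Gs j l\<bar> \<le> B" "\<And>j l. \<bar>G1 j l\<bar> \<le> B"
   "\<And>j. \<bar>Lc j\<bar> \<le> B" "\<And>j. \<bar>Ls j\<bar> \<le> B" "\<And>j. \<bar>\<kappa> j\<bar> \<le> B"
  have B0: "0 \<le> B" using B(4)[of undefined] by linarith
  have M0: "0 \<le> M" using m1[of undefined] M1p order_trans by blast
  have K0: "0 \<le> (4 * (real CARD('n))\<^sup>2 * r\<^sup>2 + 8 * real CARD('n) * r) * M * B"
   using B0 M0 by (intro mult_nonneg_nonneg add_nonneg_nonneg) (auto simp: r_def)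
  show "norm (gen Gc Gs G1 Lc Ls \<kappa> f x) \<le> (4 * (real CARD('n))\<^sup>2 * r\<^sup>2 + 8 * real CARD('n) * r) * M * B"
  proof (cases "norm (fst x) > R")
   case True
   then show ?thesis using K0 R by (simp add: gen_eq_jet_op jet_op_zero)
  next
   case False
   then have "norm (fst x) \<le> r" by (simp add: r_def)
   then have "norm (gen Gc Gs G1 Lc Ls \<kappa> f x) \<le> (4 * (real CARD('n))\<^sup>2 * r\<^sup>2 + 8 * real CARD('n) * r) * B * M"
    unfolding gen_eq_jet_op by (rule jet_op_bound[OF B]) (use M1 M2 m1 m2 order_trans in blast)+
   then show ?thesis by (simp add: mult_ac)
  qed
 qed
qed

text \<open>Coefficients and evaluation point converge together; with constant coefficients this is
  the continuity of the generator applied to a test function.\<close>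

lemma gen_tendsto:
 assumes f: "f \<in> test_functions"
  and "\<And>j. ((\<lambda>n. Lc n j) \<longlongrightarrow> Lc0 j) F" "\<And>j. ((\<lambda>n. Ls n j) \<longlongrightarrow> Ls0 j) F" "\<And>j. ((\<lambda>n. \<kappa> n j) \<longlongrightarrow> \<kappa>0 j) F"
  and x: "((\<lambda>n. x n) \<longlongrightarrow> x0) F"
 shows "((\<lambda>n. gen Gc Gs G1 (Lc n) (Ls n) (\<kappa> n) f (x n)) \<longlongrightarrow> gen Gc Gs G1 Lc0 Ls0 \<kappa>0 f x0) F"
 unfolding gen_eq_jet_op
proof (intro jet_op_tendsto assms tendsto_intros)
 fix c e
 have c: "isCont (Dc c f) x0" "isCont (Dc e (Dc c f)) x0"
  using test_functionsD(3)[OF f, of c] test_functionsD(5)[OF f, of e c]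
  by (simp_all only: continuous_on_eq_continuous_at[OF open_UNIV] UNIV_I ball_UNIV)
 show "((\<lambda>n. Dc c f (x n)) \<longlongrightarrow> Dc c f x0) F" "((\<lambda>n. Dc e (Dc c f) (x n)) \<longlongrightarrow> Dc e (Dc c f) x0) F"
  by (rule isCont_tendsto_compose[OF c(1) x], rule isCont_tendsto_compose[OF c(2) x])
qed

lemma gen_continuous:
 assumes f: "f \<in> test_functions"
 shows "continuous_on UNIV (gen Gc Gs G1 Lc Ls \<kappa> f)"
proof -
 have "isCont (gen Gc Gs G1 Lc Ls \<kappa> f) x" for x
  unfolding isCont_def by (rule gen_tendsto[OF f]) (rule tendsto_const tendsto_ident_at)+
 then show ?thesis by (simp only: continuous_on_eq_continuous_at[OF open_UNIV] ball_UNIV) simp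
qed

section \<open>Calculus for twice differentiable functions\<close>

lemma dirsum_add: "dirsum (\<lambda>c. p c + q c) u = dirsum p u + dirsum q u"
 by (simp add: dirsum_def sum.distrib[symmetric] algebra_simps)

lemma dirsum_mult: "dirsum (\<lambda>c. \<alpha> * p c) u = \<alpha> * dirsum p u"
 by (simp add: dirsum_def sum_distrib_left algebra_simps)

lemma wd_cong: "wd F D \<Longrightarrow> F = F' \<Longrightarrow> (\<And>c T. D c T = D' c T) \<Longrightarrow> wd F' D'"
 by (simp add: wd_def dirsum_def)

lemma wd_const: "wd (\<lambda>T. a) (\<lambda>c T. 0)"
 by (simp add: wd_def dirsum_def)

lemma wd_Zc: "wd (Zc c) (\<lambda>e T. if e = c then 1 else 0)"
 unfolding wd_def
proof (intro allI)
 fix T u :: "(complex, 'a) vec"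
 have "dirsum (\<lambda>e. if e = c then 1 else 0) u = Zc c u"
 proof -
  have "dirsum (\<lambda>e. if e = c then 1 else 0) u = (\<Sum>j\<in>UNIV. if j = fst c then Zc c u else 0)"
   unfolding dirsum_def by (intro sum.cong refl) (cases c, auto simp: Zc_def)
  then show ?thesis by simp
 qed
 moreover have "((\<lambda>t::real. Zc c (T + t *\<^sub>R u)) has_vector_derivative Zc c u) (at 0)"
 proof (cases "snd c")
  case True
  have "((\<lambda>t::real. T $ fst c + t *\<^sub>R (u $ fst c)) has_vector_derivative u $ fst c) (at 0)"
   by (auto intro!: derivative_eq_intros)
  then show ?thesis using True by (simp add: Zc_def)
 next
  case False
  have "((\<lambda>t::real. cnj (T $ fst c) + t *\<^sub>R cnj (u $ fst c)) has_vector_derivative cnj (u $ fst c)) (at 0)"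
   by (auto intro!: derivative_eq_intros)
  moreover have "cnj (t *\<^sub>R z) = t *\<^sub>R cnj z" for t z by (simp add: scaleR_conv_of_real)
  ultimately show ?thesis using False by (simp add: Zc_def)
 qed
 ultimately show "((\<lambda>t::real. Zc c (T + t *\<^sub>R u)) has_vector_derivative dirsum (\<lambda>e. if e = c then 1 else 0) u) (at 0)" by simp
qed

lemma wd_add: "wd F D \<Longrightarrow> wd G E \<Longrightarrow> wd (\<lambda>T. F T + G T) (\<lambda>c T. D c T + E c T)"
 unfolding wd_def dirsum_add by (auto intro: has_vector_derivative_add)

lemma wd_mult: "wd F D \<Longrightarrow> wd G E \<Longrightarrow> wd (\<lambda>T. F T * G T) (\<lambda>c T. F T * E c T + G T * D c T)"
 unfolding wd_def dirsum_add dirsum_mult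
 by (auto intro!: has_vector_derivative_eq_rhs[OF has_vector_derivative_mult] simp: mult.commute)

text \<open>The derivative of a real quantity is real, so the imaginary part of its
  \<open>dirsum\<close> vanishes and the real chain rule can be carried over to the complex
  derivative.\<close>

lemma wd_real_comp:
 assumes n: "wd (\<lambda>T. of_real (n T)) D" and ch: "\<And>x. (ch has_real_derivative ch' x) (at x)"
 shows "wd (\<lambda>T. of_real (ch (n T))) (\<lambda>c T. of_real (ch' (n T)) * D c T)"
 unfolding wd_def dirsum_mult
proof (intro allI)
 fix T u
 have d: "((\<lambda>t::real. complex_of_real (n (T + t *\<^sub>R u))) has_vector_derivative dirsum (\<lambda>c. D c T) u) (at 0)"
  using n by (simp add: wd_def)
 have r: "((\<lambda>t::real. n (T + t *\<^sub>R u)) has_vector_derivative Re (dirsum (\<lambda>c. D c T) u)) (at 0)"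
  using bounded_linear.has_vector_derivative[OF bounded_linear_Re d] by simp
 have "((\<lambda>t::real. (0::real)) has_vector_derivative Im (dirsum (\<lambda>c. D c T) u)) (at 0)"
  using bounded_linear.has_vector_derivative[OF bounded_linear_Im d] by simp
 then have im: "Im (dirsum (\<lambda>c. D c T) u) = 0"
  using vector_derivative_unique_at has_vector_derivative_const by blast
 have "((\<lambda>t::real. ch (n (T + t *\<^sub>R u))) has_real_derivative ch' (n T) * Re (dirsum (\<lambda>c. D c T) u)) (at 0)"
  using DERIV_chain2[of ch "ch' (n T)" "\<lambda>t. n (T + t *\<^sub>R u)" 0] ch[of "n T"] r
  by (simp add: has_real_derivative_iff_has_vector_derivative)
 then have "((\<lambda>t::real. ch (n (T + t *\<^sub>R u))) has_vector_derivative ch' (n T) * Re (dirsum (\<lambda>c. D c T) u)) (at 0)"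
  by (simp add: has_real_derivative_iff_has_vector_derivative)
 from bounded_linear.has_vector_derivative[OF bounded_linear_of_real this]
 have "((\<lambda>t::real. complex_of_real (ch (n (T + t *\<^sub>R u)))) has_vector_derivative of_real (ch' (n T) * Re (dirsum (\<lambda>c. D c T) u))) (at 0)" .
 also have "complex_of_real (ch' (n T) * Re (dirsum (\<lambda>c. D c T) u)) = of_real (ch' (n T)) * dirsum (\<lambda>c. D c T) u"
  using im by (simp add: complex_eq_iff)
 finally show "((\<lambda>t::real. complex_of_real (ch (n (T + t *\<^sub>R u)))) has_vector_derivative of_real (ch' (n T)) * dirsum (\<lambda>c. D c T) u) (at 0)" .
qed

lemma continuous_Zc: "continuous_on UNIV (Zc c)"
 unfolding Zc_def by (cases "snd c") (auto intro!: continuous_intros)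

lemma C2D:
 assumes "C2 F D1 D2"
 shows "wd F D1" "wd (D1 c) (D2 c)" "continuous_on UNIV F" "continuous_on UNIV (D1 c)" "continuous_on UNIV (D2 c e)"
 using assms unfolding C2_def by blast+

lemma C2_const: "C2 (\<lambda>T. a) (\<lambda>c T. 0) (\<lambda>c e T. 0)"
 by (simp add: C2_def wd_const)

lemma C2_Zc: "C2 (Zc c) (\<lambda>e T. if e = c then 1 else 0) (\<lambda>e e' T. 0)"
proof -
 have "wd (\<lambda>T. if e = c then 1 else 0) (\<lambda>e' T. 0)" for e :: "'a \<times> bool"
  by (rule wd_const)
 then show ?thesis unfolding C2_def by (intro conjI allI wd_Zc continuous_Zc continuous_on_const)
qed

lemma C2_mult:
 assumes "C2 F D1 D2" "C2 G E1 E2"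
 shows "C2 (\<lambda>T. F T * G T) (\<lambda>c T. F T * E1 c T + G T * D1 c T)
  (\<lambda>c e T. (F T * E2 c e T + E1 c T * D1 e T) + (G T * D2 c e T + D1 c T * E1 e T))"
 using assms unfolding C2_def by (auto intro!: wd_add wd_mult continuous_intros)

lemma C2_real_comp:
 assumes n: "C2 (\<lambda>T. of_real (n T)) D1 D2" and cn: "continuous_on UNIV n"
  and ch: "\<And>x. (ch has_real_derivative ch' x) (at x)" "\<And>x. (ch' has_real_derivative ch'' x) (at x)"
  and c: "continuous_on UNIV ch''"
 shows "C2 (\<lambda>T. of_real (ch (n T))) (\<lambda>c T. of_real (ch' (n T)) * D1 c T)
  (\<lambda>c e T. of_real (ch' (n T)) * D2 c e T + D1 c T * (of_real (ch'' (n T)) * D1 e T))"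
proof -
 have "continuous_on UNIV ch" "continuous_on UNIV ch'"
  by (rule DERIV_continuous_on, rule has_field_derivative_at_within, rule ch)+
 then have cc: "continuous_on UNIV (\<lambda>T. ch (n T))" "continuous_on UNIV (\<lambda>T. ch' (n T))" "continuous_on UNIV (\<lambda>T. ch'' (n T))"
  using continuous_on_compose2[OF _ cn] c by auto
 have w: "wd (\<lambda>T. of_real (n T)) D1" "\<And>c. wd (D1 c) (D2 c)"
  and cD: "\<And>c. continuous_on UNIV (D1 c)" "\<And>c e. continuous_on UNIV (D2 c e)"
  using C2D[OF n] by blast+
 show ?thesis
  unfolding C2_def
 proof (intro conjI allI)
  show "wd (\<lambda>T. of_real (ch (n T))) (\<lambda>c T. of_real (ch' (n T)) * D1 c T)"
   by (rule wd_real_comp[OF w(1) ch(1)])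
  fix c e
  show "wd (\<lambda>T. of_real (ch' (n T)) * D1 c T) (\<lambda>e T. of_real (ch' (n T)) * D2 c e T + D1 c T * (of_real (ch'' (n T)) * D1 e T))"
   by (rule wd_mult[OF wd_real_comp[OF w(1) ch(2)] w(2)])
 qed (intro continuous_intros cc cD)+
qed

lemma wd_sum: "finite A \<Longrightarrow> (\<And>i. i \<in> A \<Longrightarrow> wd (F i) (D i)) \<Longrightarrow> wd (\<lambda>T. \<Sum>i\<in>A. F i T) (\<lambda>c T. \<Sum>i\<in>A. D i c T)"
 by (induction A rule: finite_induct) (auto intro: wd_const wd_add)

text \<open>As a sum of products of a coordinate with its conjugate, the squared norm has the
  opposite letter as its derivative in each letter; hence the negated flags.\<close>

lemma C2_norm2:
 "C2 (\<lambda>T. of_real ((norm T)\<^sup>2)) (\<lambda>c T. Zc (fst c, \<not> snd c) T) (\<lambda>c e T. if e = (fst c, \<not> snd c) then 1 else 0)"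
proof -
 have eq: "complex_of_real ((norm T)\<^sup>2) = (\<Sum>j\<in>UNIV. Zc (j, True) T * Zc (j, False) T)" for T :: "(complex, 'a) vec"
  by (simp add: norm_vec_def L2_set_def sum_nonneg Zc_def flip: complex_norm_square)
 have "wd (\<lambda>T::(complex, 'a) vec. \<Sum>j\<in>UNIV. Zc (j, True) T * Zc (j, False) T)
   (\<lambda>c T. \<Sum>j\<in>UNIV. Zc (j, True) T * (if c = (j, False) then 1 else 0) + Zc (j, False) T * (if c = (j, True) then 1 else 0))"
  by (intro wd_sum wd_mult wd_Zc) auto
 then have "wd (\<lambda>T::(complex, 'a) vec. of_real ((norm T)\<^sup>2)) (\<lambda>c T. Zc (fst c, \<not> snd c) T)"
 proof (rule wd_cong)
  show "(\<lambda>T::(complex, 'a) vec. \<Sum>j\<in>UNIV. Zc (j, True) T * Zc (j, False) T) = (\<lambda>T. of_real ((norm T)\<^sup>2))" by (simp only: eq)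
  fix c :: "'a \<times> bool" and T
  obtain j b where c: "c = (j, b)" by (cases c)
  have "(\<Sum>i\<in>UNIV. Zc (i, True) T * (if c = (i, False) then 1 else 0) + Zc (i, False) T * (if c = (i, True) then 1 else 0))
   = (\<Sum>i\<in>UNIV. if i = j then Zc (j, \<not> b) T else 0)"
   by (intro sum.cong refl) (auto simp: c)
  then show "(\<Sum>i\<in>UNIV. Zc (i, True) T * (if c = (i, False) then 1 else 0) + Zc (i, False) T * (if c = (i, True) then 1 else 0)) = Zc (fst c, \<not> snd c) T"
   by (simp add: c)
 qed
 then show ?thesis unfolding C2_def by (auto intro!: wd_Zc continuous_Zc continuous_intros)
qed

section \<open>Cutoff\<close>

text \<open>At the corner the difference quotient is at most |h|^(k + 1), so the derivative there is
  0.\<close>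

lemma DERIV_pos_part_power:
 "((\<lambda>x::real. (max 0 x) ^ Suc (Suc k)) has_real_derivative (real (Suc (Suc k)) * (max 0 x) ^ Suc k)) (at x)"
proof (cases "x = 0")
 case False
 show ?thesis
 proof (cases "x > 0")
  case True
  have "((\<lambda>x::real. x ^ Suc (Suc k)) has_real_derivative (real (Suc (Suc k)) * x ^ Suc k)) (at x)"
   by (rule DERIV_cong[OF DERIV_pow]) simp
  then have "((\<lambda>x::real. (max 0 x) ^ Suc (Suc k)) has_real_derivative (real (Suc (Suc k)) * x ^ Suc k)) (at x)"
   by (rule has_field_derivative_transform_within_open[of _ _ _ "{0<..}"]) (use True in auto)
  then show ?thesis using True by simp
 next
  case neg: False
  have "((\<lambda>x::real. 0) has_real_derivative 0) (at x)" by simp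
  then have "((\<lambda>x::real. (max 0 x) ^ Suc (Suc k)) has_real_derivative 0) (at x)"
   by (rule has_field_derivative_transform_within_open[of _ _ _ "{..<0}"]) (use False neg in auto)
  then show ?thesis using neg by simp
 qed
next
 case True
 have "((\<lambda>h::real. max 0 h ^ Suc (Suc k) / h) \<longlongrightarrow> 0) (at 0)"
 proof (rule Lim_null_comparison)
  show "\<forall>\<^sub>F h in at 0. norm (max 0 h ^ Suc (Suc k) / h) \<le> \<bar>h\<bar> ^ Suc k"
  proof (intro always_eventually allI)
   fix h :: real
   show "norm (max 0 h ^ Suc (Suc k) / h) \<le> \<bar>h\<bar> ^ Suc k"
   proof (cases "h > 0")
    case False
    then have "norm (max 0 h ^ Suc (Suc k) / h) = 0" by simp
    also have "0 \<le> \<bar>h\<bar> ^ Suc k" by (rule zero_le_power) simp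
    finally show ?thesis .
   qed auto
  qed
  have "((\<lambda>h::real. \<bar>h\<bar> ^ Suc k) \<longlongrightarrow> \<bar>0\<bar> ^ Suc k) (at 0)" by (intro tendsto_intros)
  then show "((\<lambda>h::real. \<bar>h\<bar> ^ Suc k) \<longlongrightarrow> 0) (at 0)" by simp
 qed
 then show ?thesis by (simp add: True has_field_derivative_iff)
qed

text \<open>Equal to 1 up to \<open>r\<close>, to 0 from \<open>r + 1\<close> on, and nonincreasing.
  Two nested cubes of positive parts are smooth enough: the second derivative is still continuous at
  both corners, as test functions demand.\<close>

definition cutoff :: "real \<Rightarrow> real \<Rightarrow> real" where
 "cutoff r x = (max 0 (1 - (max 0 (x - r)) ^ 3)) ^ 3"

definition cutoff' :: "real \<Rightarrow> real \<Rightarrow> real" where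
 "cutoff' r x = - 9 * (max 0 (1 - (max 0 (x - r)) ^ 3))\<^sup>2 * (max 0 (x - r))\<^sup>2"

definition cutoff'' :: "real \<Rightarrow> real \<Rightarrow> real" where
 "cutoff'' r x = 54 * max 0 (1 - (max 0 (x - r)) ^ 3) * (max 0 (x - r)) ^ 4
   - 18 * (max 0 (1 - (max 0 (x - r)) ^ 3))\<^sup>2 * max 0 (x - r)"

lemma DERIV_cutoff:
 "(cutoff r has_real_derivative cutoff' r x) (at x)"
 "(cutoff' r has_real_derivative cutoff'' r x) (at x)"
 "continuous_on UNIV (cutoff'' r)"
proof -
 have p3: "((\<lambda>x::real. (max 0 x) ^ 3) has_real_derivative 3 * (max 0 y)\<^sup>2) (at y)" for y
  using DERIV_pos_part_power[of 1 y] by (simp add: numeral_3_eq_3 numeral_2_eq_2)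
 have p2: "((\<lambda>x::real. (max 0 x)\<^sup>2) has_real_derivative 2 * max 0 y) (at y)" for y
  using DERIV_pos_part_power[of 0 y] by (simp add: numeral_2_eq_2)
 have i: "((\<lambda>x. x - r) has_real_derivative 1) (at x)" by (auto intro!: derivative_eq_intros)
 have a3: "((\<lambda>x. (max 0 (x - r)) ^ 3) has_real_derivative 3 * (max 0 (x - r))\<^sup>2) (at x)"
  using DERIV_chain2[OF p3 i] by simp
 have a2: "((\<lambda>x. (max 0 (x - r))\<^sup>2) has_real_derivative 2 * max 0 (x - r)) (at x)"
  using DERIV_chain2[OF p2 i] by simp
 have b: "((\<lambda>x. 1 - (max 0 (x - r)) ^ 3) has_real_derivative 0 - 3 * (max 0 (x - r))\<^sup>2) (at x)"
  by (intro DERIV_diff DERIV_const a3)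
 show "(cutoff r has_real_derivative cutoff' r x) (at x)"
  using DERIV_chain2[OF p3 b] by (simp add: cutoff_def[abs_def] cutoff'_def mult.assoc)
 have c: "((\<lambda>x. (max 0 (1 - (max 0 (x - r)) ^ 3))\<^sup>2) has_real_derivative 2 * max 0 (1 - (max 0 (x - r)) ^ 3) * (0 - 3 * (max 0 (x - r))\<^sup>2)) (at x)"
  by (rule DERIV_chain2[OF p2 b])
 have "((\<lambda>x. (max 0 (1 - (max 0 (x - r)) ^ 3))\<^sup>2 * (max 0 (x - r))\<^sup>2) has_real_derivative
   2 * max 0 (1 - (max 0 (x - r)) ^ 3) * (0 - 3 * (max 0 (x - r))\<^sup>2) * (max 0 (x - r))\<^sup>2 + 2 * max 0 (x - r) * (max 0 (1 - (max 0 (x - r)) ^ 3))\<^sup>2) (at x)"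
  by (rule DERIV_mult[OF c a2])
 from DERIV_cmult[OF this, of "- 9"]
 have "((\<lambda>x. - 9 * ((max 0 (1 - (max 0 (x - r)) ^ 3))\<^sup>2 * (max 0 (x - r))\<^sup>2)) has_real_derivative
   - 9 * (2 * max 0 (1 - (max 0 (x - r)) ^ 3) * (0 - 3 * (max 0 (x - r))\<^sup>2) * (max 0 (x - r))\<^sup>2 + 2 * max 0 (x - r) * (max 0 (1 - (max 0 (x - r)) ^ 3))\<^sup>2)) (at x)" .
 moreover have "- 9 * (2 * A * (0 - 3 * m\<^sup>2) * m\<^sup>2 + 2 * m * A\<^sup>2) = 54 * A * m ^ 4 - 18 * A\<^sup>2 * m" for A m :: real
  by (simp add: power2_eq_square power4_eq_xxxx algebra_simps)
 ultimately show "(cutoff' r has_real_derivative cutoff'' r x) (at x)"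
  unfolding cutoff'_def[abs_def] cutoff''_def by (simp only: mult.assoc[of "- 9"])
 show "continuous_on UNIV (cutoff'' r)" unfolding cutoff''_def[abs_def] by (intro continuous_intros)
qed

lemma cutoff_props:
 "x \<le> r \<Longrightarrow> cutoff r x = 1" "x \<le> r \<Longrightarrow> cutoff' r x = 0" "x \<le> r \<Longrightarrow> cutoff'' r x = 0"
 "x \<ge> r + 1 \<Longrightarrow> cutoff r x = 0" "0 \<le> cutoff r x" "cutoff r x \<le> 1" "cutoff' r x \<le> 0"
 "x > r \<Longrightarrow> cutoff r x < 1"
proof -
 have 1: "(1::real) \<le> (x - r) ^ 3" if "x \<ge> r + 1" using that by (intro one_le_power) auto
 show "x \<le> r \<Longrightarrow> cutoff r x = 1" "x \<le> r \<Longrightarrow> cutoff' r x = 0" "x \<le> r \<Longrightarrow> cutoff'' r x = 0"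
  "0 \<le> cutoff r x" "cutoff' r x \<le> 0"
  by (auto simp: cutoff_def cutoff'_def cutoff''_def)
 show "x \<ge> r + 1 \<Longrightarrow> cutoff r x = 0" using 1 by (simp add: cutoff_def)
 have m: "max 0 (1 - (max 0 (x - r)) ^ 3) \<le> 1" by simp
 show "cutoff r x \<le> 1" unfolding cutoff_def by (intro power_le_one) auto
 show "cutoff r x < 1" if "x > r"
 proof -
  have "(max 0 (x - r)) ^ 3 > 0" using that by simp
  then have "max 0 (1 - (max 0 (x - r)) ^ 3) < 1" by simp
  then show ?thesis unfolding cutoff_def using power_strict_mono[of "max 0 (1 - (max 0 (x - r)) ^ 3)" 1 3] by simp
 qed
qed

lemma C2_cutoff:
 "C2 (\<lambda>T. of_real (cutoff r ((norm T)\<^sup>2))) (\<lambda>c T. of_real (cutoff' r ((norm T)\<^sup>2)) * Zc (fst c, \<not> snd c) T)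
  (\<lambda>c e T. of_real (cutoff' r ((norm T)\<^sup>2)) * (if e = (fst c, \<not> snd c) then 1 else 0)
    + Zc (fst c, \<not> snd c) T * (of_real (cutoff'' r ((norm T)\<^sup>2)) * Zc (fst e, \<not> snd e) T))"
 by (rule C2_real_comp[OF C2_norm2 _ DERIV_cutoff]) (intro continuous_intros)

text \<open>This is the operator on a function of the squared norm with first derivative
  \<open>a\<close> and second derivative \<open>b\<close>. The \<open>b\<close> terms cancel within
  each bracket. By symmetry and zero row sums the \<open>a\<close> terms with \<open>Gc\<close>
  cancel the first order term carrying its diagonal; the diagonal of \<open>G1\<close> cancels
  likewise, and imaginary coefficients only rotate phases. What survives is the damping by
  \<open>Lc\<close>.\<close>

lemma jet_op_radial:
 assumes sym: "\<And>j l. Gc j l = Gc l j" and diag: "\<And>j. Gc j j = - (\<Sum>l\<in>UNIV - {j}. Gc j l)"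
 shows "jet_op Gc Gs G1 Lc Ls \<kappa> T (\<lambda>c. of_real a * Zc (fst c, \<not> snd c) T)
   (\<lambda>c e. of_real a * (if e = (fst c, \<not> snd c) then 1 else 0) + Zc (fst c, \<not> snd c) T * (of_real b * Zc (fst e, \<not> snd e) T))
  = of_real (- a * (\<Sum>j\<in>UNIV. Lc j * (cmod (T $ j))\<^sup>2))"
proof -
 define m where "m j = T $ j * cnj (T $ j)" for j
 \<comment> \<open>Exchanging the two indices, by the symmetry of \<open>Gc\<close>, replaces
   \<open>m l\<close> by \<open>m j\<close>, so that both halves of the sum agree.\<close>
 have s1: "(\<Sum>j\<in>UNIV. \<Sum>l\<in>UNIV - {j}. of_real (Gc j l) * (of_real a * (m j + m l)))
   = 2 * of_real a * (\<Sum>j\<in>UNIV. m j * (\<Sum>l\<in>UNIV - {j}. of_real (Gc j l)))"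
 proof -
  have "(\<Sum>j\<in>UNIV. \<Sum>l\<in>UNIV - {j}. of_real (Gc j l) * m l) = (\<Sum>j\<in>UNIV. \<Sum>l\<in>UNIV. if l \<noteq> j then of_real (Gc j l) * m l else 0)"
   by (intro sum.cong refl sum.mono_neutral_cong_left) auto
  also have "\<dots> = (\<Sum>l\<in>UNIV. \<Sum>j\<in>UNIV. if l \<noteq> j then of_real (Gc j l) * m l else 0)" by (rule sum.swap)
  also have "\<dots> = (\<Sum>l\<in>UNIV. \<Sum>j\<in>UNIV - {l}. of_real (Gc l j) * m l)"
   by (intro sum.cong refl sum.mono_neutral_cong_right) (auto simp: sym)
  finally have *: "(\<Sum>j\<in>UNIV. \<Sum>l\<in>UNIV - {j}. of_real (Gc j l) * m l) = (\<Sum>j\<in>UNIV. \<Sum>l\<in>UNIV - {j}. of_real (Gc j l) * m j)" .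
  have "(\<Sum>j\<in>UNIV. \<Sum>l\<in>UNIV - {j}. of_real (Gc j l) * (of_real a * (m j + m l)))
   = of_real a * ((\<Sum>j\<in>UNIV. \<Sum>l\<in>UNIV - {j}. of_real (Gc j l) * m j) + (\<Sum>j\<in>UNIV. \<Sum>l\<in>UNIV - {j}. of_real (Gc j l) * m l))"
   by (simp add: sum_distrib_left sum.distrib[symmetric] algebra_simps)
  also have "\<dots> = 2 * of_real a * (\<Sum>j\<in>UNIV. \<Sum>l\<in>UNIV - {j}. of_real (Gc j l) * m j)" unfolding * by simp
  finally show ?thesis by (simp add: sum_distrib_left mult_ac)
 qed
 have d: "(\<Sum>l\<in>UNIV - {j}. complex_of_real (Gc j l)) = - of_real (Gc j j)" for j
  using diag[of j] by simp
 have t1: "(\<Sum>j\<in>UNIV. \<Sum>l\<in>UNIV - {j}. of_real (Gc j l) *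
    (T $ j * cnj (T $ j) * (of_real a * 1 + T $ l * (of_real b * cnj (T $ l))) + T $ l * cnj (T $ l) * (of_real a * 1 + T $ j * (of_real b * cnj (T $ j)))
     - T $ j * T $ l * (of_real a * 0 + cnj (T $ l) * (of_real b * cnj (T $ j))) - cnj (T $ j) * cnj (T $ l) * (of_real a * 0 + T $ l * (of_real b * T $ j))))
  = (\<Sum>j\<in>UNIV. \<Sum>l\<in>UNIV - {j}. of_real (Gc j l) * (of_real a * (m j + m l)))"
  by (intro sum.cong refl) (simp add: m_def algebra_simps)
 have t2: "(\<Sum>j\<in>UNIV. \<Sum>l\<in>UNIV. of_real (G1 j l) *
    (T $ j * cnj (T $ l) * (of_real a * (if j = l then 1 else 0) + T $ l * (of_real b * cnj (T $ j)))
    + cnj (T $ j) * T $ l * (of_real a * (if j = l then 1 else 0) + cnj (T $ l) * (of_real b * T $ j))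
     - T $ j * T $ l * (of_real a * 0 + cnj (T $ l) * (of_real b * cnj (T $ j))) - cnj (T $ j) * cnj (T $ l) * (of_real a * 0 + T $ l * (of_real b * T $ j))))
  = (\<Sum>j\<in>UNIV. \<Sum>l\<in>UNIV. if j = l then 2 * of_real (G1 j j) * of_real a * m j else 0)"
  by (intro sum.cong refl) (auto simp: m_def algebra_simps)
 have t2': "\<dots> = 2 * of_real a * (\<Sum>j\<in>UNIV. of_real (G1 j j) * m j)"
  by (simp add: sum_distrib_left mult_ac)
 have mr: "m j = of_real ((cmod (T $ j))\<^sup>2)" for j unfolding m_def by (rule complex_norm_square[symmetric])
 have "jet_op Gc Gs G1 Lc Ls \<kappa> T (\<lambda>c. of_real a * Zc (fst c, \<not> snd c) T)
   (\<lambda>c e. of_real a * (if e = (fst c, \<not> snd c) then 1 else 0) + Zc (fst c, \<not> snd c) T * (of_real b * Zc (fst e, \<not> snd e) T))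
  = (1/2) * (2 * of_real a * (\<Sum>j\<in>UNIV. m j * (- of_real (Gc j j)))) + (1/2) * (2 * of_real a * (\<Sum>j\<in>UNIV. of_real (G1 j j) * m j))
   + (1/2) * (\<Sum>j\<in>UNIV. of_real (Gc j j - G1 j j) * (2 * of_real a * m j)) - (1/2) * (\<Sum>j\<in>UNIV. 2 * of_real (Lc j) * of_real a * m j)"
  unfolding t2'[symmetric] t2[symmetric] d[symmetric] s1[symmetric] t1[symmetric] jet_op_def
  by (simp add: Zc_def m_def algebra_simps)
 also have "\<dots> = of_real (- a * (\<Sum>j\<in>UNIV. Lc j * (cmod (T $ j))\<^sup>2))"
  by (simp add: mr sum_distrib_left sum_negf sum_subtractf algebra_simps)
 finally show ?thesis .
qed

section \<open>Solutions of the martingale problem\<close>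

lemma set_integral_split:
 fixes \<phi> :: "real \<Rightarrow> complex"
 assumes "continuous_on {0..t} \<phi>" "0 \<le> s" "s \<le> t"
 shows "(LBINT u:{0..t}. \<phi> u) - (LBINT u:{0..s}. \<phi> u) = (LBINT u:{s..t}. \<phi> u)"
proof -
 have c: "continuous_on {0..s} \<phi>" "continuous_on {s..t} \<phi>"
  using assms by (auto intro: continuous_on_subset)
 have e: "(LBINT u:{a..b}. \<phi> u) = integral {a..b} \<phi>" if "continuous_on {a..b} \<phi>" for a b
  by (intro set_borel_integral_eq_integral borel_integrable_atLeastAtMost' that)
 have "integral {0..s} \<phi> + integral {s..t} \<phi> = integral {0..t} \<phi>"
  by (rule Henstock_Kurzweil_Integration.integral_combine) (use assms in \<open>auto intro!: integrable_continuous_real\<close>)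
 then show ?thesis unfolding e[OF assms(1)] e[OF c(1)] e[OF c(2)] by (simp add: algebra_simps)
qed

text \<open>The coefficients are abstract here; the medium is remembered through the symmetry and
  the zero row sums of \<Gamma>^c and the sign of \<Lambda>^c, on which confinement rests.\<close>

locale diffusion =
 fixes S :: "'n::finite state set" and Gc Gs G1 :: "'n \<Rightarrow> 'n \<Rightarrow> real" and Lc Ls \<kappa> :: "'n \<Rightarrow> real"
  and y :: "'n state" and P :: "(real \<Rightarrow> 'n state) measure"
 assumes sol: "solves_martingale_problem S (gen Gc Gs G1 Lc Ls \<kappa>) y P"
  and sym: "\<And>j l. Gc j l = Gc l j" and diag: "\<And>j. Gc j j = - (\<Sum>l\<in>UNIV - {j}. Gc j l)"
  and Lc: "\<And>j. 0 \<le> Lc j"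
begin

abbreviation "G \<equiv> gen Gc Gs G1 Lc Ls \<kappa>"

sublocale prob_space P
 using sol by (simp add: solves_martingale_problem_def)

lemma sets_P: "sets P = sets (path_space S)"
 using sol by (simp add: solves_martingale_problem_def)

lemma space_P: "space P = space (path_space S)"
 using sets_P by (rule sets_eq_imp_space_eq)

lemma path_cont: "w \<in> space P \<Longrightarrow> continuous_on {0..} w"
 by (simp add: space_P space_path_space)

lemma start: "AE w in P. w 0 = y"
 using sol by (simp add: solves_martingale_problem_def)

lemma coord_measurable: "0 \<le> t \<Longrightarrow> (\<lambda>w. w t) \<in> borel_measurable P"
 using measurable_path_space_coord measurable_cong_sets[OF sets_P refl] by blast

lemma comp_measurable:
 assumes "0 \<le> t" "continuous_on UNIV (h :: 'n state \<Rightarrow> 'b::topological_space)"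
 shows "(\<lambda>w. h (w t)) \<in> borel_measurable P"
 by (rule measurable_compose[OF coord_measurable[OF assms(1)] borel_measurable_continuous_onI[OF assms(2)]])

lemma comp_continuous:
 assumes "w \<in> space P" "continuous_on UNIV (h :: 'n state \<Rightarrow> 'b::topological_space)" "A \<subseteq> {0..}"
 shows "continuous_on A (\<lambda>t. h (w t))"
 by (rule continuous_on_compose2[OF assms(2) continuous_on_subset[OF path_cont[OF assms(1)] assms(3)]]) simp

lemma subalg: "subalgebra P (path_filtration S s)"
 using subalgebra_path_filtration[of S s] sets_P space_P by (simp add: subalgebra_def)

lemma filtration_measurable: "g \<in> borel_measurable (path_filtration S s) \<Longrightarrow> g \<in> borel_measurable P"
 by (rule measurable_from_subalg[OF subalg])

lemma G_bounded: "f \<in> test_functions \<Longrightarrow> \<exists>C. \<forall>x. norm (G f x) \<le> C"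
proof -
 assume f: "f \<in> test_functions"
 define B where "B = (\<Sum>j\<in>UNIV. \<Sum>l\<in>UNIV. \<bar>Gc j l\<bar> + \<bar>Gs j l\<bar> + \<bar>G1 j l\<bar>) + (\<Sum>j\<in>UNIV. \<bar>Lc j\<bar> + \<bar>Ls j\<bar> + \<bar>\<kappa> j\<bar>)"
 have s2: "h j l \<le> (\<Sum>j\<in>UNIV. \<Sum>l\<in>UNIV. h j l)" if "\<And>j l. 0 \<le> h j l" for h :: "'n \<Rightarrow> 'n \<Rightarrow> real" and j l
 proof -
  have "h j l \<le> (\<Sum>l\<in>UNIV. h j l)" using that by (intro member_le_sum) auto
  also have "\<dots> \<le> (\<Sum>j\<in>UNIV. \<Sum>l\<in>UNIV. h j l)"
   using member_le_sum[of j UNIV "\<lambda>j. \<Sum>l\<in>UNIV. h j l"] that by (simp add: sum_nonneg)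
  finally show ?thesis .
 qed
 have s1: "h j \<le> (\<Sum>j\<in>UNIV. h j)" if "\<And>j. 0 \<le> h j" for h :: "'n \<Rightarrow> real" and j
  using that by (intro member_le_sum) auto
 have p1: "0 \<le> (\<Sum>j\<in>UNIV. \<bar>Lc j\<bar> + \<bar>Ls j\<bar> + \<bar>\<kappa> j\<bar>)" by (intro sum_nonneg) auto
 have p2: "0 \<le> (\<Sum>j\<in>UNIV. \<Sum>l\<in>UNIV. \<bar>Gc j l\<bar> + \<bar>Gs j l\<bar> + \<bar>G1 j l\<bar>)" by (intro sum_nonneg) auto
 have b2: "\<bar>Gc j l\<bar> + \<bar>Gs j l\<bar> + \<bar>G1 j l\<bar> \<le> B" for j l
  using s2[of "\<lambda>j l. \<bar>Gc j l\<bar> + \<bar>Gs j l\<bar> + \<bar>G1 j l\<bar>" j l] p1 by (simp add: B_def)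
 have b1: "\<bar>Lc j\<bar> + \<bar>Ls j\<bar> + \<bar>\<kappa> j\<bar> \<le> B" for j
  using s1[of "\<lambda>j. \<bar>Lc j\<bar> + \<bar>Ls j\<bar> + \<bar>\<kappa> j\<bar>" j] p2 by (simp add: B_def)
 have B: "\<bar>Gc j l\<bar> \<le> B" "\<bar>Gs j l\<bar> \<le> B" "\<bar>G1 j l\<bar> \<le> B" "\<bar>Lc j\<bar> \<le> B" "\<bar>Ls j\<bar> \<le> B" "\<bar>\<kappa> j\<bar> \<le> B" for j l
  using b2[of j l] b1[of j] by linarith+
 show ?thesis by (rule gen_bounded[OF f]) (metis B)
qed

definition mart :: "('n state \<Rightarrow> complex) \<Rightarrow> real \<Rightarrow> (real \<Rightarrow> 'n state) \<Rightarrow> complex" where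
 "mart f t w = f (w t) - f (w 0) - (LBINT s:{0..t}. G f (w s))"

lemma real_orthogonal:
 assumes X: "real_martingale P (path_filtration S) X" and st: "0 \<le> s" "s \<le> t"
  and g: "g \<in> borel_measurable (path_filtration S s)" "\<And>w. w \<in> space P \<Longrightarrow> \<bar>g w\<bar> \<le> K"
 shows "integrable P (\<lambda>w. g w * X t w)" "integrable P (\<lambda>w. g w * X s w)" "(\<integral>w. g w * X t w \<partial>P) = (\<integral>w. g w * X s w \<partial>P)"
proof -
 interpret sub: finite_measure_subalgebra P "path_filtration S s"
  by unfold_locales (rule subalg)
 have gP: "g \<in> borel_measurable P" by (rule filtration_measurable[OF g(1)])
 have iX: "integrable P (X t)" "integrable P (X s)" using X st by (auto simp: real_martingale_def)
 have bI: "integrable P (\<lambda>w. g w * Y w)" if "integrable P Y" for Y :: "_ \<Rightarrow> real"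
 proof (rule Bochner_Integration.integrable_bound)
  show "integrable P (\<lambda>w. K * Y w)" using that by simp
  show "(\<lambda>w. g w * Y w) \<in> borel_measurable P" using gP that by measurable
  show "AE w in P. norm (g w * Y w) \<le> norm (K * Y w)"
  proof (rule AE_I2)
   fix w assume w: "w \<in> space P"
   have "\<bar>g w\<bar> \<le> \<bar>K\<bar>" using g(2)[OF w] by linarith
   then show "norm (g w * Y w) \<le> norm (K * Y w)" by (simp add: abs_mult mult_right_mono)
  qed
 qed
 show i: "integrable P (\<lambda>w. g w * X t w)" "integrable P (\<lambda>w. g w * X s w)" using bI iX by auto
 have "(\<integral>w. g w * real_cond_exp P (path_filtration S s) (X t) w \<partial>P) = (\<integral>w. g w * X t w \<partial>P)"
  by (rule sub.real_cond_exp_intg(2)[OF i(1) g(1)]) (use iX in auto)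
 moreover have "(\<integral>w. g w * real_cond_exp P (path_filtration S s) (X t) w \<partial>P) = (\<integral>w. g w * X s w \<partial>P)"
 proof (rule integral_cong_AE)
  have "AE w in P. real_cond_exp P (path_filtration S s) (X t) w = X s w"
   using X st unfolding real_martingale_def by blast
  then show "AE w in P. g w * real_cond_exp P (path_filtration S s) (X t) w = g w * X s w"
   by eventually_elim simp
  show "(\<lambda>w. g w * real_cond_exp P (path_filtration S s) (X t) w) \<in> borel_measurable P"
   by (intro borel_measurable_times gP borel_measurable_cond_exp2)
  show "(\<lambda>w. g w * X s w) \<in> borel_measurable P" using i by auto
 qed
 ultimately show "(\<integral>w. g w * X t w \<partial>P) = (\<integral>w. g w * X s w \<partial>P)" by simp
qed

lemma orthogonal:
 fixes g :: "_ \<Rightarrow> complex"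
 assumes f: "f \<in> test_functions" and st: "0 \<le> s" "s \<le> t"
  and g: "g \<in> borel_measurable (path_filtration S s)" "\<And>w. w \<in> space P \<Longrightarrow> norm (g w) \<le> K"
 shows "(\<integral>w. g w * (mart f t w - mart f s w) \<partial>P) = 0"
proof -
 have m: "real_martingale P (path_filtration S) (\<lambda>t w. Re (mart f t w))"
  "real_martingale P (path_filtration S) (\<lambda>t w. Im (mart f t w))"
  using sol f by (auto simp: solves_martingale_problem_def complex_martingale_def mart_def)
 have g': "(\<lambda>w. Re (g w)) \<in> borel_measurable (path_filtration S s)" "(\<lambda>w. Im (g w)) \<in> borel_measurable (path_filtration S s)"
  using g(1) by measurable
 have gb: "\<bar>Re (g w)\<bar> \<le> K" "\<bar>Im (g w)\<bar> \<le> K" if "w \<in> space P" for w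
  using g(2)[OF that] abs_Re_le_cmod[of "g w"] abs_Im_le_cmod[of "g w"] by linarith+
 note o = real_orthogonal[OF m(1) st g'(1) gb(1)] real_orthogonal[OF m(1) st g'(2) gb(2)]
  real_orthogonal[OF m(2) st g'(1) gb(1)] real_orthogonal[OF m(2) st g'(2) gb(2)]
 let ?D = "\<lambda>w. mart f t w - mart f s w"
 define X where "X w = (Re (g w) * Re (mart f t w) - Re (g w) * Re (mart f s w)) - (Im (g w) * Im (mart f t w) - Im (g w) * Im (mart f s w))" for w
 define Y where "Y w = (Re (g w) * Im (mart f t w) - Re (g w) * Im (mart f s w)) + (Im (g w) * Re (mart f t w) - Im (g w) * Re (mart f s w))" for w
 have X: "integrable P X" "(\<integral>w. X w \<partial>P) = 0" and Y: "integrable P Y" "(\<integral>w. Y w \<partial>P) = 0"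
  unfolding X_def[abs_def] Y_def[abs_def] using o by simp_all
 have eq: "g w * ?D w = of_real (X w) + \<i> * of_real (Y w)" for w
  by (simp add: complex_eq_iff algebra_simps X_def Y_def)
 show ?thesis
  unfolding eq using X Y by simp
qed

lemma mart_increment:
 assumes f: "f \<in> test_functions" and st: "0 \<le> s" "s \<le> t" and w: "w \<in> space P"
 shows "mart f t w - mart f s w = f (w t) - f (w s) - (LBINT u:{s..t}. G f (w u))"
proof -
 have "continuous_on {0..t} (\<lambda>u. G f (w u))"
  by (rule comp_continuous[OF w gen_continuous[OF f]]) auto
 from set_integral_split[OF this st] show ?thesis by (simp add: mart_def algebra_simps)
qed

text \<open>The weight \<open>g\<close> is any bounded function of the past up to \<open>s\<close>.
  The constant 1 gives the evolution of one-time expectations; products of functions of earlier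
  values give that of multi-time laws.\<close>

lemma dynkin:
 fixes g :: "_ \<Rightarrow> complex"
 assumes f: "f \<in> test_functions" and st: "0 \<le> s" "s \<le> t"
  and g: "g \<in> borel_measurable (path_filtration S s)" "\<And>w. w \<in> space P \<Longrightarrow> norm (g w) \<le> K"
 shows "(\<integral>w. g w * f (w t) \<partial>P) - (\<integral>w. g w * f (w s) \<partial>P) = (LBINT u:{s..t}. (\<integral>w. g w * G f (w u) \<partial>P))"
proof -
 have gP[measurable]: "g \<in> borel_measurable P" by (rule filtration_measurable[OF g(1)])
 obtain w0 where "w0 \<in> space P" using not_empty by blast
 then have K: "0 \<le> K" using g(2) norm_ge_zero order_trans by blast
 obtain C where C: "\<And>x. norm (G f x) \<le> C" using G_bounded[OF f] by blast
 obtain B where B: "\<And>x. norm (f x) \<le> B" using test_functionsD(2)[OF f] unfolding bounded_iff by blast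
 have mG: "(\<lambda>w. g w * G f (w u)) \<in> borel_measurable P" if "u \<in> {s..t}" for u
  using comp_measurable[OF _ gen_continuous[OF f], of u] that st gP by (intro borel_measurable_times) auto
 have cG: "continuous_on {s..t} (\<lambda>u. g w * G f (w u))" if "w \<in> space P" for w
  using comp_continuous[OF that gen_continuous[OF f], of "{s..t}"] st by (intro continuous_intros) auto
 have bG: "norm (g w * G f (w u)) \<le> K * C" if "w \<in> space P" for w u
  unfolding norm_mult by (intro mult_mono g(2) that C K) auto
 have if_: "integrable P (\<lambda>w. g w * f (w u))" if "u \<ge> 0" for u
 proof (rule integrable_const_bound[where B="K * B"])
  show "AE w in P. norm (g w * f (w u)) \<le> K * B"
   unfolding norm_mult by (intro AE_I2 mult_mono g(2) B K) auto
  show "(\<lambda>w. g w * f (w u)) \<in> borel_measurable P"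
   using comp_measurable[OF that test_functionsD(1)[OF f]] gP by measurable
 qed
 have eqI: "g w * (LBINT u:{s..t}. G f (w u)) = (LBINT u:{s..t}. g w * G f (w u))" for w
  by (rule set_integral_mult_right[symmetric])
 have iI: "integrable P (\<lambda>w. LBINT u:{s..t}. g w * G f (w u))"
 proof (rule integrable_const_bound[where B="(t - s) * (K * C)"])
  show "(\<lambda>w. LBINT u:{s..t}. g w * G f (w u)) \<in> borel_measurable P"
   by (rule measurable_time_integral[OF mG cG st(2)])
  show "AE w in P. norm (LBINT u:{s..t}. g w * G f (w u)) \<le> (t - s) * (K * C)"
  proof (rule AE_I2)
   fix w assume w: "w \<in> space P"
   have "norm (LBINT u:{s..t}. g w * G f (w u)) \<le> (LBINT u:{s..t}. K * C)"
    unfolding set_lebesgue_integral_def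
   proof (rule order_trans[OF integral_norm_bound integral_mono])
    show "integrable lborel (\<lambda>u. norm (indicator {s..t} u *\<^sub>R (g w * G f (w u))))"
     using borel_integrable_atLeastAtMost'[OF cG[OF w]] unfolding set_integrable_def by (rule integrable_norm)
    show "integrable lborel (\<lambda>u. indicator {s..t} u *\<^sub>R (K * C))"
     using borel_integrable_atLeastAtMost'[OF continuous_on_const, of s t "K * C"] by (simp add: set_integrable_def)
    show "norm (indicator {s..t} u *\<^sub>R (g w * G f (w u))) \<le> indicator {s..t} u *\<^sub>R (K * C)" for u
     using bG[OF w, of u] by (auto simp: indicator_def)
   qed
   also have "(LBINT u:{s..t}. K * C) = (t - s) * (K * C)" using st by (simp add: set_lebesgue_integral_def)
   finally show "norm (LBINT u:{s..t}. g w * G f (w u)) \<le> (t - s) * (K * C)" .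
  qed
 qed
 have "0 = (\<integral>w. g w * (mart f t w - mart f s w) \<partial>P)" using orthogonal[OF f st g] by simp
 also have "\<dots> = (\<integral>w. (g w * f (w t) - g w * f (w s)) - (LBINT u:{s..t}. g w * G f (w u)) \<partial>P)"
  by (intro Bochner_Integration.integral_cong refl) (simp only: mart_increment[OF f st] eqI[symmetric] right_diff_distrib)
 also have "\<dots> = ((\<integral>w. g w * f (w t) \<partial>P) - (\<integral>w. g w * f (w s) \<partial>P)) - (\<integral>w. (LBINT u:{s..t}. g w * G f (w u)) \<partial>P)"
  using if_ iI st by simp
 also have "(\<integral>w. (LBINT u:{s..t}. g w * G f (w u)) \<partial>P) = (LBINT u:{s..t}. (\<integral>w. g w * G f (w u) \<partial>P))"
  by (rule expectation_time_integral[OF mG cG st(2) bG prob_space_axioms])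
 finally show ?thesis by simp
qed

definition "rad = norm (fst y)"

lemma cutoff_test:
 fixes F :: "(complex, 'n) vec \<Rightarrow> complex" and h :: "L2 \<Rightarrow> complex"
 assumes "continuous_on UNIV h" "bounded (range h)" and F: "C2 F D1 D2"
 shows "(\<lambda>x. (of_real (cutoff r ((norm (fst x))\<^sup>2)) * F (fst x)) * h (snd x)) \<in> test_functions"
proof (rule test_function_prod[OF C2_mult[OF C2_cutoff F]])
 fix T :: "(complex, 'n) vec" assume T: "norm T > sqrt (\<bar>r\<bar> + 1)"
 have "(sqrt (\<bar>r\<bar> + 1))\<^sup>2 < (norm T)\<^sup>2" by (rule power_strict_mono[OF T]) auto
 then have "r + 1 \<le> (norm T)\<^sup>2" by simp
 then show "of_real (cutoff r ((norm T)\<^sup>2)) * F T = 0" by (simp add: cutoff_props(4))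
qed (use assms in auto)

text \<open>The cutoff placed at the initial squared radius starts at its maximum 1 and has drift
  \<open>- cutoff'\<close> times a nonnegative sum, so its expectation cannot fall below 1. Since
  the cutoff is strictly less than 1 beyond that radius, the path is almost surely inside.\<close>

lemma in_ball_at:
 assumes t: "0 \<le> t"
 shows "AE w in P. norm (fst (w t)) \<le> rad"
proof -
 let ?f = "\<lambda>x :: 'n state. (of_real (cutoff (rad\<^sup>2) ((norm (fst x))\<^sup>2)) * 1) * (1 :: complex)"
 have f: "?f \<in> test_functions"
  by (rule cutoff_test[where h="\<lambda>_. 1" and F="\<lambda>_. 1", OF _ _ C2_const]) auto
 have Gf: "G ?f x = of_real (- cutoff' (rad\<^sup>2) ((norm (fst x))\<^sup>2) * (\<Sum>j\<in>UNIV. Lc j * (cmod (fst x $ j))\<^sup>2))" for x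
  using gen_prod[OF C2_cutoff[of "rad\<^sup>2"], of Gc Gs G1 Lc Ls \<kappa> "\<lambda>_. 1" x] jet_op_radial[of Gc, OF sym diag]
  by simp
 have c: "continuous_on UNIV (\<lambda>x :: 'n state. cutoff (rad\<^sup>2) ((norm (fst x))\<^sup>2))"
  unfolding cutoff_def by (intro continuous_intros)
 have m: "(\<lambda>w. cutoff (rad\<^sup>2) ((norm (fst (w t)))\<^sup>2)) \<in> borel_measurable P"
  by (rule comp_measurable[OF t c])
 have "(\<integral>w. 1 * ?f (w t) \<partial>P) - (\<integral>w. 1 * ?f (w 0) \<partial>P) = (LBINT u:{0..t}. (\<integral>w. 1 * G ?f (w u) \<partial>P))"
  by (rule dynkin[OF f order_refl t, where g="\<lambda>_. 1" and K=1]) auto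
 moreover have "(\<integral>w. 1 * ?f (w 0) \<partial>P) = (\<integral>w. 1 \<partial>P)"
  using start comp_measurable[OF order_refl test_functionsD(1)[OF f]]
  by (intro integral_cong_AE) (auto simp: rad_def cutoff_props)
 moreover have "0 \<le> Re (LBINT u:{0..t}. (\<integral>w. 1 * G ?f (w u) \<partial>P))"
 proof -
  have "(\<integral>w. 1 * G ?f (w u) \<partial>P) = of_real (\<integral>w. - cutoff' (rad\<^sup>2) ((norm (fst (w u)))\<^sup>2) * (\<Sum>j\<in>UNIV. Lc j * (cmod (fst (w u) $ j))\<^sup>2) \<partial>P)" for u
   unfolding Gf by (simp del: of_real_mult of_real_minus of_real_sum)
  then have "(LBINT u:{0..t}. (\<integral>w. 1 * G ?f (w u) \<partial>P)) = of_real (LBINT u:{0..t}. (\<integral>w. - cutoff' (rad\<^sup>2) ((norm (fst (w u)))\<^sup>2) * (\<Sum>j\<in>UNIV. Lc j * (cmod (fst (w u) $ j))\<^sup>2) \<partial>P))"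
   by (simp only: set_integral_complex_of_real)
  moreover have "0 \<le> (LBINT u:{0..t}. (\<integral>w. - cutoff' (rad\<^sup>2) ((norm (fst (w u)))\<^sup>2) * (\<Sum>j\<in>UNIV. Lc j * (cmod (fst (w u) $ j))\<^sup>2) \<partial>P))"
   unfolding set_lebesgue_integral_def
   by (intro Bochner_Integration.integral_nonneg scaleR_nonneg_nonneg mult_nonneg_nonneg sum_nonneg Lc)
    (auto simp: cutoff_props(7))
  ultimately show ?thesis by simp
 qed
 moreover have "(\<integral>w. 1 * ?f (w t) \<partial>P) = of_real (\<integral>w. cutoff (rad\<^sup>2) ((norm (fst (w t)))\<^sup>2) \<partial>P)" by simp
 ultimately have ge: "1 \<le> (\<integral>w. cutoff (rad\<^sup>2) ((norm (fst (w t)))\<^sup>2) \<partial>P)"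
  by (simp add: complex_eq_iff prob_space)
 have i: "integrable P (\<lambda>w. cutoff (rad\<^sup>2) ((norm (fst (w t)))\<^sup>2))"
  by (rule integrable_const_bound[where B=1]) (use m cutoff_props in auto)
 have "(\<integral>w. 1 - cutoff (rad\<^sup>2) ((norm (fst (w t)))\<^sup>2) \<partial>P) = 1 - (\<integral>w. cutoff (rad\<^sup>2) ((norm (fst (w t)))\<^sup>2) \<partial>P)"
  using i by (simp add: prob_space)
 moreover have "0 \<le> (\<integral>w. 1 - cutoff (rad\<^sup>2) ((norm (fst (w t)))\<^sup>2) \<partial>P)"
  by (intro Bochner_Integration.integral_nonneg) (simp add: cutoff_props)
 ultimately have "(\<integral>w. 1 - cutoff (rad\<^sup>2) ((norm (fst (w t)))\<^sup>2) \<partial>P) = 0" using ge by linarith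
 then have "AE w in P. 1 - cutoff (rad\<^sup>2) ((norm (fst (w t)))\<^sup>2) = 0"
  using i by (subst (asm) integral_nonneg_eq_0_iff_AE) (auto simp: cutoff_props)
 then show ?thesis
 proof eventually_elim
  case (elim w)
  then have "(norm (fst (w t)))\<^sup>2 \<le> rad\<^sup>2" using cutoff_props(8)[of "rad\<^sup>2" "(norm (fst (w t)))\<^sup>2"] by linarith
  then show ?case by (rule power2_le_imp_le) (simp add: rad_def)
 qed
qed

text \<open>On the closed ball, boundary included, the cutoff is 1 and its first and second
  derivatives vanish, so the generator does not notice the factor there.\<close>

lemma cutoff_jet:
 assumes F: "C2 F D1 D2" and T: "norm T \<le> rad"
 shows "G (\<lambda>x. (of_real (cutoff (rad\<^sup>2) ((norm (fst x))\<^sup>2)) * F (fst x)) * h (snd x)) (T, \<phi>)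
  = jet_op Gc Gs G1 Lc Ls \<kappa> T (\<lambda>c. D1 c T) (\<lambda>c e. D2 c e T) * h \<phi>"
proof -
 have "(norm T)\<^sup>2 \<le> rad\<^sup>2" using T by (intro power_mono) auto
 then show ?thesis
  using gen_prod[OF C2_mult[OF C2_cutoff[of "rad\<^sup>2"] F], of Gc Gs G1 Lc Ls \<kappa> h "(T, \<phi>)"]
  by (simp add: cutoff_props)
qed

text \<open>The truncated distance of the L2 component from its start is a test function once cut
  off in T; inside the ball the generator annihilates it, so its expectation stays 0. Confinement
  has to come first, because outside the ball the cutoff would contribute a drift.\<close>

lemma const_at:
 assumes t: "0 \<le> t"
 shows "AE w in P. snd (w t) = snd y"
proof -
 define h :: "L2 \<Rightarrow> real" where "h \<phi> = min 1 (norm (\<phi> - snd y))" for \<phi>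
 have ch: "continuous_on UNIV h" unfolding h_def by (intro continuous_intros)
 have h: "0 \<le> h \<phi>" "h \<phi> \<le> 1" for \<phi> by (auto simp: h_def)
 let ?f = "\<lambda>x :: 'n state. (of_real (cutoff (rad\<^sup>2) ((norm (fst x))\<^sup>2)) * 1) * complex_of_real (h (snd x))"
 have f: "?f \<in> test_functions"
  by (rule cutoff_test[where h="\<lambda>\<phi>. complex_of_real (h \<phi>)" and F="\<lambda>_. 1", OF _ _ C2_const])
   (auto simp: bounded_iff h intro!: continuous_on_of_real ch exI[of _ 1])
 have G0: "G ?f x = 0" if "norm (fst x) \<le> rad" for x
  using cutoff_jet[OF C2_const[of 1] that, of "\<lambda>\<phi>. complex_of_real (h \<phi>)" "snd x"] by (simp add: jet_op_zero)
 have "(\<integral>w. 1 * G ?f (w u) \<partial>P) = 0" if "u \<in> {0..t}" for u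
 proof -
  have "AE w in P. norm (fst (w u)) \<le> rad" by (rule in_ball_at) (use that in simp)
  then have "AE w in P. 1 * G ?f (w u) = 0" by eventually_elim (simp only: G0 mult_zero_right)
  then show ?thesis by (rule integral_eq_zero_AE)
 qed
 then have "(LBINT u:{0..t}. (\<integral>w. 1 * G ?f (w u) \<partial>P)) = (LBINT u:{0..t}. 0)"
  by (intro set_lebesgue_integral_cong) auto
 moreover have "(\<integral>w. 1 * ?f (w t) \<partial>P) - (\<integral>w. 1 * ?f (w 0) \<partial>P) = (LBINT u:{0..t}. (\<integral>w. 1 * G ?f (w u) \<partial>P))"
  by (rule dynkin[OF f order_refl t, where g="\<lambda>_. 1" and K=1]) auto
 moreover have "(\<integral>w. 1 * ?f (w 0) \<partial>P) = 0"
 proof (rule integral_eq_zero_AE)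
  show "AE w in P. 1 * ?f (w 0) = 0" using start by eventually_elim (simp add: h_def)
 qed
 moreover have mh: "(\<lambda>w. h (snd (w t))) \<in> borel_measurable P"
  by (rule comp_measurable[OF t]) (intro continuous_on_compose2[OF ch] continuous_intros, auto)
 have "(\<integral>w. 1 * ?f (w t) \<partial>P) = (\<integral>w. complex_of_real (h (snd (w t))) \<partial>P)"
 proof (rule integral_cong_AE)
  show "(\<lambda>w. 1 * ?f (w t)) \<in> borel_measurable P" using comp_measurable[OF t test_functionsD(1)[OF f]] by simp
  show "AE w in P. 1 * ?f (w t) = complex_of_real (h (snd (w t)))"
   using in_ball_at[OF t]
  proof eventually_elim
   case (elim w)
   then have "(norm (fst (w t)))\<^sup>2 \<le> rad\<^sup>2" by (intro power_mono) auto
   then show ?case by (simp add: cutoff_props)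
  qed
 qed (use mh in measurable)
 ultimately have "(\<integral>w. h (snd (w t)) \<partial>P) = 0" by simp
 moreover have "integrable P (\<lambda>w. h (snd (w t)))"
  by (rule integrable_const_bound[where B=1]) (use mh h in auto)
 ultimately have "AE w in P. h (snd (w t)) = 0"
  by (subst (asm) integral_nonneg_eq_0_iff_AE) (auto simp: h)
 then show ?thesis by eventually_elim (auto simp: h_def min_def split: if_splits)
qed

definition "good w \<longleftrightarrow> w 0 = y \<and> (\<forall>t\<ge>0. norm (fst (w t)) \<le> rad \<and> snd (w t) = snd y)"

text \<open>Each property holds almost surely at a fixed time, hence simultaneously at all rational
  times, hence by continuity of the path at all times.\<close>

lemma AE_good: "AE w in P. good w"
proof -
 have "AE w in P. \<forall>q\<in>{q\<in>\<rat>. 0 \<le> q}. norm (fst (w q)) \<le> rad \<and> snd (w q) = snd y"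
 proof (subst AE_ball_countable)
  show "countable {q\<in>\<rat>. 0 \<le> (q::real)}" by (rule countable_subset[OF _ countable_rat]) auto
  show "\<forall>q\<in>{q\<in>\<rat>. 0 \<le> q}. AE w in P. norm (fst (w q)) \<le> rad \<and> snd (w q) = snd y"
   using in_ball_at const_at by auto
 qed
 then show ?thesis
  using start AE_space
 proof eventually_elim
  case (elim w)
  have c: "continuous_on {0..} w" using path_cont elim by auto
  \<comment> \<open>The time is written as an integer multiple of a point of [0, 1], so that
    \<open>rational_interval_bound\<close> applies; multiplication by an integer keeps rational
    points rational.\<close>
  have key: "g (w t) \<le> B" if g: "continuous_on UNIV g" "\<And>q. q \<in> \<rat> \<Longrightarrow> 0 \<le> q \<Longrightarrow> g (w q) \<le> B" and t: "0 \<le> t"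
   for g :: "'n state \<Rightarrow> real" and B t
  proof -
   obtain M where M: "t < real M" "M > 0" using reals_Archimedean2[of t] by (metis gr0I le_less_trans less_irrefl of_nat_0 t)
   have "g (w (real M * (t / real M))) \<le> B"
   proof (rule rational_interval_bound[where g="\<lambda>u. g (w (real M * u))"])
    show "continuous_on {0..1} (\<lambda>u. g (w (real M * u)))"
     by (intro continuous_on_compose2[OF g(1)] continuous_on_compose2[OF c] continuous_intros) auto
    show "t / real M \<in> {0..1}" using M t by auto
   qed (use g(2) in auto)
   then show ?thesis using M by simp
  qed
  show "good w" unfolding good_def
  proof (intro conjI allI impI)
   show "w 0 = y" using elim by simp
   fix t :: real assume t: "0 \<le> t"
   show "norm (fst (w t)) \<le> rad"
    by (rule key[OF _ _ t]) (use elim in \<open>auto intro!: continuous_intros\<close>)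
   have "norm (snd (w t) - snd y) \<le> 0"
    by (rule key[OF _ _ t]) (use elim in \<open>auto intro!: continuous_intros\<close>)
   then show "snd (w t) = snd y" by simp
  qed
 qed
qed

lemma jet_continuous:
 assumes F: "C2 F D1 D2"
 shows "continuous_on UNIV (\<lambda>T. jet_op Gc Gs G1 Lc Ls \<kappa> T (\<lambda>c. D1 c T) (\<lambda>c e. D2 c e T))"
proof -
 have c: "isCont (D1 c) T" "isCont (D2 c e) T" for c e T
  using C2D(4,5)[OF F] by (simp_all only: continuous_on_eq_continuous_at[OF open_UNIV] ball_UNIV)
 have "isCont (\<lambda>T. jet_op Gc Gs G1 Lc Ls \<kappa> T (\<lambda>c. D1 c T) (\<lambda>c e. D2 c e T)) T" for T
  unfolding isCont_def
  by (rule jet_op_tendsto; (rule tendsto_const tendsto_ident_at c[unfolded isCont_def])?)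
 then show ?thesis by (simp only: continuous_on_eq_continuous_at[OF open_UNIV] ball_UNIV) simp
qed

text \<open>Dynkin's formula for functions without bounded support, monomials in particular: almost
  surely the path never leaves the ball on which \<open>F\<close> coincides with its cut-off
  version.\<close>

lemma dynkin_C2:
 fixes g :: "_ \<Rightarrow> complex"
 assumes F: "C2 F D1 D2" and st: "0 \<le> s" "s \<le> t"
  and g: "g \<in> borel_measurable (path_filtration S s)" "\<And>w. w \<in> space P \<Longrightarrow> norm (g w) \<le> K"
 shows "(\<integral>w. g w * F (fst (w t)) \<partial>P) - (\<integral>w. g w * F (fst (w s)) \<partial>P)
  = (LBINT u:{s..t}. (\<integral>w. g w * jet_op Gc Gs G1 Lc Ls \<kappa> (fst (w u)) (\<lambda>c. D1 c (fst (w u))) (\<lambda>c e. D2 c e (fst (w u))) \<partial>P))"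
proof -
 let ?f = "\<lambda>x :: 'n state. (of_real (cutoff (rad\<^sup>2) ((norm (fst x))\<^sup>2)) * F (fst x)) * (1::complex)"
 let ?J = "\<lambda>T. jet_op Gc Gs G1 Lc Ls \<kappa> T (\<lambda>c. D1 c T) (\<lambda>c e. D2 c e T)"
 have f: "?f \<in> test_functions"
  by (rule cutoff_test[where h="\<lambda>_. 1", OF _ _ F]) auto
 have gP[measurable]: "g \<in> borel_measurable P" by (rule filtration_measurable[OF g(1)])
 have cF: "continuous_on UNIV F" by (rule C2D(3)[OF F])
 have cfst: "continuous_on UNIV (\<lambda>x :: 'n state. H (fst x))" if "continuous_on UNIV H" for H :: "_ \<Rightarrow> complex"
  by (intro continuous_on_compose2[OF that] continuous_intros) auto
 have 1: "(\<integral>w. g w * ?f (w u) \<partial>P) = (\<integral>w. g w * F (fst (w u)) \<partial>P)" if "u \<ge> 0" for u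
 proof (rule integral_cong_AE)
  show "AE w in P. g w * ?f (w u) = g w * F (fst (w u))"
   using AE_good
  proof eventually_elim
   case (elim w)
   then have "(norm (fst (w u)))\<^sup>2 \<le> rad\<^sup>2" using that by (intro power_mono) (auto simp: good_def)
   then show ?case by (simp add: cutoff_props)
  qed
  show "(\<lambda>w. g w * ?f (w u)) \<in> borel_measurable P"
   using comp_measurable[OF that test_functionsD(1)[OF f]] by measurable
  show "(\<lambda>w. g w * F (fst (w u))) \<in> borel_measurable P"
   using comp_measurable[OF that cfst[OF cF]] by measurable
 qed
 have 2: "(\<integral>w. g w * G ?f (w u) \<partial>P) = (\<integral>w. g w * ?J (fst (w u)) \<partial>P)" if "u \<ge> 0" for u
 proof (rule integral_cong_AE)
  show "AE w in P. g w * G ?f (w u) = g w * ?J (fst (w u))"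
   using AE_good
  proof eventually_elim
   case (elim w)
   then have "norm (fst (w u)) \<le> rad" using that by (auto simp: good_def)
   from cutoff_jet[OF F this, of "\<lambda>_. 1" "snd (w u)"] show ?case by simp
  qed
  show "(\<lambda>w. g w * G ?f (w u)) \<in> borel_measurable P"
   using comp_measurable[OF that gen_continuous[OF f]] by measurable
  show "(\<lambda>w. g w * ?J (fst (w u))) \<in> borel_measurable P"
   using comp_measurable[OF that cfst[OF jet_continuous[OF F]]] by measurable
 qed
 have "(LBINT u:{s..t}. (\<integral>w. g w * G ?f (w u) \<partial>P)) = (LBINT u:{s..t}. (\<integral>w. g w * ?J (fst (w u)) \<partial>P))"
  by (rule set_lebesgue_integral_cong) (use 2 st in auto)
 then show ?thesis using dynkin[OF f st g] 1[of t] 1[of s] st by simp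
qed

end

section \<open>Uniqueness of the diffusion\<close>

text \<open>Monomials are indexed by words. Words that differ by a permutation give the same
  function; the redundancy does no harm, since only a closed linear system for the moments is
  sought.\<close>

definition mon :: "('n::finite \<times> bool) list \<Rightarrow> (complex, 'n) vec \<Rightarrow> complex" where
 "mon ls T = (\<Prod>c\<leftarrow>ls. Zc c T)"

lemma mon_simps[simp]: "mon [] = (\<lambda>T. 1)" "mon (c # ls) = (\<lambda>T. Zc c T * mon ls T)"
 by (auto simp: mon_def)

definition homog :: "nat \<Rightarrow> ((complex, 'n::finite) vec \<Rightarrow> complex) set" where
 "homog m = {F. \<exists>A. F = (\<lambda>T. \<Sum>ls\<in>{ls. length ls = m}. A ls * mon ls T)}"

lemma finite_words: "finite {ls :: ('n::finite \<times> bool) list. length ls = m}"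
 using finite_lists_length_eq[of "UNIV :: ('n \<times> bool) set" m] by simp

lemma homog_add: "F \<in> homog m \<Longrightarrow> G \<in> homog m \<Longrightarrow> (\<lambda>T. F T + G T) \<in> homog m"
proof -
 assume "F \<in> homog m" "G \<in> homog m"
 then obtain A B where "F = (\<lambda>T. \<Sum>ls\<in>{ls. length ls = m}. A ls * mon ls T)" "G = (\<lambda>T. \<Sum>ls\<in>{ls. length ls = m}. B ls * mon ls T)"
  by (auto simp: homog_def)
 then have "(\<lambda>T. F T + G T) = (\<lambda>T. \<Sum>ls\<in>{ls. length ls = m}. (A ls + B ls) * mon ls T)"
  by (simp add: sum.distrib distrib_right)
 then show ?thesis unfolding homog_def mem_Collect_eq by (rule exI[of _ "\<lambda>ls. A ls + B ls"])
qed

lemma homog_cmult: "F \<in> homog m \<Longrightarrow> (\<lambda>T. a * F T) \<in> homog m"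
proof -
 assume "F \<in> homog m"
 then obtain A where "F = (\<lambda>T. \<Sum>ls\<in>{ls. length ls = m}. A ls * mon ls T)" by (auto simp: homog_def)
 then have "(\<lambda>T. a * F T) = (\<lambda>T. \<Sum>ls\<in>{ls. length ls = m}. (a * A ls) * mon ls T)"
  by (simp add: sum_distrib_left mult.assoc)
 then show ?thesis unfolding homog_def mem_Collect_eq by (rule exI[of _ "\<lambda>ls. a * A ls"])
qed

lemma homog_diff: "F \<in> homog m \<Longrightarrow> G \<in> homog m \<Longrightarrow> (\<lambda>T. F T - G T) \<in> homog m"
 using homog_add[OF _ homog_cmult[of G m "- 1"], of F] by simp

lemma homog_zero: "(\<lambda>T. 0) \<in> homog m"
 unfolding homog_def mem_Collect_eq by (rule exI[of _ "\<lambda>_. 0"]) simp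

lemma homog_sum: "finite I \<Longrightarrow> (\<And>i. i \<in> I \<Longrightarrow> F i \<in> homog m) \<Longrightarrow> (\<lambda>T. \<Sum>i\<in>I. F i T) \<in> homog m"
 by (induction I rule: finite_induct) (auto intro: homog_zero homog_add)

lemma homog_mon: "mon ls \<in> homog (length ls)"
proof -
 have "mon ls = (\<lambda>T. \<Sum>ls'\<in>{ls'. length ls' = length ls}. (if ls' = ls then 1 else 0) * mon ls' T)"
 proof
  fix T
  have "(\<Sum>ls'\<in>{ls'. length ls' = length ls}. (if ls' = ls then 1 else 0) * mon ls' T)
   = (\<Sum>ls'\<in>{ls'. length ls' = length ls}. if ls' = ls then mon ls T else 0)"
   by (intro sum.cong refl) auto
  also have "\<dots> = mon ls T" by (simp add: sum.delta[OF finite_words])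
  finally show "mon ls T = (\<Sum>ls'\<in>{ls'. length ls' = length ls}. (if ls' = ls then 1 else 0) * mon ls' T)" ..
 qed
 then show ?thesis unfolding homog_def mem_Collect_eq by (rule exI[of _ "\<lambda>ls'. if ls' = ls then 1 else 0"])
qed

lemma homog_Zc: "F \<in> homog m \<Longrightarrow> (\<lambda>T. Zc c T * F T) \<in> homog (Suc m)"
proof -
 assume "F \<in> homog m"
 then obtain A where "F = (\<lambda>T. \<Sum>ls\<in>{ls. length ls = m}. A ls * mon ls T)" by (auto simp: homog_def)
 then have "(\<lambda>T. Zc c T * F T) = (\<lambda>T. \<Sum>ls\<in>{ls. length ls = m}. A ls * mon (c # ls) T)"
  by (simp add: sum_distrib_left mult_ac)
 moreover have "(\<lambda>T. A ls * mon (c # ls) T) \<in> homog (Suc m)" if "length ls = m" for ls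
  using homog_cmult[OF homog_mon[of "c # ls"]] that by simp
 ultimately show ?thesis by (simp only:) (intro homog_sum finite_words, simp)
qed

text \<open>Differentiation removes letters, and the coefficients of the generator put as many back.
  The derivatives are stated together with these restoring factors, which keeps a single degree
  throughout and avoids words of length \<open>m - 1\<close> or \<open>m - 2\<close>.\<close>

lemma mon_C2:
 "\<exists>D1 D2. C2 (mon ls) D1 D2 \<and> (\<forall>c e. (\<lambda>T. Zc e T * D1 c T) \<in> homog (length ls)) \<and>
   (\<forall>c d e e'. (\<lambda>T. Zc e T * Zc e' T * D2 c d T) \<in> homog (length ls))"
proof (induction ls)
 case Nil
 show ?case
  by (rule exI[of _ "\<lambda>c T. 0"], rule exI[of _ "\<lambda>c e T. 0"]) (simp add: C2_const homog_zero)
next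
 case (Cons x xs)
 then obtain D1 D2 where D: "C2 (mon xs) D1 D2" and h1: "\<And>c e. (\<lambda>T. Zc e T * D1 c T) \<in> homog (length xs)"
  and h2: "\<And>c d e e'. (\<lambda>T. Zc e T * Zc e' T * D2 c d T) \<in> homog (length xs)" by blast
 have k1: "(\<lambda>T. Zc e T * (Zc x T * D1 c T + mon xs T * (if c = x then 1 else 0))) \<in> homog (Suc (length xs))" for c e
 proof -
  have "(\<lambda>T. Zc x T * (Zc e T * D1 c T)) \<in> homog (Suc (length xs))" by (rule homog_Zc[OF h1])
  moreover have "(\<lambda>T. (if c = x then 1 else 0) * (Zc e T * mon xs T)) \<in> homog (Suc (length xs))"
   by (rule homog_cmult[OF homog_Zc[OF homog_mon]])
  ultimately have "(\<lambda>T. Zc x T * (Zc e T * D1 c T) + (if c = x then 1 else 0) * (Zc e T * mon xs T)) \<in> homog (Suc (length xs))"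
   by (rule homog_add)
  then show ?thesis by (simp add: distrib_left mult_ac)
 qed
 have k2: "(\<lambda>T. Zc e T * Zc e' T * ((Zc x T * D2 c d T + D1 c T * (if d = x then 1 else 0)) + (mon xs T * 0 + (if c = x then 1 else 0) * D1 d T)))
   \<in> homog (Suc (length xs))" for c d e e'
 proof -
  have "(\<lambda>T. Zc x T * (Zc e T * Zc e' T * D2 c d T)) \<in> homog (Suc (length xs))" by (rule homog_Zc[OF h2])
  moreover have "(\<lambda>T. (if d = x then 1 else 0) * (Zc e T * (Zc e' T * D1 c T))) \<in> homog (Suc (length xs))"
   by (rule homog_cmult[OF homog_Zc[OF h1]])
  moreover have "(\<lambda>T. (if c = x then 1 else 0) * (Zc e T * (Zc e' T * D1 d T))) \<in> homog (Suc (length xs))"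
   by (rule homog_cmult[OF homog_Zc[OF h1]])
  ultimately have "(\<lambda>T. (Zc x T * (Zc e T * Zc e' T * D2 c d T) + (if d = x then 1 else 0) * (Zc e T * (Zc e' T * D1 c T)))
    + (if c = x then 1 else 0) * (Zc e T * (Zc e' T * D1 d T))) \<in> homog (Suc (length xs))"
   by (intro homog_add)
  then show ?thesis by (simp add: distrib_left mult_ac add_ac)
 qed
 show ?case
  unfolding mon_simps list.size add_0_right add_Suc_right
  by (rule exI, rule exI, rule conjI, rule C2_mult[OF C2_Zc D], intro conjI allI k1 k2)
qed

lemma mon_generator:
 "\<exists>D1 D2 A. C2 (mon ls) D1 D2 \<and> (\<forall>T. jet_op Gc Gs G1 Lc Ls \<kappa> T (\<lambda>c. D1 c T) (\<lambda>c e. D2 c e T)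
   = (\<Sum>ls'\<in>{ls'. length ls' = length ls}. A ls' * mon ls' T))"
proof -
 obtain D1 D2 where D: "C2 (mon ls) D1 D2" and h1: "\<And>c e. (\<lambda>T. Zc e T * D1 c T) \<in> homog (length ls)"
  and h2: "\<And>c d e e'. (\<lambda>T. Zc e T * Zc e' T * D2 c d T) \<in> homog (length ls)" using mon_C2 by blast
 have p: "(\<lambda>T. T $ j * D1 c T) \<in> homog (length ls)" "(\<lambda>T. cnj (T $ j) * D1 c T) \<in> homog (length ls)" for j c
  using h1[of "(j, True)" c] h1[of "(j, False)" c] by (simp_all add: Zc_def)
 have q: "(\<lambda>T. T $ j * T $ l * D2 c d T) \<in> homog (length ls)" "(\<lambda>T. T $ j * cnj (T $ l) * D2 c d T) \<in> homog (length ls)"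
  "(\<lambda>T. cnj (T $ j) * T $ l * D2 c d T) \<in> homog (length ls)" "(\<lambda>T. cnj (T $ j) * cnj (T $ l) * D2 c d T) \<in> homog (length ls)" for j l c d
  using h2[of "(j, True)" "(l, True)" c d] h2[of "(j, True)" "(l, False)" c d] h2[of "(j, False)" "(l, True)" c d] h2[of "(j, False)" "(l, False)" c d]
  by (simp_all add: Zc_def)
 have "(\<lambda>T. jet_op Gc Gs G1 Lc Ls \<kappa> T (\<lambda>c. D1 c T) (\<lambda>c e. D2 c e T)) \<in> homog (length ls)"
  unfolding jet_op_def mult.assoc[of "complex_of_real (Lc _) + _"] mult.assoc[of "complex_of_real (Lc _) - _"]
  by (intro homog_add homog_diff homog_cmult homog_sum p q finite_UNIV finite_Diff finite)
 then obtain A where hA: "(\<lambda>T. jet_op Gc Gs G1 Lc Ls \<kappa> T (\<lambda>c. D1 c T) (\<lambda>c e. D2 c e T)) = (\<lambda>T. \<Sum>ls'\<in>{ls'. length ls' = length ls}. A ls' * mon ls' T)"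
  unfolding homog_def by blast
 show ?thesis
  by (intro exI conjI allI) (rule D, rule fun_cong[OF hA])
qed

text \<open>Iterating the integral equation \<open>n\<close> times bounds each component by C (K (u
  - s))^n / n!, where \<open>K\<close> dominates every row sum of the matrix, and this tends to
  0.\<close>

lemma gronwall_zero:
 fixes v :: "'i \<Rightarrow> real \<Rightarrow> complex"
 assumes L: "finite L" and eq: "\<And>i u. i \<in> L \<Longrightarrow> s \<le> u \<Longrightarrow> v i u = (LBINT r:{s..u}. (\<Sum>k\<in>L. A i k * v k r))"
  and C: "\<And>i u. i \<in> L \<Longrightarrow> s \<le> u \<Longrightarrow> norm (v i u) \<le> C" and i: "i \<in> L" and u: "s \<le> u"
 shows "v i u = 0"
proof -
 define K where "K = (\<Sum>i\<in>L. \<Sum>k\<in>L. norm (A i k))"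
 have K: "(\<Sum>k\<in>L. norm (A i k)) \<le> K" if "i \<in> L" for i
  unfolding K_def using that L by (intro member_le_sum[of i L "\<lambda>i. \<Sum>k\<in>L. norm (A i k)"]) (auto intro: sum_nonneg)
 have K0: "0 \<le> K" unfolding K_def by (intro sum_nonneg) auto
 have C0: "0 \<le> C" using C[OF i u] norm_ge_zero order_trans by blast
 have pw: "set_integrable lborel {s..u} (\<lambda>r. c * (r - s) ^ n)" "(LBINT r:{s..u}. c * (r - s) ^ n) = c * (u - s) ^ Suc n / Suc n" if "s \<le> u" for u c n
 proof -
  show "set_integrable lborel {s..u} (\<lambda>r. c * (r - s) ^ n)"
   by (intro borel_integrable_atLeastAtMost' continuous_intros)
  have "(LBINT r:{s..u}. c * (r - s) ^ n) = c * (u - s) ^ Suc n / Suc n - c * (s - s) ^ Suc n / Suc n"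
   unfolding set_lebesgue_integral_def
  proof (rule integral_FTC_atLeastAtMost[OF that])
   fix x assume "s \<le> x" "x \<le> u"
   have "((\<lambda>r. r - s) has_real_derivative 1) (at x)" by (auto intro!: derivative_eq_intros)
   from DERIV_cdivide[OF DERIV_cmult[OF DERIV_power[OF this, of "Suc n"], of c], of "real (Suc n)"]
   have "((\<lambda>r. c * (r - s) ^ Suc n / Suc n) has_real_derivative c * (x - s) ^ n) (at x)"
    by simp
   then show "((\<lambda>r. c * (r - s) ^ Suc n / Suc n) has_vector_derivative c * (x - s) ^ n) (at x within {s..u})"
    by (simp add: has_real_derivative_iff_has_vector_derivative has_vector_derivative_at_within)
  qed (intro continuous_intros)
  then show "(LBINT r:{s..u}. c * (r - s) ^ n) = c * (u - s) ^ Suc n / Suc n" by simp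
 qed
 have main: "norm (v i u) \<le> C * (K ^ n * (u - s) ^ n / fact n)" if "i \<in> L" "s \<le> u" for i u n
  using that
 proof (induction n arbitrary: i u)
  case 0
  then show ?case using C by simp
 next
  case (Suc n)
  define c where "c = K * (C * (K ^ n / fact n))"
  have c0: "0 \<le> c" unfolding c_def using K0 C0 by simp
  have b: "norm (\<Sum>k\<in>L. A i k * v k r) \<le> c * (r - s) ^ n" if "s \<le> r" for r
  proof -
   have "norm (\<Sum>k\<in>L. A i k * v k r) \<le> (\<Sum>k\<in>L. norm (A i k) * (C * (K ^ n * (r - s) ^ n / fact n)))"
   proof (rule order_trans[OF norm_sum sum_mono])
    fix k assume k: "k \<in> L"
    show "norm (A i k * v k r) \<le> norm (A i k) * (C * (K ^ n * (r - s) ^ n / fact n))"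
     unfolding norm_mult by (rule mult_left_mono[OF Suc.IH[OF k that] norm_ge_zero])
   qed
   also have "\<dots> = (\<Sum>k\<in>L. norm (A i k)) * (C * (K ^ n * (r - s) ^ n / fact n))" by (rule sum_distrib_right[symmetric])
   also have "\<dots> \<le> K * (C * (K ^ n * (r - s) ^ n / fact n))"
    using K[OF Suc.prems(1)] K0 C0 that by (intro mult_right_mono) auto
   finally show ?thesis by (simp add: c_def)
  qed
  have "norm (v i u) \<le> (LBINT r. norm (indicator {s..u} r *\<^sub>R (\<Sum>k\<in>L. A i k * v k r)))"
   unfolding eq[OF Suc.prems] set_lebesgue_integral_def by (rule integral_norm_bound)
  also have "\<dots> \<le> (LBINT r. indicator {s..u} r *\<^sub>R (c * (r - s) ^ n))"
  proof (rule integral_mono')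
   show "integrable lborel (\<lambda>r. indicator {s..u} r *\<^sub>R (c * (r - s) ^ n))"
    using pw(1)[OF Suc.prems(2)] by (simp add: set_integrable_def)
   show "norm (indicator {s..u} r *\<^sub>R (\<Sum>k\<in>L. A i k * v k r)) \<le> indicator {s..u} r *\<^sub>R (c * (r - s) ^ n)" for r
    using b[of r] by (auto simp: indicator_def)
   show "0 \<le> indicator {s..u} r *\<^sub>R (c * (r - s) ^ n)" for r
    using c0 by (auto simp: indicator_def)
  qed
  also have "\<dots> = c * (u - s) ^ Suc n / Suc n"
   using pw(2)[OF Suc.prems(2), of c n] by (simp only: set_lebesgue_integral_def)
  also have "\<dots> = C * (K ^ Suc n * (u - s) ^ Suc n / fact (Suc n))"
   by (simp add: c_def field_simps)
  finally show ?case .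
 qed
 have "(\<lambda>n. C * ((K * (u - s)) ^ n /\<^sub>R fact n)) \<longlonglongrightarrow> C * 0"
  by (intro tendsto_intros summable_LIMSEQ_zero[OF summable_exp_generic])
 then have "(\<lambda>n. C * (K ^ n * (u - s) ^ n / fact n)) \<longlonglongrightarrow> 0"
  by (simp add: power_mult_distrib divide_inverse mult_ac)
 then have "norm (v i u) \<le> 0"
  by (rule LIMSEQ_le_const) (use main[OF i u] in auto)
 then show ?thesis by simp
qed

section \<open>Polynomials in T and its conjugate\<close>

inductive pol :: "((complex, 'n::finite) vec \<Rightarrow> complex) \<Rightarrow> bool" where
 pol_mon: "pol (mon ls)"
| pol_add: "pol F \<Longrightarrow> pol G \<Longrightarrow> pol (\<lambda>T. F T + G T)"
| pol_cmult: "pol F \<Longrightarrow> pol (\<lambda>T. a * F T)"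

lemma mon_append: "mon (ls @ ls') T = mon ls T * mon ls' T"
 by (simp add: mon_def)

lemma pol_mult: "pol F \<Longrightarrow> pol G \<Longrightarrow> pol (\<lambda>T. F T * G T)"
proof (induction F rule: pol.induct)
 case (pol_mon ls)
 then show ?case
 proof (induction G rule: pol.induct)
  case (pol_mon ls')
  show ?case using pol.pol_mon[of "ls @ ls'"] by (simp add: mon_append[abs_def])
 next
  case (pol_add F G)
  then show ?case using pol.pol_add by (simp add: distrib_left)
 next
  case (pol_cmult F a)
  then show ?case using pol.pol_cmult[of _ a] by (simp add: mult.left_commute)
 qed
next
 case (pol_add F G)
 then show ?case using pol.pol_add[of "\<lambda>T. F T * _ T" "\<lambda>T. G T * _ T"] by (simp add: distrib_right)
next
 case (pol_cmult F a)
 then show ?case using pol.pol_cmult[of "\<lambda>T. F T * _ T" a] by (simp add: mult.assoc)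
qed

lemma pol_const: "pol (\<lambda>T. a)"
 using pol_cmult[OF pol_mon[of "[]"], of a] by simp

lemma pol_sum: "finite I \<Longrightarrow> (\<And>i. i \<in> I \<Longrightarrow> pol (F i)) \<Longrightarrow> pol (\<lambda>T. \<Sum>i\<in>I. F i T)"
 by (induction I rule: finite_induct) (auto intro: pol_const pol_add)

text \<open>Re z = (z + cnj z) / 2 and Im z = (z - cnj z) / (2 i) turn polynomials in the real
  coordinates into polynomials in T and its conjugate, so that real Weierstrass approximation can be
  used.\<close>

lemma pol_real_polynomial:
 fixes p :: "(complex, 'n::finite) vec \<Rightarrow> real"
 assumes "real_polynomial_function p"
 shows "pol (\<lambda>T. complex_of_real (p T))"
 using assms
proof (induction p rule: real_polynomial_function.induct)
 case (linear f)
 have T: "T = (\<Sum>j\<in>UNIV. Re (T $ j) *\<^sub>R axis j 1 + Im (T $ j) *\<^sub>R axis j \<i>)" for T :: "(complex, 'n) vec"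
 proof (rule vec_eq_iff[THEN iffD2], rule allI)
  fix i
  have "(\<Sum>j\<in>UNIV. Re (T $ j) *\<^sub>R axis j 1 + Im (T $ j) *\<^sub>R axis j \<i>) $ i = (\<Sum>j\<in>UNIV. if j = i then T $ i else 0)"
   unfolding sum_component by (intro sum.cong refl) (auto simp: axis_def complex_eq_iff)
  then show "T $ i = (\<Sum>j\<in>UNIV. Re (T $ j) *\<^sub>R axis j 1 + Im (T $ j) *\<^sub>R axis j \<i>) $ i" by simp
 qed
 interpret f: bounded_linear f by fact
 have "f T = (\<Sum>j\<in>UNIV. Re (T $ j) * f (axis j 1) + Im (T $ j) * f (axis j \<i>))" for T
  by (subst T) (simp add: f.sum f.add f.scaleR)
 then have "complex_of_real (f T) = (\<Sum>j\<in>UNIV. (of_real (f (axis j 1)) / 2 + of_real (f (axis j \<i>)) / (2 * \<i>)) * mon [(j, True)] T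
   + (of_real (f (axis j 1)) / 2 - of_real (f (axis j \<i>)) / (2 * \<i>)) * mon [(j, False)] T)" for T
 proof -
  have e: "complex_of_real (Re z) * a + complex_of_real (Im z) * b = (a / 2 + b / (2 * \<i>)) * z + (a / 2 - b / (2 * \<i>)) * cnj z" for z a b
  proof -
   have "complex_of_real (Re z) = (z + cnj z) / 2" "complex_of_real (Im z) = (z - cnj z) / (2 * \<i>)"
    by (simp_all add: complex_eq_iff Re_divide Im_divide)
   then show ?thesis by (simp only:) (simp add: add_divide_distrib diff_divide_distrib algebra_simps)
  qed
  show ?thesis
   by (simp add: \<open>\<And>T. f T = _\<close>[of T] e Zc_def del: of_real_eq_iff)
 qed
 then have eq: "(\<lambda>T. complex_of_real (f T)) = (\<lambda>T. \<Sum>j\<in>UNIV. (of_real (f (axis j 1)) / 2 + of_real (f (axis j \<i>)) / (2 * \<i>)) * mon [(j, True)] T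
   + (of_real (f (axis j 1)) / 2 - of_real (f (axis j \<i>)) / (2 * \<i>)) * mon [(j, False)] T)" by (rule ext)
 show ?case unfolding eq by (intro pol_sum pol_add pol_cmult pol_mon) auto
next
 case (const c)
 then show ?case by (rule pol_const)
next
 case (add f g)
 then show ?case using pol_add by simp
next
 case (mult f g)
 then show ?case using pol_mult by simp
qed

section \<open>Expectations along confined paths\<close>

context diffusion begin

text \<open>Confinement replaces a global bound on \<open>J\<close> by its supremum over the
  ball.\<close>

lemma expect_integrable:
 fixes g :: "_ \<Rightarrow> complex"
 assumes g: "g \<in> borel_measurable P" "\<And>w. w \<in> space P \<Longrightarrow> norm (g w) \<le> K" and J: "continuous_on UNIV J" and u: "0 \<le> u"
 shows "integrable P (\<lambda>w. g w * J (fst (w u)))" and "norm (\<integral>w. g w * J (fst (w u)) \<partial>P) \<le> K * (SUP T\<in>cball 0 rad. norm (J T))"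
proof -
 have bdd: "bdd_above ((\<lambda>T. norm (J T)) ` cball 0 rad)"
  by (intro bounded_imp_bdd_above compact_imp_bounded compact_continuous_image continuous_intros continuous_on_subset[OF J]) auto
 obtain w0 where "w0 \<in> space P" using not_empty by blast
 then have K: "0 \<le> K" using g(2) norm_ge_zero order_trans by blast
 have b: "AE w in P. norm (g w * J (fst (w u))) \<le> K * (SUP T\<in>cball 0 rad. norm (J T))"
  using AE_good AE_space
 proof eventually_elim
  case (elim w)
  then have "fst (w u) \<in> cball 0 rad" using u by (auto simp: good_def)
  then have "norm (J (fst (w u))) \<le> (SUP T\<in>cball 0 rad. norm (J T))" by (rule cSUP_upper[OF _ bdd])
  then show ?case unfolding norm_mult using elim K by (intro mult_mono g(2)) auto
 qed
 have cJ: "continuous_on UNIV (\<lambda>x :: 'n state. J (fst x))"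
  by (intro continuous_on_compose2[OF J] continuous_intros) auto
 have m: "(\<lambda>w. g w * J (fst (w u))) \<in> borel_measurable P"
  using g(1) comp_measurable[OF u cJ] by measurable
 show i: "integrable P (\<lambda>w. g w * J (fst (w u)))" by (rule integrable_const_bound[OF b m])
 have "norm (\<integral>w. g w * J (fst (w u)) \<partial>P) \<le> (\<integral>w. norm (g w * J (fst (w u))) \<partial>P)" by (rule integral_norm_bound)
 also have "\<dots> \<le> (\<integral>w. K * (SUP T\<in>cball 0 rad. norm (J T)) \<partial>P)"
  by (rule integral_mono_AE) (use i b in auto)
 finally show "norm (\<integral>w. g w * J (fst (w u)) \<partial>P) \<le> K * (SUP T\<in>cball 0 rad. norm (J T))" by (simp add: prob_space)
qed

text \<open>Continuity in time makes the moments integrable over compact intervals, so that the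
  integral equations of two solutions can be subtracted.\<close>

lemma expect_continuous:
 fixes g :: "_ \<Rightarrow> complex"
 assumes g: "g \<in> borel_measurable P" "\<And>w. w \<in> space P \<Longrightarrow> norm (g w) \<le> K" and J: "continuous_on UNIV J"
 shows "continuous_on {0..} (\<lambda>u. \<integral>w. g w * J (fst (w u)) \<partial>P)"
 unfolding continuous_on_sequentially comp_def
proof (intro allI ballI impI)
 fix x and a :: real assume a: "a \<in> {0..}" and x: "(\<forall>n. x n \<in> {0..}) \<and> x \<longlonglongrightarrow> a"
 have bdd: "bdd_above ((\<lambda>T. norm (J T)) ` cball 0 rad)"
  by (intro bounded_imp_bdd_above compact_imp_bounded compact_continuous_image continuous_intros continuous_on_subset[OF J]) auto
 have cJ: "continuous_on UNIV (\<lambda>x :: 'n state. J (fst x))"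
  by (intro continuous_on_compose2[OF J] continuous_intros) auto
 obtain w0 where "w0 \<in> space P" using not_empty by blast
 then have K: "0 \<le> K" using g(2) norm_ge_zero order_trans by blast
 show "(\<lambda>n. \<integral>w. g w * J (fst (w (x n))) \<partial>P) \<longlonglongrightarrow> (\<integral>w. g w * J (fst (w a)) \<partial>P)"
 proof (rule integral_dominated_convergence[where w="\<lambda>_. K * (SUP T\<in>cball 0 rad. norm (J T))"])
  show "(\<lambda>w. g w * J (fst (w a))) \<in> borel_measurable P"
   using expect_integrable(1)[OF g J, of a] a by auto
  show "(\<lambda>w. g w * J (fst (w (x n)))) \<in> borel_measurable P" for n
   using expect_integrable(1)[OF g J, of "x n"] x by auto
  show "AE w in P. (\<lambda>n. g w * J (fst (w (x n)))) \<longlonglongrightarrow> g w * J (fst (w a))"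
  proof (rule AE_I2)
   fix w assume w: "w \<in> space P"
   have "continuous_on {0..} (\<lambda>t. J (fst (w t)))" by (rule comp_continuous[OF w cJ]) simp
   then have "(\<lambda>n. J (fst (w (x n)))) \<longlonglongrightarrow> J (fst (w a))"
    using a x unfolding continuous_on_sequentially comp_def by blast
   then show "(\<lambda>n. g w * J (fst (w (x n)))) \<longlonglongrightarrow> g w * J (fst (w a))" by (intro tendsto_intros)
  qed
  show "AE w in P. norm (g w * J (fst (w (x n)))) \<le> K * (SUP T\<in>cball 0 rad. norm (J T))" for n
   using AE_good AE_space
  proof eventually_elim
   case (elim w)
   then have "fst (w (x n)) \<in> cball 0 rad" using x by (auto simp: good_def)
   then have "norm (J (fst (w (x n)))) \<le> (SUP T\<in>cball 0 rad. norm (J T))" by (rule cSUP_upper[OF _ bdd])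
   then show ?case unfolding norm_mult using elim K by (intro mult_mono g(2)) auto
  qed
 qed simp
qed

lemma expect_good_cong:
 fixes g :: "_ \<Rightarrow> complex"
 assumes g: "g \<in> borel_measurable P" and h: "continuous_on UNIV h" "continuous_on UNIV h'" and u: "0 \<le> u"
  and eq: "\<And>T. norm T \<le> rad \<Longrightarrow> h (T, snd y) = h' (T, snd y)"
 shows "(\<integral>w. g w * h (w u) \<partial>P) = (\<integral>w. g w * h' (w u) \<partial>P)"
proof (rule integral_cong_AE)
 show "AE w in P. g w * h (w u) = g w * h' (w u)"
  using AE_good
 proof eventually_elim
  case (elim w)
  then have "norm (fst (w u)) \<le> rad" "w u = (fst (w u), snd y)" using u by (auto simp: good_def prod_eq_iff)
  then show ?case using eq by metis
 qed
 show "(\<lambda>w. g w * h (w u)) \<in> borel_measurable P" "(\<lambda>w. g w * h' (w u)) \<in> borel_measurable P"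
  using g comp_measurable[OF u h(1)] comp_measurable[OF u h(2)] by measurable
qed

end

section \<open>Finite-dimensional laws\<close>

definition cprod :: "(real \<times> ('a \<Rightarrow> complex)) list \<Rightarrow> (real \<Rightarrow> 'a) \<Rightarrow> complex" where
 "cprod l w = (\<Prod>p\<leftarrow>l. snd p (w (fst p)))"

definition cprods :: "real set \<Rightarrow> (real \<times> ('a::topological_space \<Rightarrow> complex)) list set" where
 "cprods J = {l. \<forall>p\<in>set l. fst p \<in> J \<and> continuous_on UNIV (snd p) \<and> bounded (range (snd p))}"

lemma cprod_simps[simp]: "cprod [] w = 1" "cprod (p # l) w = snd p (w (fst p)) * cprod l w"
 by (auto simp: cprod_def)

lemma cprods_Cons: "p # l \<in> cprods J \<longleftrightarrow> fst p \<in> J \<and> continuous_on UNIV (snd p) \<and> bounded (range (snd p)) \<and> l \<in> cprods J"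
 by (auto simp: cprods_def)

lemma cprod_bounded: "l \<in> cprods J \<Longrightarrow> \<exists>K. \<forall>w. norm (cprod l w) \<le> K"
proof (induction l)
 case (Cons p l)
 then obtain K where K: "\<And>w. norm (cprod l w) \<le> K" by (auto simp: cprods_Cons)
 have "bounded (range (snd p))" using Cons by (auto simp: cprods_Cons)
 then obtain B where B: "\<And>x. norm (snd p x) \<le> B" unfolding bounded_iff by blast
 have "norm (cprod (p # l) w) \<le> B * K" for w
  unfolding cprod_simps norm_mult by (intro mult_mono B K order_trans[OF norm_ge_zero B]) auto
 then show ?case by blast
qed (intro exI[of _ 1], simp)

lemma cprod_measurable:
 assumes "l \<in> cprods J" "\<And>t. t \<in> J \<Longrightarrow> (\<lambda>w. w t) \<in> borel_measurable M"
 shows "cprod l \<in> borel_measurable M"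
 using assms(1)
proof (induction l)
 case (Cons p l)
 have "snd p \<in> borel_measurable borel" "fst p \<in> J"
  using Cons.prems by (auto simp: cprods_Cons intro: borel_measurable_continuous_onI)
 then have "(\<lambda>w. snd p (w (fst p))) \<in> borel_measurable M"
  using measurable_compose[OF assms(2)] by blast
 moreover have "cprod l \<in> borel_measurable M" using Cons by (auto simp: cprods_Cons)
 ultimately have "(\<lambda>w. snd p (w (fst p)) * cprod l w) \<in> borel_measurable M" by (rule borel_measurable_times)
 then show ?case by (simp add: cprod_simps[abs_def])
qed (simp add: cprod_simps[abs_def])

text \<open>Induction on the number of times, listed from the latest to the earliest. The latest
  factor is peeled off and the product of the others becomes the weight \<open>g\<close>. The
  differences between the two solutions of the moments weighted by \<open>g\<close> start from 0 at
  the previous time and solve a linear system, so they vanish; Weierstrass approximation on the ball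
  leads from monomials to the peeled factor.\<close>

lemma diffusion_fdd_unique:
 fixes S :: "'n::finite state set"
 assumes P: "diffusion S Gc Gs G1 Lc Ls \<kappa> y P" and Q: "diffusion S Gc Gs G1 Lc Ls \<kappa> y Q"
 shows "length l = n \<Longrightarrow> l \<in> cprods {0..} \<Longrightarrow> sorted_wrt (\<lambda>p q. fst q \<le> fst p) l \<Longrightarrow>
  (\<integral>w. cprod l w \<partial>P) = (\<integral>w. cprod l w \<partial>Q)"
proof (induction n arbitrary: l)
 interpret P: diffusion S Gc Gs G1 Lc Ls \<kappa> y P by fact
 interpret Q: diffusion S Gc Gs G1 Lc Ls \<kappa> y Q by fact
 case 0
 then show ?case by (simp add: P.prob_space Q.prob_space)
next
 interpret P: diffusion S Gc Gs G1 Lc Ls \<kappa> y P by fact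
 interpret Q: diffusion S Gc Gs G1 Lc Ls \<kappa> y Q by fact
 case (Suc n)
 obtain p l' where l: "l = p # l'" using Suc.prems(1) by (cases l) auto
 define g where "g = cprod l'"
 define t where "t = fst p"
 define h where "h = snd p"
 \<comment> \<open>The latest of the remaining times, or the initial time when none remains; there
   both laws agree by the starting condition.\<close>
 define s where "s = (if l' = [] then 0 else fst (hd l'))"
 have l': "l' \<in> cprods {0..}" "length l' = n" "sorted_wrt (\<lambda>p q. fst q \<le> fst p) l'"
  and t: "0 \<le> t" and h: "continuous_on UNIV h" "bounded (range h)"
  and le: "\<And>q. q \<in> set l' \<Longrightarrow> fst q \<le> t"
  using Suc.prems by (auto simp: l cprods_Cons t_def h_def)
 have s: "0 \<le> s" "s \<le> t"
  using l'(1) le t by (cases l'; auto simp: s_def cprods_def)+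
 have l's: "l' \<in> cprods {0..s}"
  using l'(1,3) by (cases l') (auto simp: cprods_def s_def)
 have gm: "g \<in> borel_measurable (path_filtration S s)"
  unfolding g_def by (rule cprod_measurable[OF l's]) (auto intro: measurable_path_filtration_coord)
 obtain K where K: "\<And>w. norm (g w) \<le> K" using cprod_bounded[OF l'(1)] unfolding g_def by blast
 note gP = P.filtration_measurable[OF gm] and gQ = Q.filtration_measurable[OF gm]
 define v where "v ls u = (\<integral>w. g w * mon ls (fst (w u)) \<partial>P) - (\<integral>w. g w * mon ls (fst (w u)) \<partial>Q)" for ls u
 have cmon: "continuous_on UNIV (mon ls :: (complex, 'n) vec \<Rightarrow> complex)" for ls
  using mon_C2[of ls] C2D(3) by blast
 have v0: "v ls s = 0" for ls
 proof (cases l')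
  case Nil
  have g1: "g = (\<lambda>w. 1)" and s0: "s = 0" using Nil by (auto simp: g_def s_def fun_eq_iff)
  have "(\<integral>w. mon ls (fst (w 0)) \<partial>P) = (\<integral>w. mon ls (fst y) \<partial>P)"
   by (rule integral_cong_AE)
    (use P.start P.expect_integrable(1)[OF gP K cmon, of 0 ls] in \<open>auto simp: g1\<close>)
  moreover have "(\<integral>w. mon ls (fst (w 0)) \<partial>Q) = (\<integral>w. mon ls (fst y) \<partial>Q)"
   by (rule integral_cong_AE)
    (use Q.start Q.expect_integrable(1)[OF gQ K cmon, of 0 ls] in \<open>auto simp: g1\<close>)
  ultimately show ?thesis by (simp add: v_def g1 s0 P.prob_space Q.prob_space)
 next
  case (Cons q l'')
  \<comment> \<open>At time \<open>s\<close> the monomial is absorbed into the head of the remaining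
    list, which carries the same time; the list keeps its length \<open>n\<close> and the induction
    hypothesis applies. Factors of a list are bounded, so the monomial is cut off outside the
    ball.\<close>
  define m where "m x = of_real (cutoff (P.rad\<^sup>2) ((norm (fst x))\<^sup>2)) * mon ls (fst x)" for x :: "'n state"
  have mt: "(\<lambda>x. m x * 1) \<in> test_functions"
  proof -
   obtain D1 D2 where "C2 (mon ls) D1 D2" using mon_C2[of ls] by blast
   from P.cutoff_test[OF _ _ this, of "\<lambda>_. 1"] show ?thesis by (simp add: m_def)
  qed
  have cm: "continuous_on UNIV m" "bounded (range m)"
   using test_functionsD(1,2)[OF mt] by simp_all
  have m_eq: "m (T, snd y) = mon ls (fst (T, snd y))" if "norm T \<le> P.rad" for T
   using power_mono[OF that norm_ge_zero, of 2] by (simp add: m_def cutoff_props)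
  have s': "s = fst q" by (simp add: s_def Cons)
  define l1 where "l1 = (s, \<lambda>x. snd q x * m x) # l''"
  have "bounded (range (\<lambda>x. snd q x * m x))"
  proof -
   have "bounded (range (snd q))" using l'(1) by (auto simp: Cons cprods_Cons)
   then obtain B B' where B: "\<And>x. norm (snd q x) \<le> B" "\<And>x. norm (m x) \<le> B'" using cm(2) unfolding bounded_iff by blast
   have "norm (snd q x * m x) \<le> B * B'" for x
    unfolding norm_mult by (intro mult_mono B order_trans[OF norm_ge_zero B(1)]) auto
   then show ?thesis unfolding bounded_iff by blast
  qed
  then have "l1 \<in> cprods {0..}" using l'(1) s cm by (auto simp: l1_def Cons cprods_Cons intro!: continuous_intros)
  moreover have "length l1 = n" using l'(2) by (simp add: l1_def Cons)
  moreover have "sorted_wrt (\<lambda>p q. fst q \<le> fst p) l1" using l'(3) by (simp add: l1_def Cons s')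
  ultimately have IH: "(\<integral>w. cprod l1 w \<partial>P) = (\<integral>w. cprod l1 w \<partial>Q)" by (intro Suc.IH)
  have e: "cprod l1 w = g w * m (w s)" for w by (simp add: l1_def g_def Cons s' mult_ac)
  have "continuous_on UNIV (\<lambda>x :: 'n state. mon ls (fst x))"
   by (intro continuous_on_compose2[OF cmon] continuous_intros) auto
  then have "(\<integral>w. g w * m (w s) \<partial>P) = (\<integral>w. g w * mon ls (fst (w s)) \<partial>P)"
   "(\<integral>w. g w * m (w s) \<partial>Q) = (\<integral>w. g w * mon ls (fst (w s)) \<partial>Q)"
   using P.expect_good_cong[OF gP cm(1) _ s(1), of "\<lambda>x. mon ls (fst x)"] Q.expect_good_cong[OF gQ cm(1) _ s(1), of "\<lambda>x. mon ls (fst x)"] m_eq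
   by (auto simp: P.rad_def Q.rad_def)
  then show ?thesis using IH by (simp add: v_def e)
 qed
 have vz: "v ls u = 0" if u: "s \<le> u" for ls u
 proof -
  define m where "m = length ls"
  let ?L = "{ls :: ('n \<times> bool) list. length ls = m}"
  have "\<exists>A. \<forall>ls'\<in>?L. \<exists>D1 D2. C2 (mon ls') D1 D2 \<and> (\<forall>T. jet_op Gc Gs G1 Lc Ls \<kappa> T (\<lambda>c. D1 c T) (\<lambda>c e. D2 c e T)
   = (\<Sum>k\<in>?L. A ls' k * mon k T))"
  proof (intro bchoice ballI)
   fix ls' :: "('n \<times> bool) list" assume "ls' \<in> ?L"
   then show "\<exists>A. \<exists>D1 D2. C2 (mon ls') D1 D2 \<and> (\<forall>T. jet_op Gc Gs G1 Lc Ls \<kappa> T (\<lambda>c. D1 c T) (\<lambda>c e. D2 c e T)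
    = (\<Sum>k\<in>?L. A k * mon k T))"
    using mon_generator[of ls' Gc Gs G1 Lc Ls \<kappa>] by auto
  qed
  then obtain A where A: "\<And>ls'. ls' \<in> ?L \<Longrightarrow> \<exists>D1 D2. C2 (mon ls') D1 D2 \<and> (\<forall>T. jet_op Gc Gs G1 Lc Ls \<kappa> T (\<lambda>c. D1 c T) (\<lambda>c e. D2 c e T)
   = (\<Sum>k\<in>?L. A ls' k * mon k T))" by blast
  define B where "B = (\<Sum>k\<in>?L. 2 * (K * (SUP T\<in>cball 0 P.rad. norm (mon k T))))"
  have K0: "0 \<le> K" using K[of undefined] norm_ge_zero order_trans by blast
  have sup0: "0 \<le> (SUP T\<in>cball 0 P.rad. norm (mon k T))" for k :: "('n \<times> bool) list"
  proof -
   have "bdd_above ((\<lambda>T. norm (mon k T)) ` cball 0 P.rad)"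
    by (intro bounded_imp_bdd_above compact_imp_bounded compact_continuous_image continuous_intros continuous_on_subset[OF cmon]) auto
   then have "norm (mon k 0) \<le> (SUP T\<in>cball 0 P.rad. norm (mon k T))"
    by (intro cSUP_upper) (auto simp: P.rad_def)
   then show ?thesis using norm_ge_zero order_trans by blast
  qed
  show ?thesis
  proof (rule gronwall_zero[where L="?L" and C=B and s=s and A=A, OF finite_words])
   fix i r assume i: "i \<in> ?L" and r: "s \<le> r"
   have "norm (v i r) \<le> norm (\<integral>w. g w * mon i (fst (w r)) \<partial>P) + norm (\<integral>w. g w * mon i (fst (w r)) \<partial>Q)"
    unfolding v_def by (rule norm_triangle_ineq4)
   also have "\<dots> \<le> 2 * (K * (SUP T\<in>cball 0 P.rad. norm (mon i T)))"
    using P.expect_integrable(2)[OF gP K cmon, of r i] Q.expect_integrable(2)[OF gQ K cmon, of r i] s r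
    by (simp add: P.rad_def Q.rad_def)
   also have "\<dots> \<le> B" unfolding B_def
    by (rule member_le_sum[OF i]) (use K0 sup0 finite_words in auto)
   finally show "norm (v i r) \<le> B" .
   obtain D1 D2 where D: "C2 (mon i) D1 D2" "\<And>T. jet_op Gc Gs G1 Lc Ls \<kappa> T (\<lambda>c. D1 c T) (\<lambda>c e. D2 c e T) = (\<Sum>k\<in>?L. A i k * mon k T)"
    using A[OF i] by blast
   let ?J = "\<lambda>T. \<Sum>k\<in>?L. A i k * mon k T"
   have dP: "(\<integral>w. g w * mon i (fst (w r)) \<partial>P) - (\<integral>w. g w * mon i (fst (w s)) \<partial>P) = (LBINT u:{s..r}. (\<integral>w. g w * ?J (fst (w u)) \<partial>P))"
    using P.dynkin_C2[OF D(1) s(1) r gm K] unfolding D(2) .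
   have dQ: "(\<integral>w. g w * mon i (fst (w r)) \<partial>Q) - (\<integral>w. g w * mon i (fst (w s)) \<partial>Q) = (LBINT u:{s..r}. (\<integral>w. g w * ?J (fst (w u)) \<partial>Q))"
    using Q.dynkin_C2[OF D(1) s(1) r gm K] unfolding D(2) .
   have cJ: "continuous_on UNIV ?J" by (intro continuous_intros cmon)
   have sub: "{s..r} \<subseteq> {0..}" using s by auto
   have iP: "set_integrable lborel {s..r} (\<lambda>u. \<integral>w. g w * ?J (fst (w u)) \<partial>P)"
    by (rule borel_integrable_atLeastAtMost'[OF continuous_on_subset[OF P.expect_continuous[OF gP K cJ] sub]])
   have iQ: "set_integrable lborel {s..r} (\<lambda>u. \<integral>w. g w * ?J (fst (w u)) \<partial>Q)"
    by (rule borel_integrable_atLeastAtMost'[OF continuous_on_subset[OF Q.expect_continuous[OF gQ K cJ] sub]])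
   have lin: "(\<integral>w. g w * ?J (fst (w u)) \<partial>P) - (\<integral>w. g w * ?J (fst (w u)) \<partial>Q) = (\<Sum>k\<in>?L. A i k * v k u)" if "0 \<le> u" for u
   proof -
    have "(\<integral>w. g w * ?J (fst (w u)) \<partial>P) = (\<integral>w. (\<Sum>k\<in>?L. A i k * (g w * mon k (fst (w u)))) \<partial>P)"
     by (simp add: sum_distrib_left mult_ac)
    also have "\<dots> = (\<Sum>k\<in>?L. A i k * (\<integral>w. g w * mon k (fst (w u)) \<partial>P))"
     by (subst Bochner_Integration.integral_sum) (use P.expect_integrable(1)[OF gP K cmon that] in auto)
    finally have 1: "(\<integral>w. g w * ?J (fst (w u)) \<partial>P) = (\<Sum>k\<in>?L. A i k * (\<integral>w. g w * mon k (fst (w u)) \<partial>P))" .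
    have "(\<integral>w. g w * ?J (fst (w u)) \<partial>Q) = (\<integral>w. (\<Sum>k\<in>?L. A i k * (g w * mon k (fst (w u)))) \<partial>Q)"
     by (simp add: sum_distrib_left mult_ac)
    also have "\<dots> = (\<Sum>k\<in>?L. A i k * (\<integral>w. g w * mon k (fst (w u)) \<partial>Q))"
     by (subst Bochner_Integration.integral_sum) (use Q.expect_integrable(1)[OF gQ K cmon that] in auto)
    finally show ?thesis unfolding 1 by (simp add: v_def sum_subtractf right_diff_distrib)
   qed
   have "v i r = v i r - v i s" by (simp add: v0)
   also have "\<dots> = (LBINT u:{s..r}. (\<integral>w. g w * ?J (fst (w u)) \<partial>P)) - (LBINT u:{s..r}. (\<integral>w. g w * ?J (fst (w u)) \<partial>Q))"
    unfolding dP[symmetric] dQ[symmetric] v_def by (simp add: algebra_simps)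
   also have "\<dots> = (LBINT u:{s..r}. (\<integral>w. g w * ?J (fst (w u)) \<partial>P) - (\<integral>w. g w * ?J (fst (w u)) \<partial>Q))"
    by (rule set_integral_diff(2)[OF iP iQ, symmetric])
   also have "\<dots> = (LBINT u:{s..r}. (\<Sum>k\<in>?L. A i k * v k u))"
    by (rule set_lebesgue_integral_cong) (use lin s in auto)
   finally show "v i r = (LBINT u:{s..r}. (\<Sum>k\<in>?L. A i k * v k u))" .
  qed (use u in \<open>auto simp: m_def\<close>)
 qed
 have pz: "(\<integral>w. g w * F (fst (w t)) \<partial>P) = (\<integral>w. g w * F (fst (w t)) \<partial>Q)" and pc: "continuous_on UNIV F" if "pol F" for F
  using that
 proof (induction F rule: pol.induct)
  case (pol_mon ls)
  { case 1 show ?case using vz[OF s(2), of ls] by (simp add: v_def) }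
  { case 2 show ?case by (rule cmon) }
 next
  case (pol_add F H)
  { case 1 show ?case
    using pol_add P.expect_integrable(1)[OF gP K _ t] Q.expect_integrable(1)[OF gQ K _ t] by (simp add: distrib_left) }
  { case 2 show ?case using pol_add by (intro continuous_intros) }
 next
  case (pol_cmult F a)
  { case 1 show ?case using pol_cmult by (simp add: mult.left_commute) }
  { case 2 show ?case using pol_cmult by (intro continuous_intros) }
 qed
 have real_case: "(\<integral>w. g w * of_real (f (w t)) \<partial>P) = (\<integral>w. g w * of_real (f (w t)) \<partial>Q)"
  if f: "continuous_on UNIV (f :: 'n state \<Rightarrow> real)" for f
 proof -
  define a where "a = norm ((\<integral>w. g w * of_real (f (w t)) \<partial>P) - (\<integral>w. g w * of_real (f (w t)) \<partial>Q))"
  \<comment> \<open>The L2 component is frozen at its initial value, which leaves a function on a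
    finite-dimensional space, to be approximated on a compact ball.\<close>
  define f' where "f' T = f (T, snd y)" for T
  have cf': "continuous_on UNIV f'" unfolding f'_def by (intro continuous_on_compose2[OF f] continuous_intros) auto
  have cf'': "continuous_on UNIV (\<lambda>x :: 'n state. complex_of_real (f' (fst x)))" "continuous_on UNIV (\<lambda>x. complex_of_real (f x))"
   by (intro continuous_on_of_real continuous_on_compose2[OF cf'] continuous_intros f; simp)+
  have rP: "(\<integral>w. g w * of_real (f (w t)) \<partial>P) = (\<integral>w. g w * of_real (f' (fst (w t))) \<partial>P)"
   by (rule P.expect_good_cong[OF gP cf''(2,1) t]) (simp add: f'_def)
  have rQ: "(\<integral>w. g w * of_real (f (w t)) \<partial>Q) = (\<integral>w. g w * of_real (f' (fst (w t))) \<partial>Q)"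
   by (rule Q.expect_good_cong[OF gQ cf''(2,1) t]) (simp add: f'_def)
  have K0: "0 \<le> K" using K[of undefined] norm_ge_zero order_trans by blast
  have "a \<le> e" if e: "e > 0" for e
  proof -
   \<comment> \<open>The two approximation errors add up to
     \<open>2 * K * d = e * K / (K + 1)\<close>, which is at most \<open>e\<close>; adding 1 keeps
     the denominator positive when \<open>K\<close> is 0.\<close>
   define d where "d = e / (2 * (K + 1))"
   have d: "d > 0" using e K0 by (simp add: d_def)
   obtain q where q: "real_polynomial_function q" "\<And>x. x \<in> cball 0 P.rad \<Longrightarrow> \<bar>f' x - q x\<bar> < d"
    using Stone_Weierstrass_real_polynomial_function[OF compact_cball continuous_on_subset[OF cf' subset_UNIV] d] by blast
   note pq = pol_real_polynomial[OF q(1)]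
   have cJ: "continuous_on UNIV (\<lambda>T. complex_of_real (f' T))" by (intro continuous_on_of_real cf')
   have cD: "continuous_on UNIV (\<lambda>T. complex_of_real (f' T) - complex_of_real (q T))"
    by (intro continuous_intros cJ pc[OF pq])
   have sup: "(SUP T\<in>cball 0 P.rad. norm (complex_of_real (f' T) - complex_of_real (q T))) \<le> d"
   proof (rule cSUP_least)
    show "cball 0 P.rad \<noteq> ({} :: (complex, 'n) vec set)" by (simp add: P.rad_def)
    fix x :: "(complex, 'n) vec" assume "x \<in> cball 0 P.rad"
    then have "\<bar>f' x - q x\<bar> < d" by (rule q(2))
    then show "norm (complex_of_real (f' x) - complex_of_real (q x)) \<le> d"
     unfolding of_real_diff[symmetric] norm_of_real by simp
   qed
   have "(\<integral>w. g w * of_real (f' (fst (w t))) \<partial>P) - (\<integral>w. g w * of_real (q (fst (w t))) \<partial>P)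
     = (\<integral>w. g w * (of_real (f' (fst (w t))) - of_real (q (fst (w t)))) \<partial>P)"
    using P.expect_integrable(1)[OF gP K cJ t] P.expect_integrable(1)[OF gP K pc[OF pq] t]
    by (simp add: right_diff_distrib)
   then have nP: "norm ((\<integral>w. g w * of_real (f' (fst (w t))) \<partial>P) - (\<integral>w. g w * of_real (q (fst (w t))) \<partial>P)) \<le> K * d"
    using P.expect_integrable(2)[OF gP K cD t] mult_left_mono[OF sup K0] by simp
   have "(\<integral>w. g w * of_real (f' (fst (w t))) \<partial>Q) - (\<integral>w. g w * of_real (q (fst (w t))) \<partial>Q)
     = (\<integral>w. g w * (of_real (f' (fst (w t))) - of_real (q (fst (w t)))) \<partial>Q)"
    using Q.expect_integrable(1)[OF gQ K cJ t] Q.expect_integrable(1)[OF gQ K pc[OF pq] t]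
    by (simp add: right_diff_distrib)
   then have nQ: "norm ((\<integral>w. g w * of_real (f' (fst (w t))) \<partial>Q) - (\<integral>w. g w * of_real (q (fst (w t))) \<partial>Q)) \<le> K * d"
    using Q.expect_integrable(2)[OF gQ K cD t] mult_left_mono[OF sup K0] by (simp add: P.rad_def Q.rad_def)
   have "a \<le> K * d + K * d"
    unfolding a_def rP rQ using norm_triangle_mono[OF nP nQ[unfolded norm_minus_commute[of "(\<integral>w. g w * of_real (f' (fst (w t))) \<partial>Q)"]]] pz[OF pq] by simp
   also have "\<dots> = K * (2 * d)" by simp
   also have "2 * d = e / (K + 1)" unfolding d_def times_divide_eq_right by (rule mult_divide_mult_cancel_left) simp
   also have "K * (e / (K + 1)) = e * (K / (K + 1))" by simp
   also have "\<dots> \<le> e * 1" using K0 e by (intro mult_left_mono) auto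
   finally show "a \<le> e" by simp
  qed
  then have "a \<le> 0" by (rule field_le_epsilon[of a 0, simplified])
  then show ?thesis by (simp add: a_def)
 qed
 have e: "cprod l w = (g w * of_real (Re (h (w t)))) + \<i> * (g w * of_real (Im (h (w t))))" for w
  by (simp add: l g_def t_def h_def complex_eq_iff)
 obtain B where B: "\<And>x. norm (h x) \<le> B" using h(2) unfolding bounded_iff by blast
 have cRe: "continuous_on UNIV (\<lambda>x. Re (h x))" "continuous_on UNIV (\<lambda>x. Im (h x))" using h(1) by (auto intro!: continuous_intros)
 have iR: "integrable R (\<lambda>w. g w * of_real (f (w t)))" if R: "prob_space R" "g \<in> borel_measurable R" "(\<lambda>w. f (w t)) \<in> borel_measurable R" and f: "\<And>x. \<bar>f x\<bar> \<le> B" for R and f :: "'n state \<Rightarrow> real"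
 proof -
  interpret R: prob_space R by fact
  show ?thesis
  proof (rule R.integrable_const_bound[where B="K * B"])
   show "AE w in R. norm (g w * complex_of_real (f (w t))) \<le> K * B"
    unfolding norm_mult norm_of_real by (intro AE_I2 mult_mono K f order_trans[OF norm_ge_zero K]) auto
  qed (use R in measurable)
 qed
 have fB: "\<bar>Re (h x)\<bar> \<le> B" "\<bar>Im (h x)\<bar> \<le> B" for x
  using B[of x] abs_Re_le_cmod[of "h x"] abs_Im_le_cmod[of "h x"] by linarith+
 note iP = iR[OF P.prob_space_axioms gP P.comp_measurable[OF t cRe(1)] fB(1)] iR[OF P.prob_space_axioms gP P.comp_measurable[OF t cRe(2)] fB(2)]
 note iQ = iR[OF Q.prob_space_axioms gQ Q.comp_measurable[OF t cRe(1)] fB(1)] iR[OF Q.prob_space_axioms gQ Q.comp_measurable[OF t cRe(2)] fB(2)]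
 show ?case unfolding e using iP iQ real_case[OF cRe(1)] real_case[OF cRe(2)] by simp
qed

lemma diffusion_unique:
 fixes S :: "'n::finite state set"
 assumes P: "diffusion S Gc Gs G1 Lc Ls \<kappa> y P" and Q: "diffusion S Gc Gs G1 Lc Ls \<kappa> y Q"
 shows "P = Q"
proof (rule path_measure_eqI)
 interpret P: diffusion S Gc Gs G1 Lc Ls \<kappa> y P by fact
 interpret Q: diffusion S Gc Gs G1 Lc Ls \<kappa> y Q by fact
 show "prob_space P" "prob_space Q" by (rule P.prob_space_axioms, rule Q.prob_space_axioms)
 show "sets P = sets (path_space S)" "sets Q = sets (path_space S)" by (rule P.sets_P, rule Q.sets_P)
 fix l :: "(real \<times> ('n state \<Rightarrow> real)) list" assume l: "l \<in> cyl_tests {0..}"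
 \<comment> \<open>The times of a cylinder function come in any order. The product is commutative,
   so sorting does not change it, and \<open>rev\<close> puts the latest time first.\<close>
 define l' where "l' = map (\<lambda>p. (fst p, \<lambda>x. complex_of_real (snd p x))) (rev (sort_key fst l))"
 have c: "cprod l' w = of_real (cylf l w)" for w
 proof -
  have "cprod l' w = (\<Prod>p\<leftarrow>rev (sort_key fst l). complex_of_real (snd p (w (fst p))))"
   by (simp add: cprod_def l'_def comp_def)
  also have "\<dots> = prod_mset (image_mset (\<lambda>p. complex_of_real (snd p (w (fst p)))) (mset l))"
   by (simp add: prod_mset_prod_list[symmetric] mset_map)
  also have "\<dots> = (\<Prod>p\<leftarrow>l. complex_of_real (snd p (w (fst p))))"
   by (simp add: prod_mset_prod_list[symmetric] mset_map)
  also have "\<dots> = of_real (cylf l w)"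
   by (induction l) (auto simp: cylf_def)
  finally show ?thesis .
 qed
 have "sorted_wrt (\<lambda>p q. fst q \<le> fst p) (rev (sort_key fst l))"
  using sorted_sort_key[of fst l] by (simp add: sorted_wrt_rev sorted_wrt_map)
 then have "sorted_wrt (\<lambda>p q. fst q \<le> fst p) l'" by (simp add: l'_def sorted_wrt_map)
 moreover have "l' \<in> cprods {0..}"
 proof -
  have "continuous_on UNIV (\<lambda>x. complex_of_real (h x)) \<and> bounded (range (\<lambda>x. complex_of_real (h x)))"
   if "(t, h) \<in> set l" for t and h :: "'n state \<Rightarrow> real"
  proof
   have h: "continuous_on UNIV h" "\<And>x. 0 \<le> h x \<and> h x \<le> 1" using l that by (auto simp: cyl_tests_def)
   show "continuous_on UNIV (\<lambda>x. complex_of_real (h x))" by (intro continuous_on_of_real h)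
   have "norm (complex_of_real (h x)) \<le> 1" for x using h(2)[of x] by simp
   then show "bounded (range (\<lambda>x. complex_of_real (h x)))" unfolding bounded_iff by blast
  qed
  then show ?thesis using l unfolding cprods_def l'_def cyl_tests_def by fastforce
 qed
 ultimately have "(\<integral>w. cprod l' w \<partial>P) = (\<integral>w. cprod l' w \<partial>Q)"
  by (intro diffusion_fdd_unique[OF P Q refl])
 then show "(\<integral>w. cylf l w \<partial>P) = (\<integral>w. cylf l w \<partial>Q)" by (simp add: c)
qed

section \<open>Fourth moments of increments\<close>

lemma wd_cmult: "wd F D \<Longrightarrow> wd (\<lambda>T. a * F T) (\<lambda>c T. a * D c T)"
 unfolding wd_def dirsum_mult by (auto intro: has_vector_derivative_mult_right)

lemma wd_power:
 assumes "wd X D"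
 shows "wd (\<lambda>T. X T ^ k) (\<lambda>c T. of_nat k * X T ^ (k - 1) * D c T)"
 unfolding wd_def
proof (intro allI)
 fix T u
 have d: "((\<lambda>t::real. X (T + t *\<^sub>R u)) has_vector_derivative dirsum (\<lambda>c. D c T) u) (at 0)"
  using assms by (simp add: wd_def)
 have "((\<lambda>z. z ^ k) has_field_derivative of_nat k * (1 * X T ^ (k - Suc 0))) (at (X T))"
  by (rule DERIV_power[OF DERIV_ident])
 then have "((\<lambda>z. z ^ k) has_field_derivative of_nat k * (1 * X T ^ (k - Suc 0))) (at (X (T + 0 *\<^sub>R u)))"
  by simp
 from field_vector_diff_chain_at[OF d this]
 have "((\<lambda>t::real. X (T + t *\<^sub>R u) ^ k) has_vector_derivative dirsum (\<lambda>c. D c T) u * (of_nat k * (1 * X T ^ (k - Suc 0)))) (at 0)"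
  by (simp add: comp_def)
 also have "dirsum (\<lambda>c. D c T) u * (of_nat k * (1 * X T ^ (k - Suc 0))) = dirsum (\<lambda>c. of_nat k * X T ^ (k - 1) * D c T) u"
  by (simp add: dirsum_mult)
 finally show "((\<lambda>t::real. X (T + t *\<^sub>R u) ^ k) has_vector_derivative dirsum (\<lambda>c. of_nat k * X T ^ (k - 1) * D c T) u) (at 0)" .
qed

text \<open>\<open>X\<close> has constant derivatives, as a coordinate function does. The exponents
  \<open>k - 1\<close> and \<open>k - 2\<close> are truncated for small \<open>k\<close>, but
  precisely then the numerical factor in front is 0.\<close>

lemma C2_power:
 assumes X: "wd X (\<lambda>c T. l c)" "continuous_on UNIV X"
 shows "C2 (\<lambda>T. X T ^ k) (\<lambda>c T. l c * (of_nat k * X T ^ (k - 1)))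
   (\<lambda>c e T. (l c * l e) * (of_nat k * of_nat (k - 1) * X T ^ (k - 2)))"
 unfolding C2_def
proof (intro conjI allI)
 show "wd (\<lambda>T. X T ^ k) (\<lambda>c T. l c * (of_nat k * X T ^ (k - 1)))"
  using wd_power[OF X(1), of k] by (simp add: mult_ac)
 have "wd (\<lambda>T. X T ^ (k - 1)) (\<lambda>e T. of_nat (k - 1) * X T ^ (k - 1 - 1) * l e)" by (rule wd_power[OF X(1)])
 from wd_cmult[OF this] show "wd (\<lambda>T. l c * (of_nat k * X T ^ (k - 1))) (\<lambda>e T. (l c * l e) * (of_nat k * of_nat (k - 1) * X T ^ (k - 2)))" for c
  by (rule wd_cong[of _ _ "\<lambda>T. l c * (of_nat k * X T ^ (k - 1))", OF _ _ ]) (auto simp: fun_eq_iff mult_ac numeral_2_eq_2)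
qed (intro continuous_intros X)+

text \<open>The letters now name real coordinates: the flag \<open>True\<close> selects the real
  part, \<open>False\<close> the imaginary part.\<close>

definition rcoord :: "'n::finite \<times> bool \<Rightarrow> (complex, 'n) vec \<Rightarrow> real" where
 "rcoord c T = (if snd c then Re (T $ fst c) else Im (T $ fst c))"

lemma rcoord_le: "\<bar>rcoord c T\<bar> \<le> norm T"
 using abs_Re_le_cmod[of "T $ fst c"] abs_Im_le_cmod[of "T $ fst c"] Finite_Cartesian_Product.norm_nth_le[of T "fst c"]
 by (auto simp: rcoord_def)

lemma continuous_rcoord: "continuous_on UNIV (rcoord c)"
 unfolding rcoord_def by (cases "snd c") (auto intro!: continuous_intros)

lemma wd_rcoord:
 "\<exists>l. wd (\<lambda>T. complex_of_real (rcoord c T)) (\<lambda>e T. l e) \<and> (\<forall>e. norm (l e) \<le> 1)"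
proof -
 obtain j b where c: "c = (j, b)" by (cases c)
 define \<alpha> :: complex where "\<alpha> = (if b then 1 / 2 else 1 / (2 * \<i>))"
 define \<beta> :: complex where "\<beta> = (if b then 1 / 2 else - 1 / (2 * \<i>))"
 have n: "norm \<alpha> \<le> 1" "norm \<beta> \<le> 1" by (auto simp: \<alpha>_def \<beta>_def norm_divide norm_mult)
 have "wd (\<lambda>T. \<alpha> * Zc (j, True) T + \<beta> * Zc (j, False) T) (\<lambda>e T. \<alpha> * (if e = (j, True) then 1 else 0) + \<beta> * (if e = (j, False) then 1 else 0))"
  by (intro wd_add wd_cmult wd_Zc)
 moreover have "(\<lambda>T. \<alpha> * Zc (j, True) T + \<beta> * Zc (j, False) T) = (\<lambda>T. complex_of_real (rcoord c T))"
  by (auto simp: fun_eq_iff c rcoord_def Zc_def \<alpha>_def \<beta>_def complex_eq_iff Re_divide Im_divide)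
 moreover have "norm (\<alpha> * (if e = (j, True) then 1 else 0) + \<beta> * (if e = (j, False) then 1 else 0)) \<le> 1" for e
  using n by (cases "e = (j, True)"; cases "e = (j, False)") auto
 ultimately show ?thesis by auto
qed

text \<open>An increment involves two times, while Dynkin's formula pairs a function of the later
  value with a weight from the past. Binomial expansion moves the powers of the earlier value into
  the weights, and these identities sum the derivatives up again.\<close>

lemma binomial_derivatives:
 fixes X a b s :: complex
 shows "(\<Sum>k\<le>2. (of_nat (2 choose k) * (- a) ^ (2 - k)) * (X ^ k)) = (X - a)\<^sup>2"
  "(\<Sum>k\<le>4. (of_nat (4 choose k) * (- a) ^ (4 - k)) * (X ^ k)) = (X - a) ^ 4"
  "(\<Sum>k\<le>2. (of_nat (2 choose k) * (- a) ^ (2 - k)) * (b * (of_nat k * X ^ (k - 1)) + s * (of_nat k * of_nat (k - 1) * X ^ (k - 2))))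
   = 2 * (X - a) * b + 2 * s"
  "(\<Sum>k\<le>4. (of_nat (4 choose k) * (- a) ^ (4 - k)) * (b * (of_nat k * X ^ (k - 1)) + s * (of_nat k * of_nat (k - 1) * X ^ (k - 2))))
   = 4 * (X - a) ^ 3 * b + 12 * (X - a)\<^sup>2 * s"
proof -
 have s2: "{..2::nat} = {0, 1, 2}" and s4: "{..4::nat} = {0, 1, 2, 3, 4}" by auto
 have ch: "(4::nat) choose 2 = 6" "(4::nat) choose 3 = 4" by (simp_all add: eval_nat_numeral)
 show "(\<Sum>k\<le>2. (of_nat (2 choose k) * (- a) ^ (2 - k)) * (X ^ k)) = (X - a)\<^sup>2"
  unfolding s2 by (simp add: power2_eq_square algebra_simps)
 show "(\<Sum>k\<le>4. (of_nat (4 choose k) * (- a) ^ (4 - k)) * (X ^ k)) = (X - a) ^ 4"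
  unfolding s4 by (simp add: ch eval_nat_numeral algebra_simps)
 show "(\<Sum>k\<le>2. (of_nat (2 choose k) * (- a) ^ (2 - k)) * (b * (of_nat k * X ^ (k - 1)) + s * (of_nat k * of_nat (k - 1) * X ^ (k - 2))))
   = 2 * (X - a) * b + 2 * s"
  unfolding s2 by (simp add: algebra_simps)
 show "(\<Sum>k\<le>4. (of_nat (4 choose k) * (- a) ^ (4 - k)) * (b * (of_nat k * X ^ (k - 1)) + s * (of_nat k * of_nat (k - 1) * X ^ (k - 2))))
   = 4 * (X - a) ^ 3 * b + 12 * (X - a)\<^sup>2 * s"
  unfolding s4 by (simp add: ch eval_nat_numeral algebra_simps)
qed

lemma jet_op_zero_linear:
 "jet_op Gc Gs G1 Lc Ls \<kappa> T (\<lambda>c. p c * \<alpha>) (\<lambda>c e. q c e * \<beta>)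
  = jet_op Gc Gs G1 Lc Ls \<kappa> T p (\<lambda>c e. 0) * \<alpha> + jet_op Gc Gs G1 Lc Ls \<kappa> T (\<lambda>c. 0) q * \<beta>"
 using jet_op_linear(2)[of Gc Gs G1 Lc Ls \<kappa> T "\<lambda>c. p c * \<alpha>" "\<lambda>c. 0" "\<lambda>c e. 0" "\<lambda>c e. q c e * \<beta>"]
  jet_op_linear(1)[of Gc Gs G1 Lc Ls \<kappa> T p \<alpha> "\<lambda>c e. 0"] jet_op_linear(1)[of Gc Gs G1 Lc Ls \<kappa> T "\<lambda>c. 0" \<beta> q]
 by simp

context diffusion begin

lemma dynkin_sum:
 fixes g :: "nat \<Rightarrow> _ \<Rightarrow> complex"
 assumes F: "\<And>k. C2 (F k) (D1 k) (D2 k)" and st: "0 \<le> s" "s \<le> t"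
  and g: "\<And>k. g k \<in> borel_measurable (path_filtration S s)" "\<And>k w. w \<in> space P \<Longrightarrow> norm (g k w) \<le> K k"
 shows "(\<integral>w. (\<Sum>k\<le>n. g k w * F k (fst (w t))) \<partial>P) - (\<integral>w. (\<Sum>k\<le>n. g k w * F k (fst (w s))) \<partial>P)
  = (LBINT u:{s..t}. (\<integral>w. (\<Sum>k\<le>n. g k w * jet_op Gc Gs G1 Lc Ls \<kappa> (fst (w u)) (\<lambda>c. D1 k c (fst (w u))) (\<lambda>c e. D2 k c e (fst (w u)))) \<partial>P))"
proof -
 let ?J = "\<lambda>k T. jet_op Gc Gs G1 Lc Ls \<kappa> T (\<lambda>c. D1 k c T) (\<lambda>c e. D2 k c e T)"
 note gP = filtration_measurable[OF g(1)]
 have cF: "continuous_on UNIV (F k)" for k by (rule C2D(3)[OF F])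
 note cJ = jet_continuous[OF F]
 have sum_E: "(\<integral>w. (\<Sum>k\<le>n. g k w * H k (fst (w u))) \<partial>P) = (\<Sum>k\<le>n. \<integral>w. g k w * H k (fst (w u)) \<partial>P)"
  if "0 \<le> u" "\<And>k. continuous_on UNIV (H k)" for u H
  by (rule Bochner_Integration.integral_sum) (rule expect_integrable(1)[OF gP g(2) that(2,1)])
 have "(\<integral>w. (\<Sum>k\<le>n. g k w * F k (fst (w t))) \<partial>P) - (\<integral>w. (\<Sum>k\<le>n. g k w * F k (fst (w s))) \<partial>P)
  = (\<Sum>k\<le>n. (\<integral>w. g k w * F k (fst (w t)) \<partial>P) - (\<integral>w. g k w * F k (fst (w s)) \<partial>P))"
  using st by (simp only: sum_E[OF _ cF] sum_subtractf order_trans[OF st])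
 also have "\<dots> = (\<Sum>k\<le>n. (LBINT u:{s..t}. (\<integral>w. g k w * ?J k (fst (w u)) \<partial>P)))"
  by (intro sum.cong refl dynkin_C2[OF F st g])
 also have "\<dots> = (LBINT u:{s..t}. (\<Sum>k\<le>n. (\<integral>w. g k w * ?J k (fst (w u)) \<partial>P)))"
  unfolding set_lebesgue_integral_def scaleR_sum_right
 proof (rule Bochner_Integration.integral_sum[symmetric])
  fix k
  have "set_integrable lborel {s..t} (\<lambda>u. \<integral>w. g k w * ?J k (fst (w u)) \<partial>P)"
   by (rule borel_integrable_atLeastAtMost'[OF continuous_on_subset[OF expect_continuous[OF gP g(2) cJ]]]) (use st in auto)
  then show "integrable lborel (\<lambda>u. indicator {s..t} u *\<^sub>R (\<integral>w. g k w * ?J k (fst (w u)) \<partial>P))"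
   by (simp add: set_integrable_def)
 qed
 also have "\<dots> = (LBINT u:{s..t}. (\<integral>w. (\<Sum>k\<le>n. g k w * ?J k (fst (w u))) \<partial>P))"
  by (rule set_lebesgue_integral_cong) (use st in \<open>auto simp: sum_E[OF _ cJ]\<close>)
 finally show ?thesis .
qed

text \<open>With drift \<open>b\<close> and second order part \<open>\<sigma>\<close> of the
  coordinate, the generator sends the squared increment to 2 (X - a) b + 2 \<sigma> and its fourth
  power to 4 (X - a)^3 b + 12 (X - a)^2 \<sigma>. Increments are at most \<open>2 * rad\<close>, so
  the second moment is at most \<open>(4 * rad + 2) * C * (u - s)\<close>. In the fourth moment one
  factor of the cube is traded for \<open>2 * rad\<close>, and inserting the first bound gives the
  order \<open>(t - s)\<^sup>2\<close>.\<close>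

lemma increment_fourth_moment:
 assumes B: "\<And>j l. \<bar>Gc j l\<bar> \<le> B" "\<And>j l. \<bar>Gs j l\<bar> \<le> B" "\<And>j l. \<bar>G1 j l\<bar> \<le> B"
   "\<And>j. \<bar>Lc j\<bar> \<le> B" "\<And>j. \<bar>Ls j\<bar> \<le> B" "\<And>j. \<bar>\<kappa> j\<bar> \<le> B"
  and st: "0 \<le> s" "s \<le> t"
  and C: "C = (4 * (real CARD('n))\<^sup>2 * rad\<^sup>2 + 8 * real CARD('n) * rad) * B"
 shows "(\<integral>w. (rcoord c (fst (w t)) - rcoord c (fst (w s))) ^ 4 \<partial>P) \<le> ((8 * rad + 12) * C) * ((4 * rad + 2) * C) * (t - s)\<^sup>2"
  and "integrable P (\<lambda>w. (rcoord c (fst (w t)) - rcoord c (fst (w s))) ^ 4)"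
proof -
 obtain l where l: "wd (\<lambda>T. complex_of_real (rcoord c T)) (\<lambda>e T. l e)" "\<And>e. norm (l e) \<le> 1"
  using wd_rcoord by blast
 define X where "X T = complex_of_real (rcoord c T)" for T :: "(complex, 'n) vec"
 have wX: "wd X (\<lambda>e T. l e)" unfolding X_def using l(1) .
 have cX: "continuous_on UNIV X" unfolding X_def by (intro continuous_on_of_real continuous_rcoord)
 define b where "b T = jet_op Gc Gs G1 Lc Ls \<kappa> T l (\<lambda>c e. 0)" for T
 define \<sigma> where "\<sigma> T = jet_op Gc Gs G1 Lc Ls \<kappa> T (\<lambda>c. 0) (\<lambda>c e. l c * l e)" for T
 \<comment> \<open>The earlier value enters the weights, which must be bounded on every path and not
   just almost surely; hence the cut-off version, equal to \<open>X\<close> on the ball.\<close>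
 define a where "a T = of_real (cutoff (rad\<^sup>2) ((norm T)\<^sup>2)) * X T" for T
 have rad0: "0 \<le> rad" by (simp add: rad_def)
 have B0: "0 \<le> B" using B(4)[of undefined] by linarith
 have C0: "0 \<le> C" unfolding C using B0 rad0 by simp
 have bC: "norm (b T) \<le> C" "norm (\<sigma> T) \<le> C" if "norm T \<le> rad" for T
 proof -
  have ll: "norm (l c * l e) \<le> 1" for c e unfolding norm_mult using l(2) by (intro mult_le_one) auto
  show "norm (b T) \<le> C" unfolding b_def C
   using jet_op_bound[of Gc B Gs G1 Lc Ls \<kappa> T rad l 1 "\<lambda>c e. 0"] B that l(2) by simp
  show "norm (\<sigma> T) \<le> C" unfolding \<sigma>_def C
   using jet_op_bound[of Gc B Gs G1 Lc Ls \<kappa> T rad "\<lambda>c. 0" 1 "\<lambda>c e. l c * l e"] B that ll by simp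
 qed
 have ca: "continuous_on UNIV a"
  unfolding a_def cutoff_def by (intro continuous_intros cX)
 have aX: "a T = X T" if "norm T \<le> rad" for T
  using power_mono[OF that norm_ge_zero, of 2] by (simp add: a_def cutoff_props)
 have "a T = 0" if "norm T > sqrt (rad\<^sup>2 + 1)" for T
 proof -
  have "(sqrt (rad\<^sup>2 + 1))\<^sup>2 < (norm T)\<^sup>2" by (rule power_strict_mono[OF that]) auto
  then show ?thesis by (simp add: a_def cutoff_props(4))
 qed
 then have "bounded (range a)" by (intro continuous_vanish_bounded[OF ca]) auto
 then obtain A where A: "\<And>T. norm (a T) \<le> A" unfolding bounded_iff by blast
 have cfst: "continuous_on UNIV (\<lambda>x :: 'n state. H (fst x))" if "continuous_on UNIV H" for H :: "_ \<Rightarrow> complex"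
  by (intro continuous_on_compose2[OF that] continuous_intros) auto
 have gm: "(\<lambda>w. of_nat (n choose k) * (- a (fst (w s))) ^ (n - k)) \<in> borel_measurable (path_filtration S s)" for n k
 proof -
  have "(\<lambda>w. a (fst (w s))) \<in> borel_measurable (path_filtration S s)"
   by (rule measurable_compose[OF measurable_path_filtration_coord[OF st(1) order_refl] borel_measurable_continuous_onI[OF cfst[OF ca]]])
  then show ?thesis by measurable
 qed
 have gb: "norm (of_nat (n choose k) * (- a (fst (w s))) ^ (n - k)) \<le> real (n choose k) * A ^ (n - k)" for n k w
  by (simp add: norm_mult norm_power) (intro mult_left_mono power_mono A; simp)
 have jet: "jet_op Gc Gs G1 Lc Ls \<kappa> T (\<lambda>c. l c * (of_nat k * X T ^ (k - 1))) (\<lambda>c e. (l c * l e) * (of_nat k * of_nat (k - 1) * X T ^ (k - 2)))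
   = b T * (of_nat k * X T ^ (k - 1)) + \<sigma> T * (of_nat k * of_nat (k - 1) * X T ^ (k - 2))" for T k
  unfolding b_def \<sigma>_def by (rule jet_op_zero_linear)
 have dyn: "(\<integral>w. (\<Sum>k\<le>m. of_nat (m choose k) * (- a (fst (w s))) ^ (m - k) * X (fst (w u)) ^ k) \<partial>P) - (\<integral>w. (\<Sum>k\<le>m. of_nat (m choose k) * (- a (fst (w s))) ^ (m - k) * X (fst (w s)) ^ k) \<partial>P)
   = (LBINT r:{s..u}. (\<integral>w. (\<Sum>k\<le>m. of_nat (m choose k) * (- a (fst (w s))) ^ (m - k) *
     (b (fst (w r)) * (of_nat k * X (fst (w r)) ^ (k - 1)) + \<sigma> (fst (w r)) * (of_nat k * of_nat (k - 1) * X (fst (w r)) ^ (k - 2)))) \<partial>P))"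
  if su: "s \<le> u" for m u
  unfolding jet[symmetric]
  by (rule dynkin_sum[where F="\<lambda>k T. X T ^ k" and n=m and g="\<lambda>k w. of_nat (m choose k) * (- a (fst (w s))) ^ (m - k)"
    and K="\<lambda>k. real (m choose k) * A ^ (m - k)" and ?D1.0="\<lambda>k c T. l c * (of_nat k * X T ^ (k - 1))"
    and ?D2.0="\<lambda>k c e T. (l c * l e) * (of_nat k * of_nat (k - 1) * X T ^ (k - 2))"])
   (rule C2_power[OF wX cX] st(1) su gm gb)+
 define E2 where "E2 u = (\<integral>w. (X (fst (w u)) - a (fst (w s)))\<^sup>2 \<partial>P)" for u
 define E4 where "E4 u = (\<integral>w. (X (fst (w u)) - a (fst (w s))) ^ 4 \<partial>P)" for u
 have z: "AE w in P. X (fst (w s)) - a (fst (w s)) = 0"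
  using AE_good by eventually_elim (use st aX in \<open>auto simp: good_def\<close>)
 have E0: "E2 s = 0" "E4 s = 0"
  unfolding E2_def E4_def by (rule integral_eq_zero_AE, use z in eventually_elim, simp)+
 have e2: "E2 u = (LBINT r:{s..u}. (\<integral>w. 2 * (X (fst (w r)) - a (fst (w s))) * b (fst (w r)) + 2 * \<sigma> (fst (w r)) \<partial>P))" if "s \<le> u" for u
  using dyn[OF that, of 2] E0 unfolding binomial_derivatives E2_def by simp
 have e4: "E4 u = (LBINT r:{s..u}. (\<integral>w. 4 * (X (fst (w r)) - a (fst (w s))) ^ 3 * b (fst (w r)) + 12 * (X (fst (w r)) - a (fst (w s)))\<^sup>2 * \<sigma> (fst (w r)) \<partial>P))" if "s \<le> u" for u
  using dyn[OF that, of 4] E0 unfolding binomial_derivatives E4_def by simp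
 have Xa: "norm (X (fst (w u)) - a (fst (w s))) \<le> 2 * rad" if "good w" "0 \<le> u" for w u
 proof -
  have "norm (fst (w u)) \<le> rad" "norm (fst (w s)) \<le> rad" using that st by (auto simp: good_def)
  then have "norm (X (fst (w u))) \<le> rad" "norm (a (fst (w s))) \<le> rad"
   using aX[of "fst (w s)"] rcoord_le[of c "fst (w u)"] rcoord_le[of c "fst (w s)"] by (auto simp: X_def)
  then show ?thesis using norm_triangle_ineq4[of "X (fst (w u))" "a (fst (w s))"] by linarith
 qed
 have mX: "(\<lambda>w. X (fst (w u)) - a (fst (w s))) \<in> borel_measurable P" if "0 \<le> u" for u
  using comp_measurable[OF that cfst[OF cX]] comp_measurable[OF st(1) cfst[OF ca]] by measurable
 define q where "q u w = (cmod (X (fst (w u)) - a (fst (w s))))\<^sup>2" for u and w :: "real \<Rightarrow> 'n state"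
 have q_nonneg: "0 \<le> q u w" for u w by (simp add: q_def)
 have iq: "integrable P (q u)" if "0 \<le> u" for u
 proof (rule integrable_const_bound[where B="(2 * rad)\<^sup>2"])
  show "AE w in P. norm (q u w) \<le> (2 * rad)\<^sup>2"
   using AE_good by eventually_elim (use Xa that in \<open>simp only: q_def real_norm_def abs_power2, intro power_mono; simp\<close>)
  show "q u \<in> borel_measurable P" unfolding q_def[abs_def] using mX[OF that] by measurable
 qed
 have rl: "(X T - a T')\<^sup>2 = of_real ((cmod (X T - a T'))\<^sup>2)" for T T'
 proof -
  have "X T - a T' = of_real (rcoord c T - cutoff (rad\<^sup>2) ((norm T')\<^sup>2) * rcoord c T')" by (simp add: X_def a_def)
  then show ?thesis by (simp only: norm_of_real power2_abs of_real_power)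
 qed
 have nE2: "E2 u = of_real (\<integral>w. q u w \<partial>P)" for u
  unfolding E2_def rl q_def by (rule integral_complex_of_real)
 have int_bound: "norm (LBINT r:{s..u}. f r) \<le> K * (u - s)" if "\<And>r. s \<le> r \<Longrightarrow> r \<le> u \<Longrightarrow> norm (f r :: complex) \<le> K" "0 \<le> K" "s \<le> u" for f K u
 proof -
  have "norm (LBINT r:{s..u}. f r) \<le> (LBINT r. norm (indicator {s..u} r *\<^sub>R f r))"
   unfolding set_lebesgue_integral_def by (rule integral_norm_bound)
  also have "\<dots> \<le> (LBINT r. indicator {s..u} r * K)"
   proof (rule integral_mono')
   show "integrable lborel (\<lambda>r. indicator {s..u} r * K)"
    using emeasure_compact_finite[of "{s..u}"] by (intro integrable_mult_left integrable_real_indicator) auto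
  qed (use that in \<open>auto simp: indicator_def\<close>)
  also have "\<dots> = K * (u - s)" using that by simp
  finally show ?thesis .
 qed
 have E2b: "(\<integral>w. q u w \<partial>P) \<le> ((4 * rad + 2) * C) * (u - s)" if u: "s \<le> u" for u
 proof -
  have "norm (\<integral>w. 2 * (X (fst (w r)) - a (fst (w s))) * b (fst (w r)) + 2 * \<sigma> (fst (w r)) \<partial>P) \<le> (4 * rad + 2) * C" if "s \<le> r" for r
  proof -
   have "AE w in P. norm (2 * (X (fst (w r)) - a (fst (w s))) * b (fst (w r)) + 2 * \<sigma> (fst (w r))) \<le> (4 * rad + 2) * C"
    using AE_good
   proof eventually_elim
    case (elim w)
    have r: "0 \<le> r" using that st by simp
    then have n: "norm (fst (w r)) \<le> rad" using elim by (simp add: good_def)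
    have "norm (2 * (X (fst (w r)) - a (fst (w s))) * b (fst (w r)) + 2 * \<sigma> (fst (w r)))
     \<le> 2 * norm (X (fst (w r)) - a (fst (w s))) * norm (b (fst (w r))) + 2 * norm (\<sigma> (fst (w r)))"
     by (rule order_trans[OF norm_triangle_ineq]) (simp add: norm_mult del: right_diff_distrib_numeral)
    also have "\<dots> \<le> 2 * (2 * rad) * C + 2 * C"
     using Xa[OF elim r] bC[OF n] rad0 C0 by (intro add_mono mult_mono) auto
    finally show ?case by (simp add: algebra_simps)
   qed
   then have "norm (\<integral>w. 2 * (X (fst (w r)) - a (fst (w s))) * b (fst (w r)) + 2 * \<sigma> (fst (w r)) \<partial>P) \<le> (\<integral>w. (4 * rad + 2) * C \<partial>P)"
    by (intro order_trans[OF integral_norm_bound integral_mono_AE']) (use rad0 C0 in \<open>auto simp del: right_diff_distrib_numeral\<close>)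
   then show ?thesis by (simp add: prob_space)
  qed
  then have "norm (E2 u) \<le> ((4 * rad + 2) * C) * (u - s)"
   unfolding e2[OF u] by (intro int_bound u) (use rad0 C0 in auto)
  then show ?thesis unfolding nE2 by simp
 qed
 have "norm (\<integral>w. 4 * (X (fst (w r)) - a (fst (w s))) ^ 3 * b (fst (w r)) + 12 * (X (fst (w r)) - a (fst (w s)))\<^sup>2 * \<sigma> (fst (w r)) \<partial>P)
   \<le> ((8 * rad + 12) * C) * (((4 * rad + 2) * C) * (t - s))" if r: "s \<le> r" "r \<le> t" for r
 proof -
  have r0: "0 \<le> r" using r st by simp
  have "AE w in P. norm (4 * (X (fst (w r)) - a (fst (w s))) ^ 3 * b (fst (w r)) + 12 * (X (fst (w r)) - a (fst (w s)))\<^sup>2 * \<sigma> (fst (w r)))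
    \<le> ((8 * rad + 12) * C) * q r w"
   using AE_good
  proof eventually_elim
   case (elim w)
   let ?m = "norm (X (fst (w r)) - a (fst (w s)))"
   have n: "norm (fst (w r)) \<le> rad" using elim r0 by (simp add: good_def)
   have "norm (4 * (X (fst (w r)) - a (fst (w s))) ^ 3 * b (fst (w r)) + 12 * (X (fst (w r)) - a (fst (w s)))\<^sup>2 * \<sigma> (fst (w r)))
    \<le> 4 * ?m ^ 3 * norm (b (fst (w r))) + 12 * ?m\<^sup>2 * norm (\<sigma> (fst (w r)))"
    by (rule order_trans[OF norm_triangle_ineq]) (simp add: norm_mult norm_power del: right_diff_distrib_numeral)
   also have "\<dots> \<le> 4 * ((2 * rad) * ?m\<^sup>2) * C + 12 * ?m\<^sup>2 * C"
   proof (intro add_mono mult_mono mult_left_mono bC n)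
    show "?m ^ 3 \<le> (2 * rad) * ?m\<^sup>2"
     using mult_right_mono[OF Xa[OF elim r0], of "?m\<^sup>2"] by (simp add: power2_eq_square power3_eq_cube mult.assoc)
   qed (use rad0 in auto)
   finally show ?case by (simp add: q_def algebra_simps)
  qed
  then have "norm (\<integral>w. 4 * (X (fst (w r)) - a (fst (w s))) ^ 3 * b (fst (w r)) + 12 * (X (fst (w r)) - a (fst (w s)))\<^sup>2 * \<sigma> (fst (w r)) \<partial>P)
   \<le> (\<integral>w. ((8 * rad + 12) * C) * q r w \<partial>P)"
   using iq[OF r0] rad0 C0
   by (intro order_trans[OF integral_norm_bound integral_mono_AE']) (auto simp: q_nonneg simp del: right_diff_distrib_numeral)
  also have "\<dots> = ((8 * rad + 12) * C) * (\<integral>w. q r w \<partial>P)" by simp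
  also have "\<dots> \<le> ((8 * rad + 12) * C) * (((4 * rad + 2) * C) * (t - s))"
   using E2b[OF r(1)] r rad0 C0
   by (intro mult_left_mono order_trans[OF E2b[OF r(1)]] mult_left_mono) auto
  finally show ?thesis .
 qed
 then have "norm (E4 t) \<le> (((8 * rad + 12) * C) * (((4 * rad + 2) * C) * (t - s))) * (t - s)"
  unfolding e4[OF st(2)] by (intro int_bound st) (use rad0 C0 st in auto)
 moreover have "E4 t = of_real (\<integral>w. (rcoord c (fst (w t)) - rcoord c (fst (w s))) ^ 4 \<partial>P)"
 proof -
  have "E4 t = (\<integral>w. complex_of_real ((rcoord c (fst (w t)) - rcoord c (fst (w s))) ^ 4) \<partial>P)"
   unfolding E4_def
  proof (rule integral_cong_AE)
   show "AE w in P. (X (fst (w t)) - a (fst (w s))) ^ 4 = complex_of_real ((rcoord c (fst (w t)) - rcoord c (fst (w s))) ^ 4)"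
    using z by eventually_elim (simp add: X_def)
   show "(\<lambda>w. (X (fst (w t)) - a (fst (w s))) ^ 4) \<in> borel_measurable P" using mX[of t] st by (auto intro!: borel_measurable_power)
   have "continuous_on UNIV (\<lambda>x :: 'n state. rcoord c (fst x))" by (intro continuous_on_compose2[OF continuous_rcoord] continuous_intros) auto
   note comp_measurable[OF order_trans[OF st] this, measurable] comp_measurable[OF st(1) this, measurable]
   show "(\<lambda>w. complex_of_real ((rcoord c (fst (w t)) - rcoord c (fst (w s))) ^ 4)) \<in> borel_measurable P" by measurable
  qed
  then show ?thesis unfolding integral_complex_of_real .
 qed
 ultimately have "\<bar>\<integral>w. (rcoord c (fst (w t)) - rcoord c (fst (w s))) ^ 4 \<partial>P\<bar> \<le> (((8 * rad + 12) * C) * (((4 * rad + 2) * C) * (t - s))) * (t - s)"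
  by simp
 then show "(\<integral>w. (rcoord c (fst (w t)) - rcoord c (fst (w s))) ^ 4 \<partial>P) \<le> ((8 * rad + 12) * C) * ((4 * rad + 2) * C) * (t - s)\<^sup>2"
  by (simp add: power2_eq_square mult_ac)
 have cr: "continuous_on UNIV (\<lambda>x :: 'n state. rcoord c (fst x))" by (intro continuous_on_compose2[OF continuous_rcoord] continuous_intros) auto
 show "integrable P (\<lambda>w. (rcoord c (fst (w t)) - rcoord c (fst (w s))) ^ 4)"
 proof (rule integrable_const_bound[where B="(2 * rad) ^ 4"])
  show "AE w in P. norm ((rcoord c (fst (w t)) - rcoord c (fst (w s))) ^ 4) \<le> (2 * rad) ^ 4"
   using AE_good
  proof eventually_elim
   case (elim w)
   then have "norm (fst (w t)) \<le> rad" "norm (fst (w s)) \<le> rad" using st by (auto simp: good_def)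
   then have "\<bar>rcoord c (fst (w t)) - rcoord c (fst (w s))\<bar> \<le> 2 * rad"
    using rcoord_le[of c "fst (w t)"] rcoord_le[of c "fst (w s)"] by linarith
   then show ?case by (simp only: real_norm_def power_abs) (rule power_mono, auto)
  qed
  show "(\<lambda>w. (rcoord c (fst (w t)) - rcoord c (fst (w s))) ^ 4) \<in> borel_measurable P"
   using comp_measurable[OF order_trans[OF st] cr] comp_measurable[OF st(1) cr] by measurable
 qed
qed

end

section \<open>Skorokhod representation for countably many random variables\<close>

text \<open>
 With the digits 2 and 7 every tail of the expansion stays away from the places where a decimal digit
 jumps, so each digit is recovered from the number by a continuous function.
\<close>

definition digit_code :: "(nat \<Rightarrow> bool) \<Rightarrow> real" where
 "digit_code b = (\<Sum>k. (if b k then 7 else 2) / 10 ^ Suc k)"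

text \<open>For a code x, the fractional part of 10^k x lies in [0.2, 0.3] or in [0.7, 0.8]. After
  the shift by 1/4 the cosine is at most -1/2 in the first case and at least 1/2 in the second, so
  clipping returns exactly 0 or 1.\<close>

definition read_digit :: "nat \<Rightarrow> real \<Rightarrow> real" where
 "read_digit k x = max 0 (min 1 (1 / 2 + cos (2 * pi * (10 ^ k * x + 1 / 4))))"

lemma summable_digits: "summable (\<lambda>k. (if b k then 7 else 2) / (10::real) ^ Suc k)"
proof (rule summable_comparison_test)
 show "\<exists>N. \<forall>n\<ge>N. norm ((if b n then 7 else 2) / (10::real) ^ Suc n) \<le> (7/10) * (1/10) ^ n"
 proof (intro exI[of _ 0] allI impI)
  fix n :: nat
  have "norm ((if b n then 7 else 2) / (10::real) ^ Suc n) \<le> 7 / 10 ^ Suc n"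
   unfolding norm_divide by (intro frac_le) auto
  then show "norm ((if b n then 7 else 2) / (10::real) ^ Suc n) \<le> (7/10) * (1/10) ^ n"
   by (simp add: power_divide)
 qed
 show "summable (\<lambda>n. (7/10) * (1/10::real) ^ n)"
  by (intro summable_mult summable_geometric) simp
qed

lemma digit_code_range: "0 \<le> digit_code b" "digit_code b \<le> 1"
proof -
 show "0 \<le> digit_code b" unfolding digit_code_def by (intro suminf_nonneg summable_digits) auto
 have "digit_code b \<le> (\<Sum>k. (9/10) * (1/10) ^ k)"
  unfolding digit_code_def
  by (intro suminf_le summable_digits summable_mult summable_geometric) (auto simp: power_divide divide_le_eq)
 also have "\<dots> = 1" by (subst suminf_mult) (auto simp: suminf_geometric summable_geometric)
 finally show "digit_code b \<le> 1" .
qed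

lemma digit_code_shift: "\<exists>N::nat. 10 ^ k * digit_code b = real N + digit_code (\<lambda>m. b (k + m))"
proof (induction k arbitrary: b)
 case 0
 show ?case by (intro exI[of _ 0]) simp
next
 case (Suc k)
 have "digit_code b = (\<Sum>m. (if b (Suc m) then 7 else 2) / 10 ^ Suc (Suc m)) + (if b 0 then 7 else 2) / 10"
  unfolding digit_code_def using suminf_split_head[OF summable_digits[of b]] by simp
 also have "(\<Sum>m. (if b (Suc m) then 7 else 2) / 10 ^ Suc (Suc m)) = (1/10) * digit_code (\<lambda>m. b (Suc m))"
  unfolding digit_code_def by (subst suminf_mult[OF summable_digits, symmetric]) (auto intro!: suminf_cong)
 finally have "10 * digit_code b = (if b 0 then 7 else 2) + digit_code (\<lambda>m. b (Suc m))" by simp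
 then have "10 ^ Suc k * digit_code b = 10 ^ k * ((if b 0 then 7 else 2) + digit_code (\<lambda>m. b (Suc m)))"
  by simp
 moreover obtain N where "10 ^ k * digit_code (\<lambda>m. b (Suc m)) = real N + digit_code (\<lambda>m. b (Suc (k + m)))"
  using Suc.IH[of "\<lambda>m. b (Suc m)"] by auto
 ultimately have "10 ^ Suc k * digit_code b = real (10 ^ k * (if b 0 then 7 else 2) + N) + digit_code (\<lambda>m. b (Suc k + m))"
  by (simp add: distrib_left)
 then show ?case by blast
qed

lemma digit_code_head: "digit_code b = (if b 0 then 7 else 2) / 10 + (1/10) * digit_code (\<lambda>m. b (Suc m))"
proof -
 have "digit_code b = (\<Sum>m. (if b (Suc m) then 7 else 2) / 10 ^ Suc (Suc m)) + (if b 0 then 7 else 2) / 10"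
  unfolding digit_code_def using suminf_split_head[OF summable_digits[of b]] by simp
 also have "(\<Sum>m. (if b (Suc m) then 7 else 2) / 10 ^ Suc (Suc m)) = (1/10) * digit_code (\<lambda>m. b (Suc m))"
  unfolding digit_code_def by (subst suminf_mult[OF summable_digits, symmetric]) (auto intro!: suminf_cong)
 finally show ?thesis by simp
qed

lemma read_digit_code: "read_digit k (digit_code b) = (if b k then 1 else 0)"
proof -
 obtain N where N: "10 ^ k * digit_code b = real N + digit_code (\<lambda>m. b (k + m))" using digit_code_shift by blast
 define c where "c = digit_code (\<lambda>m. b (k + m))"
 define e where "e = (1/10) * digit_code (\<lambda>m. b (k + Suc m))"
 have c: "c = (if b k then 7 else 2) / 10 + e"
  unfolding c_def e_def by (subst digit_code_head) simp
 have e: "0 \<le> e" "e \<le> 1 / 10" using digit_code_range[of "\<lambda>m. b (k + Suc m)"] by (auto simp: e_def)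
 \<comment> \<open>The tail \<open>e\<close> ranges over [0, 1/10]; subtracting the midpoint centres
   the phase, and |d| \<le> 1/20 is well within the 1/6 up to which the cosine stays above
   1/2.\<close>
 define d where "d = e - 1 / 20"
 have cosd: "1 / 2 \<le> cos (2 * pi * d)"
 proof -
  have "\<bar>2 * pi * d\<bar> = 2 * pi * \<bar>d\<bar>" by (simp add: abs_mult)
  also have "\<dots> \<le> 2 * pi * (1 / 6)" using e by (intro mult_left_mono) (unfold d_def, linarith, simp)
  finally have "\<bar>2 * pi * d\<bar> \<le> pi / 3" by simp
  then have "cos (pi / 3) \<le> cos \<bar>2 * pi * d\<bar>" by (intro cos_monotone_0_pi_le) auto
  then show ?thesis by (simp add: cos_60)
 qed
 have "cos (2 * pi * (10 ^ k * digit_code b + 1 / 4)) = cos (2 * pi * (c + 1 / 4) + real N * (2 * pi))"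
  unfolding N c_def by (simp add: algebra_simps)
 also have "\<dots> = cos (2 * pi * (c + 1 / 4))" using cos.plus_of_nat[of "2 * pi * (c + 1 / 4)" N] by simp
 finally have eq: "cos (2 * pi * (10 ^ k * digit_code b + 1 / 4)) = cos (2 * pi * (c + 1 / 4))" .
 show ?thesis
 proof (cases "b k")
  case True
  have "2 * pi * (c + 1 / 4) = 2 * pi * d + 2 * pi" by (simp add: c True d_def algebra_simps)
  then have "cos (2 * pi * (c + 1 / 4)) = cos (2 * pi * d)" by (simp only: cos_periodic)
  then show ?thesis using cosd True by (simp add: read_digit_def eq)
 next
  case False
  have "2 * pi * (c + 1 / 4) = 2 * pi * d + pi" by (simp add: c False d_def algebra_simps)
  then have "cos (2 * pi * (c + 1 / 4)) = - cos (2 * pi * d)" by (simp only: cos_periodic_pi)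
  then show ?thesis using cosd False by (simp add: read_digit_def eq)
 qed
qed

section \<open>Coding countably many numbers in [0, 1) by a single number\<close>

definition bit_of :: "nat \<Rightarrow> real \<Rightarrow> bool" where
 "bit_of m u \<longleftrightarrow> odd \<lfloor>2 ^ Suc m * u\<rfloor>"

lemma binary_partial:
 assumes "0 \<le> u" "u < 1"
 shows "(\<Sum>m<M. (if bit_of m u then 1 else 0) / 2 ^ Suc m) = of_int \<lfloor>2 ^ M * u\<rfloor> / (2::real) ^ M"
proof (induction M)
 case 0
 have "\<lfloor>u\<rfloor> = 0" using assms by (simp add: floor_eq_iff)
 then show ?case by simp
next
 case (Suc M)
 define k where "k = \<lfloor>2 ^ M * u\<rfloor>"
 have "of_int k \<le> 2 ^ M * u" "2 ^ M * u < of_int k + 1" by (simp_all add: k_def)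
 then have "2 * k \<le> \<lfloor>2 ^ Suc M * u\<rfloor>" "\<lfloor>2 ^ Suc M * u\<rfloor> < 2 * k + 2"
  by (simp_all add: le_floor_iff floor_less_iff)
 then have "\<lfloor>2 ^ Suc M * u\<rfloor> = 2 * k \<or> \<lfloor>2 ^ Suc M * u\<rfloor> = 2 * k + 1" by linarith
 then have f: "\<lfloor>2 ^ Suc M * u\<rfloor> = 2 * k + (if bit_of M u then 1 else 0)"
  unfolding bit_of_def by auto
 have "(\<Sum>m<Suc M. (if bit_of m u then 1 else 0) / 2 ^ Suc m) = of_int k / (2::real) ^ M + (if bit_of M u then 1 else 0) / 2 ^ Suc M"
  using Suc by (simp add: k_def)
 also have "\<dots> = of_int (2 * k + (if bit_of M u then 1 else 0)) / 2 ^ Suc M" by (simp add: field_simps)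
 finally show ?case unfolding f .
qed

lemma binary_expansion:
 assumes "0 \<le> u" "u < 1"
 shows "(\<Sum>m. (if bit_of m u then 1 else 0) / 2 ^ Suc m) = u"
proof (rule sums_unique[symmetric], unfold sums_def binary_partial[OF assms])
 show "(\<lambda>n. of_int \<lfloor>2 ^ n * u\<rfloor> / 2 ^ n) \<longlonglongrightarrow> u"
 proof (rule tendsto_sandwich[of "\<lambda>n. u - (1 / 2) ^ n" _ _ "\<lambda>_. u"])
  have "(\<lambda>n. u - (1 / 2) ^ n) \<longlonglongrightarrow> u - 0" by (intro tendsto_intros LIMSEQ_power_zero) simp
  then show "(\<lambda>n. u - (1 / 2) ^ n) \<longlonglongrightarrow> u" by simp
  show "\<forall>\<^sub>F n in sequentially. u - (1 / 2) ^ n \<le> of_int \<lfloor>2 ^ n * u\<rfloor> / 2 ^ n"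
  proof (intro always_eventually allI)
   fix n
   have "2 ^ n * u - 1 \<le> of_int \<lfloor>2 ^ n * u\<rfloor>" by linarith
   then have "(2 ^ n * u - 1) / 2 ^ n \<le> of_int \<lfloor>2 ^ n * u\<rfloor> / 2 ^ n" by (intro divide_right_mono) auto
   then show "u - (1 / 2) ^ n \<le> of_int \<lfloor>2 ^ n * u\<rfloor> / 2 ^ n" by (simp add: diff_divide_distrib power_divide)
  qed
  show "\<forall>\<^sub>F n in sequentially. of_int \<lfloor>2 ^ n * u\<rfloor> / 2 ^ n \<le> u"
   by (intro always_eventually allI) (simp add: divide_le_eq mult.commute)
 qed simp
qed

text \<open>\<open>prod_decode\<close> interleaves the coordinates: each decimal digit stores one
  binary digit of one coordinate.\<close>

definition encode :: "('i::countable \<Rightarrow> real) \<Rightarrow> real" where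
 "encode u = digit_code (\<lambda>k. bit_of (snd (prod_decode k)) (u (from_nat (fst (prod_decode k)))))"

definition decode :: "'i::countable \<Rightarrow> real \<Rightarrow> real" where
 "decode i x = (\<Sum>m. read_digit (prod_encode (to_nat i, m)) x / 2 ^ Suc m)"

lemma decode_encode:
 assumes "0 \<le> u i" "u i < 1"
 shows "decode i (encode u) = u i"
proof -
 have "read_digit (prod_encode (to_nat i, m)) (encode u) = (if bit_of m (u i) then 1 else 0)" for m
  unfolding encode_def read_digit_code by simp
 then show ?thesis unfolding decode_def using binary_expansion[OF assms] by simp
qed

text \<open>Continuity on the whole line is the point: a limit of codes is a real number about which
  nothing else is known, and decoding still converges along it.\<close>

lemma decode_continuous: "continuous_on UNIV (decode i)"
 unfolding decode_def[abs_def]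
proof (rule uniform_limit_theorem)
 show "uniform_limit UNIV (\<lambda>n x. \<Sum>m<n. read_digit (prod_encode (to_nat i, m)) x / 2 ^ Suc m)
   (\<lambda>x. \<Sum>m. read_digit (prod_encode (to_nat i, m)) x / 2 ^ Suc m) sequentially"
 proof (rule Weierstrass_m_test)
  show "norm (read_digit (prod_encode (to_nat i, m)) x / 2 ^ Suc m) \<le> (1 / 2) ^ Suc m" for m x
   by (auto simp: read_digit_def power_divide intro!: divide_right_mono)
  show "summable (\<lambda>m. (1 / 2 :: real) ^ Suc m)" by (subst summable_Suc_iff) (simp add: summable_geometric)
 qed
 show "\<forall>\<^sub>F n in sequentially. continuous_on UNIV (\<lambda>x. \<Sum>m<n. read_digit (prod_encode (to_nat i, m)) x / 2 ^ Suc m)"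
  unfolding read_digit_def by (intro always_eventually allI continuous_intros) auto
qed simp

text \<open>Measurability is all that is asked of the encoding, since laws are compared after
  decoding.\<close>

lemma encode_measurable:
 fixes U :: "'i::countable \<Rightarrow> 'a \<Rightarrow> real"
 assumes [measurable]: "\<And>i. U i \<in> borel_measurable M"
 shows "(\<lambda>w. encode (\<lambda>i. U i w)) \<in> borel_measurable M"
 unfolding encode_def digit_code_def
proof (rule borel_measurable_suminf)
 fix k
 have "{w \<in> space M. bit_of m (U i w)} \<in> sets M" for m i
 proof -
  have "(\<lambda>w. \<lfloor>2 ^ Suc m * U i w\<rfloor>) \<in> M \<rightarrow>\<^sub>M count_space UNIV" by measurable
  from measurable_sets[OF this, of "{z. odd z}"] show ?thesis
   by (simp add: bit_of_def vimage_def Int_def conj_commute)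
 qed
 then show "(\<lambda>w. (if bit_of (snd (prod_decode k)) (U (from_nat (fst (prod_decode k))) w) then 7 else 2) / (10 :: real) ^ Suc k) \<in> borel_measurable M"
  by (intro borel_measurable_divide measurable_If borel_measurable_const)
qed

text \<open>Codes lie in [0, 1], so their laws on the line are tight; a subsequence converges weakly
  and is realized by convergent variables on one space. The continuous decoding then gives
  convergence of all coordinates at once.\<close>

lemma skorokhod_countable:
 fixes Pn :: "nat \<Rightarrow> 'a measure" and U :: "nat \<Rightarrow> 'i::countable \<Rightarrow> 'a \<Rightarrow> real"
 assumes P: "\<And>n. prob_space (Pn n)" and U: "\<And>n i. U n i \<in> borel_measurable (Pn n)"
  and range: "\<And>n i w. w \<in> space (Pn n) \<Longrightarrow> 0 \<le> U n i w \<and> U n i w < 1"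
 obtains r \<Omega> Yn Y where "strict_mono (r :: nat \<Rightarrow> nat)" "prob_space (\<Omega> :: real measure)"
  "\<And>n i. Yn n i \<in> borel_measurable \<Omega>" "\<And>i. Y i \<in> borel_measurable \<Omega>"
  "\<And>n. distr \<Omega> (\<Pi>\<^sub>M i\<in>UNIV. borel) (\<lambda>\<omega> i. Yn n i \<omega>) = distr (Pn (r n)) (\<Pi>\<^sub>M i\<in>UNIV. borel) (\<lambda>w i. U (r n) i w)"
  "\<And>\<omega> i. \<omega> \<in> space \<Omega> \<Longrightarrow> (\<lambda>n. Yn n i \<omega>) \<longlonglongrightarrow> (Y i \<omega> :: real)"
proof -
 define X where "X n w = encode (\<lambda>i. U n i w)" for n w
 have X[measurable]: "X n \<in> borel_measurable (Pn n)" for n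
  unfolding X_def[abs_def] by (rule encode_measurable[OF U])
 define \<mu> where "\<mu> n = distr (Pn n) borel (X n)" for n
 have rd: "real_distribution (\<mu> n)" for n
  unfolding \<mu>_def real_distribution_def real_distribution_axioms_def
  using prob_space.prob_space_distr[OF P X] by simp
 have "tight \<mu>"
  unfolding tight_def
 proof (intro conjI allI impI rd)
  fix \<epsilon> :: real assume "\<epsilon> > 0"
  have in_interval: "1 - \<epsilon> < measure (\<mu> n) {-1<..2}" for n
  proof -
  interpret prob_space "Pn n" by (rule P)
  have "measure (\<mu> n) {-1<..2} = measure (Pn n) (X n -` {-1<..2} \<inter> space (Pn n))"
   unfolding \<mu>_def by (rule measure_distr) auto
  also have "X n -` {-1<..2} \<inter> space (Pn n) = space (Pn n)"
  proof -
   have "X n w \<in> {-1<..2}" for w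
    unfolding X_def encode_def using digit_code_range[of "\<lambda>k. bit_of (snd (prod_decode k)) (U n (from_nat (fst (prod_decode k))) w)"] by auto
   then show ?thesis by auto
  qed
  finally show ?thesis using \<open>\<epsilon> > 0\<close> by (simp add: prob_space)
  qed
  show "\<exists>a b. a < b \<and> (\<forall>n. 1 - \<epsilon> < measure (\<mu> n) {a<..b})"
  proof (intro exI conjI allI)
   show "- 1 < (2::real)" by simp
  qed (rule in_interval)
 qed
 from tight_imp_convergent_subsubsequence[OF this strict_mono_id] obtain r M
  where r: "strict_mono r" and M: "real_distribution M" and conv: "weak_conv_m (\<mu> \<circ> id \<circ> r) M" by blast
 have "weak_conv_m (\<lambda>n. \<mu> (r n)) M" using conv by (simp add: comp_def)
 from Skorohod[OF rd M this] obtain \<Omega> :: "real measure" and Ys :: "nat \<Rightarrow> real \<Rightarrow> real" and Yl :: "real \<Rightarrow> real"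
  where \<Omega>: "prob_space \<Omega>" and Ys[measurable]: "\<And>n. Ys n \<in> borel_measurable \<Omega>"
   and dY: "\<And>n. distr \<Omega> borel (Ys n) = \<mu> (r n)" and Yl: "Yl \<in> measurable \<Omega> lborel"
   and lim: "\<And>x. x \<in> space \<Omega> \<Longrightarrow> (\<lambda>n. Ys n x) \<longlonglongrightarrow> Yl x" by blast
 have [measurable]: "Yl \<in> borel_measurable \<Omega>" using Yl by simp
 have dm[measurable]: "decode i \<in> borel_measurable borel" for i :: 'i
  by (rule borel_measurable_continuous_onI[OF decode_continuous])
 have dM: "(\<lambda>x i. decode i x) \<in> borel \<rightarrow>\<^sub>M (\<Pi>\<^sub>M i\<in>(UNIV :: 'i set). borel)"
  by (rule measurable_PiM_single') auto
 show ?thesis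
 proof (rule that[OF r \<Omega>, of "\<lambda>n i \<omega>. decode i (Ys n \<omega>)" "\<lambda>i \<omega>. decode i (Yl \<omega>)"])
  fix n
  have "distr \<Omega> (\<Pi>\<^sub>M i\<in>(UNIV :: 'i set). borel) (\<lambda>\<omega> i. decode i (Ys n \<omega>)) = distr (distr \<Omega> borel (Ys n)) (\<Pi>\<^sub>M i\<in>UNIV. borel) (\<lambda>x i. decode i x)"
   by (subst distr_distr[OF dM Ys]) (simp add: comp_def)
  also have "\<dots> = distr (Pn (r n)) (\<Pi>\<^sub>M i\<in>UNIV. borel) (\<lambda>w i. decode i (X (r n) w))"
   unfolding dY \<mu>_def by (subst distr_distr[OF dM X]) (simp add: comp_def)
  also have "\<dots> = distr (Pn (r n)) (\<Pi>\<^sub>M i\<in>UNIV. borel) (\<lambda>w i. U (r n) i w)"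
   unfolding X_def by (intro distr_cong refl ext decode_encode) (use range in auto)
  finally show "distr \<Omega> (\<Pi>\<^sub>M i\<in>UNIV. borel) (\<lambda>\<omega> i. decode i (Ys n \<omega>)) = distr (Pn (r n)) (\<Pi>\<^sub>M i\<in>UNIV. borel) (\<lambda>w i. U (r n) i w)" .
 next
  fix \<omega> and i :: 'i assume "\<omega> \<in> space \<Omega>"
  then show "(\<lambda>n. decode i (Ys n \<omega>)) \<longlonglongrightarrow> decode i (Yl \<omega>)"
   using continuous_on_tendsto_compose[OF decode_continuous lim] by auto
 qed measurable
qed

section \<open>Chaining\<close>

text \<open>\<open>i div 2\<close> is the parent of the grid point \<open>i\<close> on the next
  coarser level: the same point for even \<open>i\<close>, one increment away for odd
  \<open>i\<close>. Passing from level \<open>N + k\<close> to level \<open>N\<close> costs at most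
  one increment per level.\<close>

lemma chaining_step:
 fixes T :: "real \<Rightarrow> 'a::real_normed_vector"
 assumes \<rho>: "0 \<le> \<rho>" "\<rho> < 1" and B: "0 \<le> B"
  and inc: "\<And>n i. N \<le> n \<Longrightarrow> Suc i \<le> M * 2 ^ n \<Longrightarrow> norm (T (real (Suc i) / 2 ^ n) - T (real i / 2 ^ n)) \<le> B * \<rho> ^ n"
  and i: "i \<le> M * 2 ^ (N + k)"
 shows "norm (T (real i / 2 ^ (N + k)) - T (real (i div 2 ^ k) / 2 ^ N)) \<le> B * \<rho> ^ N * (\<Sum>j<k. \<rho> ^ Suc j)"
 using i
proof (induction k arbitrary: i)
 case (Suc k)
 have i2: "i div 2 \<le> M * 2 ^ (N + k)" using Suc.prems by simp
 have e: "real (2 * (i div 2)) / 2 ^ (N + Suc k) = real (i div 2) / 2 ^ (N + k)" by simp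
 have s: "norm (T (real i / 2 ^ (N + Suc k)) - T (real (i div 2) / 2 ^ (N + k))) \<le> B * \<rho> ^ (N + Suc k)"
 proof (cases "even i")
  case True
  then have "2 * (i div 2) = i" by simp
  then show ?thesis using e B \<rho> by simp
 next
  case False
  then have i': "i = Suc (2 * (i div 2))" by presburger
  then have "norm (T (real i / 2 ^ (N + Suc k)) - T (real (2 * (i div 2)) / 2 ^ (N + Suc k))) \<le> B * \<rho> ^ (N + Suc k)"
   using inc[of "N + Suc k" "2 * (i div 2)"] Suc.prems by simp
  then show ?thesis unfolding e .
 qed
 have d: "i div 2 div 2 ^ k = i div 2 ^ Suc k" by (simp add: div_mult2_eq)
 have "norm (T (real i / 2 ^ (N + Suc k)) - T (real (i div 2 ^ Suc k) / 2 ^ N))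
  \<le> norm (T (real i / 2 ^ (N + Suc k)) - T (real (i div 2) / 2 ^ (N + k))) + norm (T (real (i div 2) / 2 ^ (N + k)) - T (real (i div 2 ^ Suc k) / 2 ^ N))"
  using norm_triangle_ineq[of "T (real i / 2 ^ (N + Suc k)) - T (real (i div 2) / 2 ^ (N + k))" "T (real (i div 2) / 2 ^ (N + k)) - T (real (i div 2 ^ Suc k) / 2 ^ N)"] by simp
 also have "\<dots> \<le> B * \<rho> ^ (N + Suc k) + B * \<rho> ^ N * (\<Sum>j<k. \<rho> ^ Suc j)"
  using s Suc.IH[OF i2] unfolding d by (rule add_mono)
 also have "\<dots> = B * \<rho> ^ N * (\<Sum>j<Suc k. \<rho> ^ Suc j)" by (simp add: power_add algebra_simps)
 finally show ?case .
qed simp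

text \<open>In units of \<open>B * \<rho> ^ N\<close>, moving either point to level \<open>N\<close>
  costs at most 1 / (1 - \<rho>). As the points are within one mesh of each other, their ancestors
  coincide or are neighbours, which costs the remaining 1.\<close>

lemma chaining:
 fixes T :: "real \<Rightarrow> 'a::real_normed_vector"
 assumes \<rho>: "0 \<le> \<rho>" "\<rho> < 1" and B: "0 \<le> B"
  and inc: "\<And>n i. N \<le> n \<Longrightarrow> Suc i \<le> M * 2 ^ n \<Longrightarrow> norm (T (real (Suc i) / 2 ^ n) - T (real i / 2 ^ n)) \<le> B * \<rho> ^ n"
  and ij: "i \<le> M * 2 ^ n" "j \<le> M * 2 ^ n" and n: "N \<le> n" and close: "\<bar>real i / 2 ^ n - real j / 2 ^ n\<bar> \<le> 1 / 2 ^ N"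
 shows "norm (T (real i / 2 ^ n) - T (real j / 2 ^ n)) \<le> B * \<rho> ^ N * (1 + 2 / (1 - \<rho>))"
proof -
 obtain k where k: "n = N + k" using n le_Suc_ex by blast
 have geo: "(\<Sum>j<k. \<rho> ^ Suc j) \<le> 1 / (1 - \<rho>)"
 proof -
  have "(\<Sum>j<k. \<rho> ^ Suc j) \<le> (\<Sum>j<k. \<rho> ^ j)"
   using \<rho> by (intro sum_mono power_decreasing) auto
  also have "\<dots> \<le> (\<Sum>j. \<rho> ^ j)" using \<rho> by (intro sum_le_suminf summable_geometric) auto
  also have "\<dots> = 1 / (1 - \<rho>)" using \<rho> by (simp add: suminf_geometric)
  finally show ?thesis .
 qed
 have B\<rho>: "0 \<le> B * \<rho> ^ N" using B \<rho> by simp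
 have A: "norm (T (real i / 2 ^ n) - T (real (i div 2 ^ k) / 2 ^ N)) \<le> B * \<rho> ^ N * (1 / (1 - \<rho>))" if "i \<le> M * 2 ^ n" for i
 proof -
  have "norm (T (real i / 2 ^ (N + k)) - T (real (i div 2 ^ k) / 2 ^ N)) \<le> B * \<rho> ^ N * (\<Sum>j<k. \<rho> ^ Suc j)"
   by (rule chaining_step[OF \<rho> B inc]) (use that in \<open>simp_all add: k\<close>)
  then show ?thesis using mult_left_mono[OF geo B\<rho>] unfolding k by linarith
 qed
 have le: "i div 2 ^ k \<le> Suc (j div 2 ^ k)" if "\<bar>real i / 2 ^ n - real j / 2 ^ n\<bar> \<le> 1 / 2 ^ N" for i j :: nat
 proof -
  have "(real i - real j) / 2 ^ n \<le> 2 ^ k / 2 ^ n"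
   using that by (simp add: k power_add diff_divide_distrib)
  then have "real i - real j \<le> 2 ^ k" by (simp add: divide_le_cancel)
  then have "real i \<le> real (j + 2 ^ k)" by simp
  then have "i \<le> j + 2 ^ k" by (simp only: of_nat_le_iff)
  then have "i div 2 ^ k \<le> (j + 2 ^ k) div 2 ^ k" by (rule div_le_mono)
  then show ?thesis by simp
 qed
 define a where "a = i div 2 ^ k"
 define b where "b = j div 2 ^ k"
 have ab: "a \<le> Suc b" "b \<le> Suc a"
  using le[OF close] le[of j i] close by (auto simp: a_def b_def abs_minus_commute)
 have dm: "i div 2 ^ k \<le> M * 2 ^ N" if "i \<le> M * 2 ^ n" for i
 proof -
  have "i div 2 ^ k \<le> (M * 2 ^ N * 2 ^ k) div 2 ^ k" using that by (intro div_le_mono) (simp add: k power_add mult.assoc)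
  then show ?thesis by simp
 qed
 have C: "norm (T (real a / 2 ^ N) - T (real b / 2 ^ N)) \<le> B * \<rho> ^ N"
 proof -
  consider "a = b" | "a = Suc b" | "b = Suc a" using ab by linarith
  then show ?thesis
  proof cases
   case 1 then show ?thesis using B\<rho> by simp
  next
   case 2 then show ?thesis using inc[of N b] dm[OF ij(1)] by (simp add: a_def[symmetric])
  next
   case 3 then show ?thesis using inc[of N a] dm[OF ij(2)] by (simp add: b_def[symmetric] norm_minus_commute)
  qed
 qed
 have "T (real i / 2 ^ n) - T (real j / 2 ^ n) = (T (real i / 2 ^ n) - T (real a / 2 ^ N)) + (T (real a / 2 ^ N) - T (real b / 2 ^ N)) + (T (real b / 2 ^ N) - T (real j / 2 ^ n))"
  by simp
 also have "norm \<dots> \<le> (B * \<rho> ^ N * (1 / (1 - \<rho>)) + B * \<rho> ^ N) + B * \<rho> ^ N * (1 / (1 - \<rho>))"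
  by (intro norm_triangle_mono C) (use A[OF ij(1)] A[OF ij(2)] in \<open>auto simp: a_def b_def norm_minus_commute\<close>)
 also have "\<dots> = B * \<rho> ^ N * (1 + 2 / (1 - \<rho>))" by (simp add: algebra_simps)
 finally show ?thesis .
qed

section \<open>Reconstruction of paths from dyadic times\<close>

text \<open>At level \<open>n\<close> the increments are controlled on [0, n + 1], a window that
  grows so that every compact interval is eventually covered. For positive \<open>v\<close>, a
  larger \<open>v\<close> means a smaller modulus of continuity.\<close>

definition tame :: "real \<Rightarrow> (real \<Rightarrow> real) \<Rightarrow> bool" where
 "tame v x \<longleftrightarrow> (\<forall>n i. Suc i \<le> Suc n * 2 ^ n \<longrightarrow> \<bar>x (real (Suc i) / 2 ^ n) - x (real i / 2 ^ n)\<bar> \<le> (9 / 10) ^ n / v)"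

definition dyadic_floor :: "nat \<Rightarrow> real \<Rightarrow> real" where
 "dyadic_floor m t = real (nat \<lfloor>2 ^ m * t\<rfloor>) / 2 ^ m"

text \<open>\<open>lim\<close> is unspecified on divergent sequences, so the extension has a meaning
  only when the values along the dyadic floors converge, as \<open>tame_convergent\<close>
  ensures.\<close>

definition dyadic_extension :: "(real \<Rightarrow> real) \<Rightarrow> real \<Rightarrow> real" where
 "dyadic_extension x t = lim (\<lambda>m. x (dyadic_floor m t))"

text \<open>The factor 21 is 1 + 2 / (1 - 9/10) from \<open>chaining\<close>.\<close>

definition tame_modulus :: "real \<Rightarrow> nat \<Rightarrow> real" where
 "tame_modulus v N = (1 / v) * (9 / 10) ^ N * 21"

lemma dyadic_floor_bounds:
 assumes "0 \<le> t"
 shows "dyadic_floor m t \<le> t" "t - 1 / 2 ^ m < dyadic_floor m t" "0 \<le> dyadic_floor m t"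
proof -
 define z where "z = \<lfloor>2 ^ m * t\<rfloor>"
 have z: "0 \<le> z" "of_int z \<le> 2 ^ m * t" "2 ^ m * t < of_int z + 1" using assms by (auto simp: z_def)
 have e: "dyadic_floor m t = of_int z / 2 ^ m" using z(1) by (simp add: dyadic_floor_def z_def)
 show "dyadic_floor m t \<le> t" unfolding e using z(2) by (simp add: divide_le_eq mult.commute)
 have "t < (of_int z + 1) / 2 ^ m" using z(3) by (simp add: less_divide_eq mult.commute)
 then show "t - 1 / 2 ^ m < dyadic_floor m t" unfolding e by (simp add: add_divide_distrib)
 show "0 \<le> dyadic_floor m t" by (simp add: dyadic_floor_def)
qed

lemma dyadic_floor_tendsto:
 assumes "0 \<le> t"
 shows "(\<lambda>m. dyadic_floor m t) \<longlonglongrightarrow> t"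
proof (rule tendsto_sandwich[of "\<lambda>m. t - (1 / 2) ^ m" _ _ "\<lambda>_. t"])
 have "(\<lambda>n. t - (1 / 2) ^ n) \<longlonglongrightarrow> t - 0" by (intro tendsto_intros LIMSEQ_power_zero) simp
 then show "(\<lambda>n. t - (1 / 2) ^ n) \<longlonglongrightarrow> t" by simp
 show "\<forall>\<^sub>F m in sequentially. t - (1 / 2) ^ m \<le> dyadic_floor m t"
  using dyadic_floor_bounds(2)[OF assms] by (intro always_eventually allI less_imp_le) (simp add: power_divide)
 show "\<forall>\<^sub>F m in sequentially. dyadic_floor m t \<le> t"
  using dyadic_floor_bounds(1)[OF assms] by simp
qed simp

text \<open>Rounding moves both times down by less than 1 / 2^(N + 1), so the rounded times are
  within 1 / 2^N, the distance that \<open>chaining\<close> admits at level \<open>N\<close>. The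
  condition \<open>M \<le> Suc N\<close> places all times in the window of \<open>tame\<close> from
  level \<open>N\<close> on.\<close>

lemma tame_dyadic:
 assumes v: "0 < v" and x: "tame v x" and M: "M \<le> Suc N"
  and t: "0 \<le> t" "t \<le> real M" "0 \<le> t'" "t' \<le> real M" and close: "\<bar>t - t'\<bar> \<le> 1 / 2 ^ Suc N"
  and m: "Suc N \<le> m" "Suc N \<le> m'"
 shows "\<bar>x (dyadic_floor m t) - x (dyadic_floor m' t')\<bar> \<le> tame_modulus v N"
proof -
 define n where "n = max m m'"
 define i where "i = nat \<lfloor>2 ^ m * t\<rfloor> * 2 ^ (n - m)"
 define j where "j = nat \<lfloor>2 ^ m' * t'\<rfloor> * 2 ^ (n - m')"
 have pow: "(2::real) ^ n = 2 ^ m * 2 ^ (n - m)" "(2::real) ^ n = 2 ^ m' * 2 ^ (n - m')"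
  by (simp_all add: n_def flip: power_add)
 have e: "real i / 2 ^ n = dyadic_floor m t" "real j / 2 ^ n = dyadic_floor m' t'"
  unfolding i_def j_def dyadic_floor_def by (simp add: pow(1), simp add: pow(2))
 have le: "i \<le> M * 2 ^ n" "j \<le> M * 2 ^ n"
 proof -
  have "real i / 2 ^ n \<le> real M" "real j / 2 ^ n \<le> real M"
   unfolding e using dyadic_floor_bounds(1)[OF t(1), of m] dyadic_floor_bounds(1)[OF t(3), of m'] t by linarith+
  then have "real i \<le> real (M * 2 ^ n)" "real j \<le> real (M * 2 ^ n)" by (simp_all add: divide_le_eq)
  then show "i \<le> M * 2 ^ n" "j \<le> M * 2 ^ n" by (simp_all only: of_nat_le_iff)
 qed
 have small: "1 / 2 ^ m \<le> 1 / (2::real) ^ Suc N" "1 / 2 ^ m' \<le> 1 / (2::real) ^ Suc N"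
  using m by (auto intro!: divide_left_mono power_increasing simp del: power_Suc)
 have cl: "\<bar>real i / 2 ^ n - real j / 2 ^ n\<bar> \<le> 1 / 2 ^ N"
 proof -
  have "1 / (2::real) ^ N = 1 / 2 ^ Suc N + 1 / 2 ^ Suc N" by simp
  then show ?thesis
   unfolding e using dyadic_floor_bounds[OF t(1), of m] dyadic_floor_bounds[OF t(3), of m'] close small by linarith
 qed
 have "norm (x (real i / 2 ^ n) - x (real j / 2 ^ n)) \<le> (1 / v) * (9 / 10) ^ N * (1 + 2 / (1 - 9 / 10))"
 proof (rule chaining[OF _ _ _ _ le _ cl])
  fix n i assume "N \<le> n" "Suc i \<le> M * 2 ^ n"
  moreover then have "M * 2 ^ n \<le> Suc n * 2 ^ n" using M by (intro mult_right_mono) auto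
  ultimately have "Suc i \<le> Suc n * 2 ^ n" by linarith
  then show "norm (x (real (Suc i) / 2 ^ n) - x (real i / 2 ^ n)) \<le> 1 / v * (9 / 10) ^ n"
   using x by (simp add: tame_def)
 qed (use v m in \<open>auto simp: n_def\<close>)
 then show ?thesis unfolding e by (simp add: tame_modulus_def)
qed

lemma tame_modulus_tendsto: "(\<lambda>N. tame_modulus v N) \<longlonglongrightarrow> 0"
proof -
 have "(\<lambda>N. (1 / v) * (9 / 10) ^ N * 21) \<longlonglongrightarrow> (1 / v) * 0 * 21"
  by (intro tendsto_intros LIMSEQ_power_zero) simp
 then show ?thesis by (simp add: tame_modulus_def)
qed

lemma tame_modulus_eventually:
 assumes "0 < e"
 obtains N where "M \<le> Suc N" "tame_modulus v N < e"
proof -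
 have "\<forall>\<^sub>F N in sequentially. tame_modulus v N < e \<and> M \<le> N"
  by (intro eventually_conj order_tendstoD(2)[OF tame_modulus_tendsto assms] eventually_ge_at_top)
 then obtain N where "tame_modulus v N < e" "M \<le> N" by (auto simp: eventually_sequentially)
 then show ?thesis using that[of N] by simp
qed

lemma tame_convergent:
 assumes v: "0 < v" and x: "tame v x" and t: "0 \<le> t"
 shows "(\<lambda>m. x (dyadic_floor m t)) \<longlonglongrightarrow> dyadic_extension x t"
proof -
 obtain M :: nat where M: "t \<le> real M" using real_arch_simple by blast
 have "Cauchy (\<lambda>m. x (dyadic_floor m t))"
 proof (rule metric_CauchyI)
  fix e :: real assume "0 < e"
  then obtain N where N: "M \<le> Suc N" "tame_modulus v N < e" using tame_modulus_eventually by blast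
  have "dist (x (dyadic_floor m t)) (x (dyadic_floor m' t)) < e" if "Suc N \<le> m" "Suc N \<le> m'" for m m'
   using tame_dyadic[OF v x N(1) t M t M _ that] N(2) by (simp add: dist_real_def)
  then show "\<exists>K. \<forall>m\<ge>K. \<forall>n\<ge>K. dist (x (dyadic_floor m t)) (x (dyadic_floor n t)) < e" by blast
 qed
 then show ?thesis unfolding dyadic_extension_def by (simp add: Cauchy_convergent_iff convergent_LIMSEQ_iff)
qed

lemma tame_extension:
 assumes v: "0 < v" and x: "tame v x" and M: "M \<le> Suc N"
  and t: "0 \<le> t" "t \<le> real M" "0 \<le> t'" "t' \<le> real M" and close: "\<bar>t - t'\<bar> \<le> 1 / 2 ^ Suc N"
 shows "\<bar>dyadic_extension x t - dyadic_extension x t'\<bar> \<le> tame_modulus v N"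
  and "\<bar>dyadic_extension x t - x (dyadic_floor (Suc N) t)\<bar> \<le> tame_modulus v N"
proof -
 show "\<bar>dyadic_extension x t - dyadic_extension x t'\<bar> \<le> tame_modulus v N"
 proof (rule LIMSEQ_le_const2)
  show "(\<lambda>m. \<bar>x (dyadic_floor m t) - x (dyadic_floor m t')\<bar>) \<longlonglongrightarrow> \<bar>dyadic_extension x t - dyadic_extension x t'\<bar>"
   by (intro tendsto_intros tame_convergent[OF v x] t)
  show "\<exists>K. \<forall>m\<ge>K. \<bar>x (dyadic_floor m t) - x (dyadic_floor m t')\<bar> \<le> tame_modulus v N"
   using tame_dyadic[OF v x M t close] by blast
 qed
 show "\<bar>dyadic_extension x t - x (dyadic_floor (Suc N) t)\<bar> \<le> tame_modulus v N"
 proof (rule LIMSEQ_le_const2)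
  show "(\<lambda>m. \<bar>x (dyadic_floor m t) - x (dyadic_floor (Suc N) t)\<bar>) \<longlonglongrightarrow> \<bar>dyadic_extension x t - x (dyadic_floor (Suc N) t)\<bar>"
   by (intro tendsto_intros tame_convergent[OF v x] t)
  show "\<exists>K. \<forall>m\<ge>K. \<bar>x (dyadic_floor m t) - x (dyadic_floor (Suc N) t)\<bar> \<le> tame_modulus v N"
   using tame_dyadic[OF v x M t(1,2) t(1,2), of _ "Suc N"] by (intro exI[of _ "Suc N"]) auto
 qed
qed

lemma continuous_tame_extension:
 assumes v: "0 < v" and x: "tame v x"
 shows "continuous_on {0..} (dyadic_extension x)"
 unfolding continuous_on_iff
proof (intro ballI allI impI)
 fix t e :: real assume t: "t \<in> {0..}" and e: "0 < e"
 obtain M :: nat where M: "t + 1 \<le> real M" using real_arch_simple by blast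
 obtain N where N: "M \<le> Suc N" "tame_modulus v N < e" using tame_modulus_eventually[OF e] by blast
 show "\<exists>d>0. \<forall>t'\<in>{0..}. dist t' t < d \<longrightarrow> dist (dyadic_extension x t') (dyadic_extension x t) < e"
 proof (intro exI[of _ "1 / 2 ^ Suc N"] conjI ballI impI)
  fix t' :: real assume t': "t' \<in> {0..}" "dist t' t < 1 / 2 ^ Suc N"
  have "1 / (2::real) ^ Suc N \<le> 1 / 2 ^ 0" by (intro divide_left_mono power_increasing) auto
  moreover have "\<bar>t' - t\<bar> < 1 / 2 ^ Suc N" using t'(2) by (simp only: dist_real_def)
  ultimately have "t' \<le> real M" "t \<le> real M" "\<bar>t' - t\<bar> \<le> 1 / 2 ^ Suc N" using M by (simp_all only: power_0)
  then show "dist (dyadic_extension x t') (dyadic_extension x t) < e"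
   using tame_extension(1)[OF v x N(1), of t' t] t t' N(2) by (auto simp: dist_real_def)
 qed simp
qed

lemma dyadic_extension_continuous:
 assumes z: "continuous_on {0..} z" and x: "\<And>m i. x (real i / 2 ^ m) = z (real i / 2 ^ m)" and t: "0 \<le> t"
 shows "dyadic_extension x t = z t"
proof -
 have "(\<lambda>m. z (dyadic_floor m t)) \<longlonglongrightarrow> z t"
  by (rule continuous_on_tendsto_compose[OF z dyadic_floor_tendsto[OF t]]) (use t dyadic_floor_bounds(3)[OF t] in auto)
 then show ?thesis unfolding dyadic_extension_def using x by (simp add: dyadic_floor_def limI)
qed

lemma tame_limit:
 assumes v: "\<And>n. 0 < v n" "v \<longlonglongrightarrow> v0" "0 < v0" and x: "\<And>n. tame (v n) (x n)"
  and lim: "\<And>m i. (\<lambda>n. x n (real i / 2 ^ m)) \<longlonglongrightarrow> x0 (real i / 2 ^ m)"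
 shows "tame v0 x0"
 unfolding tame_def
proof (intro allI impI)
 fix n i assume i: "Suc i \<le> Suc n * 2 ^ n"
 show "\<bar>x0 (real (Suc i) / 2 ^ n) - x0 (real i / 2 ^ n)\<bar> \<le> (9 / 10) ^ n / v0"
 proof (rule LIMSEQ_le)
  show "(\<lambda>m. \<bar>x m (real (Suc i) / 2 ^ n) - x m (real i / 2 ^ n)\<bar>) \<longlonglongrightarrow> \<bar>x0 (real (Suc i) / 2 ^ n) - x0 (real i / 2 ^ n)\<bar>"
   by (intro tendsto_intros lim)
  show "(\<lambda>m. (9 / 10) ^ n / v m) \<longlonglongrightarrow> (9 / 10) ^ n / v0" by (intro tendsto_intros v) (use v in auto)
  show "\<exists>N. \<forall>m\<ge>N. \<bar>x m (real (Suc i) / 2 ^ n) - x m (real i / 2 ^ n)\<bar> \<le> (9 / 10) ^ n / v m"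
   using x i by (auto simp: tame_def)
 qed
qed

lemma tame_mono:
 assumes "tame v x" "0 < v'" "v' \<le> v"
 shows "tame v' x"
 using assms unfolding tame_def by (meson divide_left_mono order_trans zero_le_power less_le_trans mult_pos_pos zero_le_divide_iff zero_le_numeral)

text \<open>An Arzela-Ascoli argument: eventually all functions share the modulus belonging to
  \<open>v0 / 2\<close>, so convergence at the finitely many points of one grid controls the whole
  interval, with three errors of \<open>e / 3\<close>.\<close>

lemma tame_uniform_limit:
 assumes v: "\<And>n. 0 < v n" "v \<longlonglongrightarrow> v0" "0 < v0" and x: "\<And>n. tame (v n) (x n)"
  and lim: "\<And>m i. (\<lambda>n. x n (real i / 2 ^ m)) \<longlonglongrightarrow> x0 (real i / 2 ^ m)"
 shows "uniform_limit {0..L} (\<lambda>n. dyadic_extension (x n)) (dyadic_extension x0) sequentially"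
proof (rule uniform_limitI)
 fix e :: real assume e: "0 < e"
 have x0: "tame (v0 / 2) x0" using tame_mono[OF tame_limit[OF v x lim], of "v0 / 2"] v by simp
 have ev: "\<forall>\<^sub>F n in sequentially. tame (v0 / 2) (x n)"
 proof -
  have "\<forall>\<^sub>F n in sequentially. v0 / 2 < v n" using v by (intro order_tendstoD(1)[OF v(2)]) simp
  then show ?thesis by eventually_elim (use tame_mono[OF x] v in auto)
 qed
 obtain M :: nat where M: "L \<le> real M" using real_arch_simple by blast
 have e3: "0 < e / 3" using e by simp
 obtain N where N: "M \<le> Suc N" "tame_modulus (v0 / 2) N < e / 3" using tame_modulus_eventually[OF e3] by blast
 have fin: "\<forall>\<^sub>F n in sequentially. \<forall>i\<in>{..M * 2 ^ Suc N}. \<bar>x n (real i / 2 ^ Suc N) - x0 (real i / 2 ^ Suc N)\<bar> < e / 3"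
 proof (rule eventually_ball_finite)
  show "\<forall>i\<in>{..M * 2 ^ Suc N}. \<forall>\<^sub>F n in sequentially. \<bar>x n (real i / 2 ^ Suc N) - x0 (real i / 2 ^ Suc N)\<bar> < e / 3"
   using tendstoD[OF lim e3] unfolding dist_real_def by blast
 qed simp
 from ev fin show "\<forall>\<^sub>F n in sequentially. \<forall>t\<in>{0..L}. dist (dyadic_extension (x n) t) (dyadic_extension x0 t) < e"
 proof eventually_elim
  case (elim n)
  show ?case
  proof
   fix t assume "t \<in> {0..L}"
   then have t: "0 \<le> t" "t \<le> real M" using M by auto
   define i where "i = nat \<lfloor>2 ^ Suc N * t\<rfloor>"
   have i: "dyadic_floor (Suc N) t = real i / 2 ^ Suc N" by (simp only: dyadic_floor_def i_def)
   have "real i / 2 ^ Suc N \<le> real M" using dyadic_floor_bounds(1)[OF t(1), of "Suc N"] t unfolding i by linarith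
   then have "real i \<le> real (M * 2 ^ Suc N)" by (simp add: divide_le_eq)
   then have "i \<in> {..M * 2 ^ Suc N}" by (simp only: of_nat_le_iff atMost_iff)
   then have "\<bar>x n (dyadic_floor (Suc N) t) - x0 (dyadic_floor (Suc N) t)\<bar> < e / 3" using elim(2) unfolding i by blast
   moreover have "\<bar>dyadic_extension (x n) t - x n (dyadic_floor (Suc N) t)\<bar> \<le> tame_modulus (v0 / 2) N"
    by (rule tame_extension(2)[OF _ elim(1) N(1) t t]) (use v in auto)
   moreover have "\<bar>dyadic_extension x0 t - x0 (dyadic_floor (Suc N) t)\<bar> \<le> tame_modulus (v0 / 2) N"
    by (rule tame_extension(2)[OF _ x0 N(1) t t]) (use v in auto)
   ultimately show "dist (dyadic_extension (x n) t) (dyadic_extension x0 t) < e"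
    using N(2) unfolding dist_real_def by linarith
  qed
 qed
qed

definition vec_of :: "('n::finite \<times> bool \<Rightarrow> real) \<Rightarrow> (complex, 'n) vec" where
 "vec_of f = (\<Sum>c\<in>UNIV. f c *\<^sub>R axis (fst c) (if snd c then 1 else \<i>))"

lemma vec_of_rcoord: "vec_of (\<lambda>c. rcoord c T) = T"
proof -
 have "vec_of (\<lambda>c. rcoord c T) $ j = T $ j" for j
 proof -
  have "vec_of (\<lambda>c. rcoord c T) $ j = (\<Sum>i\<in>UNIV. \<Sum>b\<in>UNIV. (rcoord (i, b) T *\<^sub>R axis i (if b then 1 else \<i>)) $ j)"
   unfolding vec_of_def sum_component by (simp add: sum.cartesian_product case_prod_beta)
  also have "\<dots> = (\<Sum>i\<in>UNIV. if i = j then T $ j else 0)"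
   by (intro sum.cong refl) (auto simp: UNIV_bool rcoord_def axis_def complex_eq_iff)
  also have "\<dots> = T $ j" by simp
  finally show ?thesis .
 qed
 then show ?thesis by (simp add: vec_eq_iff)
qed

lemma norm_vec_of_diff: "norm (vec_of f - vec_of g) \<le> (\<Sum>c\<in>UNIV. \<bar>f c - g c\<bar>)"
proof -
 have "vec_of f - vec_of g = (\<Sum>c\<in>UNIV. (f c - g c) *\<^sub>R axis (fst c) (if snd c then 1 else \<i>))"
  by (simp add: vec_of_def sum_subtractf scaleR_left_diff_distrib)
 also have "norm \<dots> \<le> (\<Sum>c\<in>UNIV. norm ((f c - g c) *\<^sub>R axis (fst c) (if snd c then 1 else \<i>) :: (complex, 'a) vec))"
  by (rule norm_sum)
 also have "\<dots> = (\<Sum>c\<in>UNIV. \<bar>f c - g c\<bar>)" by (intro sum.cong refl) (simp add: norm_eq_sqrt_inner inner_axis_axis)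
 finally show ?thesis .
qed

lemma skorokhod_bounded:
 fixes Pn :: "nat \<Rightarrow> 'a measure" and U :: "nat \<Rightarrow> 'i::countable \<Rightarrow> 'a \<Rightarrow> real"
 assumes P: "\<And>n. prob_space (Pn n)" and U: "\<And>n i. U n i \<in> borel_measurable (Pn n)"
  and bound: "\<And>n i w. w \<in> space (Pn n) \<Longrightarrow> \<bar>U n i w\<bar> \<le> R"
 obtains r \<Omega> Yn Y where "strict_mono (r :: nat \<Rightarrow> nat)" "prob_space (\<Omega> :: real measure)"
  "\<And>n i. Yn n i \<in> borel_measurable \<Omega>" "\<And>i. Y i \<in> borel_measurable \<Omega>"
  "\<And>n. distr \<Omega> (\<Pi>\<^sub>M i\<in>UNIV. borel) (\<lambda>\<omega> i. Yn n i \<omega>) = distr (Pn (r n)) (\<Pi>\<^sub>M i\<in>UNIV. borel) (\<lambda>w i. U (r n) i w)"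
  "\<And>\<omega> i. \<omega> \<in> space \<Omega> \<Longrightarrow> (\<lambda>n. Yn n i \<omega>) \<longlonglongrightarrow> (Y i \<omega> :: real)"
proof -
 \<comment> \<open>The added 1 makes the rescaled values strictly less than 1, as the binary
   expansion requires.\<close>
 define Q where "Q = \<bar>R\<bar> + 1"
 have Q: "0 < Q" "R < Q" by (auto simp: Q_def)
 have rng: "0 \<le> (U n i w + Q) / (2 * Q) \<and> (U n i w + Q) / (2 * Q) < 1" if "w \<in> space (Pn n)" for n i w
  using bound[OF that, of i] Q by (auto simp: divide_less_eq)
 have meas: "(\<lambda>w. (U n i w + Q) / (2 * Q)) \<in> borel_measurable (Pn n)" for n i using U[of n i] by measurable
 have g: "(\<lambda>u i. 2 * Q * u i - Q) \<in> (\<Pi>\<^sub>M i\<in>(UNIV :: 'i set). borel) \<rightarrow>\<^sub>M (\<Pi>\<^sub>M i\<in>UNIV. borel)"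
  by (rule measurable_PiM_single') auto
 have mU: "(\<lambda>w i. (U n i w + Q) / (2 * Q)) \<in> Pn n \<rightarrow>\<^sub>M (\<Pi>\<^sub>M i\<in>UNIV. borel)" for n
  using U[measurable] by (intro measurable_PiM_single') auto
 show thesis
 proof (rule skorokhod_countable[OF P meas rng])
  fix r :: "nat \<Rightarrow> nat" and \<Omega> :: "real measure" and Yn :: "nat \<Rightarrow> 'i \<Rightarrow> real \<Rightarrow> real" and Y :: "'i \<Rightarrow> real \<Rightarrow> real"
  assume r: "strict_mono r" and \<Omega>: "prob_space \<Omega>"
   and m[measurable]: "\<And>n i. Yn n i \<in> borel_measurable \<Omega>" "\<And>i. Y i \<in> borel_measurable \<Omega>"
   and d: "\<And>n. distr \<Omega> (\<Pi>\<^sub>M i\<in>UNIV. borel) (\<lambda>\<omega> i. Yn n i \<omega>)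
    = distr (Pn (r n)) (\<Pi>\<^sub>M i\<in>UNIV. borel) (\<lambda>w i. (U (r n) i w + Q) / (2 * Q))"
   and lim: "\<And>\<omega> i. \<omega> \<in> space \<Omega> \<Longrightarrow> (\<lambda>n. Yn n i \<omega>) \<longlonglongrightarrow> Y i \<omega>"
  have mY: "(\<lambda>\<omega> i. Yn n i \<omega>) \<in> \<Omega> \<rightarrow>\<^sub>M (\<Pi>\<^sub>M i\<in>UNIV. borel)" for n
   by (rule measurable_PiM_single') auto
 show thesis
 proof (rule that[OF r \<Omega>, of "\<lambda>n i \<omega>. 2 * Q * Yn n i \<omega> - Q" "\<lambda>i \<omega>. 2 * Q * Y i \<omega> - Q"])
  show "distr \<Omega> (\<Pi>\<^sub>M i\<in>UNIV. borel) (\<lambda>\<omega> i. 2 * Q * Yn n i \<omega> - Q) = distr (Pn (r n)) (\<Pi>\<^sub>M i\<in>UNIV. borel) (\<lambda>w i. U (r n) i w)" for n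
  proof -
   have "distr \<Omega> (\<Pi>\<^sub>M i\<in>UNIV. borel) (\<lambda>\<omega> i. 2 * Q * Yn n i \<omega> - Q)
    = distr (distr \<Omega> (\<Pi>\<^sub>M i\<in>UNIV. borel) (\<lambda>\<omega> i. Yn n i \<omega>)) (\<Pi>\<^sub>M i\<in>UNIV. borel) (\<lambda>u i. 2 * Q * u i - Q)"
    by (subst distr_distr[OF g mY]) (simp add: comp_def)
   also have "\<dots> = distr (Pn (r n)) (\<Pi>\<^sub>M i\<in>UNIV. borel) (\<lambda>w i. 2 * Q * ((U (r n) i w + Q) / (2 * Q)) - Q)"
    unfolding d by (subst distr_distr[OF g mU]) (simp add: comp_def)
   finally show ?thesis using Q by simp
  qed
 qed (use lim in \<open>auto intro!: tendsto_intros\<close>)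
 qed
qed

section \<open>A random variable that controls the modulus of continuity\<close>

definition fluctuation :: "('c::finite \<Rightarrow> real \<Rightarrow> real) \<Rightarrow> nat \<Rightarrow> real" where
 "fluctuation x n = (\<Sum>c\<in>UNIV. \<Sum>i<Suc n * 2 ^ n. (x c (real (Suc i) / 2 ^ n) - x c (real i / 2 ^ n)) ^ 4) / (9 / 10) ^ (4 * n)"

definition roughness :: "('c::finite \<Rightarrow> real \<Rightarrow> real) \<Rightarrow> ennreal" where
 "roughness x = (\<Sum>n. ennreal (fluctuation x n))"

text \<open>
 The conversion sends an infinite roughness to tameness 0, which marks the irregular paths.
\<close>

definition tameness :: "('c::finite \<Rightarrow> real \<Rightarrow> real) \<Rightarrow> real" where
 "tameness x = enn2real (inverse (1 + roughness x))"

lemma tameness_cases: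
 obtains "roughness x = top" "tameness x = 0" | s where "0 \<le> s" "roughness x = ennreal s" "tameness x = 1 / (1 + s)"
proof (cases "roughness x")
 case (real s)
 have "inverse (1 + roughness x) = ennreal (1 / (1 + s))"
  using real by (simp add: inverse_ennreal inverse_eq_divide flip: ennreal_1 ennreal_plus)
 then have "tameness x = 1 / (1 + s)" using real by (simp add: tameness_def)
 then show ?thesis using real that(2) by blast
next
 case top
 then show ?thesis using that(1) by (simp add: tameness_def)
qed

lemma tameness_range: "0 \<le> tameness x" "tameness x \<le> 1"
 by (cases rule: tameness_cases[of x]; simp)+

text \<open>A single increment is dominated by the sum of all fourth powers. Replacing
  \<open>s\<close> by the larger \<open>(1 + s) ^ 4\<close> permits a fourth root and produces
  exactly \<open>1 + s\<close>, the inverse of the tameness.\<close>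

lemma tame_tameness:
 assumes "0 < tameness x"
 shows "tame (tameness x) (x c)"
proof (cases rule: tameness_cases[of x])
 case 1
 then show ?thesis using assms by simp
next
 case (2 s)
 show ?thesis unfolding tame_def
 proof (intro allI impI)
  fix n i assume i: "Suc i \<le> Suc n * 2 ^ n"
  let ?d = "\<lambda>c i. x c (real (Suc i) / 2 ^ n) - x c (real i / 2 ^ n)"
  have "ennreal (fluctuation x n) \<le> roughness x"
   unfolding roughness_def using sum_le_suminf[OF summableI, of "{n}" "\<lambda>n. ennreal (fluctuation x n)"] by simp
  then have f: "fluctuation x n \<le> s" using 2 by simp
  have "(?d c i) ^ 4 \<le> (\<Sum>i<Suc n * 2 ^ n. (?d c i) ^ 4)"
   by (rule member_le_sum) (use i in auto)
  also have "\<dots> \<le> (\<Sum>c\<in>UNIV. \<Sum>i<Suc n * 2 ^ n. (?d c i) ^ 4)"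
   by (rule member_le_sum) (auto intro!: sum_nonneg)
  also have "\<dots> = fluctuation x n * (9 / 10) ^ (4 * n)" by (simp add: fluctuation_def)
  also have "\<dots> \<le> (1 + s) ^ 4 * (9 / 10) ^ (4 * n)"
  proof (rule mult_right_mono)
   have "s \<le> (1 + s) ^ 1" by simp
   also have "\<dots> \<le> (1 + s) ^ 4" by (rule power_increasing) (use 2 in auto)
   finally show "fluctuation x n \<le> (1 + s) ^ 4" using f by simp
  qed simp
  also have "\<dots> = ((1 + s) * (9 / 10) ^ n) ^ 4" by (simp add: power_mult_distrib mult.commute flip: power_mult)
  finally have "\<bar>?d c i\<bar> ^ 4 \<le> ((1 + s) * (9 / 10) ^ n) ^ 4" by simp
  then have "\<bar>?d c i\<bar> \<le> (1 + s) * (9 / 10) ^ n" by (rule power_le_imp_le_base[of _ 3, simplified]) (use 2 in simp)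
  then show "\<bar>?d c i\<bar> \<le> (9 / 10) ^ n / tameness x" using 2 by (simp add: mult.commute)
 qed
qed

text \<open>The truncation at \<delta> gives a bounded continuous function of the tameness, which
  can be followed through the limit before \<delta> is made small.\<close>

lemma inverse_tameness_le:
 assumes "0 < \<delta>"
 shows "ennreal (1 / max (tameness x) \<delta>) \<le> 1 + roughness x"
proof (cases rule: tameness_cases[of x])
 case 1
 then show ?thesis by simp
next
 case (2 s)
 have "1 / max (tameness x) \<delta> \<le> 1 / tameness x" using 2 assms by (intro divide_left_mono) auto
 then have "1 / max (tameness x) \<delta> \<le> 1 + s" using 2 by simp
 then have "ennreal (1 / max (tameness x) \<delta>) \<le> ennreal (1 + s)" by (rule ennreal_leI)
 then show ?thesis using 2 by simp
qed

lemma roughness_measurable: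
 assumes [measurable]: "\<And>c t. (\<lambda>w. x w c t) \<in> borel_measurable M"
 shows "(\<lambda>w. fluctuation (x w) n) \<in> borel_measurable M" "(\<lambda>w. roughness (x w)) \<in> borel_measurable M" "(\<lambda>w. tameness (x w)) \<in> borel_measurable M"
 unfolding tameness_def roughness_def fluctuation_def by measurable

text \<open>Level \<open>n\<close> has (n + 1) 2^n increments per coordinate, with fourth moments at
  most K 4^(-n), divided by (9/10)^(4 n). The ratio (1/2) / (9/10)^4 = 5000/6561 is below 1, so the
  series with weights n + 1 converges.\<close>

lemma nn_integral_roughness:
 fixes x :: "'w \<Rightarrow> 'c::finite \<Rightarrow> real \<Rightarrow> real"
 assumes m[measurable]: "\<And>c t. (\<lambda>w. x w c t) \<in> borel_measurable M"
  and mom: "\<And>c s t. 0 \<le> s \<Longrightarrow> s \<le> t \<Longrightarrow> integrable M (\<lambda>w. (x w c t - x w c s) ^ 4) \<and> (\<integral>w. (x w c t - x w c s) ^ 4 \<partial>M) \<le> K * (t - s)\<^sup>2"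
 shows "(\<integral>\<^sup>+w. roughness (x w) \<partial>M) \<le> ennreal (real CARD('c) * K / (1 - 5000 / 6561)\<^sup>2)"
proof -
 have K: "0 \<le> K"
 proof -
  have "0 \<le> (\<integral>w. (x w undefined 1 - x w undefined 0) ^ 4 \<partial>M)" by (rule Bochner_Integration.integral_nonneg) simp
  also have "\<dots> \<le> K" using mom[of 0 1 undefined] by simp
  finally show ?thesis .
 qed
 have each: "(\<integral>w. fluctuation (x w) n \<partial>M) \<le> real CARD('c) * K * (of_nat (Suc n) * (5000 / 6561) ^ n)" "integrable M (\<lambda>w. fluctuation (x w) n)" for n
 proof -
  have le: "real i / 2 ^ n \<le> real (Suc i) / 2 ^ n" for i by (intro divide_right_mono) auto
  note mm = mom[OF _ le, simplified]
  have int: "integrable M (\<lambda>w. (x w c (real (Suc i) / 2 ^ n) - x w c (real i / 2 ^ n)) ^ 4)" for c i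
   using mom[OF _ le, of i c] by simp
  show "integrable M (\<lambda>w. fluctuation (x w) n)"
   unfolding fluctuation_def by (intro integrable_divide Bochner_Integration.integrable_sum int)
  have "(\<integral>w. fluctuation (x w) n \<partial>M) = (\<Sum>c\<in>UNIV. \<Sum>i<Suc n * 2 ^ n. (\<integral>w. (x w c (real (Suc i) / 2 ^ n) - x w c (real i / 2 ^ n)) ^ 4 \<partial>M)) / (9 / 10) ^ (4 * n)"
   unfolding fluctuation_def
   by (simp only: integral_divide_zero Bochner_Integration.integral_sum Bochner_Integration.integrable_sum int)
  also have "\<dots> \<le> (\<Sum>c\<in>(UNIV :: 'c set). \<Sum>i<Suc n * 2 ^ n. K * (1 / 2 ^ n)\<^sup>2) / (9 / 10) ^ (4 * n)"
  proof (intro divide_right_mono sum_mono)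
   fix c and i :: nat
   have "real (Suc i) / 2 ^ n - real i / 2 ^ n = 1 / 2 ^ n" by (simp add: diff_divide_distrib[symmetric])
   then show "(\<integral>w. (x w c (real (Suc i) / 2 ^ n) - x w c (real i / 2 ^ n)) ^ 4 \<partial>M) \<le> K * (1 / 2 ^ n)\<^sup>2"
    using mom[OF _ le, of i c] by simp
  qed simp
  also have "\<dots> = real CARD('c) * K * real (Suc n) * (2 ^ n * (1 / 2 ^ n)\<^sup>2 / (9 / 10) ^ (4 * n))" by (simp add: distrib_right distrib_left mult_ac)
  also have "2 ^ n * (1 / 2 ^ n)\<^sup>2 / (9 / 10) ^ (4 * n) = (5000 / 6561 :: real) ^ n"
  proof -
   have "(9 / 10 :: real) ^ (4 * n) = (6561 / 10000) ^ n" by (simp add: power_mult power_divide)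
   moreover have "2 ^ n * (1 / 2 ^ n)\<^sup>2 = (1 / 2 :: real) ^ n" by (simp add: power2_eq_square power_divide)
   ultimately have "2 ^ n * (1 / 2 ^ n)\<^sup>2 / (9 / 10) ^ (4 * n) = ((1 / 2) / (6561 / 10000) :: real) ^ n"
    by (simp only: power_divide)
   then show ?thesis by simp
  qed
  finally show "(\<integral>w. fluctuation (x w) n \<partial>M) \<le> real CARD('c) * K * (of_nat (Suc n) * (5000 / 6561) ^ n)" by (simp add: mult.assoc)
 qed
 have nn: "0 \<le> fluctuation (x w) n" for w n unfolding fluctuation_def by (intro divide_nonneg_nonneg sum_nonneg) auto
 note [measurable] = roughness_measurable(1)[of x, OF m]
 have "(\<integral>\<^sup>+w. roughness (x w) \<partial>M) = (\<Sum>n. \<integral>\<^sup>+w. ennreal (fluctuation (x w) n) \<partial>M)"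
  unfolding roughness_def by (rule nn_integral_suminf) measurable
 also have "\<dots> = (\<Sum>n. ennreal (\<integral>w. fluctuation (x w) n \<partial>M))"
  by (intro suminf_cong nn_integral_eq_integral each) (use nn in auto)
 also have "\<dots> \<le> (\<Sum>n. ennreal (real CARD('c) * K * (of_nat (Suc n) * (5000 / 6561) ^ n)))"
  by (intro suminf_le ennreal_leI each summableI)
 also have "\<dots> = ennreal (real CARD('c) * K * (1 / (1 - 5000 / 6561)\<^sup>2))"
 proof (rule suminf_ennreal_eq)
  show "0 \<le> real CARD('c) * K * (of_nat (Suc n) * (5000 / 6561) ^ n)" for n using K by simp
  show "(\<lambda>n. real CARD('c) * K * (of_nat (Suc n) * (5000 / 6561) ^ n)) sums (real CARD('c) * K * (1 / (1 - 5000 / 6561)\<^sup>2))"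
   by (intro sums_mult geometric_deriv_sums) simp
 qed
 finally show ?thesis unfolding times_divide_eq_right mult_1_right .
qed

text \<open>
 The index \<open>None\<close> carries the tameness of a path, so that a modulus of continuity passes to the limit
 together with the coordinates at rational times.
\<close>

type_synonym 'n probe = "(rat \<times> 'n \<times> bool) option"

text \<open>The inverse of \<open>of_rat\<close> recovers the rational index; at irrational times
  its value is arbitrary, and only dyadic times are consulted.\<close>

definition probe_coord :: "('n::finite probe \<Rightarrow> real) \<Rightarrow> 'n \<times> bool \<Rightarrow> real \<Rightarrow> real" where
 "probe_coord u c t = u (Some (inv of_rat t, c))"

definition tame_probe :: "('n::finite probe \<Rightarrow> real) \<Rightarrow> bool" where
 "tame_probe u \<longleftrightarrow> 0 < u None \<and> (\<forall>c. tame (u None) (probe_coord u c))"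

text \<open>Probes that are not tame are sent to the path with vanishing discrete coordinates, so
  that the map is total and takes its values among continuous paths.\<close>

definition reconstruct :: "L2 \<Rightarrow> ('n::finite probe \<Rightarrow> real) \<Rightarrow> real \<Rightarrow> 'n state" where
 "reconstruct \<phi> u = restrict (\<lambda>t. (vec_of (\<lambda>c. if tame_probe u then dyadic_extension (probe_coord u c) t else 0), \<phi>)) {0..}"

lemma of_rat_inv: "t \<in> \<rat> \<Longrightarrow> real_of_rat (inv real_of_rat t) = t"
 by (rule f_inv_into_f) (simp add: Rats_def)

lemma continuous_vec_of:
 assumes "\<And>c. continuous_on A (f c)"
 shows "continuous_on A (\<lambda>t. vec_of (\<lambda>c. f c t))"
 unfolding vec_of_def by (intro continuous_intros assms)

lemma measurable_probe_coord: "(\<lambda>u. probe_coord u c t) \<in> borel_measurable (\<Pi>\<^sub>M i\<in>(UNIV :: 'n::finite probe set). borel)"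
 unfolding probe_coord_def by (rule measurable_component_singleton) simp

lemma measurable_tame_probe:
 "Measurable.pred (\<Pi>\<^sub>M i\<in>(UNIV :: 'n::finite probe set). borel) tame_probe"
 unfolding tame_probe_def tame_def
proof (intro pred_intros_logic pred_intros_countable)
 let ?M = "\<Pi>\<^sub>M i\<in>(UNIV :: 'n probe set). (borel :: real measure)"
 have u: "(\<lambda>u. u None) \<in> borel_measurable ?M" by (rule measurable_component_singleton) simp
 then show "Measurable.pred ?M (\<lambda>u. 0 < u None)"
  unfolding pred_def by (intro borel_measurable_less borel_measurable_const)
 fix c :: "'n \<times> bool" and n i
 show "Measurable.pred ?M (\<lambda>u. \<bar>probe_coord u c (real (Suc i) / 2 ^ n) - probe_coord u c (real i / 2 ^ n)\<bar> \<le> (9 / 10) ^ n / u None)"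
  unfolding pred_def by (intro borel_measurable_le borel_measurable_abs borel_measurable_diff measurable_probe_coord borel_measurable_divide borel_measurable_const u)
qed simp

lemma measurable_reconstruct:
 assumes S: "\<And>T. (T, \<phi>) \<in> S"
 shows "reconstruct \<phi> \<in> (\<Pi>\<^sub>M i\<in>(UNIV :: 'n::finite probe set). borel) \<rightarrow>\<^sub>M path_space S"
proof (rule measurable_into_path_space)
 fix u :: "'n probe \<Rightarrow> real"
 have "continuous_on {0..} (\<lambda>t. if tame_probe u then dyadic_extension (probe_coord u c) t else 0)" for c
 proof (cases "tame_probe u")
  case True
  then have "continuous_on {0..} (dyadic_extension (probe_coord u c))"
   unfolding tame_probe_def using continuous_tame_extension by blast
  then show ?thesis using True by simp
 qed simp
 then have "continuous_on {0..} (\<lambda>t. (vec_of (\<lambda>c. if tame_probe u then dyadic_extension (probe_coord u c) t else 0), \<phi>))"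
  by (intro continuous_on_Pair continuous_vec_of continuous_on_const)
 then have "continuous_on {0..} (reconstruct \<phi> u)"
  by (rule continuous_on_eq) (simp add: reconstruct_def)
 then show "reconstruct \<phi> u \<in> space (path_space S)"
  using S by (auto simp: space_path_space reconstruct_def)
next
 fix t :: real assume t: "0 \<le> t"
 note [measurable] = measurable_tame_probe measurable_probe_coord
 have "continuous_on UNIV (\<lambda>T :: (complex, 'n) vec. (T, \<phi>))" by (intro continuous_intros)
 then have p: "(\<lambda>T :: (complex, 'n) vec. (T, \<phi>)) \<in> borel \<rightarrow>\<^sub>M borel" by (rule borel_measurable_continuous_onI)
 have "(\<lambda>u. vec_of (\<lambda>c. if tame_probe u then dyadic_extension (probe_coord u c) t else 0)) \<in> (\<Pi>\<^sub>M i\<in>(UNIV :: 'n probe set). borel) \<rightarrow>\<^sub>M borel"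
  unfolding vec_of_def dyadic_extension_def by measurable
 from measurable_compose[OF this p]
 show "(\<lambda>u. reconstruct \<phi> u t) \<in> borel_measurable (\<Pi>\<^sub>M i\<in>(UNIV :: 'n probe set). borel)"
  using t by (simp add: reconstruct_def)
qed

lemma tame_cong: "(\<And>m i. x (real i / 2 ^ m) = z (real i / 2 ^ m)) \<Longrightarrow> tame v x = tame v z"
 unfolding tame_def by (simp del: of_nat_Suc)

lemma uniform_limit_vec_of:
 assumes "\<And>c. uniform_limit A (\<lambda>n. f n c) (g c) F"
 shows "uniform_limit A (\<lambda>n t. vec_of (\<lambda>c. f n c t)) (\<lambda>t. vec_of (\<lambda>c. g c t)) F"
proof (rule uniform_limitI)
 fix e :: real assume e: "0 < e"
 define N where "N = card (UNIV :: ('a \<times> bool) set)"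
 have N: "0 < N" by (simp add: N_def card_gt_0_iff)
 then have e': "0 < e / real N" using e by simp
 have "\<forall>\<^sub>F n in F. \<forall>c\<in>UNIV. \<forall>t\<in>A. dist (f n c t) (g c t) < e / real N"
  by (rule eventually_ball_finite) (use uniform_limitD[OF assms e'] in auto)
 then show "\<forall>\<^sub>F n in F. \<forall>t\<in>A. dist (vec_of (\<lambda>c. f n c t)) (vec_of (\<lambda>c. g c t)) < e"
 proof eventually_elim
  case (elim n)
  show ?case
  proof
   fix t assume t: "t \<in> A"
   have "dist (vec_of (\<lambda>c. f n c t)) (vec_of (\<lambda>c. g c t)) \<le> (\<Sum>c\<in>UNIV. \<bar>f n c t - g c t\<bar>)"
    unfolding dist_norm by (rule norm_vec_of_diff)
   also have "\<dots> < (\<Sum>c\<in>(UNIV :: ('a \<times> bool) set). e / real N)"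
    by (rule sum_strict_mono) (use elim t in \<open>auto simp: dist_real_def\<close>)
   also have "\<dots> = e" using N by (simp add: N_def)
   finally show "dist (vec_of (\<lambda>c. f n c t)) (vec_of (\<lambda>c. g c t)) < e" .
  qed
 qed
qed

text \<open>Almost surely a path is a measurable function of its probe, so convergent probes yield
  versions of the paths on one space. That the limiting probe is tame does not follow from
  convergence of the coordinates alone; it rests on the uniform bound for the expected
  roughness.\<close>

theorem skorokhod_paths:
 fixes Pn :: "nat \<Rightarrow> (real \<Rightarrow> 'n::finite state) measure" and S :: "nat \<Rightarrow> 'n state set" and S0 :: "'n state set"
  and \<phi> :: "nat \<Rightarrow> L2" and \<phi>0 :: L2
 assumes P: "\<And>n. prob_space (Pn n)" "\<And>n. sets (Pn n) = sets (path_space (S n))"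
  and S: "\<And>n T. (T, \<phi> n) \<in> S n" "\<And>T. (T, \<phi>0) \<in> S0"
  and bd: "\<And>n. AE w in Pn n. \<forall>t\<ge>0. norm (fst (w t)) \<le> R \<and> snd (w t) = \<phi> n"
  and mom: "\<And>n c s t. 0 \<le> s \<Longrightarrow> s \<le> t \<Longrightarrow> integrable (Pn n) (\<lambda>w. (rcoord c (fst (w t)) - rcoord c (fst (w s))) ^ 4) \<and>
    (\<integral>w. (rcoord c (fst (w t)) - rcoord c (fst (w s))) ^ 4 \<partial>Pn n) \<le> K * (t - s)\<^sup>2"
 obtains r \<Omega> X X0 where "strict_mono (r :: nat \<Rightarrow> nat)" "prob_space (\<Omega> :: real measure)"
  "\<And>n. X n \<in> \<Omega> \<rightarrow>\<^sub>M path_space (S (r n))" "X0 \<in> \<Omega> \<rightarrow>\<^sub>M path_space S0"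
  "\<And>n. distr \<Omega> (path_space (S (r n))) (X n) = Pn (r n)"
  "\<And>n \<omega> t. 0 \<le> t \<Longrightarrow> snd (X n \<omega> t) = \<phi> (r n)" "\<And>\<omega> t. 0 \<le> t \<Longrightarrow> snd (X0 \<omega> t) = \<phi>0"
  "AE \<omega> in \<Omega>. \<forall>L. uniform_limit {0..L} (\<lambda>n t. fst (X n \<omega> t)) (\<lambda>t. fst (X0 \<omega> t)) sequentially"
proof -
 let ?PiM = "\<Pi>\<^sub>M i\<in>(UNIV :: 'n probe set). (borel :: real measure)"
 \<comment> \<open>Confinement holds only almost surely, but probes must be bounded on every path.
   Clipping is 1-Lipschitz, hence does not increase the fourth moments of increments.\<close>
 define clip where "clip x = max (- \<bar>R\<bar>) (min \<bar>R\<bar> x)" for x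
 have clip: "\<bar>clip x\<bar> \<le> \<bar>R\<bar>" "\<bar>clip x - clip x'\<bar> \<le> \<bar>x - x'\<bar>" for x x' by (auto simp: clip_def min_def max_def abs_if)
 have clip_id: "clip x = x" if "\<bar>x\<bar> \<le> R" for x using that by (auto simp: clip_def)
 \<comment> \<open>Probes are indexed by all rationals; the absolute value gives a measurable
   meaning to negative times, which the reconstruction never reads.\<close>
 define z where "z w c t = clip (rcoord c (fst (w \<bar>t\<bar>)))" for w :: "real \<Rightarrow> 'n state" and c t
 define U :: "'n probe \<Rightarrow> (real \<Rightarrow> 'n state) \<Rightarrow> real"
  where "U i w = (case i of None \<Rightarrow> tameness (z w) | Some p \<Rightarrow> z w (snd p) (real_of_rat (fst p)))" for i w
 have U: "U None w = tameness (z w)" "U (Some (q, c)) w = z w c (real_of_rat q)" for w q c by (simp_all add: U_def)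
 have mr: "(\<lambda>w. rcoord c (fst (w \<bar>t\<bar>))) \<in> borel_measurable (Pn n)" for c t n
 proof -
  have "continuous_on UNIV (\<lambda>x :: 'n state. rcoord c (fst x))"
   by (intro continuous_on_compose2[OF continuous_rcoord] continuous_intros) auto
  from measurable_compose[OF measurable_path_space_coord borel_measurable_continuous_onI[OF this], of "\<bar>t\<bar>" "S n"]
  show ?thesis by (simp add: measurable_cong_sets[OF P(2) refl])
 qed
 have mz[measurable]: "(\<lambda>w. z w c t) \<in> borel_measurable (Pn n)" for c t n
  unfolding z_def clip_def using mr[of c t n] by measurable
 have mU: "U i \<in> borel_measurable (Pn n)" for i n
 proof (cases i)
  case None
  then show ?thesis using roughness_measurable(3)[of z, OF mz] by (simp add: U(1)[abs_def])
 next
  case (Some p)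
  then show ?thesis using mz[of "snd p" "real_of_rat (fst p)" n] by (simp add: U_def[abs_def])
 qed
 have bU: "\<bar>U i w\<bar> \<le> \<bar>R\<bar> + 1" for i w
  using clip(1) tameness_range[of "z w"] by (cases i) (auto simp: U_def z_def intro: order_trans[OF clip(1)])
 have pc: "probe_coord (\<lambda>i. U i w) c (real i / 2 ^ m) = z w c (real i / 2 ^ m)" for w c i m
  unfolding probe_coord_def U by (subst of_rat_inv) auto
 define K' where "K' = real CARD('n \<times> bool) * K / (1 - 5000 / 6561)\<^sup>2"
 have rough: "(\<integral>\<^sup>+w. roughness (z w) \<partial>Pn n) \<le> ennreal K'" for n
  unfolding K'_def
 proof (rule nn_integral_roughness[of z, OF mz])
  fix c :: "'n \<times> bool" and s t :: real assume st: "0 \<le> s" "s \<le> t"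
  let ?f = "\<lambda>w. (rcoord c (fst (w t)) - rcoord c (fst (w s))) ^ 4"
  have le: "(z w c t - z w c s) ^ 4 \<le> ?f w" for w
  proof -
   have "\<bar>z w c t - z w c s\<bar> ^ 4 \<le> \<bar>rcoord c (fst (w t)) - rcoord c (fst (w s))\<bar> ^ 4"
    using st clip(2) by (intro power_mono) (auto simp: z_def)
   then show ?thesis by simp
  qed
  note m = mom[OF st, of n c]
  have int: "integrable (Pn n) (\<lambda>w. (z w c t - z w c s) ^ 4)"
   by (rule Bochner_Integration.integrable_bound[OF conjunct1[OF m]]) (use le in \<open>auto simp: abs_of_nonneg\<close>)
  have "(\<integral>w. (z w c t - z w c s) ^ 4 \<partial>Pn n) \<le> (\<integral>w. ?f w \<partial>Pn n)"
   using int m le by (intro integral_mono) auto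
  then show "integrable (Pn n) (\<lambda>w. (z w c t - z w c s) ^ 4) \<and> (\<integral>w. (z w c t - z w c s) ^ 4 \<partial>Pn n) \<le> K * (t - s)\<^sup>2"
   using int m by simp
 qed
 \<comment> \<open>Finite expected roughness makes almost every path tame, and a tame continuous
   path is recovered from its dyadic values and its constant L2 component.\<close>
 have recon: "AE w in Pn n. tame_probe (\<lambda>i. U i w) \<and> reconstruct (\<phi> n) (\<lambda>i. U i w) = w" for n
 proof -
  have "(\<integral>\<^sup>+w. roughness (z w) \<partial>Pn n) \<noteq> \<infinity>" using rough[of n] by (auto simp: top_unique)
  then have "AE w in Pn n. roughness (z w) \<noteq> \<infinity>"
   by (rule nn_integral_noteq_infinite[OF roughness_measurable(2)[of z, OF mz]])
  then show ?thesis using bd[of n] AE_space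
  proof eventually_elim
   case (elim w)
   have w: "w \<in> extensional {0..}" "continuous_on {0..} w"
    using elim(3) sets_eq_imp_space_eq[OF P(2)] by (auto simp: space_path_space)
   have zr: "z w c t = rcoord c (fst (w t))" if "0 \<le> t" for c t
    using elim(2) that rcoord_le[of c "fst (w t)"] unfolding z_def by (subst clip_id) auto
   have pos: "0 < tameness (z w)"
    using elim(1) by (cases rule: tameness_cases[of "z w"]) auto
   have t: "tame_probe (\<lambda>i. U i w)"
    unfolding tame_probe_def U(1) using pos tame_tameness[OF pos] tame_cong[of "probe_coord (\<lambda>i. U i w) c" "z w c" for c, OF pc] by blast
   have dext: "dyadic_extension (probe_coord (\<lambda>i. U i w) c) t = rcoord c (fst (w t))" if "0 \<le> t" for c t
   proof (rule dyadic_extension_continuous[OF _ _ that])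
    show "continuous_on {0..} (\<lambda>t. rcoord c (fst (w t)))"
     by (rule continuous_on_compose2[OF continuous_rcoord]) (auto intro!: continuous_intros w)
    show "probe_coord (\<lambda>i. U i w) c (real i / 2 ^ m) = rcoord c (fst (w (real i / 2 ^ m)))" for m i
     unfolding pc by (rule zr) simp
   qed
   have "reconstruct (\<phi> n) (\<lambda>i. U i w) t = w t" for t
   proof (cases "0 \<le> t")
    case True
    have "reconstruct (\<phi> n) (\<lambda>i. U i w) t = (vec_of (\<lambda>c. rcoord c (fst (w t))), \<phi> n)"
     using True t by (simp only: reconstruct_def restrict_def atLeast_iff if_True dext[OF True])
    also have "\<dots> = (fst (w t), snd (w t))" using elim(2) True by (simp only: vec_of_rcoord)
    finally show ?thesis by (simp only: prod.collapse)
   next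
    case False
    then show ?thesis using extensional_arb[OF w(1), of t] by (simp add: reconstruct_def)
   qed
   then have "reconstruct (\<phi> n) (\<lambda>i. U i w) = w" by (rule ext)
   with t show ?case by (rule conjI)
  qed
 qed
 have mu: "(\<lambda>w i. U i w) \<in> Pn n \<rightarrow>\<^sub>M ?PiM" for n
  by (rule measurable_PiM_single') (use mU in auto)
 show thesis
 proof (rule skorokhod_bounded[OF P(1), where U="\<lambda>n. U" and R="\<bar>R\<bar> + 1"])
  fix r :: "nat \<Rightarrow> nat" and \<Omega> :: "real measure" and Yn :: "nat \<Rightarrow> 'n probe \<Rightarrow> real \<Rightarrow> real" and Y :: "'n probe \<Rightarrow> real \<Rightarrow> real"
  assume r: "strict_mono r" and \<Omega>: "prob_space \<Omega>"
   and m[measurable]: "\<And>n i. Yn n i \<in> borel_measurable \<Omega>" "\<And>i. Y i \<in> borel_measurable \<Omega>"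
   and d: "\<And>n. distr \<Omega> ?PiM (\<lambda>\<omega> i. Yn n i \<omega>) = distr (Pn (r n)) ?PiM (\<lambda>w i. U i w)"
   and lim: "\<And>\<omega> i. \<omega> \<in> space \<Omega> \<Longrightarrow> (\<lambda>n. Yn n i \<omega>) \<longlonglongrightarrow> Y i \<omega>"
  interpret \<Omega>: prob_space \<Omega> by (rule \<Omega>)
  have mY: "(\<lambda>\<omega> i. Yn n i \<omega>) \<in> \<Omega> \<rightarrow>\<^sub>M ?PiM" "(\<lambda>\<omega> i. Y i \<omega>) \<in> \<Omega> \<rightarrow>\<^sub>M ?PiM" for n
   by (rule measurable_PiM_single'; simp)+
  have tset: "{u \<in> space ?PiM. tame_probe u} \<in> sets ?PiM" using measurable_tame_probe by (simp only: pred_def)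
  have AE_tame: "AE \<omega> in \<Omega>. \<forall>n. tame_probe (\<lambda>i. Yn n i \<omega>)"
  proof (subst AE_all_countable, intro allI)
   fix n
   have "AE w in Pn (r n). tame_probe (\<lambda>i. U i w)" using recon[of "r n"] by eventually_elim simp
   then have "AE u in distr (Pn (r n)) ?PiM (\<lambda>w i. U i w). tame_probe u" by (subst AE_distr_iff[OF mu tset])
   then show "AE \<omega> in \<Omega>. tame_probe (\<lambda>i. Yn n i \<omega>)" unfolding d[symmetric] by (subst (asm) AE_distr_iff[OF mY(1) tset])
  qed
  \<comment> \<open>Fatou's lemma along the convergent probes; the bound is the same for all
    \<delta>.\<close>
  have hb: "(\<integral>\<^sup>+\<omega>. ennreal (1 / max (Y None \<omega>) \<delta>) \<partial>\<Omega>) \<le> ennreal (1 + K')" if \<delta>: "0 < \<delta>" for \<delta>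
  proof -
   let ?h = "\<lambda>u :: 'n probe \<Rightarrow> real. ennreal (1 / max (u None) \<delta>)"
   have mh: "?h \<in> borel_measurable ?PiM" by measurable
   have K': "0 \<le> K'"
   proof -
    have "0 \<le> (\<integral>w. (rcoord undefined (fst (w 1)) - rcoord undefined (fst (w 0))) ^ 4 \<partial>Pn 0)"
     by (rule Bochner_Integration.integral_nonneg) simp
    also have "\<dots> \<le> K" using mom[of 0 1 0 undefined] by simp
    finally show ?thesis unfolding K'_def by simp
   qed
   have each: "(\<integral>\<^sup>+\<omega>. ?h (\<lambda>i. Yn n i \<omega>) \<partial>\<Omega>) \<le> ennreal (1 + K')" for n
   proof -
    interpret Q: prob_space "Pn (r n)" by (rule P)
    have "(\<integral>\<^sup>+\<omega>. ?h (\<lambda>i. Yn n i \<omega>) \<partial>\<Omega>) = (\<integral>\<^sup>+u. ?h u \<partial>distr \<Omega> ?PiM (\<lambda>\<omega> i. Yn n i \<omega>))"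
     by (subst nn_integral_distr[OF mY(1)]) (simp_all only: measurable_distr_eq1 mh)
    also have "\<dots> = (\<integral>\<^sup>+w. ?h (\<lambda>i. U i w) \<partial>Pn (r n))" unfolding d by (subst nn_integral_distr[OF mu]) (simp_all only: measurable_distr_eq1 mh)
    also have "\<dots> \<le> (\<integral>\<^sup>+w. 1 + roughness (z w) \<partial>Pn (r n))"
     unfolding U(1) by (intro nn_integral_mono inverse_tameness_le \<delta>)
    also have "\<dots> = 1 + (\<integral>\<^sup>+w. roughness (z w) \<partial>Pn (r n))"
     by (subst nn_integral_add) (auto simp: Q.emeasure_space_1 intro: roughness_measurable(2)[of z, OF mz])
    also have "\<dots> \<le> 1 + ennreal K'" by (intro add_left_mono rough)
    also have "\<dots> = ennreal (1 + K')" using K' by simp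
    finally show ?thesis .
   qed
   have "(\<integral>\<^sup>+\<omega>. ennreal (1 / max (Y None \<omega>) \<delta>) \<partial>\<Omega>) = (\<integral>\<^sup>+\<omega>. liminf (\<lambda>n. ?h (\<lambda>i. Yn n i \<omega>)) \<partial>\<Omega>)"
   proof (rule nn_integral_cong)
    fix \<omega> assume "\<omega> \<in> space \<Omega>"
    then have "(\<lambda>n. ?h (\<lambda>i. Yn n i \<omega>)) \<longlonglongrightarrow> ennreal (1 / max (Y None \<omega>) \<delta>)"
     using \<delta> by (intro tendsto_intros lim tendsto_ennrealI) auto
    from lim_imp_Liminf[OF _ this] show "ennreal (1 / max (Y None \<omega>) \<delta>) = liminf (\<lambda>n. ?h (\<lambda>i. Yn n i \<omega>))" by simp
   qed
   also have "\<dots> \<le> liminf (\<lambda>n. \<integral>\<^sup>+\<omega>. ?h (\<lambda>i. Yn n i \<omega>) \<partial>\<Omega>)"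
    by (rule nn_integral_liminf) measurable
   also have "\<dots> \<le> liminf (\<lambda>n. ennreal (1 + K'))" by (intro Liminf_mono always_eventually allI each)
   also have "\<dots> = ennreal (1 + K')" by (simp add: Liminf_const)
   finally show ?thesis .
  qed
  \<comment> \<open>The choice \<delta> = 1 / (n + 1) gives (n + 1) P(Y \<le> 0) \<le> max 0 (1 +
    K') for every n, so the limiting tameness is almost surely positive.\<close>
  have AE_pos: "AE \<omega> in \<Omega>. 0 < Y None \<omega>"
  proof -
   let ?A = "{\<omega> \<in> space \<Omega>. Y None \<omega> \<le> 0}"
   have A: "?A \<in> sets \<Omega>" by measurable
   have le: "real (Suc n) * \<Omega>.prob ?A \<le> max 0 (1 + K')" for n
   proof -
    have "ennreal (real (Suc n) * \<Omega>.prob ?A) = (\<integral>\<^sup>+\<omega>. ennreal (real (Suc n)) * indicator ?A \<omega> \<partial>\<Omega>)"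
     by (subst nn_integral_cmult_indicator[OF A]) (simp add: \<Omega>.emeasure_eq_measure ennreal_mult del: of_nat_Suc)
    also have "\<dots> \<le> (\<integral>\<^sup>+\<omega>. ennreal (1 / max (Y None \<omega>) (1 / real (Suc n))) \<partial>\<Omega>)"
    proof (rule nn_integral_mono)
     fix \<omega> assume "\<omega> \<in> space \<Omega>"
     have "1 / max (Y None \<omega>) (1 / real (Suc n)) = real (Suc n)" if "Y None \<omega> \<le> 0"
     proof -
      have "max (Y None \<omega>) (1 / real (Suc n)) = 1 / real (Suc n)"
       using that by (intro max_absorb2) (rule order_trans, auto)
      then show ?thesis by simp
     qed
     then show "ennreal (real (Suc n)) * indicator ?A \<omega> \<le> ennreal (1 / max (Y None \<omega>) (1 / real (Suc n)))"
      by (auto simp: indicator_def)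
    qed
    also have "\<dots> \<le> ennreal (1 + K')" by (rule hb) simp
    also have "\<dots> \<le> ennreal (max 0 (1 + K'))" by (intro ennreal_leI) simp
    finally show ?thesis by (subst (asm) ennreal_le_iff) auto
   qed
   have "\<Omega>.prob ?A = 0"
   proof (rule ccontr)
    assume "\<Omega>.prob ?A \<noteq> 0"
    then have "0 < \<Omega>.prob ?A" using measure_nonneg[of \<Omega> ?A] by linarith
    then obtain n where "max 0 (1 + K') < real n * \<Omega>.prob ?A" using reals_Archimedean3 by blast
    also have "\<dots> \<le> real (Suc n) * \<Omega>.prob ?A" by (intro mult_right_mono) auto
    finally show False using le[of n] by linarith
   qed
   then have "?A \<in> null_sets \<Omega>" using A by (simp add: null_sets_def \<Omega>.emeasure_eq_measure)
   then show ?thesis by (rule AE_I') auto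
  qed
  show thesis
  proof (rule that[OF r \<Omega>, of "\<lambda>n \<omega>. reconstruct (\<phi> (r n)) (\<lambda>i. Yn n i \<omega>)" "\<lambda>\<omega>. reconstruct \<phi>0 (\<lambda>i. Y i \<omega>)"])
   show "(\<lambda>\<omega>. reconstruct (\<phi> (r n)) (\<lambda>i. Yn n i \<omega>)) \<in> \<Omega> \<rightarrow>\<^sub>M path_space (S (r n))" for n
    by (rule measurable_compose[OF mY(1) measurable_reconstruct[OF S(1)]])
   show "(\<lambda>\<omega>. reconstruct \<phi>0 (\<lambda>i. Y i \<omega>)) \<in> \<Omega> \<rightarrow>\<^sub>M path_space S0"
    by (rule measurable_compose[OF mY(2) measurable_reconstruct[OF S(2)]])
   fix n
   let ?N = "path_space (S (r n))" and ?f = "reconstruct (\<phi> (r n)) :: ('n probe \<Rightarrow> real) \<Rightarrow> _"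
   note mrec = measurable_reconstruct[OF S(1), of "r n"]
   have "distr \<Omega> ?N (\<lambda>\<omega>. ?f (\<lambda>i. Yn n i \<omega>)) = distr (distr \<Omega> ?PiM (\<lambda>\<omega> i. Yn n i \<omega>)) ?N ?f"
    by (subst distr_distr[OF mrec mY(1)]) (simp add: comp_def)
   also have "\<dots> = distr (Pn (r n)) ?N (\<lambda>w. ?f (\<lambda>i. U i w))"
    unfolding d by (subst distr_distr[OF mrec mu]) (simp add: comp_def)
   also have "\<dots> = distr (Pn (r n)) ?N (\<lambda>w. w)"
   proof (rule distr_cong_AE[OF refl refl])
    show "AE w in Pn (r n). ?f (\<lambda>i. U i w) = w" using recon[of "r n"] by eventually_elim simp
    show "(\<lambda>w. ?f (\<lambda>i. U i w)) \<in> Pn (r n) \<rightarrow>\<^sub>M ?N" by (rule measurable_compose[OF mu mrec])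
    show "(\<lambda>w. w) \<in> Pn (r n) \<rightarrow>\<^sub>M ?N" by (rule measurable_ident_sets[OF P(2)])
   qed
   also have "\<dots> = Pn (r n)" by (rule distr_id2) (simp add: P(2))
   finally show "distr \<Omega> ?N (\<lambda>\<omega>. ?f (\<lambda>i. Yn n i \<omega>)) = Pn (r n)" .
  next
   show "AE \<omega> in \<Omega>. \<forall>L. uniform_limit {0..L} (\<lambda>n t. fst (reconstruct (\<phi> (r n)) (\<lambda>i. Yn n i \<omega>) t)) (\<lambda>t. fst (reconstruct \<phi>0 (\<lambda>i. Y i \<omega>) t)) sequentially"
    using AE_tame AE_pos AE_space
   proof eventually_elim
    case (elim \<omega>)
    have v: "\<And>n. 0 < Yn n None \<omega>" "(\<lambda>n. Yn n None \<omega>) \<longlonglongrightarrow> Y None \<omega>" "0 < Y None \<omega>"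
     using elim(1,2) lim[OF elim(3)] by (auto simp: tame_probe_def)
    have x: "tame (Yn n None \<omega>) (probe_coord (\<lambda>i. Yn n i \<omega>) c)" for n c
     using elim(1) unfolding tame_probe_def by blast
    have l: "(\<lambda>n. probe_coord (\<lambda>i. Yn n i \<omega>) c (real i / 2 ^ m)) \<longlonglongrightarrow> probe_coord (\<lambda>i. Y i \<omega>) c (real i / 2 ^ m)" for c i m
     unfolding probe_coord_def by (rule lim[OF elim(3)])
    have tY: "tame_probe (\<lambda>i. Y i \<omega>)"
     unfolding tame_probe_def using v(3) tame_limit[OF v x l] by blast
    show ?case
    proof
     fix L
     have "uniform_limit {0..L} (\<lambda>n t. vec_of (\<lambda>c. dyadic_extension (probe_coord (\<lambda>i. Yn n i \<omega>) c) t))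
       (\<lambda>t. vec_of (\<lambda>c. dyadic_extension (probe_coord (\<lambda>i. Y i \<omega>) c) t)) sequentially"
      by (intro uniform_limit_vec_of tame_uniform_limit[OF v x l])
     then show "uniform_limit {0..L} (\<lambda>n t. fst (reconstruct (\<phi> (r n)) (\<lambda>i. Yn n i \<omega>) t)) (\<lambda>t. fst (reconstruct \<phi>0 (\<lambda>i. Y i \<omega>) t)) sequentially"
      by (rule uniform_limit_cong'[THEN iffD1, rotated -1]) (use elim(1) tY in \<open>auto simp: reconstruct_def\<close>)
    qed
   qed
  qed (simp_all add: reconstruct_def)
 qed (use mU bU in auto)
qed

section \<open>Passage to the limit\<close>

lemma test_function_bound:
 assumes "f \<in> test_functions"
 obtains A where "\<And>x. norm (f x) \<le> A" "0 \<le> A"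
proof -
 from test_functionsD(2)[OF assms] obtain A where "\<And>x. norm (f x) \<le> A" unfolding bounded_iff by blast
 then show ?thesis using that[of A] norm_ge_zero order_trans by metis
qed

lemma norm_time_integral_le:
 fixes h :: "real \<Rightarrow> complex"
 assumes "\<And>u. norm (h u) \<le> C" "0 \<le> C" "0 \<le> t"
 shows "norm (LBINT u:{0..t}. h u) \<le> C * t"
proof -
 have "norm (LBINT u:{0..t}. h u) \<le> (LBINT u. norm (indicator {0..t} u *\<^sub>R h u))"
  unfolding set_lebesgue_integral_def by (rule integral_norm_bound)
 also have "\<dots> \<le> (LBINT u. indicator {0..t} u * C)"
 proof (rule integral_mono')
  show "integrable lborel (\<lambda>u. indicator {0..t} u * C)"
   using emeasure_compact_finite[of "{0..t}"] by (intro integrable_mult_left integrable_real_indicator) auto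
 qed (use assms in \<open>auto simp: indicator_def\<close>)
 also have "\<dots> = C * t" using assms by simp
 finally show ?thesis .
qed

text \<open>The process \<open>mart\<close> of the locale, for laws not yet known to be
  diffusions.\<close>

definition mart_of :: "(('n::finite state \<Rightarrow> complex) \<Rightarrow> 'n state \<Rightarrow> complex) \<Rightarrow> ('n state \<Rightarrow> complex) \<Rightarrow> real \<Rightarrow> (real \<Rightarrow> 'n state) \<Rightarrow> complex" where
 "mart_of G f t w = f (w t) - f (w 0) - (LBINT s:{0..t}. G f (w s))"

lemma mart_of_measurable:
 assumes f: "continuous_on UNIV f" "continuous_on UNIV (G f)" and t: "0 \<le> t"
 shows "mart_of G f t \<in> borel_measurable (path_filtration S t)"
proof -
 have c: "(\<lambda>w. h (w u)) \<in> borel_measurable (path_filtration S t)" if "0 \<le> u" "u \<le> t" "continuous_on UNIV h" for u and h :: "_ \<Rightarrow> complex"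
  by (rule measurable_compose[OF measurable_path_filtration_coord[OF that(1,2)] borel_measurable_continuous_onI[OF that(3)]])
 have i: "(\<lambda>w. LBINT s:{0..t}. G f (w s)) \<in> borel_measurable (path_filtration S t)"
 proof (rule measurable_time_integral[OF _ _ t])
  show "(\<lambda>w. G f (w u)) \<in> borel_measurable (path_filtration S t)" if "u \<in> {0..t}" for u
   using c[OF _ _ f(2)] that by simp
  show "continuous_on {0..t} (\<lambda>u. G f (w u))" if "w \<in> space (path_filtration S t)" for w
   using that by (intro continuous_on_compose2[OF f(2)])
    (auto simp: space_path_filtration space_path_space intro: continuous_on_subset)
 qed
 show ?thesis unfolding mart_of_def[abs_def]
  by (intro borel_measurable_diff c f i order_refl t)
qed

lemma mart_of_bound:
 assumes "\<And>x. norm (f x) \<le> A" "\<And>x. norm (G f x) \<le> C" "0 \<le> C" "0 \<le> t"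
 shows "norm (mart_of G f t w) \<le> 2 * A + C * t"
proof -
 have "norm (mart_of G f t w) \<le> norm (f (w t)) + norm (f (w 0)) + norm (LBINT s:{0..t}. G f (w s))"
  unfolding mart_of_def using norm_triangle_ineq4[of "f (w t) - f (w 0)" "LBINT s:{0..t}. G f (w s)"]
   norm_triangle_ineq4[of "f (w t)" "f (w 0)"] by linarith
 then show ?thesis using assms(1)[of "w t"] assms(1)[of "w 0"] norm_time_integral_le[OF assms(2-4), of "\<lambda>s. w s"] by linarith
qed

text \<open>By \<open>set_integral_zero_of_cyl_tests\<close> it is enough to test against continuous
  cylinder functions of the past; in this form the martingale property is stable under
  limits.\<close>

lemma real_martingaleI:
 fixes S :: "'n::finite state set"
 assumes P: "prob_space P" "sets P = sets (path_space S)"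
  and X: "\<And>t. 0 \<le> t \<Longrightarrow> X t \<in> borel_measurable (path_filtration S t)" "\<And>t. 0 \<le> t \<Longrightarrow> integrable P (X t)"
  and zero: "\<And>s t l. 0 \<le> s \<Longrightarrow> s \<le> t \<Longrightarrow> l \<in> cyl_tests {0..s} \<Longrightarrow> (\<integral>w. cylf l w * (X t w - X s w) \<partial>P) = 0"
 shows "real_martingale P (path_filtration S) X"
 unfolding real_martingale_def
proof (intro conjI allI impI)
 fix s t :: real assume st: "0 \<le> s \<and> s \<le> t"
 interpret prob_space P by fact
 have sp: "space P = space (path_space S)" using P(2) by (rule sets_eq_imp_space_eq)
 have sub: "subalgebra P (path_filtration S s)"
  using subalgebra_path_filtration[of S s] P(2) sp by (simp add: subalgebra_def)
 interpret sub: finite_measure_subalgebra P "path_filtration S s"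
  by unfold_locales (rule sub)
 have i: "integrable P (X t)" "integrable P (X s)" using X(2) st by auto
 show "AE w in P. real_cond_exp P (path_filtration S s) (X t) w = X s w"
 proof (rule sub.real_cond_exp_charact[OF _ i])
  fix A assume A: "A \<in> sets (path_filtration S s)"
  have "(\<integral>w. indicator A w * (X t w - X s w) \<partial>P) = 0"
   by (rule set_integral_zero_of_cyl_tests[OF P(2) _ _ zero]) (use st i A in \<open>auto simp: sets_path_filtration\<close>)
  moreover have AP: "A \<in> sets P" using A sub by (auto simp: subalgebra_def)
  ultimately show "(LINT w:A|P. X t w) = (LINT w:A|P. X s w)"
   using integrable_mult_indicator[OF AP i(1)] integrable_mult_indicator[OF AP i(2)]
   by (simp add: set_lebesgue_integral_def right_diff_distrib)
 qed (use X(1) st in auto)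
qed (use X in auto)

lemma solves_martingale_problemI:
 fixes S :: "'n::finite state set"
 assumes P: "prob_space P" "sets P = sets (path_space S)" and start: "AE w in P. w 0 = y"
  and G: "\<And>f. f \<in> test_functions \<Longrightarrow> continuous_on UNIV (G f)" "\<And>f. f \<in> test_functions \<Longrightarrow> \<exists>C. \<forall>x. norm (G f x) \<le> C"
  and zero: "\<And>f s t l. f \<in> test_functions \<Longrightarrow> 0 \<le> s \<Longrightarrow> s \<le> t \<Longrightarrow> l \<in> cyl_tests {0..s} \<Longrightarrow>
    (\<integral>w. of_real (cylf l w) * (mart_of G f t w - mart_of G f s w) \<partial>P) = 0"
 shows "solves_martingale_problem S G y P"
 unfolding solves_martingale_problem_def
proof (intro conjI ballI P start)
 fix f :: "'n state \<Rightarrow> complex" assume f: "f \<in> test_functions"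
 interpret prob_space P by fact
 obtain A where A: "\<And>x. norm (f x) \<le> A" "0 \<le> A" using test_function_bound[OF f] by blast
 obtain C0 where C0: "\<And>x. norm (G f x) \<le> C0" using G(2)[OF f] by blast
 have C0p: "0 \<le> C0" using C0[of undefined] norm_ge_zero order_trans by blast
 have sp: "space P = space (path_space S)" using P(2) by (rule sets_eq_imp_space_eq)
 have sub: "subalgebra P (path_filtration S s)" for s
  using subalgebra_path_filtration[of S s] P(2) sp by (simp add: subalgebra_def)
 note m = mart_of_measurable[where G=G and S=S, OF test_functionsD(1)[OF f] G(1)[OF f]]
 have mP: "mart_of G f t \<in> borel_measurable P" if "0 \<le> t" for t
  by (rule measurable_from_subalg[OF sub m[OF that]])
 have iP: "integrable P (mart_of G f t)" if "0 \<le> t" for t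
  by (rule integrable_const_bound[OF AE_I2 mP[OF that]]) (rule mart_of_bound[where f=f and G=G, OF A(1) C0 C0p that])
 \<comment> \<open>Real and imaginary parts are treated at once, as bounded real-linear functionals
   \<open>h\<close>.\<close>
 have martingale: "real_martingale P (path_filtration S) (\<lambda>t w. h (mart_of G f t w))"
  if h: "bounded_linear h" and hm: "\<And>c z. h (of_real c * z) = c * h z" for h :: "complex \<Rightarrow> real"
 proof (rule real_martingaleI[OF P])
  have hc: "h \<in> borel_measurable borel" by (intro borel_measurable_continuous_onI linear_continuous_on h)
  show "(\<lambda>w. h (mart_of G f t w)) \<in> borel_measurable (path_filtration S t)" if "0 \<le> t" for t
   by (rule measurable_compose[OF m[OF that] hc])
  show "integrable P (\<lambda>w. h (mart_of G f t w))" if "0 \<le> t" for t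
   by (rule integrable_bounded_linear[OF h iP[OF that]])
  fix s t :: real and l :: "(real \<times> ('n state \<Rightarrow> real)) list" assume st: "0 \<le> s" "s \<le> t" and l: "l \<in> cyl_tests {0..s}"
  let ?Z = "\<lambda>w :: real \<Rightarrow> 'n state. of_real (cylf l w) * (mart_of G f t w - mart_of G f s w)"
  have cm: "cylf l \<in> borel_measurable P"
   by (rule cylf_measurable[OF l]) (use measurable_path_space_coord[of _ S] in \<open>simp add: measurable_cong_sets[OF P(2) refl]\<close>)
  have "integrable P ?Z"
  proof (rule Bochner_Integration.integrable_bound)
   show "integrable P (\<lambda>w. mart_of G f t w - mart_of G f s w)" using iP st by simp
   show "?Z \<in> borel_measurable P" using cm mP[OF order_trans[OF st]] mP[OF st(1)] by measurable
   show "AE w in P. norm (?Z w) \<le> norm (mart_of G f t w - mart_of G f s w)"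
    using cylf_range[OF l] by (auto simp: norm_mult mult_left_le_one_le)
  qed
  then have "(\<integral>w. h (?Z w) \<partial>P) = h (\<integral>w. ?Z w \<partial>P)" by (rule integral_bounded_linear[OF h])
  also have "\<dots> = 0" using zero[OF f st l] bounded_linear.linear[OF h] by (simp add: linear_0)
  finally show "(\<integral>w. cylf l w * (h (mart_of G f t w) - h (mart_of G f s w)) \<partial>P) = 0"
   using linear_diff[OF bounded_linear.linear[OF h]] by (simp add: hm)
 qed
 show "complex_martingale P (path_filtration S) (\<lambda>t w. f (w t) - f (w 0) - (LBINT s:{0..t}. G f (w s)))"
  unfolding complex_martingale_def mart_of_def[symmetric]
  by (intro conjI martingale bounded_linear_Re bounded_linear_Im) simp_all
qed

lemma cylf_tendsto:
 assumes "l \<in> cyl_tests J" "\<And>t. t \<in> J \<Longrightarrow> (\<lambda>n. w n t) \<longlonglongrightarrow> w0 t"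
 shows "(\<lambda>n. cylf l (w n)) \<longlonglongrightarrow> cylf l w0"
 using assms(1)
proof (induction l)
 case (Cons p l)
 obtain t h where p: "p = (t, h)" by (cases p)
 have h: "t \<in> J" "continuous_on UNIV h" "l \<in> cyl_tests J" using Cons.prems by (auto simp: cyl_tests_def p)
 have "(\<lambda>n. h (w n t)) \<longlonglongrightarrow> h (w0 t)" by (rule continuous_on_tendsto_compose[OF h(2) assms(2)[OF h(1)]]) auto
 then show ?case unfolding p cylf_simps by (intro tendsto_mult Cons.IH h)
qed simp

lemma uniform_coefficient_bound:
 fixes f :: "nat \<Rightarrow> 'c::finite \<Rightarrow> real"
 assumes "\<And>j. (\<lambda>n. f n j) \<longlonglongrightarrow> f0 j"
 shows "\<exists>B. \<forall>n j. \<bar>f n j\<bar> \<le> B"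
proof -
 have "\<exists>K. \<forall>n. \<bar>f n j\<bar> \<le> K" for j
  using convergent_imp_Bseq[OF convergentI[OF assms[of j]]] unfolding Bseq_def by auto
 then obtain K where K: "\<And>j n. \<bar>f n j\<bar> \<le> K j" by metis
 have "\<bar>f n j\<bar> \<le> (\<Sum>j\<in>UNIV. K j)" for n j
  using K[of n j] member_le_sum[of j UNIV K] order_trans[OF abs_ge_zero K] by fastforce
 then show ?thesis by blast
qed

lemma continuous_map_borel_measurable:
 assumes "continuous_map X euclideanreal g"
 shows "g \<in> borel_measurable (borel_of_topology X)"
proof (rule borel_measurableI)
 fix U :: "real set" assume "open U"
 then have "openin X {x \<in> topspace X. g x \<in> U}" by (intro openin_continuous_map_preimage[OF assms]) simp
 also have "{x \<in> topspace X. g x \<in> U} = g -` U \<inter> space (borel_of_topology X)" by (auto simp: space_borel_of_topology)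
 finally show "g -` U \<inter> space (borel_of_topology X) \<in> sets (borel_of_topology X)"
  unfolding sets_borel_of_topology by (intro sigma_sets.Basic CollectI)
qed

lemma cpaths_limit:
 fixes w :: "nat \<Rightarrow> real \<Rightarrow> 'a::metric_space"
 assumes L: "0 \<le> L" and w: "\<And>n. w n \<in> cpaths L S" "w0 \<in> cpaths L S" and lim: "uniform_limit {0..L} w w0 sequentially"
  and g: "continuous_map (cpaths_topology L S) euclideanreal g"
 shows "(\<lambda>n. g (w n)) \<longlonglongrightarrow> g w0"
proof -
 interpret Metric_space "cpaths L S" "sup_dist L S" by (rule Metric_space_cpaths[OF L])
 have "limitin (cpaths_topology L S) w w0 sequentially"
  unfolding cpaths_topology_def limit_metric_sequentially
 proof (intro conjI w allI impI)
  fix e :: real assume e: "0 < e"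
  then have "\<forall>\<^sub>F n in sequentially. \<forall>t\<in>{0..L}. dist (w n t) (w0 t) < e / 2" using uniform_limitD[OF lim, of "e / 2"] by simp
  then obtain N where N: "\<And>n t. N \<le> n \<Longrightarrow> t \<in> {0..L} \<Longrightarrow> dist (w n t) (w0 t) < e / 2" unfolding eventually_sequentially by blast
  have "sup_dist L S (w n) w0 < e" if "N \<le> n" for n
  proof -
   have "(SUP t\<in>{0..L}. dist (w n t) (w0 t)) \<le> e / 2"
    by (rule cSUP_least) (use N[OF that] L in \<open>auto intro: less_imp_le\<close>)
   then show ?thesis using e w unfolding sup_dist_def by simp
  qed
  then show "\<exists>N. \<forall>n\<ge>N. w n \<in> cpaths L S \<and> sup_dist L S (w n) w0 < e" using w by blast
 qed
 from continuous_map_limit[OF g this] show ?thesis by (simp add: comp_def)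
qed

lemma dist_state_le: "dist x y \<le> dist (fst x) (fst y) + dist (snd x) (snd y)"
 unfolding dist_prod_def by (rule sqrt_sum_squares_le_sum) simp_all

text \<open>The generator and the path vary with \<open>n\<close> at the same time; dominated
  convergence in time uses the bound \<open>C\<close>, which is uniform in \<open>n\<close>.\<close>

lemma mart_of_tendsto:
 fixes w :: "nat \<Rightarrow> real \<Rightarrow> 'n::finite state"
 assumes f: "f \<in> test_functions"
  and coef: "\<And>j. (\<lambda>n. Lc n j) \<longlonglongrightarrow> Lc0 j" "\<And>j. (\<lambda>n. Ls n j) \<longlonglongrightarrow> Ls0 j" "\<And>j. (\<lambda>n. \<kappa> n j) \<longlonglongrightarrow> \<kappa>0 j"
  and C: "\<And>n x. norm (gen Gc Gs G1 (Lc n) (Ls n) (\<kappa> n) f x) \<le> C"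
  and w: "\<And>n. continuous_on {0..} (w n)" "continuous_on {0..} w0" "\<And>u. 0 \<le> u \<Longrightarrow> (\<lambda>n. w n u) \<longlonglongrightarrow> w0 u" and t: "0 \<le> t"
 shows "(\<lambda>n. mart_of (gen Gc Gs G1 (Lc n) (Ls n) (\<kappa> n)) f t (w n)) \<longlonglongrightarrow> mart_of (gen Gc Gs G1 Lc0 Ls0 \<kappa>0) f t w0"
 unfolding mart_of_def
proof (intro tendsto_diff)
 have cf: "continuous_on UNIV f" by (rule test_functionsD(1)[OF f])
 show "(\<lambda>n. f (w n t)) \<longlonglongrightarrow> f (w0 t)" "(\<lambda>n. f (w n 0)) \<longlonglongrightarrow> f (w0 0)"
  by (rule continuous_on_tendsto_compose[OF cf w(3)]; use t in simp)+
 have meas: "(\<lambda>u. indicator {0..t} u *\<^sub>R gen Gc Gs G1 Lc' Ls' \<kappa>' f (v u)) \<in> borel_measurable lborel"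
  if v: "continuous_on {0..} v" for Lc' Ls' \<kappa>' and v :: "real \<Rightarrow> 'n state"
 proof -
  have "continuous_on {0..t} (\<lambda>u. gen Gc Gs G1 Lc' Ls' \<kappa>' f (v u))"
   by (rule continuous_on_compose2[OF gen_continuous[OF f] continuous_on_subset[OF v]]) auto
  from borel_integrable_atLeastAtMost'[OF this] show ?thesis
   unfolding set_integrable_def by (rule borel_measurable_integrable)
 qed
 show "(\<lambda>n. LBINT s:{0..t}. gen Gc Gs G1 (Lc n) (Ls n) (\<kappa> n) f (w n s)) \<longlonglongrightarrow> (LBINT s:{0..t}. gen Gc Gs G1 Lc0 Ls0 \<kappa>0 f (w0 s))"
  unfolding set_lebesgue_integral_def
 proof (rule integral_dominated_convergence[where w="\<lambda>u. indicator {0..t} u * C"])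
  show "integrable lborel (\<lambda>u. indicator {0..t} u * C)"
   using emeasure_compact_finite[of "{0..t}"] by (intro integrable_mult_left integrable_real_indicator) auto
  show "AE u in lborel. (\<lambda>n. indicator {0..t} u *\<^sub>R gen Gc Gs G1 (Lc n) (Ls n) (\<kappa> n) f (w n u)) \<longlonglongrightarrow> indicator {0..t} u *\<^sub>R gen Gc Gs G1 Lc0 Ls0 \<kappa>0 f (w0 u)"
  proof (rule AE_I2)
   fix u :: real
   show "(\<lambda>n. indicator {0..t} u *\<^sub>R gen Gc Gs G1 (Lc n) (Ls n) (\<kappa> n) f (w n u)) \<longlonglongrightarrow> indicator {0..t} u *\<^sub>R gen Gc Gs G1 Lc0 Ls0 \<kappa>0 f (w0 u)"
   proof (cases "u \<in> {0..t}")
    case True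
    then show ?thesis by (intro tendsto_scaleR tendsto_const gen_tendsto[OF f coef] w(3)) simp
   qed simp
  qed
  show "AE u in lborel. norm (indicator {0..t} u *\<^sub>R gen Gc Gs G1 (Lc n) (Ls n) (\<kappa> n) f (w n u)) \<le> indicator {0..t} u * C" for n
   using C[of n] by (auto simp: indicator_def)
 qed (intro meas w)+
qed

text \<open>The limit diffusion is the law of the almost sure limit of the represented paths, and it
  inherits the martingale identities from them. The subsequence and \<open>P0\<close> are chosen
  before the horizon \<open>L\<close> and the functional \<open>g\<close>.\<close>

lemma diffusion_limit:
 fixes S :: "nat \<Rightarrow> 'n::finite state set" and S0 :: "'n state set"
 assumes dif: "\<And>n. diffusion (S n) Gc Gs G1 (Lc n) (Ls n) (\<kappa> n) (y n) (P n)"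
  and coef: "\<And>j. (\<lambda>n. Lc n j) \<longlonglongrightarrow> Lc0 j" "\<And>j. (\<lambda>n. Ls n j) \<longlonglongrightarrow> Ls0 j" "\<And>j. (\<lambda>n. \<kappa> n j) \<longlonglongrightarrow> \<kappa>0 j"
  and S: "\<And>n T. (T, snd (y n)) \<in> S n" "\<And>T. (T, snd y0) \<in> S0" "\<And>n. S n \<subseteq> S0"
  and y: "\<And>n. fst (y n) = fst y0" "(\<lambda>n. snd (y n)) \<longlonglongrightarrow> snd y0"
 obtains r P0 where "strict_mono (r :: nat \<Rightarrow> nat)" "diffusion S0 Gc Gs G1 Lc0 Ls0 \<kappa>0 y0 P0"
  "\<And>L g. 0 < L \<Longrightarrow> continuous_map (cpaths_topology L S0) euclideanreal g \<Longrightarrow> bounded (g ` topspace (cpaths_topology L S0)) \<Longrightarrow>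
    (\<lambda>n. \<integral>w. g w \<partial>law_upto L S0 (P (r n))) \<longlonglongrightarrow> (\<integral>w. g w \<partial>law_upto L S0 P0)"
proof -
 obtain B1 where B1: "\<And>n j. \<bar>Lc n j\<bar> \<le> B1" using uniform_coefficient_bound[where f=Lc and ?f0.0=Lc0, OF coef(1)] by blast
 obtain B2 where B2: "\<And>n j. \<bar>Ls n j\<bar> \<le> B2" using uniform_coefficient_bound[where f=Ls and ?f0.0=Ls0, OF coef(2)] by blast
 obtain B3 where B3: "\<And>n j. \<bar>\<kappa> n j\<bar> \<le> B3" using uniform_coefficient_bound[where f=\<kappa> and ?f0.0=\<kappa>0, OF coef(3)] by blast
 have fin: "\<exists>B. \<forall>j l. \<bar>g j l\<bar> \<le> B" for g :: "'n \<Rightarrow> 'n \<Rightarrow> real"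
  using uniform_coefficient_bound[of "\<lambda>n p. g (fst p) (snd p)" "\<lambda>p. g (fst p) (snd p)"] by force
 obtain B4 where B4: "\<And>j l. \<bar>Gc j l\<bar> \<le> B4" using fin[of Gc] by blast
 obtain B5 where B5: "\<And>j l. \<bar>Gs j l\<bar> \<le> B5" using fin[of Gs] by blast
 obtain B6 where B6: "\<And>j l. \<bar>G1 j l\<bar> \<le> B6" using fin[of G1] by blast
 have pos: "0 \<le> B1" "0 \<le> B2" "0 \<le> B3" "0 \<le> B4" "0 \<le> B5" "0 \<le> B6"
  by (rule order_trans[OF abs_ge_zero B1] order_trans[OF abs_ge_zero B2] order_trans[OF abs_ge_zero B3]
    order_trans[OF abs_ge_zero B4] order_trans[OF abs_ge_zero B5] order_trans[OF abs_ge_zero B6])+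
 define B where "B = B1 + B2 + B3 + B4 + B5 + B6"
 have le: "B1 \<le> B" "B2 \<le> B" "B3 \<le> B" "B4 \<le> B" "B5 \<le> B" "B6 \<le> B"
  unfolding B_def using pos by linarith+
 have B: "\<bar>Gc j l\<bar> \<le> B" "\<bar>Gs j l\<bar> \<le> B" "\<bar>G1 j l\<bar> \<le> B" "\<bar>Lc n j\<bar> \<le> B" "\<bar>Ls n j\<bar> \<le> B" "\<bar>\<kappa> n j\<bar> \<le> B" for j l n
  by (rule order_trans[OF B4 le(4)] order_trans[OF B5 le(5)] order_trans[OF B6 le(6)]
    order_trans[OF B1 le(1)] order_trans[OF B2 le(2)] order_trans[OF B3 le(3)])+
 have B0: "\<bar>Lc0 j\<bar> \<le> B" "\<bar>Ls0 j\<bar> \<le> B" "\<bar>\<kappa>0 j\<bar> \<le> B" for j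
  using LIMSEQ_le_const2[OF tendsto_rabs[OF coef(1)], of j B] LIMSEQ_le_const2[OF tendsto_rabs[OF coef(2)], of j B]
   LIMSEQ_le_const2[OF tendsto_rabs[OF coef(3)], of j B] B(4-6) by blast+
 define R where "R = norm (fst y0)"
 define C where "C = (4 * (real CARD('n))\<^sup>2 * R\<^sup>2 + 8 * real CARD('n) * R) * B"
 have PP: "prob_space (P n)" "sets (P n) = sets (path_space (S n))" for n
  using diffusion.sol[OF dif[of n]] by (auto simp: solves_martingale_problem_def)
 have rad: "diffusion.rad (y n) = R" for n
  using diffusion.rad_def[OF dif[of n]] y(1) by (simp add: R_def)
 have bd: "AE w in P n. \<forall>t\<ge>0. norm (fst (w t)) \<le> R \<and> snd (w t) = snd (y n)" for n
  using diffusion.AE_good[OF dif[of n]] by eventually_elim (simp add: diffusion.good_def[OF dif[of n]] rad)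
 have mom: "integrable (P n) (\<lambda>w. (rcoord c (fst (w t)) - rcoord c (fst (w s))) ^ 4) \<and>
    (\<integral>w. (rcoord c (fst (w t)) - rcoord c (fst (w s))) ^ 4 \<partial>P n) \<le> ((8 * R + 12) * C) * ((4 * R + 2) * C) * (t - s)\<^sup>2"
  if st: "0 \<le> s" "s \<le> t" for n c s t
  using diffusion.increment_fourth_moment[OF dif[of n] B st, of C c] by (simp add: rad C_def)
 show thesis
 proof (rule skorokhod_paths[where Pn=P and S=S and ?S0.0=S0 and \<phi>="\<lambda>n. snd (y n)" and ?\<phi>0.0="snd y0", OF PP S(1,2) bd mom])
  fix r :: "nat \<Rightarrow> nat" and \<Omega> :: "real measure" and X X0
  assume r: "strict_mono r" and \<Omega>: "prob_space \<Omega>"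
   and X: "\<And>n. X n \<in> \<Omega> \<rightarrow>\<^sub>M path_space (S (r n))" and X0: "X0 \<in> \<Omega> \<rightarrow>\<^sub>M path_space S0"
   and dX: "\<And>n. distr \<Omega> (path_space (S (r n))) (X n) = P (r n)"
   and sX: "\<And>n \<omega> t. 0 \<le> t \<Longrightarrow> snd (X n \<omega> t) = snd (y (r n))" and sX0: "\<And>\<omega> t. 0 \<le> t \<Longrightarrow> snd (X0 \<omega> t) = snd y0"
   and unif: "AE \<omega> in \<Omega>. \<forall>L. uniform_limit {0..L} (\<lambda>n t. fst (X n \<omega> t)) (\<lambda>t. fst (X0 \<omega> t)) sequentially"
  interpret \<Omega>: prob_space \<Omega> by (rule \<Omega>)
  define P0 where "P0 = distr \<Omega> (path_space S0) X0"
  have P0: "prob_space P0" "sets P0 = sets (path_space S0)" unfolding P0_def using \<Omega>.prob_space_distr[OF X0] by auto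
  have sy: "(\<lambda>n. snd (y (r n))) \<longlonglongrightarrow> snd y0" using LIMSEQ_subseq_LIMSEQ[OF y(2) r] by (simp add: comp_def)
  have coefr: "\<And>j. (\<lambda>n. Lc (r n) j) \<longlonglongrightarrow> Lc0 j" "\<And>j. (\<lambda>n. Ls (r n) j) \<longlonglongrightarrow> Ls0 j" "\<And>j. (\<lambda>n. \<kappa> (r n) j) \<longlonglongrightarrow> \<kappa>0 j"
   using LIMSEQ_subseq_LIMSEQ[OF coef(1) r] LIMSEQ_subseq_LIMSEQ[OF coef(2) r] LIMSEQ_subseq_LIMSEQ[OF coef(3) r] by (simp_all add: comp_def)
  \<comment> \<open>The representation gives convergence of the discrete coordinates; the L2
    components are deterministic and converge together with the starting points.\<close>
  have ptw: "(\<lambda>n. X n \<omega> t) \<longlonglongrightarrow> X0 \<omega> t"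
   if u: "\<forall>L. uniform_limit {0..L} (\<lambda>n t. fst (X n \<omega> t)) (\<lambda>t. fst (X0 \<omega> t)) sequentially" and t: "0 \<le> t" for \<omega> t
  proof -
   have "(\<lambda>n. fst (X n \<omega> t)) \<longlonglongrightarrow> fst (X0 \<omega> t)"
    by (rule tendsto_uniform_limitI[OF spec[OF u, of t]]) (use t in simp)
   from tendsto_Pair[OF this sy] have "(\<lambda>n. (fst (X n \<omega> t), snd (X n \<omega> t))) \<longlonglongrightarrow> (fst (X0 \<omega> t), snd (X0 \<omega> t))"
    by (simp only: sX[OF t] sX0[OF t])
   then show ?thesis by (simp only: prod.collapse)
  qed
  have cont: "continuous_on {0..} (X n \<omega>)" "continuous_on {0..} (X0 \<omega>)" if "\<omega> \<in> space \<Omega>" for n \<omega>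
   using measurable_space[OF X that] measurable_space[OF X0 that] by (auto simp: space_path_space)
  let ?G = "\<lambda>n. gen Gc Gs G1 (Lc n) (Ls n) (\<kappa> n)" and ?Glim = "gen Gc Gs G1 Lc0 Ls0 \<kappa>0"
  have Phi_meas: "(\<lambda>w. of_real (cylf l w) * (mart_of G f t w - mart_of G f s w)) \<in> borel_measurable (path_space S')"
   if "f \<in> test_functions" "continuous_on UNIV (G f)" "0 \<le> s" "s \<le> t" "l \<in> cyl_tests {0..s}" for G f s t l S'
  proof -
   have m: "mart_of G f u \<in> borel_measurable (path_space S')" if "0 \<le> u" for u
    by (rule measurable_from_subalg[OF subalgebra_path_filtration mart_of_measurable[where G=G, OF test_functionsD(1)[OF \<open>f \<in> test_functions\<close>] \<open>continuous_on UNIV (G f)\<close> that]])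
   have c: "cylf l \<in> borel_measurable (path_space S')"
    by (rule cylf_measurable[OF that(5)]) (simp add: measurable_path_space_coord)
   show ?thesis using m[OF order_trans[OF that(3,4)]] m[OF that(3)] c by measurable
  qed
  have sol: "solves_martingale_problem S0 ?Glim y0 P0"
  proof (rule solves_martingale_problemI[OF P0])
   have c0: "(\<lambda>w. w 0) -` {y0} \<inter> space (path_space S0) \<in> sets (path_space S0)"
    by (rule measurable_sets[OF measurable_path_space_coord]) auto
   have "{w \<in> space (path_space S0). w 0 = y0} = (\<lambda>w. w 0) -` {y0} \<inter> space (path_space S0)" by auto
   with c0 have c0: "{w \<in> space (path_space S0). w 0 = y0} \<in> sets (path_space S0)" by simp
   have "AE \<omega> in \<Omega>. X n \<omega> 0 = y (r n)" for n
    by (rule AE_distrD[OF X]) (unfold dX, rule diffusion.start[OF dif])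
   then have "AE \<omega> in \<Omega>. \<forall>n. X n \<omega> 0 = y (r n)" by (simp add: AE_all_countable)
   then have "AE \<omega> in \<Omega>. X0 \<omega> 0 = y0" using unif
   proof eventually_elim
    case (elim \<omega>)
    have "(\<lambda>n. fst (X n \<omega> 0)) \<longlonglongrightarrow> fst y0" using elim(1) y(1) by simp
    moreover have "(\<lambda>n. fst (X n \<omega> 0)) \<longlonglongrightarrow> fst (X0 \<omega> 0)" by (rule tendsto_fst[OF ptw[OF elim(2)]]) simp
    ultimately have "fst (X0 \<omega> 0) = fst y0" by (rule LIMSEQ_unique[THEN sym])
    then show ?case using sX0[of 0 \<omega>] by (intro prod_eqI) auto
   qed
   then show "AE w in P0. w 0 = y0" unfolding P0_def by (subst AE_distr_iff[OF X0 c0])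
   show "continuous_on UNIV (?Glim f)" if "f \<in> test_functions" for f by (rule gen_continuous[OF that])
   show "\<exists>C. \<forall>x. norm (?Glim f x) \<le> C" if "f \<in> test_functions" for f
    by (rule gen_bounded[OF that]) (metis B(1-3) B0)
   fix f :: "'n state \<Rightarrow> complex" and s t :: real and l :: "(real \<times> ('n state \<Rightarrow> real)) list" assume f: "f \<in> test_functions" and st: "0 \<le> s" "s \<le> t" and l: "l \<in> cyl_tests {0..s}"
   obtain A where A: "\<And>x. norm (f x) \<le> A" "0 \<le> A" using test_function_bound[OF f] by blast
   have "\<exists>C'. \<forall>n x. norm (?G n f x) \<le> C' * B" by (rule gen_bounded[OF f]) (metis B)
   then obtain C' where C'0: "\<And>n x. norm (?G n f x) \<le> C' * B" by blast
   define C1 where "C1 = C' * B"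
   have C1: "norm (?G n f x) \<le> C1" for n x unfolding C1_def by (rule C'0)
   have C1p: "0 \<le> C1" using C1[of 0 undefined] norm_ge_zero order_trans by blast
   \<comment> \<open>A bounded functional whose expectation vanishes for every approximating
     diffusion. Its expectation under the limiting law is the limit of these, which is the
     martingale identity tested against one cylinder function.\<close>
   define \<Phi> where "\<Phi> G w = of_real (cylf l w) * (mart_of G f t w - mart_of G f s w)" for G and w :: "real \<Rightarrow> 'n state"
   have \<Phi>m: "\<Phi> (?G n) \<in> borel_measurable (path_space S')" "\<Phi> ?Glim \<in> borel_measurable (path_space S')" for n S'
    unfolding \<Phi>_def[abs_def] by (rule Phi_meas[OF f _ st l], rule gen_continuous[OF f])+
   have "(\<lambda>n. \<integral>\<omega>. \<Phi> (?G (r n)) (X n \<omega>) \<partial>\<Omega>) \<longlonglongrightarrow> (\<integral>\<omega>. \<Phi> ?Glim (X0 \<omega>) \<partial>\<Omega>)"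
   proof (rule integral_dominated_convergence[where w="\<lambda>_. (2 * A + C1 * t) + (2 * A + C1 * s)"])
    show "(\<lambda>\<omega>. \<Phi> ?Glim (X0 \<omega>)) \<in> borel_measurable \<Omega>" by (rule measurable_compose[OF X0 \<Phi>m(2)])
    show "(\<lambda>\<omega>. \<Phi> (?G (r n)) (X n \<omega>)) \<in> borel_measurable \<Omega>" for n by (rule measurable_compose[OF X \<Phi>m(1)])
    show "AE \<omega> in \<Omega>. norm (\<Phi> (?G (r n)) (X n \<omega>)) \<le> (2 * A + C1 * t) + (2 * A + C1 * s)" for n
    proof (rule AE_I2)
     fix \<omega>
     have "norm (\<Phi> (?G (r n)) (X n \<omega>)) \<le> 1 * norm (mart_of (?G (r n)) f t (X n \<omega>) - mart_of (?G (r n)) f s (X n \<omega>))"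
      unfolding \<Phi>_def norm_mult using cylf_range[OF l] by (intro mult_right_mono) auto
     also have "\<dots> \<le> norm (mart_of (?G (r n)) f t (X n \<omega>)) + norm (mart_of (?G (r n)) f s (X n \<omega>))"
      using norm_triangle_ineq4 by simp
     also have "\<dots> \<le> (2 * A + C1 * t) + (2 * A + C1 * s)"
      by (intro add_mono mart_of_bound[where f=f and G="?G (r n)", OF A(1) C1 C1p]) (use st in auto)
     finally show "norm (\<Phi> (?G (r n)) (X n \<omega>)) \<le> (2 * A + C1 * t) + (2 * A + C1 * s)" .
    qed
    show "AE \<omega> in \<Omega>. (\<lambda>n. \<Phi> (?G (r n)) (X n \<omega>)) \<longlonglongrightarrow> \<Phi> ?Glim (X0 \<omega>)"
     using unif AE_space
    proof eventually_elim
     case (elim \<omega>)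
     note p = ptw[OF elim(1)]
     note mt = mart_of_tendsto[where w="\<lambda>n. X n \<omega>" and ?w0.0="X0 \<omega>" and Lc="\<lambda>n. Lc (r n)" and Ls="\<lambda>n. Ls (r n)"
      and \<kappa>="\<lambda>n. \<kappa> (r n)" and ?Lc0.0=Lc0 and ?Ls0.0=Ls0 and ?\<kappa>0.0=\<kappa>0 and Gc=Gc and Gs=Gs and ?G1.0=G1, OF f coefr C1 cont(1)[OF elim(2)] cont(2)[OF elim(2)] p]
     have "(\<lambda>n. cylf l (X n \<omega>)) \<longlonglongrightarrow> cylf l (X0 \<omega>)"
      by (rule cylf_tendsto[OF l]) (use p in auto)
     then show ?case unfolding \<Phi>_def by (intro tendsto_mult tendsto_of_real tendsto_diff mt) (use st in auto)
    qed
   qed simp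
   moreover have "(\<integral>\<omega>. \<Phi> (?G (r n)) (X n \<omega>) \<partial>\<Omega>) = 0" for n
   proof -
    interpret D: diffusion "S (r n)" Gc Gs G1 "Lc (r n)" "Ls (r n)" "\<kappa> (r n)" "y (r n)" "P (r n)" by (rule dif)
    have "(\<integral>\<omega>. \<Phi> (?G (r n)) (X n \<omega>) \<partial>\<Omega>) = (\<integral>w. \<Phi> (?G (r n)) w \<partial>P (r n))"
     unfolding dX[symmetric] by (rule integral_distr[OF X \<Phi>m(1), symmetric])
    also have "\<dots> = (\<integral>w. of_real (cylf l w) * (D.mart f t w - D.mart f s w) \<partial>P (r n))"
     by (simp only: \<Phi>_def mart_of_def D.mart_def)
    also have "\<dots> = 0"
    proof (rule D.orthogonal[OF f st, where K=1])
     have "cylf l \<in> borel_measurable (path_filtration (S (r n)) s)"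
      by (rule cylf_measurable[OF l]) (simp add: measurable_path_filtration_coord)
     then show "(\<lambda>w. complex_of_real (cylf l w)) \<in> borel_measurable (path_filtration (S (r n)) s)" by measurable
     show "norm (complex_of_real (cylf l w)) \<le> 1" for w using cylf_range[OF l, of w] by simp
    qed
    finally show ?thesis .
   qed
   ultimately have "(\<integral>\<omega>. \<Phi> ?Glim (X0 \<omega>) \<partial>\<Omega>) = 0" by (simp add: LIMSEQ_const_iff)
   moreover have "(\<integral>w. \<Phi> ?Glim w \<partial>P0) = (\<integral>\<omega>. \<Phi> ?Glim (X0 \<omega>) \<partial>\<Omega>)"
    unfolding P0_def by (rule integral_distr[OF X0 \<Phi>m(2)])
   ultimately show "(\<integral>w. of_real (cylf l w) * (mart_of ?Glim f t w - mart_of ?Glim f s w) \<partial>P0) = 0"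
    by (simp add: \<Phi>_def)
  qed
  have D0: "diffusion S0 Gc Gs G1 Lc0 Ls0 \<kappa>0 y0 P0"
  proof (unfold_locales)
   show "0 \<le> Lc0 j" for j
    by (rule LIMSEQ_le_const[OF coef(1)]) (use diffusion.Lc[OF dif] in auto)
  qed (use sol diffusion.sym[OF dif[of 0]] diffusion.diag[OF dif[of 0]] in auto)
  have conv: "(\<lambda>n. \<integral>w. g w \<partial>law_upto L S0 (P (r n))) \<longlonglongrightarrow> (\<integral>w. g w \<partial>law_upto L S0 P0)"
   if L: "0 < L" and g: "continuous_map (cpaths_topology L S0) euclideanreal g" "bounded (g ` topspace (cpaths_topology L S0))" for L g
  proof -
   note mg = continuous_map_borel_measurable[OF g(1)]
   have mres: "(\<lambda>w. restrict w {0..L}) \<in> path_space S' \<rightarrow>\<^sub>M borel_of_topology (cpaths_topology L S0)" if "S' \<subseteq> S0" for S'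
    by (rule measurable_restrict_path[OF L that state_space_separable])
   have law: "(\<integral>w. g w \<partial>law_upto L S0 (distr \<Omega> (path_space S') Z)) = (\<integral>\<omega>. g (restrict (Z \<omega>) {0..L}) \<partial>\<Omega>)"
    if Z: "Z \<in> \<Omega> \<rightarrow>\<^sub>M path_space S'" and S': "S' \<subseteq> S0" for Z S'
   proof -
    have "(\<integral>w. g w \<partial>law_upto L S0 (distr \<Omega> (path_space S') Z)) = (\<integral>w. g (restrict w {0..L}) \<partial>distr \<Omega> (path_space S') Z)"
     unfolding law_upto_def by (rule integral_distr[OF _ mg]) (simp add: mres[OF S'])
    also have "\<dots> = (\<integral>\<omega>. g (restrict (Z \<omega>) {0..L}) \<partial>\<Omega>)"
     by (rule integral_distr[OF Z measurable_compose[OF mres[OF S'] mg]])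
    finally show ?thesis .
   qed
   have cp: "restrict (X n \<omega>) {0..L} \<in> cpaths L S0" "restrict (X0 \<omega>) {0..L} \<in> cpaths L S0" if "\<omega> \<in> space \<Omega>" for n \<omega>
    by (rule restrict_in_cpaths[OF measurable_space[OF X that] S(3)], rule restrict_in_cpaths[OF measurable_space[OF X0 that] order_refl])
   obtain b where b: "\<And>w. w \<in> cpaths L S0 \<Longrightarrow> \<bar>g w\<bar> \<le> b"
    using g(2) L unfolding bounded_iff by (auto simp: topspace_cpaths)
   have "(\<lambda>n. \<integral>\<omega>. g (restrict (X n \<omega>) {0..L}) \<partial>\<Omega>) \<longlonglongrightarrow> (\<integral>\<omega>. g (restrict (X0 \<omega>) {0..L}) \<partial>\<Omega>)"
   proof (rule integral_dominated_convergence[where w="\<lambda>_. b"])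
    show "(\<lambda>\<omega>. g (restrict (X0 \<omega>) {0..L})) \<in> borel_measurable \<Omega>"
     by (rule measurable_compose[OF X0 measurable_compose[OF mres[OF order_refl] mg]])
    show "(\<lambda>\<omega>. g (restrict (X n \<omega>) {0..L})) \<in> borel_measurable \<Omega>" for n
     by (rule measurable_compose[OF X measurable_compose[OF mres[OF S(3)] mg]])
    show "AE \<omega> in \<Omega>. norm (g (restrict (X n \<omega>) {0..L})) \<le> b" for n
     using b[OF cp(1)] by (intro AE_I2) simp
    show "AE \<omega> in \<Omega>. (\<lambda>n. g (restrict (X n \<omega>) {0..L})) \<longlonglongrightarrow> g (restrict (X0 \<omega>) {0..L})"
     using unif AE_space
    proof eventually_elim
     case (elim \<omega>)
     show ?case
     proof (rule cpaths_limit[OF less_imp_le[OF L] cp(1)[OF elim(2)] cp(2)[OF elim(2)] _ g(1)], rule uniform_limitI)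
      fix e :: real assume "0 < e"
      then have e: "0 < e / 2" by simp
      from uniform_limitD[OF spec[OF elim(1), of L] e] tendstoD[OF sy e]
      show "\<forall>\<^sub>F n in sequentially. \<forall>t\<in>{0..L}. dist (restrict (X n \<omega>) {0..L} t) (restrict (X0 \<omega>) {0..L} t) < e"
      proof eventually_elim
       case (elim n)
       show ?case
       proof
        fix t assume t: "t \<in> {0..L}"
        have "dist (X n \<omega> t) (X0 \<omega> t) \<le> dist (fst (X n \<omega> t)) (fst (X0 \<omega> t)) + dist (snd (y (r n))) (snd y0)"
         using dist_state_le[of "X n \<omega> t" "X0 \<omega> t"] sX[of t n \<omega>] sX0[of t \<omega>] t by simp
        also have "\<dots> < e" using elim t by fastforce
        finally show "dist (restrict (X n \<omega>) {0..L} t) (restrict (X0 \<omega>) {0..L} t) < e" using t by simp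
       qed
      qed
     qed
    qed
   qed simp
   then show ?thesis using law[OF X S(3)] law[OF X0 order_refl] by (simp add: dX P0_def)
  qed
  show thesis by (rule that[OF r D0 conv])
 qed
qed

section \<open>From abstract coefficients to those of the medium\<close>

lemma generator_eq_gen:
 "generator d n1 k \<sigma> M V Lc Ls \<kappa> = gen (Gamma cos d n1 k \<sigma> M V) (Gamma sin d n1 k \<sigma> M V) (Gamma1 d n1 k \<sigma> M V) Lc Ls \<kappa>"
 by (intro ext) (simp add: generator_def gen_def)

lemma Gamma_diag: "Gamma trig d n1 k \<sigma> M V j j = - (\<Sum>l\<in>UNIV - {j}. Gamma trig d n1 k \<sigma> M V j l)"
proof -
 have "(\<Sum>l\<in>UNIV - {j}. Gamma trig d n1 k \<sigma> M V j l) = (\<Sum>l\<in>UNIV - {j}. Gamma_offdiag trig d n1 k \<sigma> M V j l)"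
  by (intro sum.cong refl) (auto simp: Gamma_def)
 then show ?thesis by (simp add: Gamma_def)
qed

theorem theorem4p2:
  fixes d n1 k a L :: real
    and \<sigma> :: "'n::{finite,linorder} \<Rightarrow> real"
    and \<gamma>0 :: "real \<times> real \<Rightarrow> real"
    and M :: "'w measure"
    and V :: "real \<Rightarrow> real \<Rightarrow> 'w \<Rightarrow> real"
    and y :: "'n state"
    and P :: "real \<Rightarrow> (real \<Rightarrow> 'n state) measure"
  assumes "d > 0" and "n1 > 1" and "k > 0" and "a > 0"
    and "discrete_modes d n1 k \<sigma>"
    and "random_medium d a \<gamma>0 M V"
    and "L > 0"
    and "y \<in> H_space k 0"
    and "\<forall>\<^sub>F \<xi> in at_right 0.
           unique_diffusion_law (H_space k \<xi>)
             (generator d n1 k \<sigma> M V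
                (Lambda_cut cos d n1 k \<sigma> M V \<xi>)
                (Lambda_cut sin d n1 k \<sigma> M V \<xi>)
                (kappa_cut d n1 k \<sigma> M V \<xi>))
             (H_restrict k \<xi> y) (P \<xi>)"
  shows "\<exists>\<Lambda>c \<Lambda>s \<kappa> :: 'n \<Rightarrow> real.
           (\<forall>j. ((\<lambda>\<xi>. Lambda_cut cos d n1 k \<sigma> M V \<xi> j) \<longlongrightarrow> \<Lambda>c j) (at_right 0)) \<and>
           (\<forall>j. ((\<lambda>\<xi>. Lambda_cut sin d n1 k \<sigma> M V \<xi> j) \<longlongrightarrow> \<Lambda>s j) (at_right 0)) \<and>
           (\<forall>j. ((\<lambda>\<xi>. kappa_cut d n1 k \<sigma> M V \<xi> j) \<longlongrightarrow> \<kappa> j) (at_right 0)) \<and>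
           (\<exists>P0. unique_diffusion_law (H_space k 0) (generator d n1 k \<sigma> M V \<Lambda>c \<Lambda>s \<kappa>) y P0 \<and>
              weakly_converges (cpaths_topology L (H_space k 0))
                (\<lambda>\<xi>. law_upto L (H_space k 0) (P \<xi>)) (law_upto L (H_space k 0) P0) (at_right 0))"
proof -
 note medium = assms(6,1,2,3,4)
 let ?Gc = "Gamma cos d n1 k \<sigma> M V" and ?Gs = "Gamma sin d n1 k \<sigma> M V" and ?G1 = "Gamma1 d n1 k \<sigma> M V"
 let ?Lc = "Lambda_cut cos d n1 k \<sigma> M V" and ?Ls = "Lambda_cut sin d n1 k \<sigma> M V" and ?\<kappa> = "kappa_cut d n1 k \<sigma> M V"
 let ?S0 = "H_space k 0 :: 'n state set"
 have "\<forall>j. \<exists>\<Lambda>. ((\<lambda>\<xi>. ?Lc \<xi> j) \<longlongrightarrow> \<Lambda>) (at_right 0)"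
  by (intro allI Lambda_cut_tendsto[OF medium] abs_cos_le_one) simp
 from choice[OF this] obtain \<Lambda>c where \<Lambda>c: "\<And>j. ((\<lambda>\<xi>. ?Lc \<xi> j) \<longlongrightarrow> \<Lambda>c j) (at_right 0)" by blast
 have "\<forall>j. \<exists>\<Lambda>. ((\<lambda>\<xi>. ?Ls \<xi> j) \<longlongrightarrow> \<Lambda>) (at_right 0)"
  by (intro allI Lambda_cut_tendsto[OF medium] abs_sin_le_one) simp
 from choice[OF this] obtain \<Lambda>s where \<Lambda>s: "\<And>j. ((\<lambda>\<xi>. ?Ls \<xi> j) \<longlongrightarrow> \<Lambda>s j) (at_right 0)" by blast
 have "\<forall>j. \<exists>\<Lambda>. ((\<lambda>\<xi>. ?\<kappa> \<xi> j) \<longlongrightarrow> \<Lambda>) (at_right 0)"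
  by (intro allI kappa_cut_tendsto[OF medium])
 from choice[OF this] obtain \<kappa> where \<kappa>: "\<And>j. ((\<lambda>\<xi>. ?\<kappa> \<xi> j) \<longlongrightarrow> \<kappa> j) (at_right 0)" by blast
 obtain b where b: "0 < b" and sol: "\<And>\<xi>. 0 < \<xi> \<Longrightarrow> \<xi> < b \<Longrightarrow>
   unique_diffusion_law (H_space k \<xi>) (gen ?Gc ?Gs ?G1 (?Lc \<xi>) (?Ls \<xi>) (?\<kappa> \<xi>)) (H_restrict k \<xi> y) (P \<xi>)"
  using assms(9) unfolding eventually_at_right_field generator_eq_gen by blast
 have Lc_nonneg: "0 \<le> ?Lc \<xi> j" if "0 < \<xi>" for \<xi> j
  by (rule Lambda_cut_nonneg[OF medium less_imp_le[OF that] wavenumber_nonneg[OF assms(5,1,2,3)]])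
 note sym = Gamma_cos_symmetric[of d n1 k \<sigma> M V]
 have dif: "diffusion (H_space k \<xi>) ?Gc ?Gs ?G1 (?Lc \<xi>) (?Ls \<xi>) (?\<kappa> \<xi>) (H_restrict k \<xi> y) (P \<xi>)" if "0 < \<xi>" "\<xi> < b" for \<xi>
  using sol[OF that] Lc_nonneg[OF that(1)] sym Gamma_diag
  by (unfold_locales) (auto simp: unique_diffusion_law_def)
 \<comment> \<open>Used twice: for one explicit sequence, which yields the existence of the limit
   diffusion, and for arbitrary subsequences, which yields convergence of the whole family.\<close>
 have key: "\<exists>r P0. strict_mono (r :: nat \<Rightarrow> nat) \<and> diffusion ?S0 ?Gc ?Gs ?G1 \<Lambda>c \<Lambda>s \<kappa> y P0 \<and>
   (\<forall>g. continuous_map (cpaths_topology L ?S0) euclideanreal g \<longrightarrow> bounded (g ` topspace (cpaths_topology L ?S0)) \<longrightarrow>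
    (\<lambda>n. \<integral>w. g w \<partial>law_upto L ?S0 (P (X (r n)))) \<longlonglongrightarrow> (\<integral>w. g w \<partial>law_upto L ?S0 P0))"
  if X: "\<And>n. 0 < X n" "\<And>n. X n < b" "X \<longlonglongrightarrow> 0" for X
 proof -
  have fX: "filterlim X (at_right 0) sequentially"
   unfolding filterlim_at using X by (auto simp: less_le)
  note c = filterlim_compose[OF \<Lambda>c fX] filterlim_compose[OF \<Lambda>s fX] filterlim_compose[OF \<kappa> fX]
  have y: "(\<lambda>n. snd (H_restrict k (X n) y)) \<longlonglongrightarrow> snd y"
   using H_restrict_tendsto[OF assms(8) X(1,3)] by (simp add: H_restrict_def)
  have mem: "(T, snd (H_restrict k (X n) y)) \<in> H_space k (X n)" for n T
   using H_restrict_in[of k "X n" y] by (simp add: H_space_def)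
  have mem0: "(T, snd y) \<in> ?S0" for T using assms(8) by (simp add: H_space_def)
  have sub: "H_space k (X n) \<subseteq> ?S0" for n by (rule H_space_mono[OF less_imp_le[OF X(1)]])
  have fst: "fst (H_restrict k (X n) y) = fst y" for n by (simp add: H_restrict_def)
  show ?thesis
  proof (rule diffusion_limit[where S="\<lambda>n. H_space k (X n)" and P="\<lambda>n. P (X n)" and y="\<lambda>n. H_restrict k (X n) y"
     and Lc="\<lambda>n. ?Lc (X n)" and Ls="\<lambda>n. ?Ls (X n)" and \<kappa>="\<lambda>n. ?\<kappa> (X n)"
     and ?Lc0.0=\<Lambda>c and ?Ls0.0=\<Lambda>s and ?\<kappa>0.0=\<kappa> and ?S0.0="?S0" and ?y0.0=y, OF dif[OF X(1,2)] c mem mem0 sub fst y])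
   fix r P0
   assume 1: "strict_mono (r :: nat \<Rightarrow> nat)" and 2: "diffusion ?S0 ?Gc ?Gs ?G1 \<Lambda>c \<Lambda>s \<kappa> y P0"
    and 3: "\<And>L g. 0 < L \<Longrightarrow> continuous_map (cpaths_topology L ?S0) euclideanreal g \<Longrightarrow> bounded (g ` topspace (cpaths_topology L ?S0)) \<Longrightarrow>
     (\<lambda>n. \<integral>w. g w \<partial>law_upto L ?S0 (P (X (r n)))) \<longlonglongrightarrow> (\<integral>w. g w \<partial>law_upto L ?S0 P0)"
   show ?thesis
    by (intro exI[of _ r] exI[of _ P0] conjI allI impI 1 2 3[OF assms(7)])
  qed
 qed
 have "\<exists>P0. diffusion ?S0 ?Gc ?Gs ?G1 \<Lambda>c \<Lambda>s \<kappa> y P0"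
 proof -
  \<comment> \<open>The denominators start at 2, so that every term, including the first, is
    strictly below \<open>b\<close>.\<close>
  have "(\<lambda>n. b * inverse (real (Suc (Suc n)))) \<longlonglongrightarrow> b * 0"
   by (intro tendsto_intros LIMSEQ_Suc[OF LIMSEQ_inverse_real_of_nat])
  then have lim: "(\<lambda>n. b * inverse (real (Suc (Suc n)))) \<longlonglongrightarrow> 0" by simp
  have "inverse (real (Suc (Suc n))) < 1" for n by (simp add: field_simps)
  from mult_strict_left_mono[OF this b] have lt: "b * inverse (real (Suc (Suc n))) < b" for n by simp
  have "0 < b * inverse (real (Suc (Suc n)))" for n using b by simp
  from key[OF this lt lim] show ?thesis by blast
 qed
 then obtain P0 where D0: "diffusion ?S0 ?Gc ?Gs ?G1 \<Lambda>c \<Lambda>s \<kappa> y P0" by blast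
 have uniq: "unique_diffusion_law ?S0 (generator d n1 k \<sigma> M V \<Lambda>c \<Lambda>s \<kappa>) y P0"
  unfolding unique_diffusion_law_def generator_eq_gen
 proof (intro conjI allI impI)
  show "solves_martingale_problem ?S0 (gen ?Gc ?Gs ?G1 \<Lambda>c \<Lambda>s \<kappa>) y P0" by (rule diffusion.sol[OF D0])
  fix Q assume "solves_martingale_problem ?S0 (gen ?Gc ?Gs ?G1 \<Lambda>c \<Lambda>s \<kappa>) y Q"
  then have "diffusion ?S0 ?Gc ?Gs ?G1 \<Lambda>c \<Lambda>s \<kappa> y Q"
   using diffusion.sym[OF D0] diffusion.diag[OF D0] diffusion.Lc[OF D0] by (intro diffusion.intro)
  then show "Q = P0" using D0 by (rule diffusion_unique)
 qed
 have law: "prob_space (law_upto L ?S0 R) \<and> sets (law_upto L ?S0 R) = sets (borel_of_topology (cpaths_topology L ?S0))"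
  if R: "prob_space R" "sets R = sets (path_space S)" and S: "S \<subseteq> ?S0" for R S
 proof -
  have "(\<lambda>w. restrict w {0..L}) \<in> R \<rightarrow>\<^sub>M borel_of_topology (cpaths_topology L ?S0)"
   using measurable_restrict_path[OF assms(7) S state_space_separable] measurable_cong_sets[OF R(2) refl] by blast
  then show ?thesis unfolding law_upto_def using prob_space.prob_space_distr[OF R(1)] by simp
 qed
 have laws: "prob_space (law_upto L ?S0 (P \<xi>)) \<and> sets (law_upto L ?S0 (P \<xi>)) = sets (borel_of_topology (cpaths_topology L ?S0))"
  if "0 < \<xi>" "\<xi> < b" for \<xi>
  using law[OF _ _ H_space_mono[OF less_imp_le[OF that(1)]]] diffusion.sol[OF dif[OF that]]
  by (auto simp: solves_martingale_problem_def)
 have conv: "((\<lambda>\<xi>. \<integral>w. g w \<partial>law_upto L ?S0 (P \<xi>)) \<longlongrightarrow> (\<integral>w. g w \<partial>law_upto L ?S0 P0)) (at_right 0)"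
  if g: "continuous_map (cpaths_topology L ?S0) euclideanreal g" "bounded (g ` topspace (cpaths_topology L ?S0))" for g
  unfolding tendsto_at_iff_sequentially comp_def
 proof (intro allI impI)
  fix X :: "nat \<Rightarrow> real" assume X: "\<forall>i. X i \<in> {0<..} - {0}" "X \<longlonglongrightarrow> 0"
  let ?I = "\<lambda>\<xi>. \<integral>w. g w \<partial>law_upto L ?S0 (P \<xi>)" and ?Ilim = "\<integral>w. g w \<partial>law_upto L ?S0 P0"
  show "(\<lambda>n. ?I (X n)) \<longlonglongrightarrow> ?Ilim"
  \<comment> \<open>If convergence failed, some subsequence would stay at distance at least
    \<open>e\<close>; by \<open>key\<close> a further subsequence converges to the value for some
    solution, and uniqueness identifies that solution with \<open>P0\<close>.\<close>
  proof (rule tendstoI, rule ccontr)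
   fix e :: real assume e: "0 < e" and not: "\<not> (\<forall>\<^sub>F n in sequentially. dist (?I (X n)) ?Ilim < e)"
   \<comment> \<open>The bound \<open>b\<close> is built into the negated statement, so that every
     term of the extracted subsequence lies where the diffusions are known to exist.\<close>
   have "\<not> (\<forall>\<^sub>F n in sequentially. X n < b \<longrightarrow> dist (?I (X n)) ?Ilim < e)"
    using not eventually_mp[OF _ order_tendstoD(2)[OF X(2) b], of "\<lambda>n. dist (?I (X n)) ?Ilim < e"] by blast
   from not_eventually_sequentiallyD[OF this] obtain q where q: "strict_mono (q :: nat \<Rightarrow> nat)"
    "\<And>n. X (q n) < b" "\<And>n. \<not> dist (?I (X (q n))) ?Ilim < e" by blast
   have "(\<lambda>n. X (q n)) \<longlonglongrightarrow> 0" using LIMSEQ_subseq_LIMSEQ[OF X(2) q(1)] by (simp add: comp_def)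
   from key[OF _ q(2) this] X(1) obtain r P1 where D1: "diffusion ?S0 ?Gc ?Gs ?G1 \<Lambda>c \<Lambda>s \<kappa> y P1"
    and "(\<lambda>n. ?I (X (q (r n)))) \<longlonglongrightarrow> (\<integral>w. g w \<partial>law_upto L ?S0 P1)" using g by auto
   then have "(\<lambda>n. ?I (X (q (r n)))) \<longlonglongrightarrow> ?Ilim" using diffusion_unique[OF D1 D0] by simp
   from tendstoD[OF this e] q(3) show False by simp
  qed
 qed
 have "weakly_converges (cpaths_topology L ?S0) (\<lambda>\<xi>. law_upto L ?S0 (P \<xi>)) (law_upto L ?S0 P0) (at_right 0)"
  unfolding weakly_converges_def
 proof (intro conjI allI impI)
  show "\<forall>\<^sub>F \<xi> in at_right 0. prob_space (law_upto L ?S0 (P \<xi>)) \<and> sets (law_upto L ?S0 (P \<xi>)) = sets (borel_of_topology (cpaths_topology L ?S0))"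
   unfolding eventually_at_right_field using b laws by blast
  have "prob_space P0" "sets P0 = sets (path_space ?S0)"
   using diffusion.sol[OF D0] by (auto simp: solves_martingale_problem_def)
  from law[OF this order_refl] show "prob_space (law_upto L ?S0 P0)" "sets (law_upto L ?S0 P0) = sets (borel_of_topology (cpaths_topology L ?S0))"
   by auto
 qed (use conv in blast)
 with \<Lambda>c \<Lambda>s \<kappa> uniq show ?thesis by blast
qed

end
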